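(* There exists $\varepsilon_0>0$ such that for every $\varepsilon\in(0,\varepsilon_0]$ the RLP-type solution $(D(\cdot;\bar x_* ),W(\cdot;\bar x_* ))$ launched at the critical point $\bar x_*$ extends to the left to the closed interval $[0,\bar x_*]$, is real analytic there, and satisfies \[W(0;\bar x_* )=\tfrac13,\qquad D(0;\bar x_* )>\tfrac13 .\]
   Context: Fix small $\varepsilon>0$, $\eta=\frac{2\varepsilon}{1-\varepsilon}$. The self-similar Einstein--Euler system for $D>0$ and $W$ as functions of $x>0$ is \[D'=-\frac{2x(1-\varepsilon)D(W+\varepsilon)(D-W)}{B},\quad W'=\frac{1-3W}{x}+\frac{2x(1+\varepsilon)W(W+\varepsilon)(D-W)}{B},\quad B=D^{-\eta}-[(W+\varepsilon)^2-\varepsilon(W-1)^2+4\varepsilon DW]x^2.\] RLP-type solutions. Given $x_*$, put $z=x/x_*$, $\mathcal R(z)=D(x)$, $\mathcal W(z)=W(x)$, $\delta z=z-1$. Formal series $\mathcal R=\sum_{N\ge0}\mathcal R_N(\delta z)^N$, $\mathcal W=\sum_{N\ge0}\mathcal W_N(\delta z)^N$ are of relativistic Larson--Penston (RLP) type if: (1) $\mathcal R_0=\mathcal W_0=\omega$, where $\omega=\omega(\varepsilon;x_* )>0$ is the branch, $C^1$ in $\varepsilon$ near $0$ with $\omega(0;x_* )=1/x_*$, of solutions of $[(1+3\varepsilon)\omega^2+4\varepsilon\omega+\varepsilon(\varepsilon-1)]\omega^{\eta}=x_*^{-2}$; (2) as formal power series in $\delta z$, $\mathcal B\mathcal R'+2x_*^2(1-\varepsilon)z\mathcal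 R(\mathcal W+\varepsilon)(\mathcal R-\mathcal W)=0$ and $\mathcal B\mathcal W'-\frac{(1-3\mathcal W)\mathcal B}{z}-2x_*^2(1+\varepsilon)z\mathcal W(\mathcal W+\varepsilon)(\mathcal R-\mathcal W)=0$, with $\mathcal B=\mathcal R^{-\eta}-[(\mathcal W+\varepsilon)^2-\varepsilon(\mathcal W-1)^2+4\varepsilon\mathcal R\mathcal W]x_*^2z^2$; (3) with $H_0=(1+3\varepsilon)\omega^2+4\varepsilon\omega+\varepsilon^2-\varepsilon$, $a=\omega(\omega+\varepsilon)$, $b=\frac{\varepsilon}{1-\varepsilon}\frac{H_0}{\omega}+2\varepsilon\omega$, $c=3\omega-1$, $d=(1+\varepsilon)\omega+2\varepsilon$, $e=(3+5\varepsilon)\omega^2-(1-8\varepsilon+\varepsilon^2)\omega-(3\varepsilon-\varepsilon^2)$, $f=(1-\varepsilon)a-H_0$, $h=(1+\varepsilon)a+bc$, and $a_3=d(dh-be)-b(fd+(1-\varepsilon)ab)$, $a_2=-[bcdH_0-e(dh-be)+h(fd+(1-\varepsilon)ab)+b(fe+(1-\varepsilon)ah)]$, $a_1=-[bceH_0-cH_0(dh-be)+bcfH_0+h(fe+(1-\varepsilon)ah)]$, $a_0=-cH_0(bcH_0+fh)$, let $\mathcal W_1^{\mathrm{gh}}(\varepsilon)$ be the real root of $X^3+\frac{a_2}{a_3}X^2+\frac{a_1}{a_3}X+\frac{a_0}{a_3}$ depending continuously on $\varepsilon$ with value $-1/x_*$ at $\varepsilon=0$; then $\mathcal W_1=\frac12\big(-[\frac{a_2}{a_3}+\mathcal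 W_1^{\mathrm{gh}}]+\sqrt{\Delta_Q}\big)$, $\Delta_Q=(\frac{a_2}{a_3}+\mathcal W_1^{\mathrm{gh}})^2+\frac{4a_0}{a_3\mathcal W_1^{\mathrm{gh}}}$, and $\mathcal R_1=-\frac{d\mathcal W_1^2+e\mathcal W_1+cH_0}{h+b\mathcal W_1}$. Coefficients with $N\ge2$ are then uniquely determined by (2). For small $\varepsilon$ the series converge near $z=1$ and define a real-analytic solution $(D(\cdot;x_* ),W(\cdot;x_* ))$ near $x=x_*$, the RLP-type solution associated with (launched at) $x_*$; $B>0$ just to the left and $B<0$ just to the right of $x_*$. Sonic window. $x_{\max}(\varepsilon)$ is defined by $\omega(\varepsilon;x_{\max})=\frac13$ (so $x_{\max}=3+O(\varepsilon)<3$). $x_{\mathrm{crit}}(\varepsilon)=2+O(\sqrt\varepsilon)>2$ is the largest zero of $\Delta_Q(\varepsilon;\cdot)$ below $x_{\max}$. $x_{\min}=2+\delta_0>x_{\mathrm{crit}}$, where $\delta_0>0$ is a fixed small constant, independent of $\varepsilon$, such that for all sufficiently small $\varepsilon$ the RLP-type solution with $x_*=2+\delta_0$ satisfies $\mathcal W(z_0)>\frac1{2-2\eta}$ for some $z_0\in(0,1)$. The sonic window is $[x_{\min},x_{\max}(\varepsilon)]$. Critical point. For $x_*\in[x_{\min},x_{\max}]$ the sonic time $s(x_* )$ is the infimum of all $x\in(0,x_*]$ such that the RLP-type solution extends to a solution on $[x,x_* )$ with $B>0$ on $[x,x_* )$. Let $\mathcal X_{1/3}=\{x_*\in[x_{\min},x_{\max}]:\exists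 x\in(s(x_* ),x_*]\text{ with }W(x;x_* )=\frac13\}$, $X=\{x_*\in[x_{\min},x_{\max}]:\tilde x_*\in\mathcal X_{1/3}\ \forall\tilde x_*\in[x_*,x_{\max}]\}$ and $\bar x_*=\inf X$. *)

theory Defs
  imports "HOL-Analysis.Analysis"
begin

section \<open>The self-similar Einstein--Euler system\<close>

definition eta :: "real \<Rightarrow> real" where
  "eta \<epsilon> = 2 * \<epsilon> / (1 - \<epsilon>)"

definition B_fun :: "real \<Rightarrow> real \<Rightarrow> real \<Rightarrow> real \<Rightarrow> real" where
  "B_fun \<epsilon> x D W =
     D powr (- eta \<epsilon>) - ((W + \<epsilon>)^2 - \<epsilon> * (W - 1)^2 + 4 * \<epsilon> * D * W) * x^2"

text \<open>Derivatives at points of \<open>I\<close> that are not interior are one-sided. The condition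
  \<open>B > 0\<close> is part of the notion: only the region to the left of the sonic point is considered.\<close>

definition solves_EE :: "real \<Rightarrow> real set \<Rightarrow> (real \<Rightarrow> real) \<Rightarrow> (real \<Rightarrow> real) \<Rightarrow> bool" where
  "solves_EE \<epsilon> I D W \<longleftrightarrow>
     (\<forall>x\<in>I. x > 0 \<and> D x > 0 \<and> B_fun \<epsilon> x (D x) (W x) > 0 \<and>
        (D has_real_derivative
           - (2 * x * (1 - \<epsilon>) * D x * (W x + \<epsilon>) * (D x - W x) / B_fun \<epsilon> x (D x) (W x)))
           (at x within I) \<and>
        (W has_real_derivative
           (1 - 3 * W x) / x
           + 2 * x * (1 + \<epsilon>) * W x * (W x + \<epsilon>) * (D x - W x) / B_fun \<epsilon> x (D x) (W x))
           (at x within I))"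

section \<open>The value at the sonic point and the first Taylor coefficients\<close>

definition omega_branch :: "real \<Rightarrow> real \<Rightarrow> (real \<Rightarrow> real) \<Rightarrow> bool" where
  "omega_branch \<epsilon> xs w \<longleftrightarrow>
     w C1_differentiable_on {0..\<epsilon>} \<and> w 0 = 1 / xs \<and>
     (\<forall>e\<in>{0..\<epsilon>}. w e > 0 \<and>
        ((1 + 3 * e) * (w e)^2 + 4 * e * w e + e * (e - 1)) * (w e) powr (eta e) = 1 / xs^2)"

text \<open>For \<open>0 \<le> \<epsilon> < 1\<close> and \<open>xs > 0\<close> the equation has exactly one positive root, so the description
  below is proper.\<close>

definition omega :: "real \<Rightarrow> real \<Rightarrow> real" where
  "omega \<epsilon> xs = (THE v. \<exists>w. omega_branch \<epsilon> xs w \<and> v = w \<epsilon>)"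

definition c_H0 :: "real \<Rightarrow> real \<Rightarrow> real" where
  "c_H0 \<epsilon> xs = (let \<omega> = omega \<epsilon> xs in (1 + 3*\<epsilon>) * \<omega>^2 + 4*\<epsilon>*\<omega> + \<epsilon>^2 - \<epsilon>)"
definition c_a :: "real \<Rightarrow> real \<Rightarrow> real" where
  "c_a \<epsilon> xs = (let \<omega> = omega \<epsilon> xs in \<omega> * (\<omega> + \<epsilon>))"
definition c_b :: "real \<Rightarrow> real \<Rightarrow> real" where
  "c_b \<epsilon> xs = (let \<omega> = omega \<epsilon> xs in \<epsilon> / (1 - \<epsilon>) * (c_H0 \<epsilon> xs / \<omega>) + 2*\<epsilon>*\<omega>)"
definition c_c :: "real \<Rightarrow> real \<Rightarrow> real" where
  "c_c \<epsilon> xs = 3 * omega \<epsilon> xs - 1"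
definition c_d :: "real \<Rightarrow> real \<Rightarrow> real" where
  "c_d \<epsilon> xs = (1 + \<epsilon>) * omega \<epsilon> xs + 2*\<epsilon>"
definition c_e :: "real \<Rightarrow> real \<Rightarrow> real" where
  "c_e \<epsilon> xs = (let \<omega> = omega \<epsilon> xs in
     (3 + 5*\<epsilon>) * \<omega>^2 - (1 - 8*\<epsilon> + \<epsilon>^2) * \<omega> - (3*\<epsilon> - \<epsilon>^2))"
definition c_f :: "real \<Rightarrow> real \<Rightarrow> real" where
  "c_f \<epsilon> xs = (1 - \<epsilon>) * c_a \<epsilon> xs - c_H0 \<epsilon> xs"
definition c_h :: "real \<Rightarrow> real \<Rightarrow> real" where
  "c_h \<epsilon> xs = (1 + \<epsilon>) * c_a \<epsilon> xs + c_b \<epsilon> xs * c_c \<epsilon> xs"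

definition a3 :: "real \<Rightarrow> real \<Rightarrow> real" where
  "a3 \<epsilon> xs = (let a = c_a \<epsilon> xs; b = c_b \<epsilon> xs; d = c_d \<epsilon> xs; e = c_e \<epsilon> xs;
                  f = c_f \<epsilon> xs; h = c_h \<epsilon> xs in
     d * (d*h - b*e) - b * (f*d + (1 - \<epsilon>)*a*b))"
definition a2 :: "real \<Rightarrow> real \<Rightarrow> real" where
  "a2 \<epsilon> xs = (let H0 = c_H0 \<epsilon> xs; a = c_a \<epsilon> xs; b = c_b \<epsilon> xs; c = c_c \<epsilon> xs; d = c_d \<epsilon> xs;
                  e = c_e \<epsilon> xs; f = c_f \<epsilon> xs; h = c_h \<epsilon> xs in
     - (b*c*d*H0 - e * (d*h - b*e) + h * (f*d + (1 - \<epsilon>)*a*b) + b * (f*e + (1 - \<epsilon>)*a*h)))"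
definition a1 :: "real \<Rightarrow> real \<Rightarrow> real" where
  "a1 \<epsilon> xs = (let H0 = c_H0 \<epsilon> xs; a = c_a \<epsilon> xs; b = c_b \<epsilon> xs; c = c_c \<epsilon> xs; d = c_d \<epsilon> xs;
                  e = c_e \<epsilon> xs; f = c_f \<epsilon> xs; h = c_h \<epsilon> xs in
     - (b*c*e*H0 - c*H0 * (d*h - b*e) + b*c*f*H0 + h * (f*e + (1 - \<epsilon>)*a*h)))"
definition a0 :: "real \<Rightarrow> real \<Rightarrow> real" where
  "a0 \<epsilon> xs = (let H0 = c_H0 \<epsilon> xs; b = c_b \<epsilon> xs; c = c_c \<epsilon> xs;
                  f = c_f \<epsilon> xs; h = c_h \<epsilon> xs in
     - (c*H0 * (b*c*H0 + f*h)))"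

definition gh_branch :: "real \<Rightarrow> real \<Rightarrow> (real \<Rightarrow> real) \<Rightarrow> bool" where
  "gh_branch \<epsilon> xs w \<longleftrightarrow>
     continuous_on {0..\<epsilon>} w \<and> w 0 = - 1 / xs \<and>
     (\<forall>e\<in>{0..\<epsilon>}. (w e)^3 + a2 e xs / a3 e xs * (w e)^2
                      + a1 e xs / a3 e xs * w e + a0 e xs / a3 e xs = 0)"

text \<open>At \<open>\<epsilon> = 0\<close> the cubic has the roots \<open>0\<close>, \<open>- 1 / xs\<close> and \<open>1 - 2 / xs\<close>, so for \<open>xs > 1\<close>
  the root \<open>- 1 / xs\<close> is simple and the branch is unique for small \<open>\<epsilon>\<close>.\<close>

definition W1_gh :: "real \<Rightarrow> real \<Rightarrow> real" where
  "W1_gh \<epsilon> xs = (THE v. \<exists>w. gh_branch \<epsilon> xs w \<and> v = w \<epsilon>)"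

definition Delta_Q :: "real \<Rightarrow> real \<Rightarrow> real" where
  "Delta_Q \<epsilon> xs = (a2 \<epsilon> xs / a3 \<epsilon> xs + W1_gh \<epsilon> xs)^2 + 4 * a0 \<epsilon> xs / (a3 \<epsilon> xs * W1_gh \<epsilon> xs)"

definition W1_rlp :: "real \<Rightarrow> real \<Rightarrow> real" where
  "W1_rlp \<epsilon> xs = 1/2 * (- (a2 \<epsilon> xs / a3 \<epsilon> xs + W1_gh \<epsilon> xs) + sqrt (Delta_Q \<epsilon> xs))"

definition R1_rlp :: "real \<Rightarrow> real \<Rightarrow> real" where
  "R1_rlp \<epsilon> xs = - ((c_d \<epsilon> xs * (W1_rlp \<epsilon> xs)^2 + c_e \<epsilon> xs * W1_rlp \<epsilon> xs + c_c \<epsilon> xs * c_H0 \<epsilon> xs)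
                    / (c_h \<epsilon> xs + c_b \<epsilon> xs * W1_rlp \<epsilon> xs))"

section \<open>Formal series of RLP type\<close>

text \<open>Real power of a formal power series with positive constant coefficient, by the binomial
  series: \<open>F\<^sup>p = F\<^sub>0\<^sup>p (1 + (F / F\<^sub>0 - 1))\<^sup>p\<close>.\<close>

definition fps_rpow :: "real fps \<Rightarrow> real \<Rightarrow> real fps" where
  "fps_rpow F p =
     fps_const (fps_nth F 0 powr p) *
     fps_compose (fps_binomial p) (fps_const (1 / fps_nth F 0) * F - 1)"

text \<open>The formal variable is \<open>\<delta>z = z - 1\<close>, so \<open>z\<close> is the series \<open>1 + fps_X\<close>.\<close>

definition fps_z :: "real fps" where
  "fps_z = 1 + fps_X"

definition B_fps :: "real \<Rightarrow> real \<Rightarrow> real fps \<Rightarrow> real fps \<Rightarrow> real fps" where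
  "B_fps \<epsilon> xs R W =
     fps_rpow R (- eta \<epsilon>)
     - ((W + fps_const \<epsilon>)^2 - fps_const \<epsilon> * (W - 1)^2 + fps_const (4 * \<epsilon>) * R * W)
       * fps_const (xs^2) * fps_z^2"

definition rlp_series :: "real \<Rightarrow> real \<Rightarrow> real fps \<Rightarrow> real fps \<Rightarrow> bool" where
  "rlp_series \<epsilon> xs R W \<longleftrightarrow>
     fps_nth R 0 = omega \<epsilon> xs \<and> fps_nth W 0 = omega \<epsilon> xs \<and>
     B_fps \<epsilon> xs R W * fps_deriv R
       + fps_const (2 * xs^2 * (1 - \<epsilon>)) * fps_z * R * (W + fps_const \<epsilon>) * (R - W) = 0 \<and>
     B_fps \<epsilon> xs R W * fps_deriv W
       - (1 - 3 * W) * B_fps \<epsilon> xs R W * inverse fps_z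
       - fps_const (2 * xs^2 * (1 + \<epsilon>)) * fps_z * W * (W + fps_const \<epsilon>) * (R - W) = 0 \<and>
     fps_nth W 1 = W1_rlp \<epsilon> xs \<and> fps_nth R 1 = R1_rlp \<epsilon> xs"

section \<open>Solutions of RLP type and their extensions to the left\<close>

definition rlp_germ :: "real \<Rightarrow> real \<Rightarrow> (real \<Rightarrow> real) \<Rightarrow> (real \<Rightarrow> real) \<Rightarrow> bool" where
  "rlp_germ \<epsilon> xs D W \<longleftrightarrow>
     (\<exists>R V. rlp_series \<epsilon> xs R V \<and>
        (\<lambda>t. D (xs * (1 + t))) has_fps_expansion R \<and>
        (\<lambda>t. W (xs * (1 + t))) has_fps_expansion V)"

text \<open>\<open>D\<close> and \<open>W\<close> are total functions; only their values near \<open>xs\<close> and on \<open>I\<close> are constrained.\<close>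

definition rlp_extends :: "real \<Rightarrow> real \<Rightarrow> real set \<Rightarrow> (real \<Rightarrow> real) \<Rightarrow> (real \<Rightarrow> real) \<Rightarrow> bool" where
  "rlp_extends \<epsilon> xs I D W \<longleftrightarrow> rlp_germ \<epsilon> xs D W \<and> solves_EE \<epsilon> I D W"

definition sonic_time :: "real \<Rightarrow> real \<Rightarrow> real" where
  "sonic_time \<epsilon> xs = Inf {x \<in> {0<..xs}. \<exists>D W. rlp_extends \<epsilon> xs {x..<xs} D W}"

section \<open>The sonic window and the critical point\<close>

definition x_max :: "real \<Rightarrow> real" where
  "x_max \<epsilon> = (THE x. x > 0 \<and> omega \<epsilon> x = 1/3)"

definition x_crit :: "real \<Rightarrow> real" where
  "x_crit \<epsilon> = (GREATEST x. 0 < x \<and> x < x_max \<epsilon> \<and> Delta_Q \<epsilon> x = 0)"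

definition x_min :: "real \<Rightarrow> real" where
  "x_min \<delta>\<^sub>0 = 2 + \<delta>\<^sub>0"

text \<open>The requirement on the constant \<open>\<delta>\<^sub>0\<close>. Since \<open>x_max\<close> tends to \<open>3\<close> as \<open>\<epsilon>\<close> tends to \<open>0\<close>,
  smallness of \<open>\<delta>\<^sub>0\<close> is only needed in the form \<open>\<delta>\<^sub>0 < 1\<close>, which makes the window nonempty.\<close>

definition admissible_delta0 :: "real \<Rightarrow> bool" where
  "admissible_delta0 \<delta>\<^sub>0 \<longleftrightarrow> 0 < \<delta>\<^sub>0 \<and> \<delta>\<^sub>0 < 1 \<and>
     (\<exists>\<epsilon>\<^sub>1>0. \<forall>\<epsilon>\<in>{0<..\<epsilon>\<^sub>1}. x_crit \<epsilon> < x_min \<delta>\<^sub>0 \<and>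
        (\<exists>z\<^sub>0\<in>{0<..<1}. \<exists>D W.
           rlp_extends \<epsilon> (x_min \<delta>\<^sub>0) {z\<^sub>0 * x_min \<delta>\<^sub>0..<x_min \<delta>\<^sub>0} D W \<and>
           W (z\<^sub>0 * x_min \<delta>\<^sub>0) > 1 / (2 - 2 * eta \<epsilon>)))"

definition sonic_window :: "real \<Rightarrow> real \<Rightarrow> real set" where
  "sonic_window \<delta>\<^sub>0 \<epsilon> = {x_min \<delta>\<^sub>0..x_max \<epsilon>}"

definition X_third :: "real \<Rightarrow> real \<Rightarrow> real set" where
  "X_third \<delta>\<^sub>0 \<epsilon> = {xs \<in> sonic_window \<delta>\<^sub>0 \<epsilon>.
     \<exists>x\<in>{sonic_time \<epsilon> xs<..xs}. \<exists>D W. rlp_extends \<epsilon> xs {x..<xs} D W \<and> W x = 1/3}"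

definition X_set :: "real \<Rightarrow> real \<Rightarrow> real set" where
  "X_set \<delta>\<^sub>0 \<epsilon> = {xs \<in> sonic_window \<delta>\<^sub>0 \<epsilon>. \<forall>y\<in>{xs..x_max \<epsilon>}. y \<in> X_third \<delta>\<^sub>0 \<epsilon>}"

definition x_bar :: "real \<Rightarrow> real \<Rightarrow> real" where
  "x_bar \<delta>\<^sub>0 \<epsilon> = Inf (X_set \<delta>\<^sub>0 \<epsilon>)"

section \<open>Real analyticity\<close>

text \<open>Expansions are two-sided, so for closed \<open>S\<close> this is analyticity on an open neighbourhood
  of \<open>S\<close>.\<close>

definition real_analytic_on :: "(real \<Rightarrow> real) \<Rightarrow> real set \<Rightarrow> bool" where
  "real_analytic_on f S \<longleftrightarrow> (\<forall>x\<in>S. \<exists>F. (\<lambda>t. f (x + t)) has_fps_expansion F)"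

end

theory Submission
  imports Defs "HOL-Complex_Analysis.Complex_Analysis"
begin

text \<open>In blown-up variables at the sonic point the equations take the form
  \<open>t y' + \<mu> y = N(t, y)\<close> with \<open>\<mu> > 0\<close> and \<open>N\<close> a contraction, which has exactly one analytic
  solution; it is the RLP germ and depends continuously on the parameters. To the left of the sonic
  point \<open>q = x * D powr (1 / (1 - eps))\<close> is increasing as long as \<open>1/3 \<le> W \<le> D\<close>, and \<open>q < 1\<close> keeps
  \<open>B\<close> positive. Both to fall below \<open>W = 1/3\<close> and to meet \<open>D < W\<close> or \<open>W > 1 / (2 - eps)\<close> while
  \<open>W > 1/3\<close> are open conditions on the sonic point, each persists to the left, and they exclude each
  other; they hold at the right and at the left end of the window. The critical point satisfies neither,
  so its solution stays in \<open>1/3 \<le> W \<le> D\<close> and reaches \<open>x = 0\<close>. There \<open>D\<close> has a limit and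
  \<open>W - 1/3 = O(x^2)\<close>, and analyticity follows from the same theorem on singular points.\<close>

subsection \<open>Real power series\<close>

text \<open>At the sonic point B and D - W vanish together, so the equations degenerate to 0/0 and
  the slopes are fixed only up to the choice of a root of a cubic. At eps = 0 the roots are - w, 0
  and 1 - 2 w with w = 1 / x_*. On the RLP slope 1 - 2 w the blown-up right-hand side has derivative
  w / (1 - w) in the direction of the slope of W; this is below 1 exactly for w < 1/2, that is x_* >
  2. The fixed distance of the window from 2 therefore gives a contraction constant independent of
  eps and x_*. The power D powr (- eta eps) becomes a third unknown, so that all right-hand sides
  are rational. The exponent in q gives x q' / q = Q / B with Q = B - 2 x^2 (W + eps) (D - W), and D
  powr (eta eps) * Q is at least 1 - (1 + 20 eps) q^2 for 1/3 <= W <= D. Hence q bounded away from 1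
  makes Q positive for small eps. This bounds the source term in W' and leads to the threshold 1 /
  (2 - eps). That q is below 1 at a relative distance from the sonic point independent of eps is
  proved at eps = 0, where it reads z R < w, and then carried over by compactness in w.\<close>

definition fps_cplx :: "real fps \<Rightarrow> complex fps" where
  "fps_cplx F = Abs_fps (\<lambda>n. complex_of_real (fps_nth F n))"

lemma fps_cplx_nth [simp]: "fps_nth (fps_cplx F) n = of_real (fps_nth F n)" by (simp add: fps_cplx_def)

lemma fps_cplx_1 [simp]: "fps_cplx 1 = 1" by (rule fps_ext) simp

lemma fps_cplx_const [simp]: "fps_cplx (fps_const c) = fps_const (of_real c)" by (rule fps_ext) simp

lemma fps_cplx_diff [simp]: "fps_cplx (F - G) = fps_cplx F - fps_cplx G" by (rule fps_ext) simp

lemma fps_cplx_mult [simp]: "fps_cplx (F * G) = fps_cplx F * fps_cplx G" by (rule fps_ext) (simp add: fps_mult_nth)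

lemma fps_cplx_power [simp]: "fps_cplx (F ^ n) = fps_cplx F ^ n" by (induction n) simp_all

lemma fps_cplx_compose: "fps_cplx (fps_compose F G) = fps_compose (fps_cplx F) (fps_cplx G)"
  by (rule fps_ext) (simp add: fps_compose_nth flip: fps_cplx_power)

lemma fps_cplx_binomial: "fps_cplx (fps_binomial p) = fps_binomial (of_real p)"
  by (rule fps_ext) (simp add: fps_binomial_def gbinomial_prod_rev)

lemma fps_conv_radius_cplx [simp]: "fps_conv_radius (fps_cplx F) = fps_conv_radius F"
proof -
  have "fps_conv_radius (fps_cplx F) = fps_conv_radius (Abs_fps (\<lambda>n. norm (fps_nth (fps_cplx F) n)))"
    by (rule fps_conv_radius_norm[symmetric])
  also have "(\<lambda>n. norm (fps_nth (fps_cplx F) n)) = (\<lambda>n. norm (fps_nth F n))" by simp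
  also have "fps_conv_radius (Abs_fps \<dots>) = fps_conv_radius F" by (rule fps_conv_radius_norm)
  finally show ?thesis .
qed

lemma eval_fps_cplx:
  assumes "ereal (norm x) < fps_conv_radius F"
  shows "eval_fps (fps_cplx F) (of_real x) = of_real (eval_fps F x)"
proof -
  have "(\<lambda>n. fps_nth F n * x ^ n) sums eval_fps F x" using sums_eval_fps[OF assms] by simp
  then have "(\<lambda>n. complex_of_real (fps_nth F n * x ^ n)) sums of_real (eval_fps F x)" by (rule sums_of_real)
  then show ?thesis by (simp add: eval_fps_def sums_iff)
qed

text \<open>Bridge between real and complex germs: one direction takes the sum of the complexified
  series, the other compares both functions on the real axis. Complex facts about composition and
  the binomial series thus become available for real functions.\<close>

lemma has_fps_expansion_cplx_iff:
  fixes f :: "real \<Rightarrow> real"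
  shows "f has_fps_expansion F \<longleftrightarrow>
    (\<exists>g. g has_fps_expansion fps_cplx F \<and> (\<forall>\<^sub>F x in nhds 0. g (of_real x) = of_real (f x)))"
proof -
  have *: "\<forall>\<^sub>F x::real in nhds 0. eval_fps (fps_cplx F) (of_real x) = of_real (eval_fps F x)"
    if "fps_conv_radius F > 0"
  proof -
    have "\<forall>\<^sub>F x::real in nhds 0. x \<in> eball 0 (fps_conv_radius F)"
      using that by (intro eventually_nhds_in_open) (auto simp: zero_ereal_def)
    then show ?thesis by eventually_elim (auto intro!: eval_fps_cplx)
  qed
  show ?thesis
  proof
    assume f: "f has_fps_expansion F"
    then have pos: "fps_conv_radius F > 0" by (simp add: has_fps_expansion_def)
    have "eval_fps (fps_cplx F) has_fps_expansion fps_cplx F" using pos by (intro eval_fps_has_fps_expansion) simp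
    moreover have "\<forall>\<^sub>F x in nhds 0. eval_fps F x = f x" using f by (simp add: has_fps_expansion_def)
    with *[OF pos] have "\<forall>\<^sub>F x in nhds 0. eval_fps (fps_cplx F) (of_real x) = of_real (f x)"
      by eventually_elim simp
    ultimately show "\<exists>g. g has_fps_expansion fps_cplx F \<and> (\<forall>\<^sub>F x in nhds 0. g (of_real x) = of_real (f x))"
      by blast
  next
    assume "\<exists>g. g has_fps_expansion fps_cplx F \<and> (\<forall>\<^sub>F x in nhds 0. g (of_real x) = of_real (f x))"
    then obtain g where g: "g has_fps_expansion fps_cplx F"
      and gf: "\<forall>\<^sub>F x in nhds 0. g (of_real x) = of_real (f x)"
      by blast
    have pos: "fps_conv_radius F > 0" using g by (simp add: has_fps_expansion_def)
    have "\<forall>\<^sub>F z in nhds 0. eval_fps (fps_cplx F) z = g z" using g by (simp add: has_fps_expansion_def)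
    then have "\<forall>\<^sub>F x in nhds 0. eval_fps (fps_cplx F) (of_real x) = g (of_real x)"
    proof (rule eventually_compose_filterlim)
      show "filterlim complex_of_real (nhds 0) (nhds 0)"
        using tendsto_of_real[of "\<lambda>x. x" 0 "nhds 0"] by (simp add: filterlim_ident)
    qed
    with *[OF pos] gf have "\<forall>\<^sub>F x in nhds 0. eval_fps F x = f x" by eventually_elim (metis of_real_eq_iff)
    with pos show "f has_fps_expansion F" by (simp add: has_fps_expansion_def)
  qed
qed

text \<open>This ties the formal \<open>fps_rpow\<close> to the actual power. With c = f 0 one has
  f^p = c^p (1 + (f / c - 1))^p, and f / c - 1 vanishes at 0, so the complex binomial series can be
  composed with it. Positivity of f near 0 makes the complex power agree with the real one.\<close>

lemma has_fps_expansion_powr: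
  fixes f :: "real \<Rightarrow> real"
  assumes f: "f has_fps_expansion F" and pos: "fps_nth F 0 > 0"
  shows "(\<lambda>x. f x powr p) has_fps_expansion fps_rpow F p"
proof -
  define c where "c = fps_nth F 0"
  have c: "c > 0" using pos by (simp add: c_def)
  obtain g where g: "g has_fps_expansion fps_cplx F"
    and gf: "\<forall>\<^sub>F x in nhds 0. g (of_real x) = of_real (f x)"
    using f by (auto simp: has_fps_expansion_cplx_iff)
  let ?h = "\<lambda>z. of_real (1 / c) * g z - 1"
  have h: "?h has_fps_expansion fps_cplx (fps_const (1 / c) * F - 1)"
    unfolding fps_cplx_diff fps_cplx_mult fps_cplx_const fps_cplx_1 by (intro fps_expansion_intros g)
  have "((\<lambda>x. (1 + x) powr of_real p) \<circ> ?h) has_fps_expansion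
      fps_compose (fps_binomial (of_real p)) (fps_cplx (fps_const (1 / c) * F - 1))"
    using c by (intro has_fps_expansion_compose has_fps_expansion_binomial_complex h) (simp add: c_def)
  then have "(\<lambda>z. of_real (c powr p) * ((\<lambda>x. (1 + x) powr of_real p) \<circ> ?h) z) has_fps_expansion
      fps_const (of_real (c powr p)) *
        fps_compose (fps_binomial (of_real p)) (fps_cplx (fps_const (1 / c) * F - 1))"
    by (rule has_fps_expansion_cmult_left)
  also have "fps_const (of_real (c powr p)) *
        fps_compose (fps_binomial (of_real p)) (fps_cplx (fps_const (1 / c) * F - 1)) =
      fps_cplx (fps_rpow F p)"
    by (simp only: fps_rpow_def c_def fps_cplx_mult fps_cplx_const fps_cplx_compose fps_cplx_binomial)
  finally have *: "(\<lambda>z. of_real (c powr p) * ((\<lambda>x. (1 + x) powr of_real p) \<circ> ?h) z)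
      has_fps_expansion fps_cplx (fps_rpow F p)" .
  have f0: "f 0 = c" using f eventually_nhds_x_imp_x[of "\<lambda>x. eval_fps F x = f x" 0]
    by (simp add: has_fps_expansion_def c_def eval_fps_at_0)
  have "isCont f 0" using has_fps_expansion_imp_continuous[OF f, of UNIV] by simp
  then have "\<forall>\<^sub>F x in at 0. f x > 0"
    using c f0 by (intro order_tendstoD(1)[of f c]) (simp_all add: isCont_def)
  then have fpos: "\<forall>\<^sub>F x in nhds 0. f x > 0" using f0 c by (simp add: eventually_nhds_conv_at)
  have "\<forall>\<^sub>F x in nhds 0. of_real (c powr p) * ((\<lambda>x. (1 + x) powr of_real p) \<circ> ?h) (of_real x)
      = complex_of_real (f x powr p)"
    using gf fpos
  proof eventually_elim
    case (elim x)
    have "((\<lambda>x. (1 + x) powr of_real p) \<circ> ?h) (of_real x) = complex_of_real (f x / c) powr of_real p"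
      using elim(1) by (simp add: divide_inverse mult.commute)
    also have "\<dots> = of_real ((f x / c) powr p)" using elim(2) c by (intro powr_of_real) simp
    finally have "of_real (c powr p) * ((\<lambda>x. (1 + x) powr of_real p) \<circ> ?h) (of_real x)
        = complex_of_real (c powr p * (f x / c) powr p)"
      by (simp only: of_real_mult)
    also have "c powr p * (f x / c) powr p = f x powr p" using elim(2) c by (subst powr_mult[symmetric]) auto
    finally show ?case .
  qed
  with * show ?thesis by (subst has_fps_expansion_cplx_iff) blast
qed

text \<open>On the real axis the real part of a complex power series is the series of the real parts
  of its coefficients.\<close>

lemma holomorphic_imp_real_fps_expansion:
  fixes f :: "real \<Rightarrow> real"
  assumes h: "h holomorphic_on ball 0 \<rho>" and \<rho>: "\<rho> > 0"
    and eq: "\<And>x. \<bar>x\<bar> < \<rho> \<Longrightarrow> f x = Re (h (of_real x))"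
  shows "\<exists>F. f has_fps_expansion F"
proof -
  have "h has_fps_expansion fps_expansion h 0"
    using h \<rho> by (intro has_fps_expansion_fps_expansion[of "ball 0 \<rho>"]) auto
  define H where "H = fps_expansion h 0"
  have sums: "(\<lambda>n. fps_nth H n * of_real x ^ n) sums h (of_real x)" if "\<bar>x\<bar> < \<rho>" for x :: real
    using holomorphic_power_series[OF h, of "of_real x"] that by (simp add: H_def fps_expansion_def)
  have "(\<lambda>n. fps_nth (Abs_fps (\<lambda>n. Re (fps_nth H n))) n * x ^ n) sums f x" if "\<bar>x\<bar> < \<rho>" for x
  proof -
    have "(\<lambda>n. Re (fps_nth H n * of_real x ^ n)) sums Re (h (of_real x))" using sums[OF that] by (rule sums_Re)
    moreover have "Re (fps_nth H n * of_real x ^ n) = Re (fps_nth H n) * x ^ n" for n by (simp flip: of_real_power)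
    ultimately show ?thesis using eq[OF that] by simp
  qed
  moreover have "\<forall>\<^sub>F x::real in nhds 0. x \<in> ball 0 \<rho>"
    using \<rho> by (intro eventually_nhds_in_open) auto
  ultimately have "\<forall>\<^sub>F x in nhds 0. (\<lambda>n. fps_nth (Abs_fps (\<lambda>n. Re (fps_nth H n))) n * x ^ n) sums f x"
    by (auto elim!: eventually_mono)
  then show ?thesis by (blast intro: has_fps_expansionI)
qed

text \<open>Zeros of a nonzero power series are isolated. This is what makes formal identities
  equivalent to identities of germs.\<close>

lemma has_fps_expansion_0_real:
  fixes F :: "real fps"
  assumes "(\<lambda>_. 0) has_fps_expansion F"
  shows "F = 0"
proof (rule ccontr)
  assume "F \<noteq> 0"
  have pos: "fps_conv_radius F > 0" and ev: "\<forall>\<^sub>F z in nhds 0. eval_fps F z = 0"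
    using assms by (auto simp: has_fps_expansion_def)
  obtain e where e: "e > 0" "\<And>z. \<bar>z\<bar> < e \<Longrightarrow> eval_fps F z = 0"
    using ev by (auto simp: eventually_nhds_metric)
  obtain r where r: "0 < r" "ereal r < fps_conv_radius F" using ereal_dense2[OF pos] by (auto simp: zero_ereal_def)
  define d where "d = min e r"
  have sm: "(\<lambda>n. fps_nth F n * (x - 0) ^ n) sums 0" if "norm (x - 0) < d" for x
  proof -
    have "ereal (norm x) < ereal r" using that by (simp add: d_def)
    then have "ereal (norm x) < fps_conv_radius F" using r(2) by (rule less_trans)
    then show ?thesis using sums_eval_fps[of x F] e(2)[of x] that by (simp add: d_def)
  qed
  have F0: "fps_nth F 0 = 0" using e(2)[of 0] e(1) by (simp add: eval_fps_at_0)
  obtain m where m: "fps_nth F m \<noteq> 0" "m > 0"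
    using \<open>F \<noteq> 0\<close> F0 by (metis fps_nonzero_nth gr0I)
  obtain s where "0 < s" "\<And>z::real. z \<in> cball 0 s - {0} \<Longrightarrow> (0::real) \<noteq> 0"
    using powser_0_nonzero[of d 0 "fps_nth F" "\<lambda>_. 0" m] sm m e(1) r(1) by (auto simp: d_def)
  from this(2)[of s] this(1) show False by simp
qed

subsection \<open>Analytic solutions at regular singular points\<close>

text \<open>The derivative of \<tau>^\<mu> y is \<tau>^(\<mu> - 1) n, which is dominated by the
  derivative of M \<tau>^\<mu>. Boundedness of y excludes the homogeneous solution \<tau>^(-\<mu>):
  the boundary term s^\<mu> K tends to 0 with s, and K drops out of the result.\<close>

lemma regular_singular_bound:
  fixes y :: "real \<Rightarrow> 'a::real_normed_vector"
  assumes \<mu>: "\<mu> > 0"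
    and der: "\<And>\<tau>. 0 < \<tau> \<Longrightarrow> \<tau> < T \<Longrightarrow>
      (y has_vector_derivative (1 / \<tau>) *\<^sub>R (n \<tau> - \<mu> *\<^sub>R y \<tau>)) (at \<tau>)"
    and n: "\<And>\<tau>. 0 < \<tau> \<Longrightarrow> \<tau> < T \<Longrightarrow> norm (n \<tau>) \<le> \<mu> * M"
    and K: "\<And>\<tau>. 0 < \<tau> \<Longrightarrow> \<tau> < T \<Longrightarrow> norm (y \<tau>) \<le> K"
    and t: "0 < t" "t < T"
  shows "norm (y t) \<le> M"
proof -
  have *: "t powr \<mu> * norm (y t) \<le> s powr \<mu> * K + M * t powr \<mu>" if s: "0 < s" "s < t" for s
  proof -
    have der': "((\<lambda>\<tau>. (\<tau> powr \<mu>) *\<^sub>R y \<tau>) has_vector_derivative (\<tau> powr (\<mu> - 1)) *\<^sub>R n \<tau>) (at \<tau>)"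
      if "0 < \<tau>" "\<tau> < T" for \<tau>
    proof -
      have "((\<lambda>\<tau>. \<tau> powr \<mu>) has_real_derivative \<mu> * \<tau> powr (\<mu> - 1)) (at \<tau>)"
        using that by (auto intro!: derivative_eq_intros)
      then have "((\<lambda>\<tau>. (\<tau> powr \<mu>) *\<^sub>R y \<tau>) has_vector_derivative
          (\<tau> powr \<mu>) *\<^sub>R ((1 / \<tau>) *\<^sub>R (n \<tau> - \<mu> *\<^sub>R y \<tau>)) + (\<mu> * \<tau> powr (\<mu> - 1)) *\<^sub>R y \<tau>) (at \<tau>)"
        by (rule has_vector_derivative_scaleR) (rule der[OF that])
      moreover have "\<tau> powr \<mu> = \<tau> * \<tau> powr (\<mu> - 1)" using that by (simp add: powr_diff)
      ultimately show ?thesis using that by (simp add: algebra_simps scaleR_diff_right)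
    qed
    have "norm ((t powr \<mu>) *\<^sub>R y t - (s powr \<mu>) *\<^sub>R y s) \<le> M * t powr \<mu> - M * s powr \<mu>"
    proof (rule differentiable_bound_general[where f' = "\<lambda>\<tau>. (\<tau> powr (\<mu> - 1)) *\<^sub>R n \<tau>"
          and \<phi>' = "\<lambda>\<tau>. M * (\<mu> * \<tau> powr (\<mu> - 1))"])
      show "s < t" by (rule s)
      show "continuous_on {s..t} (\<lambda>\<tau>. (\<tau> powr \<mu>) *\<^sub>R y \<tau>)"
        using s t by (intro continuous_at_imp_continuous_on ballI)
          (rule has_vector_derivative_continuous[OF der'], auto)
      show "continuous_on {s..t} (\<lambda>\<tau>. M * \<tau> powr \<mu>)" using s by (auto intro!: continuous_intros)
      fix \<tau> assume \<tau>: "s < \<tau>" "\<tau> < t"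
      show "((\<lambda>\<tau>. (\<tau> powr \<mu>) *\<^sub>R y \<tau>) has_vector_derivative (\<tau> powr (\<mu> - 1)) *\<^sub>R n \<tau>) (at \<tau>)"
        using \<tau> s t by (intro der') auto
      show "((\<lambda>\<tau>. M * \<tau> powr \<mu>) has_vector_derivative M * (\<mu> * \<tau> powr (\<mu> - 1))) (at \<tau>)"
        unfolding has_real_derivative_iff_has_vector_derivative[symmetric]
        using \<tau> s by (auto intro!: derivative_eq_intros)
      show "norm ((\<tau> powr (\<mu> - 1)) *\<^sub>R n \<tau>) \<le> M * (\<mu> * \<tau> powr (\<mu> - 1))"
        using mult_left_mono[OF n[of \<tau>], of "\<tau> powr (\<mu> - 1)"] \<tau> s t by (simp add: mult_ac)
    qed
    moreover have "M \<ge> 0" using n[of t] t \<mu> norm_ge_zero[of "n t"] by (smt (verit) zero_le_mult_iff)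
    moreover have "norm ((s powr \<mu>) *\<^sub>R y s) \<le> s powr \<mu> * K"
      using K[of s] s t by (simp add: mult_left_mono)
    moreover have "norm ((t powr \<mu>) *\<^sub>R y t) \<le>
        norm ((t powr \<mu>) *\<^sub>R y t - (s powr \<mu>) *\<^sub>R y s) + norm ((s powr \<mu>) *\<^sub>R y s)"
      using norm_triangle_ineq[of "(t powr \<mu>) *\<^sub>R y t - (s powr \<mu>) *\<^sub>R y s" "(s powr \<mu>) *\<^sub>R y s"] by simp
    moreover have "norm ((t powr \<mu>) *\<^sub>R y t) = t powr \<mu> * norm (y t)" by simp
    moreover have "M * s powr \<mu> \<ge> 0" using \<open>M \<ge> 0\<close> by simp
    ultimately show ?thesis by linarith
  qed
  have "((\<lambda>s. s powr \<mu> * K + M * t powr \<mu>) \<longlongrightarrow> 0 powr \<mu> * K + M * t powr \<mu>) (at_right 0)"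
    using \<mu> eventually_mono[OF eventually_at_right_less[of "0::real"], of "\<lambda>s. 0 \<le> s"]
    by (intro tendsto_intros) auto
  moreover have "\<forall>\<^sub>F s in at_right 0. t powr \<mu> * norm (y t) \<le> s powr \<mu> * K + M * t powr \<mu>"
    using eventually_at_right_less eventually_at_right_real[OF t(1)] by eventually_elim (auto intro: *)
  ultimately have "t powr \<mu> * norm (y t) \<le> 0 powr \<mu> * K + M * t powr \<mu>"
    by (intro tendsto_lowerbound) auto
  then have "t powr \<mu> * norm (y t) \<le> t powr \<mu> * M" by (simp add: mult.commute)
  then show ?thesis using t by simp
qed

text \<open>On coefficients, t G' + \<mu> G multiplies the n-th one by n + \<mu>; dividing by it
  never meets zero and does not shrink the radius of convergence.\<close>

lemma regular_singular_linear:
  assumes g: "g holomorphic_on ball 0 \<rho>" and \<rho>: "\<rho> > 0" and \<mu>: "\<mu> > 0"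
  shows "\<exists>G. G holomorphic_on ball 0 \<rho> \<and>
    (\<forall>t\<in>ball 0 \<rho>. t * deriv G t + of_real \<mu> * G t = g t)"
proof -
  define F where "F = fps_expansion g 0"
  define H where "H = Abs_fps (\<lambda>n. fps_nth F n / (of_nat n + of_real \<mu>))"
  have nz: "complex_of_nat n + of_real \<mu> \<noteq> 0" for n
  proof -
    have "complex_of_nat n + of_real \<mu> = of_real (real n + \<mu>)" by simp
    then show ?thesis using \<mu> by (metis add_nonneg_pos less_irrefl of_nat_0_le_iff of_real_eq_0_iff)
  qed
  have radF: "fps_conv_radius F \<ge> \<rho>" using g unfolding F_def by (intro conv_radius_fps_expansion) auto
  have "fps_conv_radius H \<ge> \<rho>"
  proof -
    have "conv_radius (fps_nth H) \<ge> \<rho>"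
    proof (rule conv_radius_geI_ex')
      fix r :: real
      assume r: "0 < r" "ereal r < ereal \<rho>"
      have "ereal (norm (of_real r :: complex)) < fps_conv_radius F"
        using r radF by (metis abs_of_pos less_le_trans norm_of_real)
      then have "summable (\<lambda>n. norm (fps_nth F n * of_real r ^ n))" by (rule norm_summable_fps)
      then have sm: "summable (\<lambda>n. norm (fps_nth F n * of_real r ^ n) / \<mu>)" by (rule summable_divide)
      show "summable (\<lambda>n. fps_nth H n * of_real r ^ n)"
      proof (rule summable_comparison_test'[OF sm])
        fix n
        have "norm (complex_of_nat n + of_real \<mu>) = real n + \<mu>"
          using \<mu> norm_of_real[of "real n + \<mu>", where 'a = complex] by simp
        then have "norm (fps_nth H n * of_real r ^ n) = norm (fps_nth F n * of_real r ^ n) / (real n + \<mu>)"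
          by (simp add: H_def norm_mult norm_divide)
        also have "\<dots> \<le> norm (fps_nth F n * of_real r ^ n) / \<mu>"
          using \<mu> by (intro divide_left_mono) (auto intro: add_nonneg_pos)
        finally show "norm (fps_nth H n * of_real r ^ n) \<le> norm (fps_nth F n * of_real r ^ n) / \<mu>" .
      qed
    qed
    then show ?thesis by (simp add: fps_conv_radius_def)
  qed
  then have in_rad: "ereal (norm t) < fps_conv_radius H" if "t \<in> ball 0 \<rho>" for t
    using that by (metis dist_0_norm ereal_less(2) less_le_trans less_ereal.simps(1) mem_ball)
  have in_radF: "ereal (norm t) < fps_conv_radius F" if "t \<in> ball 0 \<rho>" for t
    using that radF by (metis dist_0_norm ereal_less(2) less_le_trans less_ereal.simps(1) mem_ball)
  have eq: "fps_X * fps_deriv H + fps_const (of_real \<mu>) * H = F"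
  proof (rule fps_ext)
    fix n
    have "fps_nth (fps_X * fps_deriv H + fps_const (of_real \<mu>) * H) n =
        (of_nat n + of_real \<mu>) * fps_nth H n"
      by (cases n) (simp_all add: algebra_simps)
    then show "fps_nth (fps_X * fps_deriv H + fps_const (of_real \<mu>) * H) n = fps_nth F n"
      using nz[of n] by (simp add: H_def)
  qed
  have holo: "eval_fps H holomorphic_on ball 0 \<rho>"
    by (rule holomorphic_on_eval_fps) (use in_rad in \<open>auto simp: in_eball_iff\<close>)
  moreover have "t * deriv (eval_fps H) t + of_real \<mu> * eval_fps H t = g t" if t: "t \<in> ball 0 \<rho>" for t
  proof -
    have r': "ereal (norm t) < fps_conv_radius (fps_deriv H)"
      using in_rad[OF t] fps_conv_radius_deriv[of H] by (rule less_le_trans)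
    have "ereal (norm t) < fps_conv_radius (fps_X * fps_deriv H)"
      using r' fps_conv_radius_mult[of fps_X "fps_deriv H"] by (simp add: less_le_trans)
    moreover have "ereal (norm t) < fps_conv_radius (fps_const (of_real \<mu>) * H)"
      using in_rad[OF t] \<mu> by (simp add: fps_conv_radius_cmult_left)
    ultimately have "eval_fps F t = t * eval_fps (fps_deriv H) t + of_real \<mu> * eval_fps H t"
      unfolding eq[symmetric] using r' in_rad[OF t] by (simp add: eval_fps_add eval_fps_mult)
    moreover have "eval_fps F t = g t"
    proof -
      have "(\<lambda>n. fps_nth F n * (t - 0) ^ n) sums g t"
        using holomorphic_power_series[OF g t] by (simp add: F_def fps_expansion_def)
      then show ?thesis by (simp add: eval_fps_def sums_iff)
    qed
    moreover have "deriv (eval_fps H) t = eval_fps (fps_deriv H) t"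
      using in_rad[OF t] by (intro eval_fps_deriv[symmetric])
    ultimately show ?thesis by simp
  qed
  ultimately show ?thesis by blast
qed

text \<open>Along each ray \<tau> t the equation becomes the real-variable one, so the solution
  operator has norm 1 / \<mu> in the sup norm on the same disc. The iteration below loses no
  domain.\<close>

lemma regular_singular_linear_bound:
  assumes G: "G holomorphic_on ball 0 \<rho>" and \<mu>: "\<mu> > 0"
    and eq: "\<And>t. t \<in> ball 0 \<rho> \<Longrightarrow> t * deriv G t + of_real \<mu> * G t = g t"
    and bd: "\<And>t. t \<in> ball 0 \<rho> \<Longrightarrow> norm (g t) \<le> \<mu> * M"
    and t: "t \<in> ball 0 \<rho>"
  shows "norm (G t) \<le> M"
proof (cases "t = 0")
  case True
  have "\<mu> * norm (G t) = norm (g t)"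
    using eq[OF t] \<mu> True by (metis add_0 mult_zero_left norm_mult norm_of_real abs_of_pos)
  then show ?thesis using bd[OF t] \<mu> by (metis mult_le_cancel_left_pos)
next
  case False
  define T where "T = \<rho> / norm t"
  have T: "1 < T" using t False by (simp add: T_def)
  have inb: "of_real \<tau> * t \<in> ball 0 \<rho>" if "0 < \<tau>" "\<tau> < T" for \<tau>
    using that False by (simp add: T_def norm_mult field_simps)
  \<comment> \<open>The ray is followed slightly beyond \<tau> = 1, because the bound holds on an
    open interval, but only up to S < T, because G has to be bounded there.\<close>
  obtain S where S: "1 < S" "S < T" using T dense by blast
  have "compact (G ` cball 0 (S * norm t))"
  proof (intro compact_continuous_image)
    show "continuous_on (cball 0 (S * norm t)) G"
      using S False by (intro continuous_on_subset[OF holomorphic_on_imp_continuous_on[OF G]])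
        (auto simp: T_def field_simps)
  qed auto
  then obtain K where K: "\<And>z. z \<in> cball 0 (S * norm t) \<Longrightarrow> norm (G z) \<le> K"
    by (meson bounded_iff compact_imp_bounded image_eqI)
  have "norm (G (of_real 1 * t)) \<le> M"
  proof (rule regular_singular_bound[where y = "\<lambda>\<tau>. G (of_real \<tau> * t)" and n = "\<lambda>\<tau>. g (of_real \<tau> * t)" and T = S and K = K])
    fix \<tau> assume \<tau>: "0 < \<tau>" "\<tau> < S"
    have b: "of_real \<tau> * t \<in> ball 0 \<rho>" using \<tau> S by (intro inb) auto
    have "(G has_field_derivative deriv G (of_real \<tau> * t)) (at (of_real \<tau> * t))"
      using G b by (intro holomorphic_derivI) auto
    then have "((G \<circ> (\<lambda>\<tau>. of_real \<tau> * t)) has_vector_derivative t * deriv G (of_real \<tau> * t)) (at \<tau>)"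
      by (intro field_vector_diff_chain_at) (auto intro!: derivative_eq_intros)
    moreover have "t * deriv G (of_real \<tau> * t) = (1 / \<tau>) *\<^sub>R (g (of_real \<tau> * t) - \<mu> *\<^sub>R G (of_real \<tau> * t))"
      using eq[OF b] \<tau> by (simp add: scaleR_conv_of_real field_simps)
    ultimately show "((\<lambda>\<tau>. G (of_real \<tau> * t)) has_vector_derivative
        (1 / \<tau>) *\<^sub>R (g (of_real \<tau> * t) - \<mu> *\<^sub>R G (of_real \<tau> * t))) (at \<tau>)"
      by (simp add: o_def)
    show "norm (g (of_real \<tau> * t)) \<le> \<mu> * M" by (rule bd[OF b])
    show "norm (G (of_real \<tau> * t)) \<le> K" using \<tau> by (intro K) (auto simp: norm_mult intro: mult_right_mono)
  qed (use \<mu> S in auto)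
  then show ?thesis by simp
qed

text \<open>The steps are bounded by differences of the decreasing sequence K \<theta>^n, so their
  sums telescope and the error is bounded by K \<theta>^n, without a factor 1 / (1 -
  \<theta>).\<close>

lemma geometric_limit:
  fixes a :: "nat \<Rightarrow> 'a::banach"
  assumes a: "\<And>n. norm (a (Suc n) - a n) \<le> K * (\<theta> ^ n - \<theta> ^ Suc n)" and \<theta>: "0 \<le> \<theta>" "\<theta> < 1" and K: "0 \<le> K"
  shows "\<exists>l. \<forall>n. norm (l - a n) \<le> K * \<theta> ^ n"
proof -
  have "norm (a m - a n) \<le> K * (\<theta> ^ n - \<theta> ^ m)" if "n \<le> m" for m n using that
  proof (induction m rule: dec_induct)
    case (step m)
    have "norm (a (Suc m) - a n) \<le> K * (\<theta> ^ m - \<theta> ^ Suc m) + K * (\<theta> ^ n - \<theta> ^ m)"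
      by (intro norm_diff_triangle_le[of _ "a m"] a step)
    then show ?case by (simp add: algebra_simps)
  qed simp
  moreover have "K * (\<theta> ^ n - \<theta> ^ m) \<le> K * \<theta> ^ n" for m n
    using K \<theta> by (intro mult_left_mono) auto
  ultimately have le: "norm (a m - a n) \<le> K * \<theta> ^ n" if "n \<le> m" for m n using that order_trans by blast
  have lim0: "(\<lambda>n. K * \<theta> ^ n) \<longlonglongrightarrow> 0"
    using \<theta> by (auto intro!: tendsto_mult_right_zero LIMSEQ_power_zero)
  have "Cauchy a"
  proof (rule CauchyI')
    fix e :: real assume "e > 0"
    then obtain M where "\<And>n. n \<ge> M \<Longrightarrow> K * \<theta> ^ n < e"
      using order_tendstoD(2)[OF lim0] by (auto simp: eventually_sequentially)
    then show "\<exists>M. \<forall>m\<ge>M. \<forall>n>m. dist (a m) (a n) < e"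
      using le by (metis dist_norm less_imp_le norm_minus_commute order.strict_trans1)
  qed
  then obtain l where l: "a \<longlonglongrightarrow> l" using Cauchy_convergent convergent_def by blast
  have "norm (l - a n) \<le> K * \<theta> ^ n" for n
    by (rule LIMSEQ_le_const2[OF tendsto_norm[OF tendsto_diff[OF l tendsto_const]]]) (use le in blast)
  then show ?thesis by blast
qed

section \<open>Nonlinear singular systems: contraction in a weighted polydisc\<close>

definition rs_ball :: "('i \<Rightarrow> real) \<Rightarrow> ('i \<Rightarrow> real) \<Rightarrow> real \<Rightarrow> ('i \<Rightarrow> complex) \<Rightarrow> bool" where
  "rs_ball c k r u \<longleftrightarrow> (\<forall>j. norm (u j - of_real (c j)) \<le> k j * r)"

text \<open>The right-hand side stays complex, so one \<open>N\<close> serves both the holomorphic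
  iteration and the real solutions compared with it. The set \<open>I\<close> may be a half-interval
  on one side of the singular point.\<close>

definition rs_solution :: "('i \<Rightarrow> complex \<Rightarrow> ('i \<Rightarrow> complex) \<Rightarrow> complex) \<Rightarrow> ('i \<Rightarrow> real) \<Rightarrow> ('i \<Rightarrow> real) \<Rightarrow>
    ('i \<Rightarrow> real) \<Rightarrow> real \<Rightarrow> real set \<Rightarrow> ('i \<Rightarrow> real \<Rightarrow> real) \<Rightarrow> ('i \<Rightarrow> real \<Rightarrow> real) \<Rightarrow> bool" where
  "rs_solution N c \<mu> k r I y y' \<longleftrightarrow> (\<forall>i. \<forall>t\<in>I. \<bar>y i t - c i\<bar> \<le> k i * r \<and> (y i has_real_derivative y' i t) (at t) \<and>
    of_real (t * y' i t + \<mu> i * y i t) = N i (of_real t) (\<lambda>j. of_real (y j t)))"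

lemma rs_ball_of_real: "rs_ball c k r (\<lambda>j. of_real (y j)) \<longleftrightarrow> (\<forall>j. \<bar>y j - c j\<bar> \<le> k j * r)"
  unfolding rs_ball_def of_real_diff[symmetric] norm_of_real ..

text \<open>The number d bounds the distance of u and v in the weighted sup norm max |u j - v j| / k
  j. The factor \<mu> i in \<open>lip\<close> is cancelled by the norm 1 / \<mu> i of the linear
  solution operator, which leaves the contraction constant \<theta>.\<close>

locale rs_contraction =
  fixes N :: "'i \<Rightarrow> complex \<Rightarrow> ('i \<Rightarrow> complex) \<Rightarrow> complex" and c \<mu> k :: "'i \<Rightarrow> real" and \<rho> r \<theta> :: real
  assumes \<rho>: "0 < \<rho>" and r: "0 \<le> r" and \<theta>: "0 \<le> \<theta>" "\<theta> < 1" and \<mu>: "\<And>i. 0 < \<mu> i" and k: "\<And>i. 0 < k i"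
    and lip: "\<And>i t u v d. \<lbrakk>norm t < \<rho>; rs_ball c k r u; rs_ball c k r v; 0 \<le> d; \<And>j. norm (u j - v j) \<le> k j * d\<rbrakk> \<Longrightarrow>
      norm (N i t u - N i t v) \<le> \<theta> * \<mu> i * k i * d"
begin

text \<open>Uniqueness (e = 0) and dependence on the right-hand side in one estimate. Two solutions
  in the ball differ by at most 2 r in the weighted norm; \<open>regular_singular_bound\<close>
  improves a bound d to \<theta> d + e, and iterating leads to the fixed point e / (1 - \<theta>).
  The sign \<sigma> selects the side of the singular point.\<close>

lemma compare:
  assumes \<sigma>: "\<sigma> = 1 \<or> \<sigma> = - 1" and e: "0 \<le> e" and T: "T \<le> \<rho>"
    and y: "rs_solution N c \<mu> k r {t. 0 < \<sigma> * t \<and> \<sigma> * t < T} y D"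
    and y': "rs_solution N' c \<mu> k r {t. 0 < \<sigma> * t \<and> \<sigma> * t < T} y' D'"
    and close: "\<And>i t u. \<lbrakk>norm t < T; rs_ball c k r u\<rbrakk> \<Longrightarrow> norm (N i t u - N' i t u) \<le> e * \<mu> i * k i"
    and t: "0 < \<sigma> * t" "\<sigma> * t < T"
  shows "\<bar>y i t - y' i t\<bar> \<le> k i * (e / (1 - \<theta>))"
proof -
  define I where "I = {t. 0 < \<sigma> * t \<and> \<sigma> * t < T}"
  have y: "\<bar>y i t - c i\<bar> \<le> k i * r" "(y i has_real_derivative D i t) (at t)" "rs_ball c k r (\<lambda>j. of_real (y j t))"
      "of_real (t * D i t + \<mu> i * y i t) = N i (of_real t) (\<lambda>j. of_real (y j t))"
    and y': "\<bar>y' i t - c i\<bar> \<le> k i * r" "(y' i has_real_derivative D' i t) (at t)" "rs_ball c k r (\<lambda>j. of_real (y' j t))"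
      "of_real (t * D' i t + \<mu> i * y' i t) = N' i (of_real t) (\<lambda>j. of_real (y' j t))" if "t \<in> I" for i t
    using y y' that unfolding rs_solution_def I_def[symmetric] rs_ball_of_real by blast+
  have dist: "\<bar>y i t - y' i t\<bar> \<le> k i * (2 * r)" if "t \<in> I" for i t
    using y(1)[OF that, of i] y'(1)[OF that, of i] by simp
  have "\<forall>i. \<forall>t\<in>I. \<bar>y i t - y' i t\<bar> \<le> k i * (\<theta> ^ m * (2 * r) + e / (1 - \<theta>))" for m
  proof (induction m)
    case 0
    have "k i * (2 * r) \<le> k i * (\<theta> ^ 0 * (2 * r) + e / (1 - \<theta>))" for i
      using e \<theta> k[of i] by (intro mult_left_mono) auto
    then show ?case using dist order_trans by blast
  next
    case (Suc m)
    define d where "d = \<theta> ^ m * (2 * r) + e / (1 - \<theta>)"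
    have d: "d \<ge> 0" using r \<theta> e by (simp add: d_def)
    have step: "\<theta> ^ Suc m * (2 * r) + e / (1 - \<theta>) = \<theta> * d + e"
      using \<theta> by (simp add: d_def field_simps)
    show ?case unfolding step
    proof (intro allI ballI)
      fix i t assume t: "t \<in> I"
      have "norm (y i (\<sigma> * (\<sigma> * t)) - y' i (\<sigma> * (\<sigma> * t))) \<le> k i * (\<theta> * d + e)"
      proof (rule regular_singular_bound[where y = "\<lambda>\<tau>. y i (\<sigma> * \<tau>) - y' i (\<sigma> * \<tau>)" and \<mu> = "\<mu> i" and T = T
            and K = "k i * (2 * r)"
            and n = "\<lambda>\<tau>. \<sigma> * \<tau> * (D i (\<sigma> * \<tau>) - D' i (\<sigma> * \<tau>)) + \<mu> i * (y i (\<sigma> * \<tau>) - y' i (\<sigma> * \<tau>))"])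
        fix \<tau> assume "0 < \<tau>" "\<tau> < T"
        then have s: "\<sigma> * \<tau> \<in> I" and t: "norm (complex_of_real (\<sigma> * \<tau>)) < T"
          using \<sigma> by (auto simp: I_def)
        have "((\<lambda>\<tau>. f (\<sigma> * \<tau>)) has_real_derivative d * \<sigma>) (at \<tau>)" if "(f has_real_derivative d) (at (\<sigma> * \<tau>))" for f d
          by (rule DERIV_chain2[where f = f and g = "\<lambda>\<tau>. \<sigma> * \<tau>", OF that]) (auto intro!: derivative_eq_intros)
        from DERIV_diff[OF this[OF y(2)[OF s, of i]] this[OF y'(2)[OF s, of i]]] show "((\<lambda>\<tau>. y i (\<sigma> * \<tau>) - y' i (\<sigma> * \<tau>)) has_vector_derivative (1 / \<tau>) *\<^sub>R
            (\<sigma> * \<tau> * (D i (\<sigma> * \<tau>) - D' i (\<sigma> * \<tau>)) + \<mu> i * (y i (\<sigma> * \<tau>) - y' i (\<sigma> * \<tau>)) -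
              \<mu> i *\<^sub>R (y i (\<sigma> * \<tau>) - y' i (\<sigma> * \<tau>)))) (at \<tau>)"
          using \<open>0 < \<tau>\<close> unfolding has_real_derivative_iff_has_vector_derivative
          by (simp add: algebra_simps)
        have "norm (N i (of_real (\<sigma> * \<tau>)) (\<lambda>j. of_real (y j (\<sigma> * \<tau>))) - N i (of_real (\<sigma> * \<tau>)) (\<lambda>j. of_real (y' j (\<sigma> * \<tau>))))
            \<le> \<theta> * \<mu> i * k i * d"
        proof (rule lip[OF _ y(3)[OF s] y'(3)[OF s] d])
          show "norm (complex_of_real (y j (\<sigma> * \<tau>)) - of_real (y' j (\<sigma> * \<tau>))) \<le> k j * d" for j
            using Suc.IH s unfolding of_real_diff[symmetric] norm_of_real d_def by blast
        qed (use t T in linarith)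
        from norm_diff_triangle_le[OF this close[OF t y'(3)[OF s]]]
        show "norm (\<sigma> * \<tau> * (D i (\<sigma> * \<tau>) - D' i (\<sigma> * \<tau>)) + \<mu> i * (y i (\<sigma> * \<tau>) - y' i (\<sigma> * \<tau>))) \<le> \<mu> i * (k i * (\<theta> * d + e))"
          unfolding y(4)[OF s, symmetric] y'(4)[OF s, symmetric] of_real_diff[symmetric] norm_of_real
          by (simp add: algebra_simps)
        show "norm (y i (\<sigma> * \<tau>) - y' i (\<sigma> * \<tau>)) \<le> k i * (2 * r)" using dist[OF s] by simp
      qed (use \<mu> t in \<open>auto simp: I_def\<close>)
      then show "\<bar>y i t - y' i t\<bar> \<le> k i * (\<theta> * d + e)" using \<sigma> by auto
    qed
  qed
  moreover have "(\<lambda>m. k i * (\<theta> ^ m * (2 * r) + e / (1 - \<theta>))) \<longlonglongrightarrow> k i * (0 * (2 * r) + e / (1 - \<theta>))"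
    using \<theta> by (intro tendsto_intros LIMSEQ_power_zero) auto
  ultimately show ?thesis using t by (intro LIMSEQ_le_const[of _ "k i * (e / (1 - \<theta>))"]) (auto simp: I_def)
qed

end

text \<open>\<open>bd\<close> limits the first step of the iteration from the constant c to (1 -
  \<theta>) r; later steps shrink by \<theta>, so all iterates stay in the ball of radius r.
  \<open>sym\<close> makes the solution real on the real axis.\<close>

locale rs_problem = rs_contraction +
  assumes bd: "\<And>i t. norm t < \<rho> \<Longrightarrow> norm (N i t (\<lambda>j. of_real (c j)) - of_real (\<mu> i * c i)) \<le> (1 - \<theta>) * \<mu> i * k i * r"
    and holo: "\<And>i Y. \<lbrakk>\<And>j. Y j holomorphic_on ball 0 \<rho>; \<And>t. norm t < \<rho> \<Longrightarrow> rs_ball c k r (\<lambda>j. Y j t)\<rbrakk> \<Longrightarrow>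
      (\<lambda>t. N i t (\<lambda>j. Y j t)) holomorphic_on ball 0 \<rho>"
    and sym: "\<And>i t u. N i (cnj t) (\<lambda>j. cnj (u j)) = cnj (N i t u)"
begin

definition good :: "('a \<Rightarrow> complex \<Rightarrow> complex) \<Rightarrow> bool" where
  "good Y \<longleftrightarrow> (\<forall>i. Y i holomorphic_on ball 0 \<rho>) \<and> (\<forall>t\<in>ball 0 \<rho>. rs_ball c k r (\<lambda>j. Y j t))"

text \<open>Z is the image of Y under the Picard map: the nonlinearity is frozen at Y and the linear
  singular equation is solved.\<close>

definition solves :: "('a \<Rightarrow> complex \<Rightarrow> complex) \<Rightarrow> ('a \<Rightarrow> complex \<Rightarrow> complex) \<Rightarrow> bool" where
  "solves Y Z \<longleftrightarrow> (\<forall>i. Z i holomorphic_on ball 0 \<rho> \<and>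
    (\<forall>t\<in>ball 0 \<rho>. t * deriv (Z i) t + of_real (\<mu> i) * Z i t = N i t (\<lambda>j. Y j t)))"

lemma solves_exists:
  assumes "good Y"
  shows "\<exists>Z. solves Y Z"
proof -
  have "\<forall>i. \<exists>Z. Z holomorphic_on ball 0 \<rho> \<and>
      (\<forall>t\<in>ball 0 \<rho>. t * deriv Z t + of_real (\<mu> i) * Z t = N i t (\<lambda>j. Y j t))"
    using assms by (intro allI regular_singular_linear \<rho> \<mu> holo) (auto simp: good_def)
  then show ?thesis unfolding solves_def by (rule choice)
qed

lemma solves_diff:
  assumes Y: "good Y" "good Y'" "solves Y Z" "solves Y' Z'" "0 \<le> d" "t \<in> ball 0 \<rho>"
    and d: "\<And>j t. t \<in> ball 0 \<rho> \<Longrightarrow> norm (Y j t - Y' j t) \<le> k j * d"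
  shows "norm (Z i t - Z' i t) \<le> k i * (\<theta> * d)"
proof (rule regular_singular_linear_bound[where G = "\<lambda>t. Z i t - Z' i t" and \<mu> = "\<mu> i" and \<rho> = \<rho>
      and g = "\<lambda>t. N i t (\<lambda>j. Y j t) - N i t (\<lambda>j. Y' j t)"])
  show "(\<lambda>t. Z i t - Z' i t) holomorphic_on ball 0 \<rho>"
    using Y by (auto simp: solves_def intro!: holomorphic_intros)
  fix t :: complex assume t: "t \<in> ball 0 \<rho>"
  have "Z i field_differentiable at t" "Z' i field_differentiable at t"
    using Y t by (auto simp: solves_def intro!: holomorphic_on_imp_differentiable_at)
  then show "t * deriv (\<lambda>t. Z i t - Z' i t) t + of_real (\<mu> i) * (Z i t - Z' i t) =
      N i t (\<lambda>j. Y j t) - N i t (\<lambda>j. Y' j t)"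
    using \<open>solves Y Z\<close> \<open>solves Y' Z'\<close> t unfolding solves_def by (simp add: algebra_simps)
  show "norm (N i t (\<lambda>j. Y j t) - N i t (\<lambda>j. Y' j t)) \<le> \<mu> i * (k i * (\<theta> * d))"
    using lip[of t "\<lambda>j. Y j t" "\<lambda>j. Y' j t" d i] d t Y by (simp add: good_def mult_ac)
qed (use \<mu> Y in auto)

lemma solves_unique:
  assumes Y: "good Y" "good Y'" "solves Y Y" "solves Y' Y'" and t: "t \<in> ball 0 \<rho>"
  shows "Y i t = Y' i t"
proof -
  have "\<forall>i. \<forall>t\<in>ball 0 \<rho>. norm (Y i t - Y' i t) \<le> k i * (\<theta> ^ m * (2 * r))" for m
  proof (induction m)
    case 0
    have "norm (Y i t - Y' i t) \<le> k i * (2 * r)" if "t \<in> ball 0 \<rho>" for i t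
    proof -
      have "norm (Y i t - of_real (c i)) \<le> k i * r" "norm (Y' i t - of_real (c i)) \<le> k i * r"
        using Y(1,2) that by (auto simp: good_def rs_ball_def)
      then show ?thesis using norm_triangle_ineq4[of "Y i t - of_real (c i)" "Y' i t - of_real (c i)"] by simp
    qed
    then show ?case by simp
  next
    case (Suc m)
    then show ?case using solves_diff[OF Y, of "\<theta> ^ m * (2 * r)"] r \<theta> by (simp add: mult_ac)
  qed
  moreover have "(\<lambda>m. k i * (\<theta> ^ m * (2 * r))) \<longlonglongrightarrow> k i * (0 * (2 * r))"
    using \<theta> by (intro tendsto_intros LIMSEQ_power_zero) auto
  ultimately have "norm (Y i t - Y' i t) \<le> 0" using t by (intro LIMSEQ_le_const) auto
  then show ?thesis by simp
qed

text \<open>Picard iteration from the constant c: convergence is uniform on the whole disc, so the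
  limit is holomorphic, and the contraction estimate identifies it as a fixed point.\<close>

lemma exists_holomorphic: "\<exists>Y. good Y \<and> solves Y Y"
proof -
  define Y where "Y = rec_nat (\<lambda>i _. of_real (c i)) (\<lambda>_ Y. SOME Z. solves Y Z)"
  have Y0: "Y 0 = (\<lambda>i _. of_real (c i))" and YS: "Y (Suc n) = (SOME Z. solves (Y n) Z)" for n
    by (simp_all add: Y_def)
  have main: "good (Y n) \<and> solves (Y n) (Y (Suc n)) \<and>
    (\<forall>i. \<forall>t\<in>ball 0 \<rho>. norm (Y n i t - of_real (c i)) \<le> k i * (r * (1 - \<theta> ^ n))) \<and>
    (\<forall>i. \<forall>t\<in>ball 0 \<rho>. norm (Y (Suc n) i t - Y n i t) \<le> k i * (r * (\<theta> ^ n - \<theta> ^ Suc n)))" for n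
  proof (induction n)
    case 0
    have g: "good (Y 0)" using k r by (auto simp: good_def rs_ball_def Y0 less_imp_le)
    have s: "solves (Y 0) (Y (Suc 0))" unfolding YS by (rule someI_ex[OF solves_exists[OF g]])
    have "norm (Y (Suc 0) i t - of_real (c i)) \<le> k i * (r * (1 - \<theta>))" if t: "t \<in> ball 0 \<rho>" for i t
    proof (rule regular_singular_linear_bound[where G = "\<lambda>t. Y (Suc 0) i t - of_real (c i)" and \<mu> = "\<mu> i" and \<rho> = \<rho>
          and g = "\<lambda>t. N i t (\<lambda>j. of_real (c j)) - of_real (\<mu> i * c i)"])
      show "(\<lambda>t. Y (Suc 0) i t - of_real (c i)) holomorphic_on ball 0 \<rho>"
        using s by (auto simp: solves_def intro!: holomorphic_intros)
      fix t :: complex assume t: "t \<in> ball 0 \<rho>"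
      have "Y (Suc 0) i field_differentiable at t"
        using s t by (auto simp: solves_def intro!: holomorphic_on_imp_differentiable_at)
      then show "t * deriv (\<lambda>t. Y (Suc 0) i t - of_real (c i)) t + of_real (\<mu> i) * (Y (Suc 0) i t - of_real (c i)) =
          N i t (\<lambda>j. of_real (c j)) - of_real (\<mu> i * c i)"
        using s t unfolding solves_def Y0 by (simp add: algebra_simps)
      show "norm (N i t (\<lambda>j. of_real (c j)) - of_real (\<mu> i * c i)) \<le> \<mu> i * (k i * (r * (1 - \<theta>)))"
        using bd[of t i] t by (simp add: mult_ac)
    qed (use \<mu> t in auto)
    then show ?case using g s by (auto simp: Y0)
  next
    case (Suc n)
    have le: "norm (Y (Suc n) i t - of_real (c i)) \<le> k i * (r * (1 - \<theta> ^ Suc n))" if "t \<in> ball 0 \<rho>" for i t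
    proof -
      have "norm (Y (Suc n) i t - of_real (c i)) \<le> k i * (r * (\<theta> ^ n - \<theta> ^ Suc n)) + k i * (r * (1 - \<theta> ^ n))"
        using Suc.IH that by (intro norm_diff_triangle_le[of _ "Y n i t"]) auto
      then show ?thesis by (simp add: algebra_simps)
    qed
    have "k i * (r * (1 - \<theta> ^ Suc n)) \<le> k i * r" for i
      using k[of i] r \<theta> by (intro mult_left_mono) (auto intro: mult_left_le)
    then have g: "good (Y (Suc n))"
      using Suc.IH le order_trans unfolding good_def rs_ball_def by (fastforce simp: solves_def)
    have s: "solves (Y (Suc n)) (Y (Suc (Suc n)))" unfolding YS[of "Suc n"] by (rule someI_ex[OF solves_exists[OF g]])
    have nn: "0 \<le> r * (\<theta> ^ n - \<theta> ^ Suc n)"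
      using r \<theta> by (auto intro!: mult_nonneg_nonneg mult_left_le_one_le)
    have "norm (Y (Suc (Suc n)) i t - Y (Suc n) i t) \<le> k i * (\<theta> * (r * (\<theta> ^ n - \<theta> ^ Suc n)))"
      if "t \<in> ball 0 \<rho>" for i t
      using Suc.IH g s that nn by (intro solves_diff[of "Y (Suc n)" "Y n"]) auto
    then show ?case using g s le by (simp add: algebra_simps)
  qed
  define Z where "Z i t = (SOME l. \<forall>n. norm (l - Y n i t) \<le> k i * r * \<theta> ^ n)" for i t
  have ex: "\<exists>l. \<forall>n. norm (l - Y n i t) \<le> k i * r * \<theta> ^ n" if "t \<in> ball 0 \<rho>" for i t
    using main that k[of i] r \<theta> by (intro geometric_limit) (auto simp: mult.assoc)
  have ZY: "norm (Z i t - Y n i t) \<le> k i * r * \<theta> ^ n" if "t \<in> ball 0 \<rho>" for i t n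
    using someI_ex[OF ex[OF that]] unfolding Z_def by blast
  have lim0: "(\<lambda>n. k i * r * \<theta> ^ n) \<longlonglongrightarrow> 0" for i
    using \<theta> by (auto intro!: tendsto_mult_right_zero LIMSEQ_power_zero)
  have uni: "uniform_limit (ball 0 \<rho>) (\<lambda>n. Y n i) (Z i) sequentially" for i
  proof (rule uniform_limitI)
    fix e :: real assume "e > 0"
    then have "\<forall>\<^sub>F n in sequentially. k i * r * \<theta> ^ n < e"
      using lim0[of i] by (intro order_tendstoD)
    then show "\<forall>\<^sub>F n in sequentially. \<forall>t\<in>ball 0 \<rho>. dist (Y n i t) (Z i t) < e"
      by eventually_elim (use ZY in \<open>fastforce simp: dist_norm norm_minus_commute intro: le_less_trans\<close>)
  qed
  have Zh: "Z i holomorphic_on ball 0 \<rho>" for i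
  proof (rule holomorphic_uniform_sequence)
    show "open (ball 0 \<rho> :: complex set)" by simp
    show "Y n i holomorphic_on ball 0 \<rho>" for n using main[of n] by (auto simp: good_def)
    fix x :: complex assume "x \<in> ball 0 \<rho>"
    then obtain d where "0 < d" "cball x d \<subseteq> ball 0 \<rho>"
      using open_contains_cball[of "ball 0 \<rho> :: complex set"] open_ball by blast
    then show "\<exists>d>0. cball x d \<subseteq> ball 0 \<rho> \<and> uniform_limit (cball x d) (\<lambda>n. Y n i) (Z i) sequentially"
      using uniform_limit_on_subset[OF uni] by blast
  qed
  have gZ: "good Z" using Zh ZY[of _ _ 0] by (auto simp: good_def rs_ball_def Y0)
  then obtain Z' where Z': "solves Z Z'" using solves_exists by blast
  have eq: "Z' i t = Z i t" if t: "t \<in> ball 0 \<rho>" for i t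
  proof -
    have "norm (Z' i t - Y (Suc n) i t) \<le> k i * (\<theta> * (r * \<theta> ^ n))" for n
      using main[of n] gZ Z' t r \<theta> ZY[of _ _ n] by (intro solves_diff[of Z "Y n"]) (auto simp: mult_ac)
    then have "norm (Z' i t - Z i t) \<le> k i * r * \<theta> ^ Suc n + k i * r * \<theta> ^ Suc n" for n
      using ZY[OF t, of i "Suc n"] by (intro norm_diff_triangle_le[of _ "Y (Suc n) i t"]) (auto simp: norm_minus_commute mult_ac)
    with LIMSEQ_le_const[OF tendsto_add[OF lim0[THEN LIMSEQ_Suc] lim0[THEN LIMSEQ_Suc]], of "norm (Z' i t - Z i t)" i i]
    have "norm (Z' i t - Z i t) \<le> 0 + 0" by blast
    then show ?thesis by simp
  qed
  have "deriv (Z' i) t = deriv (Z i) t" if t: "t \<in> ball 0 \<rho>" for i t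
  proof (rule deriv_cong_ev)
    show "\<forall>\<^sub>F x in nhds t. Z' i x = Z i x"
      using eventually_nhds_in_open[OF open_ball t] by eventually_elim (rule eq)
  qed simp
  with eq Z' gZ Zh show ?thesis by (intro exI[of _ Z]) (auto simp: solves_def)
qed

text \<open>Reflection principle: t -> cnj (Y (cnj t)) solves the same equation by
  \<open>sym\<close>, so uniqueness makes Y and its derivative real on the real axis.\<close>

theorem exists_real:
  "\<exists>y y'. rs_solution N c \<mu> k r {t. \<bar>t\<bar> < \<rho>} y y' \<and> (\<forall>i t. \<bar>t\<bar> < \<rho> \<longrightarrow> (\<exists>F. (\<lambda>s. y i (t + s)) has_fps_expansion F))"
proof -
  obtain Y where Y: "good Y" "solves Y Y" using exists_holomorphic by blast
  then have Yh: "Y i holomorphic_on ball 0 \<rho>" for i by (simp add: good_def)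
  have inb: "of_real t \<in> (ball 0 \<rho> :: complex set)" if "\<bar>t\<bar> < \<rho>" for t using that by simp
  define Y' where "Y' i t = cnj (Y i (cnj t))" for i t
  have der: "(Y' i has_field_derivative cnj (deriv (Y i) (cnj t))) (at t)" if "t \<in> ball 0 \<rho>" for i t
  proof -
    have "(Y i has_field_derivative deriv (Y i) (cnj t)) (at (cnj t))"
      using Yh that by (intro holomorphic_derivI[OF _ open_ball]) auto
    from has_field_derivative_cnj_cnj[OF this] show ?thesis by (simp add: Y'_def[abs_def] o_def)
  qed
  have "rs_ball c k r (\<lambda>j. Y' j t)" if "t \<in> ball 0 \<rho>" for t
  proof -
    have "norm (Y' j t - of_real (c j)) = norm (Y j (cnj t) - of_real (c j))" for j
      using complex_mod_cnj[of "Y j (cnj t) - of_real (c j)"] by (simp add: Y'_def)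
    then show ?thesis using Y(1) that by (auto simp: good_def rs_ball_def)
  qed
  moreover have hY': "Y' i holomorphic_on ball 0 \<rho>" for i
    unfolding holomorphic_on_open[OF open_ball] using der by blast
  ultimately have "good Y'" by (auto simp: good_def)
  moreover have "solves Y' Y'" unfolding solves_def
  proof (intro allI conjI ballI)
    fix i t assume t: "t \<in> ball (0::complex) \<rho>"
    then have "cnj t * deriv (Y i) (cnj t) + of_real (\<mu> i) * Y i (cnj t) = N i (cnj t) (\<lambda>j. Y j (cnj t))"
      using Y(2) by (simp add: solves_def)
    from arg_cong[OF this, of cnj] show "t * deriv (Y' i) t + of_real (\<mu> i) * Y' i t = N i t (\<lambda>j. Y' j t)"
      unfolding DERIV_imp_deriv[OF der[OF t]] sym[symmetric] by (simp add: Y'_def)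
  qed (rule hY')
  ultimately have eqY: "Y' i t = Y i t" if "t \<in> ball 0 \<rho>" for i t using that Y by (intro solves_unique)
  define y where "y = (\<lambda>i t. Re (Y i (of_real t)))"
  define y' where "y' = (\<lambda>i t. Re (deriv (Y i) (of_real t)))"
  have real: "Y i (of_real t) = of_real (y i t)" if "\<bar>t\<bar> < \<rho>" for i t
    using eqY[OF inb[OF that], of i] by (simp add: Y'_def y_def complex_eq_iff)
  have real': "deriv (Y i) (of_real t) = of_real (y' i t)" if "\<bar>t\<bar> < \<rho>" for i t
    using DERIV_imp_deriv[OF has_field_derivative_transform_within_open[OF der[OF inb[OF that]] open_ball inb[OF that] eqY], of i]
    by (simp add: y'_def complex_eq_iff)
  have der_y: "(y i has_real_derivative y' i t) (at t)" if t: "\<bar>t\<bar> < \<rho>" for i t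
  proof -
    have "(Y i has_field_derivative deriv (Y i) (of_real t)) (at (of_real t))"
      using Yh inb[OF t] by (intro holomorphic_derivI) auto
    then have "((Y i \<circ> of_real) has_vector_derivative 1 * deriv (Y i) (of_real t)) (at t)"
      using has_vector_derivative_of_real[of "\<lambda>x. x" 1 "at t", where 'a = complex]
      by (intro field_vector_diff_chain_at) (auto simp: has_real_derivative_iff_has_vector_derivative)
    from bounded_linear.has_vector_derivative[OF bounded_linear_Re this] show ?thesis
      by (simp add: y_def y'_def o_def has_real_derivative_iff_has_vector_derivative)
  qed
  have "\<exists>F. (\<lambda>s. y i (t + s)) has_fps_expansion F" if t: "\<bar>t\<bar> < \<rho>" for i t
  proof (rule holomorphic_imp_real_fps_expansion)
    have "of_real t + z \<in> ball 0 \<rho>" if "z \<in> ball 0 (\<rho> - \<bar>t\<bar>)" for z :: complex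
      using that norm_triangle_ineq[of "of_real t" z] by simp
    then have "(\<lambda>z. of_real t + z) ` ball 0 (\<rho> - \<bar>t\<bar>) \<subseteq> (ball 0 \<rho> :: complex set)"
      by blast
    then show "(Y i \<circ> (\<lambda>z. of_real t + z)) holomorphic_on ball 0 (\<rho> - \<bar>t\<bar>)"
      by (intro holomorphic_on_compose_gen[OF _ Yh] holomorphic_intros)
  qed (use t in \<open>simp_all add: y_def\<close>)
  moreover have "rs_solution N c \<mu> k r {t. \<bar>t\<bar> < \<rho>} y y'" unfolding rs_solution_def
  proof (intro allI ballI conjI; unfold mem_Collect_eq)
    fix i t assume t: "\<bar>t\<bar> < \<rho>"
    have "rs_ball c k r (\<lambda>j. of_real (y j t))"
      using Y(1) inb[OF t] unfolding good_def real[OF t, symmetric] by blast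
    then show "\<bar>y i t - c i\<bar> \<le> k i * r" unfolding rs_ball_of_real by blast
    have "of_real t * deriv (Y i) (of_real t) + of_real (\<mu> i) * Y i (of_real t) = N i (of_real t) (\<lambda>j. Y j (of_real t))"
      using Y(2) inb[OF t] unfolding solves_def by blast
    then show "of_real (t * y' i t + \<mu> i * y i t) = N i (of_real t) (\<lambda>j. of_real (y j t))"
      by (simp add: real[OF t] real'[OF t])
  qed (rule der_y)
  ultimately show ?thesis by blast
qed

end

subsection \<open>The equations at the sonic point in blown-up variables\<close>

text \<open>Tube lemma, by extracting a convergent subsequence from counterexamples. It turns
  statements that hold near eps = 0 for each w into statements uniform over the compact range of
  w.\<close>

lemma uniform_eventually_compact:
  fixes P :: "'a::metric_space \<times> 'b::real_normed_vector \<Rightarrow> bool"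
  assumes K: "compact K" and ev: "\<And>k. k \<in> K \<Longrightarrow> eventually P (nhds (k, 0))"
  shows "\<exists>\<delta>>0. \<forall>k\<in>K. \<forall>v. norm v < \<delta> \<longrightarrow> P (k, v)"
proof (rule ccontr)
  assume "\<not> ?thesis"
  then have "\<exists>k v. k \<in> K \<and> norm v < 1 / Suc n \<and> \<not> P (k, v)" for n
    by (metis of_nat_0_less_iff zero_less_Suc zero_less_divide_1_iff)
  then obtain k v where kv: "\<And>n. k n \<in> K" "\<And>n. norm (v n) < 1 / Suc n" "\<And>n. \<not> P (k n, v n)"
    by metis
  obtain l s where l: "l \<in> K" "strict_mono s" "(k \<circ> s) \<longlonglongrightarrow> l"
    using K kv(1) unfolding compact_def by blast
  have "(\<lambda>n. 1 / Suc n) \<longlonglongrightarrow> (0::real)" by real_asymp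
  then have "v \<longlonglongrightarrow> 0"
    using kv(2) by (intro Lim_null_comparison[of v "\<lambda>n. 1 / Suc n"] always_eventually allI less_imp_le)
  then have v: "(v \<circ> s) \<longlonglongrightarrow> 0" using l(2) by (rule LIMSEQ_subseq_LIMSEQ)
  have "(\<lambda>n. ((k \<circ> s) n, (v \<circ> s) n)) \<longlonglongrightarrow> (l, 0)" by (intro tendsto_intros l v)
  then have "\<forall>\<^sub>F n in sequentially. P ((k \<circ> s) n, (v \<circ> s) n)"
    using ev[OF l(1)] by (rule eventually_compose_filterlim[rotated])
  then show False using kv(3) by (auto simp: eventually_sequentially)
qed

lemma isCont_eventually_less:
  fixes f :: "'a::t2_space \<Rightarrow> real"
  assumes "isCont f x"
  shows "f x < c \<Longrightarrow> eventually (\<lambda>y. f y < c) (nhds x)" "c < f x \<Longrightarrow> eventually (\<lambda>y. c < f y) (nhds x)"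
  using order_tendstoD[of f "f x" "nhds x" c] assms by (auto simp: isCont_def tendsto_at_iff_tendsto_nhds)

lemma uniform_near_compact:
  fixes f :: "'a::metric_space \<times> 'b::real_normed_vector \<Rightarrow> 'c::metric_space"
  assumes K: "compact K" and cont: "\<And>k. k \<in> K \<Longrightarrow> isCont f (k, 0)" and e: "e > 0"
  shows "\<exists>\<delta>>0. \<forall>k\<in>K. \<forall>v. norm v < \<delta> \<longrightarrow> dist (f (k, v)) (f (k, 0)) < e"
proof -
  have "eventually (\<lambda>kv. dist (f kv) (f (fst kv, 0)) < e) (nhds (k, 0))" if "k \<in> K" for k
  proof -
    have "isCont (\<lambda>kv. f (fst kv, 0)) (k, 0)"
      by (rule isCont_o2[where f = "\<lambda>kv. (fst kv, 0)"]) (auto intro!: continuous_intros cont that)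
    then have "isCont (\<lambda>kv. dist (f kv) (f (fst kv, 0))) (k, 0)"
      using cont[OF that] by (intro continuous_intros)
    then show ?thesis using e by (intro isCont_eventually_less) auto
  qed
  from uniform_eventually_compact[OF K this] show ?thesis by simp
qed

text \<open>Near the sonic point \<open>R = w + t (p - u)\<close>, \<open>W = w + t u\<close>, and \<open>(R / w) powr (- eta e)\<close> is
  replaced by the additional unknown \<open>1 + t g\<close>, which makes the equations rational. Divided by
  \<open>x_*\<^sup>2\<close>, the denominator \<open>B\<close> becomes \<open>t * son_b\<close>. The combination \<open>p\<close> makes the linearization
  triangular for \<open>e = 0\<close>.\<close>

definition son_H0 :: "'a::real_normed_field \<Rightarrow> 'a \<Rightarrow> 'a" where
  "son_H0 e w = (1 + 3 * e) * w^2 + 4 * e * w + e^2 - e"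

text \<open>The bracket of B at R = w + t (p - u), W = w + t u, minus its value
  \<open>son_H0\<close> at the sonic point, divided by t and written as a polynomial so that t = 0
  is harmless.\<close>

definition son_S :: "'a::real_normed_field \<Rightarrow> 'a \<Rightarrow> 'a \<Rightarrow> 'a \<Rightarrow> 'a \<Rightarrow> 'a" where
  "son_S e w t p u = 2 * (w + e) * u + t * u^2 - e * (2 * (w - 1) * u + t * u^2)
     + 4 * e * (w * p + t * (p - u) * u)"

definition son_b :: "'a::real_normed_field \<Rightarrow> 'a \<Rightarrow> 'a \<Rightarrow> 'a \<Rightarrow> 'a \<Rightarrow> 'a \<Rightarrow> 'a" where
  "son_b e w t p u g = son_H0 e w * g - son_S e w t p u * (1 + t)^2 - son_H0 e w * (2 + t)"

text \<open>Since R - W = t (p - 2 u), this is x_*^2 (R - W) / B with the factor t cancelled: the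
  indeterminate quotient of the equations.\<close>

definition son_q :: "'a::real_normed_field \<Rightarrow> 'a \<Rightarrow> 'a \<Rightarrow> 'a \<Rightarrow> 'a \<Rightarrow> 'a \<Rightarrow> 'a" where
  "son_q e w t p u g = (p - 2 * u) / son_b e w t p u g"

text \<open>This and the next two are the right-hand sides for the z-derivatives of R + W, W and (R
  / w) powr (- eta e). In terms of p, u, g these derivatives are t p' + p, t u' + u and t g' + g:
  the singular form with \<mu> = 1.\<close>

definition son_NP :: "'a::real_normed_field \<Rightarrow> 'a \<Rightarrow> 'a \<Rightarrow> 'a \<Rightarrow> 'a \<Rightarrow> 'a \<Rightarrow> 'a" where
  "son_NP e w t p u g = (1 - 3 * (w + t * u)) / (1 + t) + 2 * (1 + t) * (w + t * u + e) *
     ((1 + e) * (w + t * u) - (1 - e) * (w + t * (p - u))) * son_q e w t p u g"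

definition son_NU :: "'a::real_normed_field \<Rightarrow> 'a \<Rightarrow> 'a \<Rightarrow> 'a \<Rightarrow> 'a \<Rightarrow> 'a \<Rightarrow> 'a" where
  "son_NU e w t p u g = (1 - 3 * (w + t * u)) / (1 + t) + 2 * (1 + e) * (1 + t) * (w + t * u) *
     (w + t * u + e) * son_q e w t p u g"

definition son_NG :: "'a::real_normed_field \<Rightarrow> 'a \<Rightarrow> 'a \<Rightarrow> 'a \<Rightarrow> 'a \<Rightarrow> 'a \<Rightarrow> 'a" where
  "son_NG e w t p u g = 4 * e * (1 + t) * (1 + t * g) * (w + t * u + e) * son_q e w t p u g"

lemmas son_defs = son_H0_def son_S_def son_b_def son_q_def son_NP_def son_NU_def son_NG_def

datatype son_var = VP | VU | VG

definition son_N :: "real \<Rightarrow> real \<Rightarrow> son_var \<Rightarrow> complex \<Rightarrow> (son_var \<Rightarrow> complex) \<Rightarrow> complex" where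
  "son_N e w i t v = (case i of
     VP \<Rightarrow> son_NP (of_real e) (of_real w) t (v VP) (v VU) (v VG)
   | VU \<Rightarrow> son_NU (of_real e) (of_real w) t (v VP) (v VU) (v VG)
   | VG \<Rightarrow> son_NG (of_real e) (of_real w) t (v VP) (v VU) (v VG))"

text \<open>For e = 0 the slopes of RLP type are W_1 = 1 - 2 w and R_1 = - w, hence p = R_1 + W_1 =
  1 - 3 w.\<close>

definition son_c :: "real \<Rightarrow> son_var \<Rightarrow> real" where
  "son_c w i = (case i of VP \<Rightarrow> 1 - 3 * w | VU \<Rightarrow> 1 - 2 * w | VG \<Rightarrow> 0)"

text \<open>The weights make the off-diagonal part of the triangular linearization small.\<close>

definition son_k :: "real \<Rightarrow> son_var \<Rightarrow> real" where
  "son_k \<kappa> i = (case i of VP \<Rightarrow> \<kappa> | VU \<Rightarrow> 1 | VG \<Rightarrow> \<kappa>)"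

abbreviation son_ball :: "real \<Rightarrow> real \<Rightarrow> real \<Rightarrow> (son_var \<Rightarrow> complex) \<Rightarrow> bool" where
  "son_ball \<kappa> w \<equiv> rs_ball (son_c w) (son_k \<kappa>)"

text \<open>The constants do not depend on e and w. The estimates hold on the doubled ball 2 r, so
  that a solution for w can also be seen in the ball centred for a nearby w'. The lower bound 3/10
  leaves room below the value 1/3 at the right end of the window; wM < 1/2 keeps the slope 1 - 2 w
  away from the root 0 of the cubic.\<close>

locale sonic =
  fixes wM \<eta> \<theta> \<kappa> r \<rho> e0 :: real
  assumes wM: "3/10 \<le> wM" "wM < 1/2"
    and \<eta>: "0 < \<eta>" "\<eta> \<le> (1 - 2 * wM) / 8"
    and \<theta>: "0 \<le> \<theta>" "\<theta> < 1"
    and \<kappa>: "0 < \<kappa>" "\<kappa> \<le> 1"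
    and r: "0 < r" "r \<le> \<eta> / 10"
    and \<rho>: "0 < \<rho>" "\<rho> \<le> \<eta>" "\<rho> \<le> 1/4"
    and e0: "0 < e0" "e0 \<le> 1/4"
    and near: "\<lbrakk>0 \<le> e; e \<le> e0; 3/10 \<le> w; w \<le> wM; norm t < \<rho>; son_ball \<kappa> w (2 * r) v\<rbrakk> \<Longrightarrow>
      norm (son_b (of_real e) (of_real w) t (v VP) (v VU) (v VG) + of_real (2 * w * (1 - w))) < \<eta> \<and>
      norm (son_N e w i t v - of_real (son_c w i)) < \<eta>"
    and lip: "\<lbrakk>0 \<le> e; e \<le> e0; 3/10 \<le> w; w \<le> wM; norm t < \<rho>; son_ball \<kappa> w (2 * r) v; son_ball \<kappa> w (2 * r) v';
        0 \<le> d; \<And>j. norm (v j - v' j) \<le> son_k \<kappa> j * d\<rbrakk> \<Longrightarrow>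
      norm (son_N e w i t v - son_N e w i t v') \<le> \<theta> * son_k \<kappa> i * d"
    and start: "\<lbrakk>0 \<le> e; e \<le> e0; 3/10 \<le> w; w \<le> wM; norm t < \<rho>\<rbrakk> \<Longrightarrow>
      norm (son_N e w i t (\<lambda>j. of_real (son_c w j)) - of_real (son_c w i)) \<le> (1 - \<theta>) * son_k \<kappa> i * r"

lemma isCont_son:
  fixes e w t p u g :: "'b::t2_space \<Rightarrow> 'a::real_normed_field"
  assumes "isCont e x" "isCont w x" "isCont t x" "isCont p x" "isCont u x" "isCont g x"
    and nz: "son_b (e x) (w x) (t x) (p x) (u x) (g x) \<noteq> 0" "1 + t x \<noteq> 0"
  shows "isCont (\<lambda>x. son_b (e x) (w x) (t x) (p x) (u x) (g x)) x"
    "isCont (\<lambda>x. son_NP (e x) (w x) (t x) (p x) (u x) (g x)) x"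
    "isCont (\<lambda>x. son_NU (e x) (w x) (t x) (p x) (u x) (g x)) x"
    "isCont (\<lambda>x. son_NG (e x) (w x) (t x) (p x) (u x) (g x)) x"
proof -
  show b: "isCont (\<lambda>x. son_b (e x) (w x) (t x) (p x) (u x) (g x)) x"
    unfolding son_b_def son_S_def son_H0_def by (intro continuous_intros assms)
  show "isCont (\<lambda>x. son_NP (e x) (w x) (t x) (p x) (u x) (g x)) x"
    "isCont (\<lambda>x. son_NU (e x) (w x) (t x) (p x) (u x) (g x)) x"
    "isCont (\<lambda>x. son_NG (e x) (w x) (t x) (p x) (u x) (g x)) x"
    unfolding son_NP_def son_NU_def son_NG_def son_q_def by (intro continuous_intros assms b)+
qed

lemma son_N_holomorphic_on:
  assumes Y: "\<And>j. Y j holomorphic_on A" and \<tau>: "\<tau> holomorphic_on A"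
    and nz: "\<And>z. z \<in> A \<Longrightarrow> son_b (of_real e) (of_real w) (\<tau> z) (Y VP z) (Y VU z) (Y VG z) \<noteq> 0"
      "\<And>z. z \<in> A \<Longrightarrow> 1 + \<tau> z \<noteq> 0"
  shows "(\<lambda>z. son_N e w i (\<tau> z) (\<lambda>j. Y j z)) holomorphic_on A"
proof -
  have "(\<lambda>z. son_b (of_real e) (of_real w) (\<tau> z) (Y VP z) (Y VU z) (Y VG z)) holomorphic_on A"
    unfolding son_b_def son_S_def son_H0_def by (intro holomorphic_intros Y \<tau>)
  then show ?thesis unfolding son_N_def
    by (cases i; simp; unfold son_NP_def son_NU_def son_NG_def son_q_def; intro holomorphic_intros Y \<tau> nz; simp)
qed

text \<open>Schwarz lemma for (g (S z) - g 0) / (2 M) at z = 1 / S: a small holomorphic function on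
  a large disc has a small increment.\<close>

lemma holomorphic_diff_le:
  assumes g: "g holomorphic_on ball 0 S" and S: "1 < S" and M: "\<And>z. norm z < S \<Longrightarrow> norm (g z) < M"
  shows "norm (g 1 - g 0) \<le> 2 * M / S"
proof -
  have M0: "0 < M" using M[of 0] S norm_ge_zero[of "g 0"] by (simp del: norm_ge_zero)
  define f where "f z = (g (of_real S * z) - g 0) / of_real (2 * M)" for z
  have f0: "f 0 = 0" by (simp add: f_def)
  have lt: "norm (of_real S * z) < S" if "norm z < 1" for z :: complex using that S by (simp add: norm_mult)
  have "(\<lambda>z. g (of_real S * z)) holomorphic_on ball 0 1"
    using lt by (intro holomorphic_on_compose_gen[OF _ g, unfolded o_def] holomorphic_intros) auto
  then have "f holomorphic_on ball 0 1" unfolding f_def using M0 by (intro holomorphic_intros) auto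
  moreover have "norm (f z) < 1" if "norm z < 1" for z
    using M[OF lt[OF that]] M[of 0] S M0 norm_triangle_ineq4[of "g (of_real S * z)" "g 0"]
    by (simp add: f_def norm_divide)
  moreover have "norm (of_real (1 / S) :: complex) < 1" using S unfolding norm_of_real by simp
  ultimately have "norm (f (of_real (1 / S))) \<le> norm (of_real (1 / S) :: complex)"
    using f0 by (intro Schwarz_Lemma(1)) auto
  moreover have "f (of_real (1 / S)) = (g 1 - g 0) / of_real (2 * M)" using S by (simp add: f_def)
  ultimately have "norm (g 1 - g 0) / (2 * M) \<le> 1 / S" using S M0 unfolding norm_of_real by (simp add: norm_divide)
  then show ?thesis using M0 S by (simp add: field_simps)
qed

lemma son_b_base:
  "son_b 0 w 0 (1 - 3 * w + dp) (1 - 2 * w + du) dg = w * (w * dg - 2 * du - 2 * (1 - w))"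
  by (simp add: son_b_def son_S_def son_H0_def algebra_simps power2_eq_square)

text \<open>The centre is a fixed point, and the derivative in du there is w / (1 - w), which is
  below 1 exactly for w < 1/2. The influence of dp and dg is off-diagonal and will be damped by the
  weights.\<close>

lemma son_NU_base:
  fixes w :: "'a::real_normed_field"
  assumes "w \<noteq> 0" "w * dg - 2 * du - 2 * (1 - w) \<noteq> 0"
  shows "son_NU 0 w 0 (1 - 3 * w + dp) (1 - 2 * w + du) dg =
    1 - 2 * w + w * (2 * dp - 2 * du - w * dg) / (w * dg - 2 * du - 2 * (1 - w))"
proof -
  define y z where "y = w * dg - 2 * du - 2 * (1 - w)" "z = 1 - 3 * w + dp - 2 * (1 - 2 * w + du)"
  note d = this
  have "1 - 3 * w + 2 * w * w * (z / (w * y)) = 1 - 2 * w + w * (2 * z - y) / y"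
    using assms(1) assms(2)[folded d(1)] by (simp add: field_simps)
  also have "2 * z - y = 2 * dp - 2 * du - w * dg" by (simp add: d algebra_simps)
  finally show ?thesis by (simp add: son_NU_def son_q_def son_b_base d mult.assoc)
qed

lemma son_N_base:
  "son_NP 0 w 0 p u g = 1 - 3 * w" "son_NG 0 w 0 p u g = 0"
  by (simp_all add: son_NP_def son_NG_def)

text \<open>For \<open>e = 0\<close>, \<open>t = 0\<close> only the second equation is not constant, and it is a contraction
  since \<open>w < 1/2\<close>; the difference to this case is a small holomorphic function of the unknowns, hence has
  a small Lipschitz constant by the Schwarz lemma.\<close>

lemma sonic_exists:
  assumes wM: "3/10 \<le> wM" "wM < 1/2" and \<eta>: "0 < \<eta>" "\<eta> \<le> (1 - 2 * wM) / 8"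
  shows "\<exists>\<theta> \<kappa> r \<rho> e0. sonic wM \<eta> \<theta> \<kappa> r \<rho> e0"
proof -
  \<comment> \<open>m measures the gap of the contraction: w / (1 - w) <= (1 - m) / (1 + m). The
    unperturbed second equation will get the Lipschitz constant 1 - m / 2; the remaining m / 4 up to
    \<theta> is room for the perturbation.\<close>
  define m \<kappa> r \<theta> where "m = 1 - 2 * wM" "\<kappa> = m / 10" "r = \<eta> / 10" "\<theta> = 1 - m / 4"
  note d = this
  \<comment> \<open>Tolerance for the difference to the case e = 0, t = 0. The product form makes it
    small against each of r, \<kappa>, m and against the margin m / 4 * \<kappa> * r.\<close>
  define eps where "eps = m * \<kappa> * r / 100"
  have m: "0 < m" "m \<le> 4/10" and \<kappa>: "0 < \<kappa>" "\<kappa> \<le> 4/100" and r: "0 < r" "r \<le> 1/200" "r \<le> m / 80" and \<theta>: "9/10 \<le> \<theta>" "\<theta> < 1"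
    using wM \<eta> by (auto simp: d)
  have "m * \<kappa> \<le> 1 * 1" using m \<kappa> by (intro mult_mono) auto
  then have "m * \<kappa> * r \<le> 1 * r" using r by (intro mult_right_mono) auto
  moreover have "m * r * \<kappa> \<le> 1 * \<kappa>" "\<kappa> * r * m \<le> 1 * m"
    using m r \<kappa> by (intro mult_right_mono; auto intro!: mult_le_one)+
  ultimately have eps: "0 < eps" "eps \<le> r / 100" "eps \<le> \<kappa> / 100" "eps \<le> m / 100" "eps \<le> m / 4 * \<kappa> * r"
    using m \<kappa> r by (auto simp: eps_def mult_ac)
  \<comment> \<open>The polydiscs have radius 1/10, much larger than the ball of radius 2 r <=
    1/100, so that complex lines through points of the ball have room for the Schwarz lemma.\<close>
  define K :: "(real \<times> complex \<times> complex \<times> complex) set"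
    where "K = {3/10..wM} \<times> cball 0 (1/10) \<times> cball 0 (1/10) \<times> cball 0 (1/10)"
  have K: "compact K" unfolding K_def by (intro compact_Times compact_Icc compact_cball)
  define F where "F = (\<lambda>((w :: real, dp, du, dg), (e, t)).
    (son_b e (of_real w) t (1 - 3 * of_real w + dp) (1 - 2 * of_real w + du) dg,
     son_NP e (of_real w) t (1 - 3 * of_real w + dp) (1 - 2 * of_real w + du) dg,
     son_NU e (of_real w) t (1 - 3 * of_real w + dp) (1 - 2 * of_real w + du) dg,
     son_NG e (of_real w) t (1 - 3 * of_real w + dp) (1 - 2 * of_real w + du) (dg :: complex)))"
  have Y: "2 * (1 - w) - a \<le> norm (of_real w * dg - 2 * du - 2 * (1 - of_real w) :: complex)"
    if "3/10 \<le> w" "w \<le> wM" "norm dg \<le> b" "norm du \<le> b" "5 / 2 * b \<le> a" for w dg du a b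
  proof -
    have "norm (of_real w * dg - 2 * du :: complex) \<le> norm (of_real w * dg) + norm (2 * du)"
      by (rule norm_triangle_ineq4)
    also have "\<dots> \<le> 1 / 2 * b + 2 * b"
      using that wM by (simp only: norm_mult norm_of_real) (intro add_mono mult_mono; simp)
    finally have "norm (of_real w * dg - 2 * du :: complex) \<le> a" using that by simp
    moreover have "norm (2 * (1 - of_real w) :: complex) = 2 * (1 - w)"
      using norm_of_real[of "2 * (1 - w)", where 'a = complex] that wM by simp
    ultimately show ?thesis using norm_triangle_ineq2[of "2 * (1 - of_real w) :: complex" "of_real w * dg - 2 * du"]
      by (simp add: norm_minus_commute)
  qed
  have b0: "29/100 \<le> norm (son_b 0 (of_real w) 0 (1 - 3 * of_real w + dp) (1 - 2 * of_real w + du) dg)"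
    if "(w, dp, du, dg) \<in> K" for w dp du dg
  proof -
    have "2 * (1 - w) - 1/4 \<le> norm (of_real w * dg - 2 * du - 2 * (1 - of_real w))"
      using that by (intro Y[of _ _ "1/10"]) (auto simp: K_def)
    moreover have "29/100 \<le> w * (2 * (1 - w) - 1/4)"
    proof -
      have "0 \<le> (w - 3/10) * (1/2 - w)" using that wM by (intro mult_nonneg_nonneg) (auto simp: K_def)
      moreover have "w * (2 * (1 - w) - 1/4) = 2 * ((w - 3/10) * (1/2 - w)) + 15/100 * w + 3/10"
        by (simp add: field_simps)
      ultimately show ?thesis using that by (simp add: K_def)
    qed
    moreover have w: "0 \<le> w" using that by (simp add: K_def)
    ultimately have "29/100 \<le> w * norm (of_real w * dg - 2 * du - 2 * (1 - of_real w))"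
      by (meson mult_left_mono order_trans)
    with w show ?thesis unfolding son_b_base norm_mult norm_of_real by simp
  qed
  have "isCont F (k, 0)" if "k \<in> K" for k
  proof -
    obtain w dp du dg where k: "k = (w, dp, du, dg)" by (cases k) auto
    have nz: "son_b 0 (of_real w) 0 (1 - 3 * of_real w + dp) (1 - 2 * of_real w + du) dg \<noteq> 0"
      using b0[of w dp du dg] that k by auto
    show ?thesis unfolding F_def k zero_prod_def case_prod_unfold
      by (intro isCont_Pair isCont_son continuous_intros) (use nz in simp_all)
  qed
  from uniform_near_compact[OF K this \<open>0 < eps\<close>] obtain \<delta> where \<delta>: "\<delta> > 0"
    "\<And>k v. k \<in> K \<Longrightarrow> norm v < \<delta> \<Longrightarrow> dist (F (k, v)) (F (k, 0)) < eps"
    by blast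
  define \<rho> where "\<rho> = min (\<delta> / 2) (min \<eta> (1/4))"
  define e0 where "e0 = min (\<delta> / 3) (1/4)"
  define pol where "pol w v \<longleftrightarrow> norm (v VP - (1 - 3 * of_real w)) \<le> 1/10 \<and> norm (v VU - (1 - 2 * of_real w)) \<le> 1/10
    \<and> norm (v VG) \<le> 1/10" for w :: real and v :: "son_var \<Rightarrow> complex"
  have four: "dist a a' < eps \<and> dist b b' < eps \<and> dist c c' < eps \<and> dist d d' < eps"
    if "dist (a, b, c, d) (a', b', c', d') < eps" for a b c d a' b' c' d' :: complex
    using that dist_fst_le[of "(a, b, c, d)" "(a', b', c', d')"] dist_snd_le[of "(a, b, c, d)" "(a', b', c', d')"]
      dist_fst_le[of "(b, c, d)" "(b', c', d')"] dist_snd_le[of "(b, c, d)" "(b', c', d')"]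
      dist_fst_le[of "(c, d)" "(c', d')"] dist_snd_le[of "(c, d)" "(c', d')"] by auto
  have diff: "dist (son_b (of_real e) (of_real w) t (v VP) (v VU) (v VG)) (son_b 0 (of_real w) 0 (v VP) (v VU) (v VG)) < eps
      \<and> norm (son_N e w i t v - son_N 0 w i 0 v) < eps"
    if A: "0 \<le> e" "e \<le> e0" "3/10 \<le> w" "w \<le> wM" "norm t < \<rho>" "pol w v" for e w i and t :: complex and v
  proof -
    have "norm (complex_of_real e, t) \<le> norm (complex_of_real e) + norm t" by (rule norm_Pair_le)
    then have "norm (complex_of_real e, t) < \<delta>" using A \<delta>(1) by (auto simp: e0_def \<rho>_def)
    moreover have "(w, v VP - (1 - 3 * of_real w), v VU - (1 - 2 * of_real w), v VG) \<in> K"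
      using A by (simp add: K_def pol_def)
    ultimately have "dist (F ((w, v VP - (1 - 3 * of_real w), v VU - (1 - 2 * of_real w), v VG), (of_real e, t)))
        (F ((w, v VP - (1 - 3 * of_real w), v VU - (1 - 2 * of_real w), v VG), 0)) < eps"
      by (intro \<delta>)
    then have F: "dist (F ((w, v VP - (1 - 3 * of_real w), v VU - (1 - 2 * of_real w), v VG), (of_real e, t)))
        (F ((w, v VP - (1 - 3 * of_real w), v VU - (1 - 2 * of_real w), v VG), (0, 0))) < eps"
      by (simp only: zero_prod_def)
    show ?thesis using four[OF F[unfolded F_def prod.case]] by (cases i) (simp_all add: dist_norm[symmetric] son_N_def)
  qed
  define X Z where "X w v = 2 * (v VP - (1 - 3 * of_real w)) - 2 * (v VU - (1 - 2 * of_real w)) - of_real w * v VG"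
    "Z w v = of_real w * v VG - 2 * (v VU - (1 - 2 * of_real w)) - 2 * (1 - of_real w)"
    for w :: real and v :: "son_var \<Rightarrow> complex"
  note XZ = this
  have ballD: "norm (v VP - (1 - 3 * of_real w)) \<le> \<kappa> * (2 * r)" "norm (v VU - (1 - 2 * of_real w)) \<le> 2 * r"
      "norm (v VG) \<le> \<kappa> * (2 * r)" if v: "son_ball \<kappa> w (2 * r) v" for w v
    using v[unfolded rs_ball_def, rule_format, of VP] v[unfolded rs_ball_def, rule_format, of VU]
      v[unfolded rs_ball_def, rule_format, of VG] by (simp_all add: son_c_def son_k_def)
  have \<kappa>r: "\<kappa> * (2 * r) \<le> 2 * r" using \<kappa> r by simp
  have pol: "pol w v" if "son_ball \<kappa> w (2 * r) v" for w v
    unfolding pol_def using ballD[OF that] \<kappa>r r by (intro conjI; linarith)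
  have Zb: "2 * (1 - w) - 5 * r \<le> norm (Z w v)" if "3/10 \<le> w" "w \<le> wM" "son_ball \<kappa> w (2 * r) v" for w v
    unfolding XZ using that ballD[OF that(3)] \<kappa>r by (intro Y[of _ _ "2 * r"]; linarith)
  have Z9: "9/10 \<le> norm (Z w v)" if "3/10 \<le> w" "w \<le> wM" "son_ball \<kappa> w (2 * r) v" for w v
    using Zb[OF that] that wM r by simp
  have tri: "norm (c - 2 * b) \<le> norm c + 2 * norm b" "norm (2 * a - 2 * b - c) \<le> 2 * norm a + 2 * norm b + norm c" for a b c :: complex
    using norm_triangle_ineq4[of c "2 * b"] norm_triangle_ineq4[of "2 * a - 2 * b" c] norm_triangle_ineq4[of "2 * a" "2 * b"]
    by (simp_all add: norm_mult)
  have near_add: "norm (x + z) < eps + a" if "dist x y < eps" "norm (y + z) \<le> a" for x y z :: complex and a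
    using that norm_triangle_ineq[of "x - y" "y + z"] by (simp add: dist_norm)
  have XZb: "norm (X w v / Z w v) \<le> 10 * r" if "3/10 \<le> w" "w \<le> wM" "son_ball \<kappa> w (2 * r) v" for w v
  proof -
    have "norm (of_real w * v VG) \<le> 1/2 * (2 * r)"
      unfolding norm_mult norm_of_real using that(1,2) wM ballD[OF that(3)] \<kappa>r r by (intro mult_mono; linarith?) auto
    then have "norm (X w v) \<le> 9 * r"
      using ballD[OF that(3)] \<kappa>r unfolding XZ by (intro order_trans[OF tri(2)]) linarith
    then show ?thesis
      unfolding norm_divide using frac_le[of "9 * r" "norm (X w v)" "9/10" "norm (Z w v)"] Z9[OF that] r by simp
  qed
  have NU0: "son_N 0 w VU 0 v = 1 - 2 * of_real w + of_real w * (X w v / Z w v)"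
    if "3/10 \<le> w" "w \<le> wM" "son_ball \<kappa> w (2 * r) v" for w v
  proof -
    have "Z w v \<noteq> 0" using Z9[OF that] by auto
    from son_NU_base[OF _ this[unfolded XZ], of "v VP - (1 - 3 * of_real w)"] show ?thesis
      using that(1) by (simp add: son_N_def XZ)
  qed
  have "sonic wM \<eta> \<theta> \<kappa> r \<rho> e0"
  proof
    fix e w :: real and t :: complex and v :: "son_var \<Rightarrow> complex" and i :: son_var
    assume A: "0 \<le> e" "e \<le> e0" "3/10 \<le> w" "w \<le> wM" "norm t < \<rho>" "son_ball \<kappa> w (2 * r) v"
    note D = diff[OF A(1-5) pol[OF A(6)]]
    have "norm (of_real w * v VG) \<le> 1/2 * (2 * r)"
      unfolding norm_mult norm_of_real using A(3,4) wM ballD[OF A(6)] \<kappa>r r by (intro mult_mono; linarith?) auto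
    then have "norm (of_real w * v VG - 2 * (v VU - (1 - 2 * of_real w))) \<le> 5 * r"
      using ballD[OF A(6)] by (intro order_trans[OF tri(1)]) linarith
    then have b: "norm (of_real w * (of_real w * v VG - 2 * (v VU - (1 - 2 * of_real w))) :: complex) \<le> 1/2 * (5 * r)"
      unfolding norm_mult[of "of_real w"] using A(3,4) wM by (intro mult_mono) auto
    have u: "norm (of_real w * (X w v / Z w v)) \<le> 1/2 * (10 * r)"
      unfolding norm_mult using A wM r by (intro mult_mono XZb) auto
    have "son_b 0 (of_real w) 0 (v VP) (v VU) (v VG) + of_real (2 * w * (1 - w)) =
        of_real w * (of_real w * v VG - 2 * (v VU - (1 - 2 * of_real w)))"
      using son_b_base[of "of_real w" "v VP - (1 - 3 * of_real w)" "v VU - (1 - 2 * of_real w)" "v VG"]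
      by (simp add: algebra_simps)
    then have "norm (son_b 0 (of_real w) 0 (v VP) (v VU) (v VG) + of_real (2 * w * (1 - w))) \<le> 5 * r"
      using b r by simp
    from near_add[OF D[THEN conjunct1] this]
    have "norm (son_b (of_real e) (of_real w) t (v VP) (v VU) (v VG) + of_real (2 * w * (1 - w))) < eps + 5 * r" .
    moreover have "norm (son_N 0 w i 0 v + - of_real (son_c w i)) \<le> 5 * r"
      using u NU0[OF A(3,4,6)] r by (cases i) (auto simp: son_N_base son_N_def son_c_def)
    from near_add[OF _ this, of "son_N e w i t v"]
    have "norm (son_N e w i t v - of_real (son_c w i)) < eps + 5 * r" using D[of i] by (simp add: dist_norm)
    ultimately show "norm (son_b (of_real e) (of_real w) t (v VP) (v VU) (v VG) + of_real (2 * w * (1 - w))) < \<eta> \<and>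
      norm (son_N e w i t v - of_real (son_c w i)) < \<eta>"
      using eps(2) r(1) d(3) by simp
  next
    fix e w :: real and t :: complex and i :: son_var
    assume A: "0 \<le> e" "e \<le> e0" "3/10 \<le> w" "w \<le> wM" "norm t < \<rho>"
    have B: "son_ball \<kappa> w (2 * r) (\<lambda>j. of_real (son_c w j))"
      using \<kappa> r by (auto simp: rs_ball_def son_k_def split: son_var.split)
    have "son_N 0 w i 0 (\<lambda>j. of_real (son_c w j)) = of_real (son_c w i)"
      using NU0[OF A(3,4) B] by (cases i) (auto simp: son_N_def son_N_base XZ son_c_def)
    then have "norm (son_N e w i t (\<lambda>j. of_real (son_c w j)) - of_real (son_c w i)) \<le> eps"
      using diff[OF A pol[OF B], of i] by simp
    also have "eps \<le> (1 - \<theta>) * son_k \<kappa> i * r"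
    proof -
      have "m / 4 * \<kappa> * r \<le> m / 4 * son_k \<kappa> i * r"
        using m r \<kappa> by (intro mult_right_mono mult_left_mono) (auto simp: son_k_def split: son_var.split)
      then show ?thesis using eps(5) by (simp add: d(4))
    qed
    finally show "norm (son_N e w i t (\<lambda>j. of_real (son_c w j)) - of_real (son_c w i)) \<le> (1 - \<theta>) * son_k \<kappa> i * r" .
  next
    fix e w d :: real and t :: complex and v v' :: "son_var \<Rightarrow> complex" and i :: son_var
    assume A: "0 \<le> e" "e \<le> e0" "3/10 \<le> w" "w \<le> wM" "norm t < \<rho>" and v: "son_ball \<kappa> w (2 * r) v"
      and v': "son_ball \<kappa> w (2 * r) v'" and dv: "0 \<le> d" "\<And>j. norm (v j - v' j) \<le> son_k \<kappa> j * d"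
    \<comment> \<open>Points of the ball are at weighted distance at most 4 r, so d may be cut off
      there; the cut-off ensures S > 1 below.\<close>
    define d' where "d' = min d (4 * r)"
    have d'0: "0 \<le> d'" "d' \<le> d" "d' \<le> 4 * r" using dv r by (auto simp: d'_def)
    have k: "0 < son_k \<kappa> j" "son_k \<kappa> j \<le> 1" for j using \<kappa> by (cases j; simp add: son_k_def)+
    have d': "norm (v j - v' j) \<le> son_k \<kappa> j * d'" for j
    proof -
      have "norm (v j - v' j) \<le> son_k \<kappa> j * (4 * r)"
        using v[unfolded rs_ball_def, rule_format, of j] v'[unfolded rs_ball_def, rule_format, of j] by norm
      then show ?thesis using dv(2)[of j] by (auto simp: d'_def min_def)
    qed
    show "norm (son_N e w i t v - son_N e w i t v') \<le> \<theta> * son_k \<kappa> i * d"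
    proof (cases "d' = 0")
      case True
      then have "v = v'" using d' by (intro ext) (metis mult_zero_right norm_le_zero_iff right_minus_eq)
      then show ?thesis using \<theta> k[of i] dv by simp
    next
      case False
      \<comment> \<open>For |z| < S the point v' + z (v - v') is at most 8/100 away from v', hence
        within 1/10 of the centre.\<close>
      define S where "S = 8 / 100 / d'"
      have S: "1 < S" "2 * eps / S = 25 * eps * d'" "S * d' = 8/100" using False d'0 r by (auto simp: S_def field_simps)
      define L where "L j z = v' j + z * (v j - v' j)" for j z
      have polL: "pol w (\<lambda>j. L j z)" if z: "norm z < S" for z
      proof -
        have "norm (L j z - of_real (son_c w j)) \<le> 1/10" for j
        proof -
          have "norm (z * (v j - v' j)) \<le> S * (son_k \<kappa> j * d')"
            unfolding norm_mult using z d'[of j] S by (intro mult_mono) auto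
          also have "\<dots> = son_k \<kappa> j * (8/100)" using S(3) by simp
          finally have "norm (L j z - of_real (son_c w j)) \<le> son_k \<kappa> j * (8/100 + 2 * r)"
            using v'[unfolded rs_ball_def, rule_format, of j] unfolding L_def ring_distribs by norm
          also have "\<dots> \<le> 1 * (8/100 + 2 * r)" using k[of j] r by (intro mult_right_mono) auto
          finally show ?thesis using r by simp
        qed
        from this[of VP] this[of VU] this[of VG] show ?thesis by (simp add: pol_def son_c_def)
      qed
      define D where "D z = son_N e w i t (\<lambda>j. L j z) - son_N 0 w i 0 (\<lambda>j. L j z)" for z
      have b0': "29/100 \<le> norm (son_b 0 (of_real w) 0 (L VP z) (L VU z) (L VG z))" if "norm z < S" for z
        using b0[of w "L VP z - (1 - 3 * of_real w)" "L VU z - (1 - 2 * of_real w)" "L VG z"] polL[OF that] A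
        by (simp add: K_def pol_def)
      have b: "son_b (of_real e) (of_real w) t (L VP z) (L VU z) (L VG z) \<noteq> 0" if "norm z < S" for z
        using b0'[OF that] diff[OF A polL[OF that]] eps r by (auto simp: dist_norm)
      have t: "1 + t \<noteq> 0"
      proof
        assume "1 + t = 0"
        then have "t = - 1" by (simp add: add_eq_0_iff)
        with A(5) show False by (simp add: \<rho>_def)
      qed
      have "D holomorphic_on ball 0 S" unfolding D_def using b b0' t
        by (intro holomorphic_on_diff son_N_holomorphic_on) (force simp: L_def intro!: holomorphic_intros)+
      moreover have "norm (D z) < eps" if "norm z < S" for z using diff[OF A polL[OF that]] by (simp add: D_def)
      ultimately have "norm (D 1 - D 0) \<le> 25 * eps * d'"
        using S(1) unfolding S(2)[symmetric] by (intro holomorphic_diff_le)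
      then have D: "norm (son_N e w i t v - son_N e w i t v') \<le> 25 * eps * d' + norm (son_N 0 w i 0 v - son_N 0 w i 0 v')"
        using norm_triangle_sub[of "son_N e w i t v - son_N e w i t v'" "son_N 0 w i 0 v - son_N 0 w i 0 v'"]
        by (simp add: D_def L_def algebra_simps)
      have VPG: "25 * eps * d' \<le> \<theta> * \<kappa> * d"
      proof (rule mult_mono[OF _ d'0(2)])
        have "9/10 * \<kappa> \<le> \<theta> * \<kappa>" using \<theta> \<kappa> by (intro mult_right_mono) auto
        then show "25 * eps \<le> \<theta> * \<kappa>" using eps(3) \<kappa>(1) by linarith
      qed (use \<theta> \<kappa> d'0 in auto)
      show ?thesis
      proof (cases i)
        case VU
        have G: "norm (v VG - v' VG) \<le> \<kappa> * d'" "norm (v VU - v' VU) \<le> d'" "norm (v VP - v' VP) \<le> \<kappa> * d'"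
          using d'[of VG] d'[of VU] d'[of VP] by (simp_all add: son_k_def)
        have wG: "norm (of_real w * v VG - of_real w * v' VG) \<le> 1/2 * (\<kappa> * d')"
          unfolding right_diff_distrib[symmetric] norm_mult norm_of_real using A wM G(1) by (intro mult_mono) auto
        have "\<kappa> * d' \<le> 4/100 * d'" using \<kappa> d'0 by (intro mult_right_mono)
        moreover have dXZ: "X w v - X w v' = 2 * (v VP - v' VP) - 2 * (v VU - v' VU) - (of_real w * v VG - of_real w * v' VG)"
          "Z w v - Z w v' = (of_real w * v VG - of_real w * v' VG) - 2 * (v VU - v' VU)"
          by (simp_all add: XZ algebra_simps)
        ultimately have dX: "norm (Z w v - Z w v') \<le> 21/10 * d'"
          unfolding dXZ(2) using G wG d'0 tri(1)[of "of_real w * v VG - of_real w * v' VG" "v VU - v' VU"] by linarith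
        have "norm (X w v - X w v') \<le> 2 * (\<kappa> * d') + 2 * d' + 1/2 * (\<kappa> * d')"
          unfolding dXZ using G wG by (intro order_trans[OF tri(2)] add_mono) auto
        then have dX': "norm (X w v - X w v') \<le> (2 + 5/2 * \<kappa>) * d'" by (simp add: algebra_simps)
        have n: "Z w v \<noteq> 0" "Z w v' \<noteq> 0" using Z9[OF A(3,4) v] Z9[OF A(3,4) v'] by auto
        have "X w v / Z w v - X w v' / Z w v' = ((X w v - X w v') - (X w v' / Z w v') * (Z w v - Z w v')) / Z w v"
          using n by (simp add: field_simps)
        also have "norm \<dots> \<le> ((2 + 5/2 * \<kappa>) * d' + (10 * r) * (21/10 * d')) / (2 * (1 - w) - 5 * r)"
          unfolding norm_divide
        proof (rule frac_le)
          have "norm (X w v' / Z w v' * (Z w v - Z w v')) \<le> (10 * r) * (21/10 * d')"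
            unfolding norm_mult using dX r XZb[OF A(3,4) v'] by (intro mult_mono) auto
          then show "norm (X w v - X w v' - X w v' / Z w v' * (Z w v - Z w v')) \<le> (2 + 5/2 * \<kappa>) * d' + (10 * r) * (21/10 * d')"
            using dX' norm_triangle_ineq4[of "X w v - X w v'" "X w v' / Z w v' * (Z w v - Z w v')"] by linarith
        qed (use Zb[OF A(3,4) v] A wM r \<kappa> d'0 in \<open>auto intro!: add_nonneg_nonneg mult_nonneg_nonneg\<close>)
        also have "\<dots> = (2 + 5/2 * \<kappa> + 21 * r) / (2 * (1 - w) - 5 * r) * d'" by (simp add: algebra_simps)
        finally have "norm (son_N 0 w i 0 v - son_N 0 w i 0 v') \<le> w * ((2 + 5/2 * \<kappa> + 21 * r) / (2 * (1 - w) - 5 * r) * d')"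
          unfolding VU NU0[OF A(3,4) v] NU0[OF A(3,4) v'] add_diff_cancel_left right_diff_distrib[symmetric] norm_mult norm_of_real
          using A by (intro mult_mono) auto
        also have "\<dots> = w * (2 + 5/2 * \<kappa> + 21 * r) / (2 * (1 - w) - 5 * r) * d'" by simp
        also have "\<dots> \<le> (1 - m / 2) * d'"
        proof (intro mult_right_mono d'0)
          \<comment> \<open>With w <= (1 - m) / 2, \<kappa> = m / 10 and r <= m / 80 the quotient is
            a perturbation of w / (1 - w) <= (1 - m) / (1 + m), which leaves enough room below 1 - m
            / 2.\<close>
          have "w * (2 + 5/2 * \<kappa> + 21 * r) \<le> (1 - m) / 2 * (2 + 1/4 * m + 21/80 * m)"
          proof (rule mult_mono)
            show "2 + 5/2 * \<kappa> + 21 * r \<le> 2 + 1/4 * m + 21/80 * m" using r d(2) by linarith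
          qed (use A m d(1) r \<kappa> in \<open>simp_all add: field_simps\<close>)
          also have "\<dots> = (1 - m / 2) * (1 + m - m / 16) - m * (189/160 - 17/80 * m)" by (simp add: field_simps)
          also have "\<dots> \<le> (1 - m / 2) * (1 + m - m / 16)" using m by simp
          also have "\<dots> \<le> (1 - m / 2) * (2 * (1 - w) - 5 * r)"
            using A wM r m d(1) by (intro mult_left_mono; simp add: field_simps)
          finally have "w * (2 + 5/2 * \<kappa> + 21 * r) \<le> (1 - m / 2) * (2 * (1 - w) - 5 * r)" .
          then show "w * (2 + 5/2 * \<kappa> + 21 * r) / (2 * (1 - w) - 5 * r) \<le> 1 - m / 2"
            using A wM r by (simp add: divide_le_eq)
        qed
        finally have "norm (son_N e w i t v - son_N e w i t v') \<le> 25 * eps * d' + (1 - m / 2) * d'" using D by simp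
        also have "\<dots> = (25 * eps + (1 - m / 2)) * d'" by (simp add: algebra_simps)
        also have "\<dots> \<le> \<theta> * d" using eps \<theta> m d'0 by (intro mult_mono) (auto simp: d(4))
        finally show ?thesis by (simp add: VU son_k_def)
      qed (use D VPG in \<open>auto simp: son_N_def son_N_base son_k_def\<close>)
    qed
  qed (use wM \<eta> \<theta> \<kappa> r \<delta> in \<open>auto simp: \<rho>_def e0_def d\<close>)
  then show ?thesis by blast
qed

subsection \<open>The solution through the sonic point\<close>

lemma son_of_real:
  fixes e w t p u g :: real
  shows "son_b (of_real e) (of_real w) (of_real t) (of_real p) (of_real u) (of_real g) = (of_real (son_b e w t p u g) :: complex)"
    and "son_NP (of_real e) (of_real w) (of_real t) (of_real p) (of_real u) (of_real g) = (of_real (son_NP e w t p u g) :: complex)"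
    and "son_NU (of_real e) (of_real w) (of_real t) (of_real p) (of_real u) (of_real g) = (of_real (son_NU e w t p u g) :: complex)"
    and "son_NG (of_real e) (of_real w) (of_real t) (of_real p) (of_real u) (of_real g) = (of_real (son_NG e w t p u g) :: complex)"
  by (simp_all add: son_defs)

lemma son_N_cnj: "son_N e w i (cnj t) (\<lambda>j. cnj (v j)) = cnj (son_N e w i t v)"
  by (cases i) (simp_all add: son_N_def son_defs)

definition EE_S :: "real \<Rightarrow> real \<Rightarrow> real \<Rightarrow> real" where
  "EE_S e R W = (W + e)^2 - e * (W - 1)^2 + 4 * e * R * W"

lemma son_b_eq:
  fixes t :: real
  assumes "R = w + t * (p - u)" "W = w + t * u" "E = 1 + t * g"
  shows "t * son_b e w t p u g = son_H0 e w * E - EE_S e R W * (1 + t)^2"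
  unfolding assms EE_S_def son_b_def son_S_def son_H0_def by (simp add: algebra_simps power2_eq_square)

context sonic
begin

abbreviation "par e w \<equiv> 0 \<le> e \<and> e \<le> e0 \<and> 3/10 \<le> w \<and> w \<le> wM"

lemma son_ball_mono: "son_ball \<kappa> w r v \<Longrightarrow> son_ball \<kappa> w (2 * r) v"
proof -
  have "son_k \<kappa> j * r \<le> son_k \<kappa> j * (2 * r)" for j
    using \<kappa> r by (cases j) (auto simp: son_k_def)
  then show "son_ball \<kappa> w r v \<Longrightarrow> son_ball \<kappa> w (2 * r) v"
    unfolding rs_ball_def by (meson order_trans)
qed

lemma w_bounds:
  assumes "par e w"
  shows "3/10 \<le> w" "w < 1/2" "42/100 \<le> 2 * w * (1 - w)" "2 * w * (1 - w) \<le> 1/2"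
proof -
  show w: "3/10 \<le> w" "w < 1/2" using assms wM by auto
  have "(w - 3/10) * (7/10 - w) \<ge> 0" using w by (intro mult_nonneg_nonneg) auto
  also have "(w - 3/10) * (7/10 - w) = w * (1 - w) - 21/100" by (simp add: field_simps)
  finally show "42/100 \<le> 2 * w * (1 - w)" by linarith
  have "(2 * w - 1)^2 \<ge> 0" by simp
  then show "2 * w * (1 - w) \<le> 1/2" by (simp add: power2_eq_square algebra_simps)
qed

lemma eta_small: "\<eta> \<le> 1/20" "r \<le> 1/200" using \<eta> r wM by auto

lemma son_b_nz:
  assumes "par e w" "norm t < \<rho>" "son_ball \<kappa> w (2 * r) v"
  shows "son_b (of_real e) (of_real w) t (v VP) (v VU) (v VG) \<noteq> 0"
proof
  assume 0: "son_b (of_real e) (of_real w) t (v VP) (v VU) (v VG) = 0"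
  have "norm (son_b (of_real e) (of_real w) t (v VP) (v VU) (v VG) + of_real (2 * w * (1 - w))) < \<eta>"
    using near[of e w t v] assms by blast
  then have "2 * w * (1 - w) < \<eta>" unfolding 0 add_0 norm_of_real by linarith
  then show False using w_bounds(3)[OF assms(1)] eta_small by simp
qed

lemma one_plus_t_nz: "norm t < \<rho> \<Longrightarrow> 1 + t \<noteq> (0::complex)"
  using \<rho> by (metis add_eq_0_iff norm_minus_cancel norm_one not_less order.strict_trans2 less_imp_le
      one_le_numeral divide_le_eq_1 zero_less_numeral order.trans)

lemma son_N_holomorphic:
  assumes p: "par e w"
    and Y: "\<And>j. Y j holomorphic_on ball 0 \<rho>"
    and b: "\<And>t. norm t < \<rho> \<Longrightarrow> son_ball \<kappa> w r (\<lambda>j. Y j t)"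
  shows "(\<lambda>t. son_N e w i t (\<lambda>j. Y j t)) holomorphic_on ball 0 \<rho>"
proof -
  have nz: "son_b (of_real e) (of_real w) t (Y VP t) (Y VU t) (Y VG t) \<noteq> 0" "1 + t \<noteq> 0" if "t \<in> ball 0 \<rho>" for t
    using son_b_nz[OF p, of t "\<lambda>j. Y j t"] that b[of t] son_ball_mono[of w "\<lambda>j. Y j t"] one_plus_t_nz[of t]
    by auto
  show ?thesis using nz by (intro son_N_holomorphic_on[where \<tau> = "\<lambda>t. t"] Y holomorphic_on_ident) auto
qed

lemma son_contraction:
  assumes "par e w" "s = r \<or> s = 2 * r"
  shows "rs_contraction (son_N e w) (son_c w) (\<lambda>_. 1) (son_k \<kappa>) \<rho> s \<theta>"
proof
  show "son_k \<kappa> i > 0" for i using \<kappa> by (cases i) (auto simp: son_k_def)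
  show "norm (son_N e w i t u - son_N e w i t v) \<le> \<theta> * 1 * son_k \<kappa> i * d"
    if "norm t < \<rho>" "son_ball \<kappa> w s u" "son_ball \<kappa> w s v" "0 \<le> d" "\<And>j. norm (u j - v j) \<le> son_k \<kappa> j * d" for i t u v d
    using lip[of e w t u v d i] assms that son_ball_mono[of w] by auto
qed (use assms \<rho> r \<theta> in auto)

definition is_sol :: "real \<Rightarrow> real \<Rightarrow> (son_var \<Rightarrow> real \<Rightarrow> real) \<Rightarrow> (son_var \<Rightarrow> real \<Rightarrow> real) \<Rightarrow> bool" where
  "is_sol e w y y' \<longleftrightarrow> rs_solution (son_N e w) (son_c w) (\<lambda>_. 1) (son_k \<kappa>) r {t. \<bar>t\<bar> < \<rho>} y y' \<and>
    (\<forall>i t. \<bar>t\<bar> < \<rho> \<longrightarrow> (\<exists>F. (\<lambda>s. y i (t + s)) has_fps_expansion F))"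

lemma sol_exists:
  assumes p: "par e w"
  shows "\<exists>y y'. is_sol e w y y'" unfolding is_sol_def
proof (intro rs_problem.exists_real[where \<theta> = \<theta>] rs_problem.intro son_contraction p rs_problem_axioms.intro)
  show "norm (son_N e w i t (\<lambda>j. of_real (son_c w j)) - of_real (1 * son_c w i)) \<le> (1 - \<theta>) * 1 * son_k \<kappa> i * r"
    if "norm t < \<rho>" for i t
    using start[of e w t i] p that by auto
qed (auto simp: son_N_cnj intro: son_N_holomorphic[OF p])

text \<open>One solution per parameter pair is picked by choice; \<open>sol_unique\<close> and
  \<open>sol_continuous\<close> below make the choice harmless.\<close>

definition sol :: "real \<Rightarrow> real \<Rightarrow> son_var \<Rightarrow> real \<Rightarrow> real" where
  "sol e w = (SOME y. \<exists>y'. is_sol e w y y')"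

definition sol' :: "real \<Rightarrow> real \<Rightarrow> son_var \<Rightarrow> real \<Rightarrow> real" where
  "sol' e w = (SOME y'. is_sol e w (sol e w) y')"

lemma is_sol_sol: "par e w \<Longrightarrow> is_sol e w (sol e w) (sol' e w)"
proof -
  assume "par e w"
  then have "\<exists>y'. is_sol e w (sol e w) y'"
    unfolding sol_def by (intro someI_ex[of "\<lambda>y. \<exists>y'. is_sol e w y y'"] sol_exists)
  then show "is_sol e w (sol e w) (sol' e w)" unfolding sol'_def by (rule someI_ex)
qed

text \<open>As functions of t = z - 1 on the chosen solution: R, W, the auxiliary power E, then
  \<open>sb\<close> = B / (x_*^2 t) and \<open>sq\<close> = x_*^2 (R - W) / B.\<close>

definition sR where "sR e w t = w + t * (sol e w VP t - sol e w VU t)"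
definition sW where "sW e w t = w + t * sol e w VU t"
definition sE where "sE e w t = 1 + t * sol e w VG t"
definition sb where "sb e w t = son_b e w t (sol e w VP t) (sol e w VU t) (sol e w VG t)"
definition sq where "sq e w t = son_q e w t (sol e w VP t) (sol e w VU t) (sol e w VG t)"

context
  fixes e w t :: real
  assumes p: "par e w" and t: "\<bar>t\<bar> < \<rho>"
begin

lemma sol_props:
  "\<bar>sol e w i t - son_c w i\<bar> \<le> son_k \<kappa> i * r" "(sol e w i has_real_derivative sol' e w i t) (at t)"
  "of_real (t * sol' e w i t + 1 * sol e w i t) = son_N e w i (of_real t) (\<lambda>j. of_real (sol e w j t))"
  using is_sol_sol[OF p] t unfolding is_sol_def rs_solution_def by blast+

lemma sol_bounds:
  "\<bar>sol e w VP t - (1 - 3 * w)\<bar> \<le> r" "\<bar>sol e w VU t - (1 - 2 * w)\<bar> \<le> r" "\<bar>sol e w VG t\<bar> \<le> r"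
proof -
  note * = sol_props(1)
  have "\<kappa> * r \<le> r" using \<kappa> r by simp
  then show "\<bar>sol e w VP t - (1 - 3 * w)\<bar> \<le> r" "\<bar>sol e w VU t - (1 - 2 * w)\<bar> \<le> r" "\<bar>sol e w VG t\<bar> \<le> r"
    using *[of VP] *[of VU] *[of VG] by (auto simp: son_c_def son_k_def)
qed

lemma sol_ball: "son_ball \<kappa> w r (\<lambda>j. complex_of_real (sol e w j t))"
  using sol_props(1) unfolding rs_ball_of_real by blast

lemma sol_near:
  "\<bar>sb e w t + 2 * w * (1 - w)\<bar> < \<eta>"
  "\<bar>son_NP e w t (sol e w VP t) (sol e w VU t) (sol e w VG t) - (1 - 3 * w)\<bar> < \<eta>"
  "\<bar>son_NU e w t (sol e w VP t) (sol e w VU t) (sol e w VG t) - (1 - 2 * w)\<bar> < \<eta>"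
proof -
  have n: "norm (complex_of_real t) < \<rho>" using t by simp
  have N: "norm (complex_of_real (sb e w t) + of_real (2 * w * (1 - w))) < \<eta>"
    "norm (son_N e w i (of_real t) (\<lambda>j. of_real (sol e w j t)) - of_real (son_c w i)) < \<eta>" for i
    using near[of e w "of_real t" "\<lambda>j. of_real (sol e w j t)"] p n son_ball_mono[OF sol_ball]
    by (auto simp: sb_def son_of_real)
  show "\<bar>sb e w t + 2 * w * (1 - w)\<bar> < \<eta>" using N(1) by (metis norm_of_real of_real_add)
  show "\<bar>son_NP e w t (sol e w VP t) (sol e w VU t) (sol e w VG t) - (1 - 3 * w)\<bar> < \<eta>"
    using N(2)[of VP] unfolding son_N_def son_c_def son_var.case son_of_real by (metis norm_of_real of_real_diff)
  show "\<bar>son_NU e w t (sol e w VP t) (sol e w VU t) (sol e w VG t) - (1 - 2 * w)\<bar> < \<eta>"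
    using N(2)[of VU] unfolding son_N_def son_c_def son_var.case son_of_real by (metis norm_of_real of_real_diff)
qed

lemma sb_bounds: "sb e w t < - 3/10" "- 6/10 < sb e w t" "sb e w t \<noteq> 0" "- sb e w t > 2 * w * (1 - w) - \<eta>"
  using sol_near(1) w_bounds[OF p] eta_small by auto

lemma sol_eqs:
  "t * sol' e w VP t + sol e w VP t = son_NP e w t (sol e w VP t) (sol e w VU t) (sol e w VG t)"
  "t * sol' e w VU t + sol e w VU t = son_NU e w t (sol e w VP t) (sol e w VU t) (sol e w VG t)"
  "t * sol' e w VG t + sol e w VG t = son_NG e w t (sol e w VP t) (sol e w VU t) (sol e w VG t)"
  using sol_props(3)[of VP] sol_props(3)[of VU] sol_props(3)[of VG]
  unfolding son_N_def son_var.case son_of_real of_real_eq_iff by simp_all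

lemmas sol_deriv = sol_props(2)

lemma sol_fps: "\<exists>F. (\<lambda>s. sol e w i (t + s)) has_fps_expansion F"
  using is_sol_sol[OF p] t unfolding is_sol_def rs_solution_def by blast

lemma sR_deriv: "(sR e w has_real_derivative - 2 * (1 - e) * (1 + t) * sR e w t * (sW e w t + e) * sq e w t) (at t)"
proof -
  have "(sR e w has_real_derivative (sol e w VP t - sol e w VU t) + t * (sol' e w VP t - sol' e w VU t)) (at t)"
    unfolding sR_def using sol_deriv by (auto intro!: derivative_eq_intros)
  also have "(sol e w VP t - sol e w VU t) + t * (sol' e w VP t - sol' e w VU t) =
      son_NP e w t (sol e w VP t) (sol e w VU t) (sol e w VG t) - son_NU e w t (sol e w VP t) (sol e w VU t) (sol e w VG t)"
    unfolding sol_eqs[symmetric] by (simp add: algebra_simps)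
  also have "\<dots> = - 2 * (1 - e) * (1 + t) * sR e w t * (sW e w t + e) * sq e w t"
    unfolding son_NP_def son_NU_def sq_def[symmetric] sW_def[symmetric] sR_def[symmetric] by (simp add: algebra_simps)
  finally show ?thesis .
qed

lemma sW_deriv: "(sW e w has_real_derivative
    (1 - 3 * sW e w t) / (1 + t) + 2 * (1 + e) * (1 + t) * sW e w t * (sW e w t + e) * sq e w t) (at t)"
proof -
  have "(sW e w has_real_derivative sol e w VU t + t * sol' e w VU t) (at t)"
    unfolding sW_def using sol_deriv by (auto intro!: derivative_eq_intros)
  also have "sol e w VU t + t * sol' e w VU t = son_NU e w t (sol e w VP t) (sol e w VU t) (sol e w VG t)"
    unfolding sol_eqs[symmetric] by (simp add: algebra_simps)
  also have "\<dots> = (1 - 3 * sW e w t) / (1 + t) + 2 * (1 + e) * (1 + t) * sW e w t * (sW e w t + e) * sq e w t"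
    unfolding son_NU_def sq_def[symmetric] sW_def[symmetric] ..
  finally show ?thesis .
qed

lemma sE_deriv: "(sE e w has_real_derivative 4 * e * (1 + t) * sE e w t * (sW e w t + e) * sq e w t) (at t)"
proof -
  have "(sE e w has_real_derivative sol e w VG t + t * sol' e w VG t) (at t)"
    unfolding sE_def using sol_deriv by (auto intro!: derivative_eq_intros)
  also have "sol e w VG t + t * sol' e w VG t = son_NG e w t (sol e w VP t) (sol e w VU t) (sol e w VG t)"
    unfolding sol_eqs[symmetric] by (simp add: algebra_simps)
  also have "\<dots> = 4 * e * (1 + t) * sE e w t * (sW e w t + e) * sq e w t"
    unfolding son_NG_def sq_def[symmetric] sW_def[symmetric] sE_def[symmetric] ..
  finally show ?thesis .
qed

text \<open>The derivative of W equals \<open>son_NU\<close>, which lies within \<eta> of 1 - 2 w,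
  and \<eta> is at most an eighth of 1 - 2 wM.\<close>

lemma sW_deriv_pos: "\<exists>d>0. (sW e w has_real_derivative d) (at t)"
proof -
  have "(sW e w has_real_derivative sol e w VU t + t * sol' e w VU t) (at t)"
    unfolding sW_def using sol_deriv by (auto intro!: derivative_eq_intros)
  moreover have "sol e w VU t + t * sol' e w VU t > 0" using sol_near(3) sol_eqs(2) w_bounds[OF p] \<eta> p by auto
  ultimately show ?thesis by blast
qed

lemma sR_minus_sW: "sR e w t - sW e w t = t * (sol e w VP t - 2 * sol e w VU t)"
    and sol_diff_neg: "sol e w VP t - 2 * sol e w VU t < - 4/10"
    and sq_eq: "sb e w t * sq e w t = sol e w VP t - 2 * sol e w VU t"
    and sb_eq: "t * sb e w t = son_H0 e w * sE e w t - EE_S e (sR e w t) (sW e w t) * (1 + t)^2"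
proof -
  show "sR e w t - sW e w t = t * (sol e w VP t - 2 * sol e w VU t)" by (simp add: sR_def sW_def algebra_simps)
  show "sol e w VP t - 2 * sol e w VU t < - 4/10" using sol_bounds eta_small w_bounds[OF p] by (simp add: abs_le_iff)
  show "sb e w t * sq e w t = sol e w VP t - 2 * sol e w VU t"
    using sb_bounds(3) by (simp add: sq_def son_q_def sb_def[symmetric])
  show "t * sb e w t = son_H0 e w * sE e w t - EE_S e (sR e w t) (sW e w t) * (1 + t)^2"
    unfolding sb_def by (rule son_b_eq) (simp_all add: sR_def sW_def sE_def)
qed

lemma sRW_bounds: "sW e w t > 1/10" "sR e w t > 1/10" "sE e w t > 1/2" "sW e w t < 1" "sR e w t < 1"
    "1 + t > 1/2" "t < 0 \<Longrightarrow> sW e w t < w" "t < 0 \<Longrightarrow> sR e w t > w" "t < 0 \<Longrightarrow> sR e w t < w + \<eta>"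
proof -
  have t': "\<bar>t\<bar> \<le> 1/20" using t \<rho> eta_small by auto
  have u: "0 < sol e w VU t" "sol e w VU t \<le> 1/2"
    using sol_bounds(2) w_bounds[OF p] r \<eta> eta_small p by (auto simp: abs_le_iff)
  have v: "sol e w VP t - sol e w VU t < 0" "- 1 < sol e w VP t - sol e w VU t"
    using sol_bounds(1,2) w_bounds[OF p] eta_small by (auto simp: abs_le_iff)
  have *: "\<bar>t * x\<bar> \<le> 1/20" if "\<bar>x\<bar> \<le> 1" for x
    using mult_mono[OF t' that] by (simp add: abs_mult)
  show "sW e w t > 1/10" "sW e w t < 1" using *[of "sol e w VU t"] u w_bounds[OF p] by (auto simp: sW_def)
  show "sR e w t > 1/10" "sR e w t < 1"
    using *[of "sol e w VP t - sol e w VU t"] v w_bounds[OF p] by (auto simp: sR_def)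
  show "sE e w t > 1/2" using *[of "sol e w VG t"] sol_bounds(3) eta_small by (auto simp: sE_def)
  show "1 + t > 1/2" using t' by auto
  show "sW e w t < w" "sR e w t > w" if "t < 0" using that u v by (auto simp: sW_def sR_def mult_neg_pos mult_neg_neg)
  show "sR e w t < w + \<eta>" if "t < 0"
  proof -
    have "t * (sol e w VP t - sol e w VU t) = (- t) * (- (sol e w VP t - sol e w VU t))"
      by (simp only: minus_mult_minus)
    also have "\<dots> \<le> (- t) * 1" using that v by (intro mult_left_mono) auto
    also have "\<dots> < \<eta>" using t \<rho> by auto
    finally show ?thesis by (simp add: sR_def)
  qed
qed

end

text \<open>So far E only satisfies the linear equation that (R / w) powr (- eta e) satisfies; their
  quotient is constant and equals 1 at t = 0. Hence the rational system gives back the original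
  one.\<close>

lemma sE_eq:
  assumes p: "par e w" and t: "\<bar>t\<bar> < \<rho>"
  shows "sE e w t = (sR e w t / w) powr (- eta e)"
proof -
  have w: "w > 0" and e1: "1 - e > 0" using p e0 by auto
  have der: "((\<lambda>t. sE e w t * (sR e w t / w) powr (eta e)) has_real_derivative 0) (at t)" if t: "\<bar>t\<bar> < \<rho>" for t
  proof -
    have R: "sR e w t / w > 0" using sRW_bounds[OF p t] w by simp
    define X where "X = (1 + t) * (sW e w t + e) * sq e w t"
    have dE: "(sE e w has_real_derivative 4 * e * sE e w t * X) (at t)"
      using sE_deriv[OF p t] by (simp only: X_def mult_ac)
    have dR: "(sR e w has_real_derivative - 2 * (1 - e) * sR e w t * X) (at t)"
      using sR_deriv[OF p t] by (simp only: X_def mult_ac)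
    have "((\<lambda>t. sE e w t * (sR e w t / w) powr (eta e)) has_real_derivative
        4 * e * sE e w t * X * (sR e w t / w) powr (eta e)
        + sE e w t * (eta e * (sR e w t / w) powr (eta e - 1) * (- 2 * (1 - e) * sR e w t * X / w))) (at t)"
      using R w by (auto intro!: derivative_eq_intros dE dR simp: powr_diff field_simps)
    also have "(sR e w t / w) powr (eta e - 1) = (sR e w t / w) powr (eta e) / (sR e w t / w)"
      using R powr_diff[of "sR e w t / w" "eta e" 1] powr_one[of "sR e w t / w"] by simp
    also have "4 * e * sE e w t * X * (sR e w t / w) powr (eta e)
        + sE e w t * (eta e * ((sR e w t / w) powr (eta e) / (sR e w t / w)) * (- 2 * (1 - e) * sR e w t * X / w)) =
        sE e w t * X * (sR e w t / w) powr (eta e) * (4 * e - eta e * (2 * (1 - e)))"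
      using R w by (simp add: field_simps)
    also have "4 * e - eta e * (2 * (1 - e)) = 0" using e1 by (simp add: eta_def field_simps)
    finally show ?thesis by simp
  qed
  have "sE e w t * (sR e w t / w) powr (eta e) = sE e w 0 * (sR e w 0 / w) powr (eta e)"
  proof (cases "t = 0")
    case False
    show ?thesis by (rule DERIV_isconst3[of "- \<rho>" \<rho>]) (use \<rho> t der in auto)
  qed simp
  also have "\<dots> = 1" using w by (simp add: sE_def sR_def)
  finally show ?thesis using sRW_bounds[OF p t] w by (simp add: powr_minus field_simps)
qed


section \<open>Uniqueness of the blown-up solution and its dependence on the parameters\<close>

lemma son_k_pos: "son_k \<kappa> i > 0" using \<kappa> by (cases i) (auto simp: son_k_def)

lemma son_ballI_real:
  assumes "\<And>j. \<bar>v j - son_c w j\<bar> \<le> son_k \<kappa> j * s"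
  shows "son_ball \<kappa> w s (\<lambda>j. complex_of_real (v j))"
  unfolding rs_ball_def using assms by (metis norm_of_real of_real_diff)

text \<open>At t = 0 the equation reads y = N (0, y), and the contraction allows one fixed point in
  the ball. This will identify the slopes of the constructed solution with those given by the
  cubic.\<close>

lemma fixed_point_unique:
  assumes p: "par e w"
    and b: "\<And>j. \<bar>v j - son_c w j\<bar> \<le> son_k \<kappa> j * (2 * r)" "\<And>j. \<bar>v' j - son_c w j\<bar> \<le> son_k \<kappa> j * (2 * r)"
    and fp: "\<And>i. son_N e w i 0 (\<lambda>j. of_real (v j)) = of_real (v i)"
      "\<And>i. son_N e w i 0 (\<lambda>j. of_real (v' j)) = of_real (v' i)"
  shows "v i = v' i"
proof -
  define M where "M = max (\<bar>v VP - v' VP\<bar> / \<kappa>) (max \<bar>v VU - v' VU\<bar> (\<bar>v VG - v' VG\<bar> / \<kappa>))"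
  have d: "\<bar>v j - v' j\<bar> \<le> son_k \<kappa> j * M" for j
  proof (cases j)
    case VP
    have "\<bar>v VP - v' VP\<bar> / \<kappa> \<le> M" by (simp add: M_def)
    then show ?thesis using \<kappa> by (simp add: VP son_k_def field_simps)
  next
    case VU
    then show ?thesis by (simp add: M_def son_k_def)
  next
    case VG
    have "\<bar>v VG - v' VG\<bar> / \<kappa> \<le> M" by (simp add: M_def)
    then show ?thesis using \<kappa> by (simp add: VG son_k_def field_simps)
  qed
  have M0: "M \<ge> 0" using \<kappa> by (auto simp: M_def le_max_iff_disj)
  have "norm (son_N e w i 0 (\<lambda>j. of_real (v j)) - son_N e w i 0 (\<lambda>j. of_real (v' j))) \<le> \<theta> * son_k \<kappa> i * M" for i
    using p \<rho> M0 d by (intro lip son_ballI_real b) (auto simp flip: of_real_diff)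
  then have *: "\<bar>v i - v' i\<bar> \<le> \<theta> * son_k \<kappa> i * M" for i
    unfolding fp of_real_diff[symmetric] norm_of_real by blast
  have "M \<le> \<theta> * M"
  proof -
    have "\<bar>v VP - v' VP\<bar> / \<kappa> \<le> \<theta> * M" "\<bar>v VG - v' VG\<bar> / \<kappa> \<le> \<theta> * M" "\<bar>v VU - v' VU\<bar> \<le> \<theta> * M"
      using *[of VP] *[of VG] *[of VU] \<kappa> by (simp_all add: son_k_def field_simps)
    then show ?thesis by (simp add: M_def)
  qed
  then have "M = 0" using M0 \<theta> by (smt (verit) mult_less_cancel_right2)
  then show ?thesis using d[of i] by simp
qed

text \<open>Each component of the centre \<open>son_c\<close> moves with w at rate at most 3; the
  shift is absorbed by enlarging the radius from r to 2 r.\<close>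

lemma sol_solution:
  assumes p: "par e w" and I: "I \<subseteq> {t. \<bar>t\<bar> < \<rho>}" and w': "3 * \<bar>w - w'\<bar> \<le> \<kappa> * r"
  shows "rs_solution (son_N e w) (son_c w') (\<lambda>_. 1) (son_k \<kappa>) (2 * r) I (sol e w) (sol' e w)"
proof -
  have "\<bar>son_c w i - son_c w' i\<bar> \<le> son_k \<kappa> i * r" for i
  proof -
    have "\<bar>son_c w i - son_c w' i\<bar> \<le> 3 * \<bar>w - w'\<bar>" by (cases i) (auto simp: son_c_def abs_if)
    also have "\<dots> \<le> \<kappa> * r" by (rule w')
    also have "\<dots> \<le> son_k \<kappa> i * r"
      using \<kappa> r by (intro mult_right_mono) (cases i; simp add: son_k_def)+
    finally show ?thesis .
  qed
  moreover have "\<bar>x - b\<bar> \<le> k * (2 * r)" if "\<bar>x - a\<bar> \<le> k * r" "\<bar>a - b\<bar> \<le> k * r" for x a b k r :: real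
    using that by linarith
  ultimately show ?thesis using is_sol_sol[OF p] I unfolding is_sol_def rs_solution_def by blast
qed

lemma sol_unique:
  assumes p: "par e w" and T: "0 < T" "T \<le> \<rho>"
    and der: "\<And>i t. - T < t \<Longrightarrow> t < 0 \<Longrightarrow> (y i has_real_derivative y' i t) (at t)"
    and eq: "\<And>i t. - T < t \<Longrightarrow> t < 0 \<Longrightarrow>
      of_real (t * y' i t + y i t) = son_N e w i (of_real t) (\<lambda>j. of_real (y j t))"
    and b: "\<And>i t. - T < t \<Longrightarrow> t < 0 \<Longrightarrow> \<bar>y i t - son_c w i\<bar> \<le> son_k \<kappa> i * (2 * r)"
    and t: "- T < t" "t < 0"
  shows "y i t = sol e w i t"
proof -
  have "\<bar>y i t - sol e w i t\<bar> \<le> son_k \<kappa> i * (0 / (1 - \<theta>))"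
  proof (rule rs_contraction.compare[OF son_contraction[OF p, of "2 * r"], where \<sigma> = "-1" and T = T and t = t])
    show "rs_solution (son_N e w) (son_c w) (\<lambda>_. 1) (son_k \<kappa>) (2 * r) {t. 0 < - 1 * t \<and> - 1 * t < T} y y'"
      using der eq b by (auto simp: rs_solution_def)
    have "{t. 0 < - 1 * t \<and> - 1 * t < T} \<subseteq> {t. \<bar>t\<bar> < \<rho>}" using T by auto
    then show "rs_solution (son_N e w) (son_c w) (\<lambda>_. 1) (son_k \<kappa>) (2 * r) {t. 0 < - 1 * t \<and> - 1 * t < T} (sol e w) (sol' e w)"
      by (rule sol_solution[OF p]) (use \<kappa> r in simp)
  qed (use T t in auto)
  then show ?thesis by simp
qed

lemma son_N_continuous:
  assumes p: "par e w" and T: "T < \<rho>" and eps: "eps > 0"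
  shows "\<exists>\<delta>>0. \<forall>e' w' i t v. \<bar>e' - e\<bar> < \<delta> \<longrightarrow> \<bar>w' - w\<bar> < \<delta> \<longrightarrow> norm t \<le> T \<longrightarrow> son_ball \<kappa> w (2 * r) v \<longrightarrow>
    norm (son_N e w i t v - son_N e' w' i t v) < eps"
proof -
  define K where "K = cball (0::complex) T \<times> cball (complex_of_real (1 - 3 * w)) (\<kappa> * (2 * r)) \<times>
    cball (complex_of_real (1 - 2 * w)) (2 * r) \<times> cball (0::complex) (\<kappa> * (2 * r))"
  define f where "f i = (\<lambda>((t, p, u, g), (de, dw)). son_N (e + de) (w + dw) i t (case_son_var p u g))" for i
  have K: "compact K" unfolding K_def by (intro compact_Times compact_cball)
  have "isCont (f i) (k, 0)" if k: "k \<in> K" for k i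
  proof -
    obtain t p' u g where [simp]: "k = (t, p', u, g)" by (cases k) auto
    have "son_ball \<kappa> w (2 * r) (case_son_var p' u g)" unfolding rs_ball_def
    proof
      fix j show "norm ((case j of VP \<Rightarrow> p' | VU \<Rightarrow> u | VG \<Rightarrow> g) - of_real (son_c w j)) \<le> son_k \<kappa> j * (2 * r)"
        using k by (cases j) (auto simp: K_def son_c_def son_k_def dist_norm norm_minus_commute)
    qed
    then have b: "son_b (of_real e) (of_real w) t p' u g \<noteq> 0"
      using son_b_nz[OF p, of t "case_son_var p' u g"] k T by (auto simp: K_def)
    have t: "1 + t \<noteq> 0" using k T by (intro one_plus_t_nz) (auto simp: K_def)
    show ?thesis unfolding f_def son_N_def case_prod_unfold using b t
      by (cases i; simp; intro isCont_son continuous_intros; simp)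
  qed
  then have "\<exists>\<delta>>0. \<forall>k\<in>K. \<forall>v. norm v < \<delta> \<longrightarrow> dist (f i (k, v)) (f i (k, 0)) < eps" for i
    by (rule uniform_near_compact[OF K _ eps])
  then obtain \<delta> where \<delta>: "\<And>i. \<delta> i > 0" "\<And>i k v. k \<in> K \<Longrightarrow> norm v < \<delta> i \<Longrightarrow> dist (f i (k, v)) (f i (k, 0)) < eps"
    by metis
  define \<delta>0 where "\<delta>0 = min (\<delta> VP) (min (\<delta> VU) (\<delta> VG))"
  have \<delta>0: "\<delta>0 > 0" "\<delta>0 \<le> \<delta> i" for i
    using \<delta>(1) by (auto simp: \<delta>0_def) (cases i; simp)
  show ?thesis
  proof (intro exI[of _ "\<delta>0 / 2"] conjI allI impI)
    fix e' w' i and t :: complex and v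
    assume A: "\<bar>e' - e\<bar> < \<delta>0 / 2" "\<bar>w' - w\<bar> < \<delta>0 / 2" "norm t \<le> T" "son_ball \<kappa> w (2 * r) v"
    have "norm (e' - e, w' - w) \<le> \<bar>e' - e\<bar> + \<bar>w' - w\<bar>"
      by (rule order_trans[OF norm_Pair_le]) simp
    then have "norm (e' - e, w' - w) < \<delta> i" using A \<delta>0(2)[of i] by linarith
    moreover have "(t, v VP, v VU, v VG) \<in> K"
      using A(3) A(4)[unfolded rs_ball_def, rule_format, of VP] A(4)[unfolded rs_ball_def, rule_format, of VU]
        A(4)[unfolded rs_ball_def, rule_format, of VG]
      by (auto simp: K_def son_c_def son_k_def dist_norm norm_minus_commute)
    ultimately have "dist (f i ((t, v VP, v VU, v VG), (e' - e, w' - w))) (f i ((t, v VP, v VU, v VG), 0)) < eps"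
      by (intro \<delta>(2))
    moreover have "case_son_var (v VP) (v VU) (v VG) = v" by (rule ext) (simp split: son_var.split)
    ultimately show "norm (son_N e w i t v - son_N e' w' i t v) < eps"
      by (simp add: f_def dist_norm norm_minus_commute zero_prod_def)
  qed (use \<delta>0 in auto)
qed

text \<open>\<open>compare\<close> applied to the two right-hand sides, both solutions seen in the
  ball centred for w. The restriction T < \<rho> gives a compact time range in
  \<open>son_N_continuous\<close>; division by \<kappa>, the smallest weight, converts an absolute
  error into a weighted one.\<close>

lemma sol_continuous:
  assumes p: "par e w" and T: "T < \<rho>" and eps: "eps > 0"
  shows "\<exists>\<delta>>0. \<forall>e' w' i t. par e' w' \<longrightarrow> \<bar>e' - e\<bar> < \<delta> \<longrightarrow> \<bar>w' - w\<bar> < \<delta> \<longrightarrow> - T < t \<longrightarrow> t < 0 \<longrightarrow>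
    \<bar>sol e w i t - sol e' w' i t\<bar> \<le> eps"
proof -
  define eps1 where "eps1 = eps * (1 - \<theta>) * \<kappa>"
  have eps1: "eps1 > 0" using eps \<theta> \<kappa> by (simp add: eps1_def)
  obtain \<delta> where \<delta>: "\<delta> > 0" "\<And>e' w' i t v. \<bar>e' - e\<bar> < \<delta> \<Longrightarrow> \<bar>w' - w\<bar> < \<delta> \<Longrightarrow> norm t \<le> T \<Longrightarrow> son_ball \<kappa> w (2 * r) v \<Longrightarrow>
    norm (son_N e w i t v - son_N e' w' i t v) < eps1"
    using son_N_continuous[OF p T eps1] by blast
  define \<delta>' where "\<delta>' = min \<delta> (\<kappa> * r / 3)"
  have \<delta>': "\<delta>' > 0" using \<delta> \<kappa> r by (simp add: \<delta>'_def)
  have k\<kappa>: "\<kappa> \<le> son_k \<kappa> i" "son_k \<kappa> i \<le> 1" for i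
    using \<kappa> by (cases i; simp add: son_k_def)+
  have "\<bar>sol e w i t - sol e' w' i t\<bar> \<le> eps"
    if p': "par e' w'" and d: "\<bar>e' - e\<bar> < \<delta>'" "\<bar>w' - w\<bar> < \<delta>'" and t: "- T < t" "t < 0" for e' w' i t
  proof -
    have "\<bar>sol e w i t - sol e' w' i t\<bar> \<le> son_k \<kappa> i * ((eps1 / \<kappa>) / (1 - \<theta>))"
    proof (rule rs_contraction.compare[OF son_contraction[OF p, of "2 * r"], where \<sigma> = "-1" and T = T and t = t])
      have I: "{t. 0 < - 1 * t \<and> - 1 * t < T} \<subseteq> {t. \<bar>t\<bar> < \<rho>}" using T by auto
      then show "rs_solution (son_N e w) (son_c w) (\<lambda>_. 1) (son_k \<kappa>) (2 * r) {t. 0 < - 1 * t \<and> - 1 * t < T} (sol e w) (sol' e w)"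
        by (rule sol_solution[OF p]) (use \<kappa> r in simp)
      have "3 * \<bar>w' - w\<bar> \<le> \<kappa> * r" using d by (simp add: \<delta>'_def)
      with I show "rs_solution (son_N e' w') (son_c w) (\<lambda>_. 1) (son_k \<kappa>) (2 * r) {t. 0 < - 1 * t \<and> - 1 * t < T} (sol e' w') (sol' e' w')"
        by (rule sol_solution[OF p'])
    next
      fix i t u
      assume "norm (t::complex) < T" "son_ball \<kappa> w (2 * r) u"
      then have "norm (son_N e w i t u - son_N e' w' i t u) \<le> eps1"
        using \<delta>(2)[of e' w' t u i] d by (auto simp: \<delta>'_def)
      also have "\<dots> \<le> eps1 / \<kappa> * 1 * son_k \<kappa> i"
        using k\<kappa>(1)[of i] \<kappa> eps1 by (simp add: field_simps)
      finally show "norm (son_N e w i t u - son_N e' w' i t u) \<le> eps1 / \<kappa> * 1 * son_k \<kappa> i" .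
    qed (use T t eps1 \<kappa> in auto)
    also have "\<dots> = son_k \<kappa> i * eps" using \<theta> \<kappa> by (simp add: eps1_def)
    also have "\<dots> \<le> eps" using k\<kappa>(2)[of i] eps by simp
    finally show ?thesis .
  qed
  with \<delta>' show ?thesis by blast
qed

end

subsection \<open>The value at the sonic point\<close>

text \<open>A point w slightly below the root has \<phi> < 0, which persists for nearby parameters
  by continuity; the sign pattern then keeps their roots above or at w.\<close>

lemma root_eventually_greater:
  fixes \<phi> :: "'a::topological_space \<Rightarrow> real \<Rightarrow> real"
  assumes J: "open J" and root: "\<And>p. p \<in> S \<Longrightarrow> \<omega> p \<in> J"
    and lo: "\<And>p w. p \<in> S \<Longrightarrow> w \<in> J \<Longrightarrow> w < \<omega> p \<Longrightarrow> \<phi> p w < 0"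
    and hi: "\<And>p w. p \<in> S \<Longrightarrow> w \<in> J \<Longrightarrow> \<omega> p < w \<Longrightarrow> 0 < \<phi> p w"
    and cont: "\<And>w. w \<in> J \<Longrightarrow> continuous_on S (\<lambda>p. \<phi> p w)" and p: "p \<in> S" and a: "a < \<omega> p"
  shows "\<forall>\<^sub>F q in at p within S. a < \<omega> q"
proof -
  obtain \<delta> where \<delta>: "\<delta> > 0" "\<And>y. dist y (\<omega> p) < \<delta> \<Longrightarrow> y \<in> J"
    using J root[OF p] unfolding open_dist by blast
  define w where "w = max ((a + \<omega> p) / 2) (\<omega> p - \<delta> / 2)"
  have w: "a < w" "w < \<omega> p" "w \<in> J"
    using a \<delta>(1) by (auto simp: w_def dist_real_def max_def intro!: \<delta>(2))
  have "((\<lambda>p. \<phi> p w) \<longlongrightarrow> \<phi> p w) (at p within S)"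
    using cont[OF w(3)] p unfolding continuous_on_def by blast
  then have "\<forall>\<^sub>F q in at p within S. \<phi> q w < 0" using lo[OF p w(3,2)] by (rule order_tendstoD)
  moreover have "\<forall>\<^sub>F q in at p within S. q \<in> S" by (auto simp: eventually_at_filter)
  ultimately show ?thesis
  proof eventually_elim
    case (elim q)
    have "\<not> \<omega> q < w" using hi[OF elim(2) w(3)] elim(1) by force
    then show ?case using w(1) by simp
  qed
qed

lemma root_continuous:
  fixes \<phi> :: "'a::topological_space \<Rightarrow> real \<Rightarrow> real"
  assumes J: "open J" and root: "\<And>p. p \<in> S \<Longrightarrow> \<omega> p \<in> J"
    and lo: "\<And>p w. p \<in> S \<Longrightarrow> w \<in> J \<Longrightarrow> w < \<omega> p \<Longrightarrow> \<phi> p w < 0"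
    and hi: "\<And>p w. p \<in> S \<Longrightarrow> w \<in> J \<Longrightarrow> \<omega> p < w \<Longrightarrow> 0 < \<phi> p w"
    and cont: "\<And>w. w \<in> J \<Longrightarrow> continuous_on S (\<lambda>p. \<phi> p w)"
  shows "continuous_on S \<omega>" unfolding continuous_on_def
proof (intro ballI order_tendstoI)
  fix p a assume p: "p \<in> S"
  show "a < \<omega> p \<Longrightarrow> \<forall>\<^sub>F q in at p within S. a < \<omega> q"
    by (rule root_eventually_greater[OF assms p])
  assume "\<omega> p < a"
  \<comment> \<open>The upper estimate is the lower one after reflecting w -> - w and changing the
    sign of \<phi>.\<close>
  then have "\<forall>\<^sub>F q in at p within S. - a < - \<omega> q" using J root lo hi p
    by (intro root_eventually_greater[of "uminus ` J" S "\<lambda>p. - \<omega> p" "\<lambda>p w. - \<phi> p (- w)"] open_negations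
        continuous_on_minus) (auto intro: cont)
  then show "\<forall>\<^sub>F q in at p within S. \<omega> q < a" by simp
qed

lemma MVT_closed_segment:
  fixes f :: "real \<Rightarrow> real"
  assumes der: "\<And>x. x \<in> closed_segment a b \<Longrightarrow> (f has_real_derivative f' x) (at x)"
  shows "\<exists>z\<in>closed_segment a b. f b - f a = f' z * (b - a)"
proof (cases a b rule: linorder_cases)
  case less
  then have "\<exists>z>a. z < b \<and> f b - f a = (b - a) * f' z"
    by (intro MVT2 der) (auto simp: closed_segment_eq_real_ivl)
  then obtain z where "a < z" "z < b" "f b - f a = (b - a) * f' z" by blast
  with less show ?thesis by (intro bexI[of _ z]) (auto simp: closed_segment_eq_real_ivl)
next
  case greater
  then have "\<exists>z>b. z < a \<and> f a - f b = (a - b) * f' z"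
    by (intro MVT2 der) (auto simp: closed_segment_eq_real_ivl)
  then obtain z where "b < z" "z < a" "f a - f b = (a - b) * f' z" by blast
  with greater show ?thesis by (intro bexI[of _ z]) (auto simp: closed_segment_eq_real_ivl algebra_simps)
qed auto

text \<open>Implicit differentiation by two mean value steps, one in e at fixed w and one in w at
  e0. The relative form is made for the parameter set {0..<1}, at whose end point 0 the root is
  known on one side.\<close>

lemma implicit_derivative_within:
  fixes F :: "real \<Rightarrow> real \<Rightarrow> real"
  assumes U: "open U" "convex U" "w0 = \<omega> e0" "w0 \<in> U" and S: "convex S" "e0 \<in> S"
    and cont: "(\<omega> \<longlongrightarrow> w0) (at e0 within S)"
    and const: "\<And>e. e \<in> S \<Longrightarrow> F e (\<omega> e) = c"
    and Fe: "\<And>e w. e \<in> S \<Longrightarrow> w \<in> U \<Longrightarrow> ((\<lambda>e. F e w) has_real_derivative Fe e w) (at e)"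
    and Fw: "\<And>e w. e \<in> S \<Longrightarrow> w \<in> U \<Longrightarrow> ((\<lambda>w. F e w) has_real_derivative Fw e w) (at w)"
    and cFe: "isCont (\<lambda>(e, w). Fe e w) (e0, w0)"
    and cFw: "isCont (\<lambda>w. Fw e0 w) w0" and nz: "Fw e0 w0 \<noteq> 0"
  shows "(\<omega> has_real_derivative - Fe e0 w0 / Fw e0 w0) (at e0 within S)"
proof -
  have "\<exists>\<xi>\<in>closed_segment e0 e. F e w - F e0 w = Fe \<xi> w * (e - e0)" if "e \<in> S" "w \<in> U" for e w
  proof (rule MVT_closed_segment[of e0 e "\<lambda>e. F e w" "\<lambda>e. Fe e w"])
    show "((\<lambda>e. F e w) has_real_derivative Fe x w) (at x)" if "x \<in> closed_segment e0 e" for x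
      using that \<open>w \<in> U\<close> closed_segment_subset[OF S(2) \<open>e \<in> S\<close> S(1)] by (intro Fe) auto
  qed
  then obtain \<xi> where \<xi>: "\<And>e w. e \<in> S \<Longrightarrow> w \<in> U \<Longrightarrow> \<xi> e w \<in> closed_segment e0 e"
    "\<And>e w. e \<in> S \<Longrightarrow> w \<in> U \<Longrightarrow> F e w - F e0 w = Fe (\<xi> e w) w * (e - e0)"
    by metis
  have "\<exists>\<zeta>\<in>closed_segment w0 w. F e0 w - F e0 w0 = Fw e0 \<zeta> * (w - w0)" if "w \<in> U" for w
  proof (rule MVT_closed_segment[of w0 w "F e0" "Fw e0"])
    show "(F e0 has_real_derivative Fw e0 x) (at x)" if "x \<in> closed_segment w0 w" for x
      using that S closed_segment_subset[OF U(4) \<open>w \<in> U\<close> U(2)] by (intro Fw) auto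
  qed
  then obtain \<zeta> where \<zeta>: "\<And>w. w \<in> U \<Longrightarrow> \<zeta> w \<in> closed_segment w0 w"
    "\<And>w. w \<in> U \<Longrightarrow> F e0 w - F e0 w0 = Fw e0 (\<zeta> w) * (w - w0)"
    by metis
  let ?Fl = "at e0 within S"
  have inS: "\<forall>\<^sub>F e in ?Fl. e \<in> S \<and> e \<noteq> e0" by (auto simp: eventually_at_filter)
  have inU: "\<forall>\<^sub>F e in ?Fl. \<omega> e \<in> U" using cont U by (auto dest: topological_tendstoD)
  have l\<zeta>: "((\<lambda>e. \<zeta> (\<omega> e)) \<longlongrightarrow> w0) ?Fl"
  proof (rule Lim_transform2[of "\<lambda>_. w0"])
    have "\<forall>\<^sub>F e in ?Fl. norm (w0 - \<zeta> (\<omega> e)) \<le> \<bar>\<omega> e - w0\<bar>"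
      using inU by eventually_elim (use \<zeta>(1) in \<open>fastforce simp: closed_segment_eq_real_ivl split: if_splits\<close>)
    then show "((\<lambda>e. w0 - \<zeta> (\<omega> e)) \<longlongrightarrow> 0) ?Fl"
      by (rule Lim_null_comparison) (use cont in \<open>auto intro!: tendsto_eq_intros tendsto_rabs_zero\<close>)
  qed simp
  have l\<xi>: "((\<lambda>e. \<xi> e (\<omega> e)) \<longlongrightarrow> e0) ?Fl"
  proof (rule Lim_transform2[of "\<lambda>_. e0"])
    have "\<forall>\<^sub>F e in ?Fl. norm (e0 - \<xi> e (\<omega> e)) \<le> \<bar>e - e0\<bar>"
      using inU inS by eventually_elim (use \<xi>(1) in \<open>fastforce simp: closed_segment_eq_real_ivl split: if_splits\<close>)
    then show "((\<lambda>e. e0 - \<xi> e (\<omega> e)) \<longlongrightarrow> 0) ?Fl"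
      by (rule Lim_null_comparison) (auto intro!: tendsto_eq_intros tendsto_rabs_zero)
  qed simp
  have lFe: "((\<lambda>e. Fe (\<xi> e (\<omega> e)) (\<omega> e)) \<longlongrightarrow> Fe e0 w0) ?Fl"
    using isCont_tendsto_compose[OF cFe tendsto_Pair[OF l\<xi> cont]] by simp
  have lFw: "((\<lambda>e. Fw e0 (\<zeta> (\<omega> e))) \<longlongrightarrow> Fw e0 w0) ?Fl"
    using isCont_tendsto_compose[OF cFw l\<zeta>] by simp
  have nz': "\<forall>\<^sub>F e in ?Fl. Fw e0 (\<zeta> (\<omega> e)) \<noteq> 0"
    using tendsto_imp_eventually_ne[OF lFw nz] .
  have "\<forall>\<^sub>F e in ?Fl. - Fe (\<xi> e (\<omega> e)) (\<omega> e) / Fw e0 (\<zeta> (\<omega> e)) = (\<omega> e - \<omega> e0) / (e - e0)"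
    using inS inU nz'
  proof eventually_elim
    case (elim e)
    have "0 = F e (\<omega> e) - F e0 (\<omega> e0)" using const elim S by simp
    also have "\<dots> = Fe (\<xi> e (\<omega> e)) (\<omega> e) * (e - e0) + Fw e0 (\<zeta> (\<omega> e)) * (\<omega> e - w0)"
      using \<xi>(2)[OF elim(1)[THEN conjunct1] elim(2)] \<zeta>(2)[OF elim(2)] unfolding U(3) by linarith
    finally have "Fw e0 (\<zeta> (\<omega> e)) * (\<omega> e - w0) = - Fe (\<xi> e (\<omega> e)) (\<omega> e) * (e - e0)"
      by simp
    then have "\<omega> e - w0 = - Fe (\<xi> e (\<omega> e)) (\<omega> e) * (e - e0) / Fw e0 (\<zeta> (\<omega> e))"
      using elim(3) by (metis nonzero_mult_div_cancel_left)
    then show ?case using elim(1) unfolding U(3)[symmetric] by simp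
  qed
  moreover have "((\<lambda>e. - Fe (\<xi> e (\<omega> e)) (\<omega> e) / Fw e0 (\<zeta> (\<omega> e))) \<longlongrightarrow> - Fe e0 w0 / Fw e0 w0) ?Fl"
    by (intro tendsto_intros lFe lFw nz)
  ultimately show ?thesis unfolding has_field_derivative_iff by (rule Lim_transform_eventually[rotated])
qed

section \<open>The equation for the value at the sonic point\<close>

definition om_G :: "real \<Rightarrow> real \<Rightarrow> real" where
  "om_G e w = son_H0 e w * w powr (eta e)"

lemma om_G_eq: "om_G e w = ((1 + 3 * e) * w^2 + 4 * e * w + e * (e - 1)) * w powr (eta e)"
  by (simp add: om_G_def son_H0_def algebra_simps power2_eq_square)

lemma eta_nonneg: "0 \<le> e \<Longrightarrow> e < 1 \<Longrightarrow> 0 \<le> eta e" by (simp add: eta_def)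

text \<open>Monotonicity may fail where \<open>son_H0\<close> is negative, but from a point of
  positivity on both factors increase. Since the level 1 / x^2 is positive, this suffices for
  uniqueness of the root.\<close>

lemma om_G_mono:
  assumes e: "0 \<le> e" "e < 1" and w: "0 < w" "w < w'" and pos: "0 < om_G e w"
  shows "om_G e w < om_G e w'"
proof -
  have H: "0 < son_H0 e w" using pos w by (auto simp: om_G_def zero_less_mult_iff)
  have "(1 + 3 * e) * w^2 < (1 + 3 * e) * w'^2" using e w by (intro mult_strict_left_mono power_strict_mono) auto
  moreover have "4 * e * w \<le> 4 * e * w'" using e w by (intro mult_left_mono) auto
  ultimately have "son_H0 e w < son_H0 e w'" by (simp add: son_H0_def)
  moreover have "w powr eta e \<le> w' powr eta e" using e w by (intro powr_mono2 eta_nonneg) auto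
  ultimately show ?thesis unfolding om_G_def using H w by (intro mult_less_le_imp_less) auto
qed

lemma om_G_root_unique:
  assumes e: "0 \<le> e" "e < 1" and w: "0 < w" "0 < w'" "om_G e w = om_G e w'" "0 < om_G e w"
  shows "w = w'" using om_G_mono[OF e, of w w'] om_G_mono[OF e, of w' w] w by (cases w w' rule: linorder_cases) auto

lemma om_G_continuous_on_w: "continuous_on {0<..} (om_G e)"
  unfolding om_G_def son_H0_def by (intro continuous_intros) auto

lemma om_G_continuous_on_e: "w > 0 \<Longrightarrow> continuous_on {0..<1} (\<lambda>e. om_G e w)"
  unfolding om_G_def son_H0_def eta_def by (intro continuous_intros) auto

lemma om_G_root_exists:
  assumes e: "0 \<le> e" "e < 1" and y: "0 < y"
  shows "\<exists>w>0. om_G e w = y"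
proof -
  have "\<exists>w0>0. om_G e w0 \<le> y"
  proof (cases "e = 0")
    case True
    have "om_G e (min 1 (sqrt y)) = (min 1 (sqrt y))^2" using True y by (auto simp: om_G_def son_H0_def eta_def)
    also have "\<dots> \<le> (sqrt y)^2" using y by (intro power_mono) auto
    finally show ?thesis using y by (intro exI[of _ "min 1 (sqrt y)"]) auto
  next
    case False
    \<comment> \<open>This point satisfies e^2 - e = - 8 w, which outweighs the two other terms of
      \<open>son_H0\<close>, together at most 9/2 w.\<close>
    define w where "w = (1 - e) * e / 8"
    have w: "0 < w" "w \<le> 1/8" using e False mult_mono[of "1 - e" 1 e 1] by (auto simp: w_def)
    have "(1 + 3 * e) * w^2 \<le> 4 * (w * (1/8))" unfolding power2_eq_square using e w by (intro mult_mono) auto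
    moreover have "4 * e * w \<le> 4 * w" using e w by simp
    moreover have "e^2 - e = - 8 * w" by (simp add: w_def power2_eq_square algebra_simps)
    ultimately have "son_H0 e w \<le> 0" using w unfolding son_H0_def by linarith
    then have "om_G e w \<le> 0" unfolding om_G_def by (intro mult_nonpos_nonneg) auto
    then show ?thesis using w y by (intro exI[of _ w]) auto
  qed
  then obtain w0 where w0: "w0 > 0" "om_G e w0 \<le> y" by blast
  define w1 where "w1 = max w0 (y + 2)"
  have w1: "w0 \<le> w1" "1 \<le> w1" "y + 2 \<le> w1" using y by (auto simp: w1_def)
  have "om_G e w1 \<ge> y"
  proof -
    have "1 * w1 \<le> (1 + 3 * e) * w1^2"
      unfolding power2_eq_square using e w1 by (intro mult_mono mult_le_cancel_right1[THEN iffD2]) auto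
    moreover have "4 * e * w1 \<ge> 0" "e^2 \<ge> 0" using e w1 by auto
    ultimately have H: "son_H0 e w1 \<ge> y" using w1 e unfolding son_H0_def by linarith
    have "w1 powr eta e \<ge> 1" using w1 e by (intro ge_one_powr_ge_zero eta_nonneg) auto
    then have "son_H0 e w1 * w1 powr eta e \<ge> son_H0 e w1 * 1" using H y by (intro mult_left_mono) auto
    then show ?thesis using H by (simp add: om_G_def)
  qed
  then have "\<exists>w\<ge>w0. w \<le> w1 \<and> om_G e w = y"
    using w0 w1 by (intro IVT' continuous_on_subset[OF om_G_continuous_on_w]) auto
  then obtain w where "w0 \<le> w" "om_G e w = y" by blast
  then show ?thesis using w0(1) by (intro exI[of _ w]) auto
qed

definition om_root :: "real \<Rightarrow> real \<Rightarrow> real" where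
  "om_root e x = (THE w. 0 < w \<and> om_G e w = 1 / x^2)"

lemma om_root:
  assumes "0 \<le> e" "e < 1" "0 < x"
  shows "0 < om_root e x" "om_G e (om_root e x) = 1 / x^2"
proof -
  have pos: "0 < 1 / x^2" using assms by simp
  have "\<exists>!w. 0 < w \<and> om_G e w = 1 / x^2"
  proof (rule ex_ex1I)
    show "\<exists>w. 0 < w \<and> om_G e w = 1 / x^2" using om_G_root_exists[OF assms(1,2) pos] by blast
    show "w = w'" if "0 < w \<and> om_G e w = 1 / x^2" "0 < w' \<and> om_G e w' = 1 / x^2" for w w'
      using om_G_root_unique[OF assms(1,2), of w w'] that pos by simp
  qed
  from theI'[OF this] show "0 < om_root e x" "om_G e (om_root e x) = 1 / x^2" unfolding om_root_def by auto
qed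

lemma om_root_eqI:
  assumes "0 \<le> e" "e < 1" "0 < x" "0 < w" "om_G e w = 1 / x^2"
  shows "om_root e x = w"
proof -
  have "0 < 1 / x^2" using assms by simp
  then show ?thesis using om_root[OF assms(1-3)] om_G_root_unique[OF assms(1,2), of "om_root e x" w] assms(4,5) by simp
qed

lemma om_root_sign:
  assumes "0 \<le> e" "e < 1" "0 < x" "0 < w"
  shows "w < om_root e x \<Longrightarrow> om_G e w < 1 / x^2" "om_root e x < w \<Longrightarrow> 1 / x^2 < om_G e w"
proof -
  note R = om_root[OF assms(1-3)]
  show "om_G e w < 1 / x^2" if "w < om_root e x"
  proof (cases "0 < om_G e w")
    case True
    show ?thesis using om_G_mono[OF assms(1,2,4) that True] R by simp
  next
    case False
    then show ?thesis using assms(3) by (smt (verit) divide_pos_pos zero_less_power)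
  qed
  show "1 / x^2 < om_G e w" if "om_root e x < w" using om_G_mono[OF assms(1,2) R(1) that] R assms by simp
qed

lemma om_root_less_iff:
  assumes "0 \<le> e" "e < 1" "0 < x" "0 < w"
  shows "om_root e x < w \<longleftrightarrow> 1 / x^2 < om_G e w" "w < om_root e x \<longleftrightarrow> om_G e w < 1 / x^2"
  using om_root_sign[OF assms] om_root(2)[OF assms(1-3)] by (cases w "om_root e x" rule: linorder_cases; force)+

lemma om_root_continuous_e: "0 < x \<Longrightarrow> continuous_on {0..<1} (\<lambda>e. om_root e x)"
  by (rule root_continuous[of "{0<..}" _ _ "\<lambda>e w. om_G e w - 1 / x^2"])
    (auto simp: om_root om_root_sign intro!: continuous_intros om_G_continuous_on_e)

lemma om_root_continuous_x: "0 \<le> e \<Longrightarrow> e < 1 \<Longrightarrow> continuous_on {0<..} (om_root e)"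
  by (rule root_continuous[of "{0<..}" _ _ "\<lambda>x w. om_G e w - 1 / x^2"])
    (auto simp: om_root om_root_sign intro!: continuous_intros)

lemma om_root_strict_antimono:
  assumes "0 \<le> e" "e < 1" "0 < x" "x < y"
  shows "om_root e y < om_root e x"
proof -
  have "1 / y^2 < 1 / x^2" using assms by (intro divide_strict_left_mono power_strict_mono) auto
  then show ?thesis using assms om_root[of e x] by (subst om_root_less_iff) auto
qed

definition om_Ge :: "real \<Rightarrow> real \<Rightarrow> real" where
  "om_Ge e w = (3 * w^2 + 4 * w + 2 * e - 1) * w powr (eta e) + son_H0 e w * (w powr (eta e) * (ln w * (2 / (1 - e)^2)))"

definition om_Gw :: "real \<Rightarrow> real \<Rightarrow> real" where
  "om_Gw e w = (2 * (1 + 3 * e) * w + 4 * e) * w powr (eta e) + son_H0 e w * (eta e * w powr (eta e - 1))"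

lemma om_G_has_derivative_e:
  assumes "e < 1" "0 < w"
  shows "((\<lambda>e. om_G e w) has_real_derivative om_Ge e w) (at e)"
proof -
  have "(eta has_real_derivative 2 / (1 - e)^2) (at e)" unfolding eta_def using assms
    by (auto intro!: derivative_eq_intros simp: power2_eq_square field_simps)
  then have "((\<lambda>e. w powr (eta e)) has_real_derivative w powr (eta e) * (ln w * (2 / (1 - e)^2))) (at e)"
    using assms by (auto intro!: derivative_eq_intros simp: powr_def)
  moreover have "((\<lambda>e. son_H0 e w) has_real_derivative 3 * w^2 + 4 * w + 2 * e - 1) (at e)"
    unfolding son_H0_def by (auto intro!: derivative_eq_intros)
  ultimately have "((\<lambda>e. son_H0 e w * w powr (eta e)) has_real_derivative
      (3 * w^2 + 4 * w + 2 * e - 1) * w powr (eta e) + w powr (eta e) * (ln w * (2 / (1 - e)^2)) * son_H0 e w) (at e)"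
    by (rule DERIV_mult[rotated])
  then show ?thesis unfolding om_G_def om_Ge_def by (simp only: mult.commute)
qed

lemma om_G_has_derivative_w:
  assumes "0 < w"
  shows "((\<lambda>w. om_G e w) has_real_derivative om_Gw e w) (at w)"
  unfolding om_G_def om_Gw_def son_H0_def using assms
  by (auto intro!: derivative_eq_intros simp: powr_diff field_simps power2_eq_square)

definition om_D :: "real \<Rightarrow> real \<Rightarrow> real" where
  "om_D x e = - om_Ge e (om_root e x) / om_Gw e (om_root e x)"

text \<open>At the root \<open>son_H0\<close> is positive, because the level 1 / x^2 is; hence the
  derivative in w does not vanish there.\<close>

lemma om_root_C1:
  assumes x: "0 < x"
  shows "continuous_on {0..<1} (om_D x)"
    and "e \<in> {0..<1} \<Longrightarrow> ((\<lambda>e. om_root e x) has_real_derivative om_D x e) (at e within {0..<1})"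
proof -
  note R = om_root[OF _ _ x]
  have nz: "om_Gw e (om_root e x) \<noteq> 0" if "e \<in> {0..<1}" for e
  proof -
    have "om_G e (om_root e x) > 0" using R(2)[of e] that x by simp
    then have "son_H0 e (om_root e x) > 0"
      unfolding om_G_def by (metis less_le_not_le linorder_not_le mult_nonpos_nonneg powr_ge_zero)
    moreover have "(2 * (1 + 3 * e) * om_root e x + 4 * e) * om_root e x powr (eta e) > 0"
      using that R(1)[of e] by (intro mult_pos_pos add_pos_nonneg) auto
    moreover have "eta e * om_root e x powr (eta e - 1) \<ge> 0"
      using that by (intro mult_nonneg_nonneg eta_nonneg) auto
    ultimately have "om_Gw e (om_root e x) > 0"
      unfolding om_Gw_def by (intro add_pos_nonneg mult_nonneg_nonneg[of "son_H0 e (om_root e x)"]) auto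
    then show ?thesis by simp
  qed
  show "continuous_on {0..<1} (om_D x)" unfolding om_D_def using nz R(1) om_root_continuous_e[OF x]
    unfolding om_Ge_def om_Gw_def son_H0_def eta_def by (intro continuous_intros) (auto simp: less_le)
  show "((\<lambda>e. om_root e x) has_real_derivative om_D x e) (at e within {0..<1})" if e: "e \<in> {0..<1}"
    unfolding om_D_def
  proof (rule implicit_derivative_within[of "{0<..}" _ _ _ _ om_G "1 / x^2" om_Ge om_Gw])
    show "((\<lambda>e. om_root e x) \<longlongrightarrow> om_root e x) (at e within {0..<1})"
      using om_root_continuous_e[OF x] e unfolding continuous_on_def by blast
    show "om_root e x \<in> {0<..}" using R(1) e by simp
    then show "isCont (\<lambda>(e, w). om_Ge e w) (e, om_root e x)" "isCont (om_Gw e) (om_root e x)"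
      unfolding case_prod_unfold om_Ge_def om_Gw_def son_H0_def eta_def using e by (intro continuous_intros; simp)+
  qed (use e R nz in \<open>auto intro: om_G_has_derivative_e om_G_has_derivative_w\<close>)
qed

text \<open>The branch is continued linearly to negative \<open>e\<close>, because \<open>C1_differentiable_on\<close> asks for
  two-sided derivatives at the end point \<open>0\<close>.\<close>

lemma omega_branch_om_root:
  assumes eps: "0 \<le> eps" "eps < 1" and x: "0 < x"
  shows "\<exists>w. omega_branch eps x w \<and> w eps = om_root eps x"
proof -
  define D where "D = om_D x"
  note C1 = om_root_C1[OF x, folded D_def]
  define w where "w = (\<lambda>e. if e < 0 then om_root 0 x + D 0 * e else om_root e x)"
  have der: "(w has_real_derivative D e) (at e)" if e: "e \<in> {0..<1}" for e
  proof (cases "e = 0")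
    case False
    have "((\<lambda>e. om_root e x) has_real_derivative D e) (at e within {0<..<1})"
      by (rule DERIV_subset[OF C1(2)[OF e]]) auto
    then have "((\<lambda>e. om_root e x) has_real_derivative D e) (at e)"
      using e False by (simp add: at_within_open[of e "{0<..<1}"])
    then show ?thesis
      by (rule has_field_derivative_transform_within_open[of _ _ _ "{0<..}"]) (use e False in \<open>auto simp: w_def\<close>)
  next
    case True
    have "(w has_real_derivative D 0) (at 0 within {0..<1})"
    proof (rule has_field_derivative_transform_within[of _ _ _ _ 1])
      show "((\<lambda>e. om_root e x) has_real_derivative D 0) (at 0 within {0..<1})" using C1(2)[of 0] by simp
    qed (auto simp: w_def)
    moreover have "(w has_real_derivative D 0) (at 0 within {..0})"
    proof (rule has_field_derivative_transform_within[of "\<lambda>e. om_root 0 x + D 0 * e" _ _ _ 1])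
      show "((\<lambda>e. om_root 0 x + D 0 * e) has_real_derivative D 0) (at 0 within {..0})"
        by (auto intro!: derivative_eq_intros)
    qed (auto simp: w_def)
    \<comment> \<open>The left derivative of the linear continuation is the right derivative of the
      root, so both glue to a two-sided one.\<close>
    ultimately have "(w has_real_derivative D 0) (at 0 within {0..<1} \<union> {..0})"
      unfolding has_field_derivative_iff unfolding at_within_union by (rule filterlim_sup)
    moreover have "{0..<1} \<union> {..0} = {..<1::real}" by auto
    ultimately show ?thesis using True by (simp add: at_within_open[of 0 "{..<1::real}"])
  qed
  have "w C1_differentiable_on {0..eps}" unfolding C1_differentiable_on_def
  proof (intro exI[of _ D] conjI ballI)
    show "(w has_vector_derivative D e) (at e)" if "e \<in> {0..eps}" for e
      using der[of e] that eps by (simp add: has_real_derivative_iff_has_vector_derivative)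
    show "continuous_on {0..eps} D" using C1(1) by (rule continuous_on_subset) (use eps in auto)
  qed
  moreover have "w 0 = 1 / x"
  proof -
    have "om_root 0 x = 1 / x" using x by (intro om_root_eqI) (auto simp: om_G_def son_H0_def eta_def power_divide)
    then show ?thesis by (simp add: w_def)
  qed
  moreover have "w e > 0 \<and> ((1 + 3 * e) * (w e)^2 + 4 * e * w e + e * (e - 1)) * (w e) powr (eta e) = 1 / x^2"
    if "e \<in> {0..eps}" for e
    using om_root[of e x] that eps x by (simp add: w_def om_G_eq)
  ultimately have "omega_branch eps x w" by (simp add: omega_branch_def)
  then show ?thesis using eps by (intro exI[of _ w]) (simp add: w_def)
qed

text \<open>Any branch value at eps is a positive root of the equation for this eps, and that root
  is unique; a branch exists by \<open>omega_branch_om_root\<close>.\<close>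

lemma omega_eq:
  assumes eps: "0 \<le> eps" "eps < 1" and x: "0 < x"
  shows "omega eps x = om_root eps x" unfolding omega_def
proof (rule the_equality)
  show "\<exists>w. omega_branch eps x w \<and> om_root eps x = w eps" using omega_branch_om_root[OF assms] by metis
  fix v assume "\<exists>w. omega_branch eps x w \<and> v = w eps"
  then have "v > 0" "om_G eps v = 1 / x^2" using eps by (auto simp: omega_branch_def om_G_eq)
  then show "v = om_root eps x" using om_root_eqI[OF assms] by simp
qed

subsection \<open>The cubic for the slopes at the sonic point\<close>

lemma isCont_son_H0 [continuous_intros]:
  fixes e w :: "'b::t2_space \<Rightarrow> 'a::real_normed_field"
  assumes "isCont e x" "isCont w x"
  shows "isCont (\<lambda>x. son_H0 (e x) (w x)) x" unfolding son_H0_def by (intro continuous_intros assms)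

text \<open>Subtracting the factored form leaves a polynomial of degree at most two with three
  distinct zeros. Vieta's formulas are recorded for the two coefficients that enter W_1.\<close>

lemma cubic_factor:
  fixes k3 :: real
  assumes roots: "k3 * r1^3 + k2 * r1^2 + k1 * r1 + k0 = 0" "k3 * r2^3 + k2 * r2^2 + k1 * r2 + k0 = 0"
      "k3 * r3^3 + k2 * r3^2 + k1 * r3 + k0 = 0"
    and distinct: "r1 \<noteq> r2" "r2 \<noteq> r3" "r1 \<noteq> r3"
  shows "k2 = - k3 * (r1 + r2 + r3)" "k0 = - k3 * r1 * r2 * r3"
    "k3 * X^3 + k2 * X^2 + k1 * X + k0 = k3 * ((X - r1) * (X - r2) * (X - r3))"
proof -
  define A B C where "A = k2 + k3 * (r1 + r2 + r3)" "B = k1 - k3 * (r1 * r2 + r2 * r3 + r1 * r3)"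
    "C = k0 + k3 * r1 * r2 * r3"
  note ABC = this
  have q: "k3 * X^3 + k2 * X^2 + k1 * X + k0 = k3 * ((X - r1) * (X - r2) * (X - r3)) + A * X^2 + B * X + C" for X
    by (simp add: ABC algebra_simps power2_eq_square power3_eq_cube)
  have z: "A * r1^2 + B * r1 + C = 0" "A * r2^2 + B * r2 + C = 0" "A * r3^2 + B * r3 + C = 0"
    using roots unfolding q by simp_all
  have "(r1 - r2) * (A * (r1 + r2) + B) = 0" "(r1 - r3) * (A * (r1 + r3) + B) = 0"
    using z by (simp_all add: algebra_simps power2_eq_square)
  then have *: "A * (r1 + r2) + B = 0" "A * (r1 + r3) + B = 0" using distinct by auto
  have "A * (r2 - r3) = (A * (r1 + r2) + B) - (A * (r1 + r3) + B)" by (simp add: algebra_simps)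
  then have "A * (r2 - r3) = 0" using * by simp
  then have A: "A = 0" using distinct by simp
  with * have B: "B = 0" by simp
  with A z have C: "C = 0" by simp
  show "k2 = - k3 * (r1 + r2 + r3)" "k0 = - k3 * r1 * r2 * r3" using A C by (simp_all add: ABC)
  show "k3 * X^3 + k2 * X^2 + k1 * X + k0 = k3 * ((X - r1) * (X - r2) * (X - r3))" by (simp add: q A B C)
qed

text \<open>The coefficients are rewritten as functions of e and w instead of e and x_*: the sonic
  value w ranges over a compact interval independent of eps, which permits a uniform perturbation of
  e = 0.\<close>

definition cu_a :: "real \<Rightarrow> real \<Rightarrow> real" where "cu_a e w = w * (w + e)"
definition cu_b :: "real \<Rightarrow> real \<Rightarrow> real" where "cu_b e w = e / (1 - e) * (son_H0 e w / w) + 2 * e * w"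
definition cu_c :: "real \<Rightarrow> real" where "cu_c w = 3 * w - 1"
definition cu_d :: "real \<Rightarrow> real \<Rightarrow> real" where "cu_d e w = (1 + e) * w + 2 * e"
definition cu_e :: "real \<Rightarrow> real \<Rightarrow> real" where
  "cu_e e w = (3 + 5 * e) * w^2 - (1 - 8 * e + e^2) * w - (3 * e - e^2)"
definition cu_f :: "real \<Rightarrow> real \<Rightarrow> real" where "cu_f e w = (1 - e) * cu_a e w - son_H0 e w"
definition cu_h :: "real \<Rightarrow> real \<Rightarrow> real" where "cu_h e w = (1 + e) * cu_a e w + cu_b e w * cu_c w"
definition cu3 :: "real \<Rightarrow> real \<Rightarrow> real" where
  "cu3 e w = cu_d e w * (cu_d e w * cu_h e w - cu_b e w * cu_e e w)
     - cu_b e w * (cu_f e w * cu_d e w + (1 - e) * cu_a e w * cu_b e w)"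
definition cu2 :: "real \<Rightarrow> real \<Rightarrow> real" where
  "cu2 e w = - (cu_b e w * cu_c w * cu_d e w * son_H0 e w - cu_e e w * (cu_d e w * cu_h e w - cu_b e w * cu_e e w)
     + cu_h e w * (cu_f e w * cu_d e w + (1 - e) * cu_a e w * cu_b e w)
     + cu_b e w * (cu_f e w * cu_e e w + (1 - e) * cu_a e w * cu_h e w))"
definition cu1 :: "real \<Rightarrow> real \<Rightarrow> real" where
  "cu1 e w = - (cu_b e w * cu_c w * cu_e e w * son_H0 e w - cu_c w * son_H0 e w * (cu_d e w * cu_h e w - cu_b e w * cu_e e w)
     + cu_b e w * cu_c w * cu_f e w * son_H0 e w + cu_h e w * (cu_f e w * cu_e e w + (1 - e) * cu_a e w * cu_h e w))"
definition cu0 :: "real \<Rightarrow> real \<Rightarrow> real" where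
  "cu0 e w = - (cu_c w * son_H0 e w * (cu_b e w * cu_c w * son_H0 e w + cu_f e w * cu_h e w))"
definition cu :: "real \<Rightarrow> real \<Rightarrow> real \<Rightarrow> real" where
  "cu e w X = cu3 e w * X^3 + cu2 e w * X^2 + cu1 e w * X + cu0 e w"
definition cu_R :: "real \<Rightarrow> real \<Rightarrow> real \<Rightarrow> real" where
  "cu_R e w X = - ((cu_d e w * X^2 + cu_e e w * X + cu_c w * son_H0 e w) / (cu_h e w + cu_b e w * X))"

lemmas cu_coeff_defs = cu_a_def cu_b_def cu_c_def cu_d_def cu_e_def cu_f_def cu_h_def

lemma coeff_eq_cu:
  "c_H0 e x = son_H0 e (omega e x)" "c_a e x = cu_a e (omega e x)" "c_b e x = cu_b e (omega e x)"
  "c_c e x = cu_c (omega e x)" "c_d e x = cu_d e (omega e x)" "c_e e x = cu_e e (omega e x)"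
  "c_f e x = cu_f e (omega e x)" "c_h e x = cu_h e (omega e x)"
  "a3 e x = cu3 e (omega e x)" "a2 e x = cu2 e (omega e x)" "a1 e x = cu1 e (omega e x)" "a0 e x = cu0 e (omega e x)"
proof -
  show *: "c_H0 e x = son_H0 e (omega e x)" "c_a e x = cu_a e (omega e x)"
    "c_c e x = cu_c (omega e x)" "c_d e x = cu_d e (omega e x)" "c_e e x = cu_e e (omega e x)"
    by (simp_all add: c_H0_def c_a_def c_c_def c_d_def c_e_def cu_coeff_defs son_H0_def Let_def)
  show b: "c_b e x = cu_b e (omega e x)" "c_f e x = cu_f e (omega e x)"
    by (simp_all add: c_b_def c_f_def * cu_b_def cu_f_def Let_def)
  show h: "c_h e x = cu_h e (omega e x)" by (simp add: c_h_def * b cu_h_def)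
  show "a3 e x = cu3 e (omega e x)" "a2 e x = cu2 e (omega e x)" "a1 e x = cu1 e (omega e x)" "a0 e x = cu0 e (omega e x)"
    unfolding a3_def a2_def a1_def a0_def Let_def * b h cu3_def cu2_def cu1_def cu0_def by (rule refl)+
qed

lemma cu_0:
  assumes "w \<noteq> 0"
  shows "cu 0 w X = w^4 * (X * (X + w) * (X + 2 * w - 1))" "cu3 0 w = w^4"
  using assms by (simp_all add: cu_def cu3_def cu2_def cu1_def cu0_def cu_coeff_defs son_H0_def)
    (simp_all add: algebra_simps power2_eq_square power3_eq_cube power4_eq_xxxx)

text \<open>Elimination of R_1: with R_1 = - N / D from one slope equation, the other one multiplied
  by D^2 becomes this cubic in X = W_1.\<close>

lemma cu_resultant:
  fixes a b c d e' f h H X eps :: real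
  assumes "f = (1 - eps) * a - H" "N = d * X^2 + e' * X + c * H" "D = h + b * X"
  shows "(- b * N + (d * X + H) * D) * N - (1 - eps) * a * (N + X * D) * D =
    (d * (d * h - b * e') - b * (f * d + (1 - eps) * a * b)) * X^3
    + (- (b * c * d * H - e' * (d * h - b * e') + h * (f * d + (1 - eps) * a * b) + b * (f * e' + (1 - eps) * a * h))) * X^2
    + (- (b * c * e' * H - c * H * (d * h - b * e') + b * c * f * H + h * (f * e' + (1 - eps) * a * h))) * X
    + (- (c * H * (b * c * H + f * h)))"
  unfolding assms by (simp add: algebra_simps power2_eq_square power3_eq_cube)

text \<open>The two identities are the equations of first order in \<delta>z at the sonic point. The
  first is the cubic divided by D^2, the second is the definition of \<open>cu_R\<close>
  rearranged.\<close>

lemma cu_slopes: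
  assumes root: "cu e w X = 0" and nz: "cu_h e w + cu_b e w * X \<noteq> 0"
  defines "Rx \<equiv> cu_R e w X"
  shows "(cu_b e w * Rx + cu_d e w * X + son_H0 e w) * Rx = (1 - e) * cu_a e w * (Rx - X)"
    and "- (cu_b e w * Rx + cu_d e w * X + son_H0 e w) * (X + cu_c w) = (1 + e) * cu_a e w * (Rx - X)"
proof -
  define N where "N = cu_d e w * X^2 + cu_e e w * X + cu_c w * son_H0 e w"
  define D where "D = cu_h e w + cu_b e w * X"
  have RD: "Rx * D = - N" "D \<noteq> 0" using nz by (simp_all add: Rx_def cu_R_def N_def D_def)
  have "(- cu_b e w * N + (cu_d e w * X + son_H0 e w) * D) * N - (1 - e) * cu_a e w * (N + X * D) * D = cu e w X"
    unfolding cu_def cu3_def cu2_def cu1_def cu0_def by (rule cu_resultant[OF cu_f_def N_def D_def])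
  then have 0: "(- cu_b e w * N + (cu_d e w * X + son_H0 e w) * D) * N = (1 - e) * cu_a e w * (N + X * D) * D"
    using root by simp
  have "D * D * ((cu_b e w * Rx + cu_d e w * X + son_H0 e w) * Rx) = D * D * ((1 - e) * cu_a e w * (Rx - X))"
  proof -
    have "D * D * ((cu_b e w * Rx + cu_d e w * X + son_H0 e w) * Rx) =
        (cu_b e w * (Rx * D) + (cu_d e w * X + son_H0 e w) * D) * (Rx * D)"
      by (simp add: algebra_simps)
    also have "\<dots> = - ((- cu_b e w * N + (cu_d e w * X + son_H0 e w) * D) * N)"
      unfolding RD by (simp add: algebra_simps)
    also have "\<dots> = (1 - e) * cu_a e w * (Rx * D - X * D) * D" unfolding 0 RD by (simp add: algebra_simps)
    finally show ?thesis by (simp add: algebra_simps)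
  qed
  then show "(cu_b e w * Rx + cu_d e w * X + son_H0 e w) * Rx = (1 - e) * cu_a e w * (Rx - X)" using RD by simp
  have ce: "cu_e e w = cu_c w * cu_d e w + son_H0 e w - (1 + e) * cu_a e w"
    by (simp add: cu_coeff_defs son_H0_def algebra_simps power2_eq_square)
  have "Rx * (cu_h e w + cu_b e w * X) = - (cu_d e w * X^2 + cu_e e w * X + cu_c w * son_H0 e w)"
    using RD(1) unfolding N_def D_def .
  then show "- (cu_b e w * Rx + cu_d e w * X + son_H0 e w) * (X + cu_c w) = (1 + e) * cu_a e w * (Rx - X)"
    unfolding ce cu_h_def by (simp add: algebra_simps power2_eq_square)
qed

text \<open>Location of the three roots for small \<open>e\<close>: they are close to \<open>- w\<close>, \<open>0\<close> and \<open>1 - 2 * w\<close>.\<close>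

definition cubic_ok :: "real \<Rightarrow> real \<Rightarrow> real \<Rightarrow> bool" where
  "cubic_ok s e w \<longleftrightarrow> 0 < cu3 e w \<and> cu e w (-1) < 0 \<and> 0 < cu e w (-1/6) \<and> cu e w (1 - 2 * w - s) < 0 \<and> 0 < cu e w (1 - 2 * w + s)
    \<and> (\<forall>y. \<bar>y\<bar> \<le> s \<longrightarrow> cu_h e w + cu_b e w * (1 - 2 * w + y) > 0)"

text \<open>For e = 0 the cubic is w^4 X (X + w) (X + 2 w - 1). As w lies in [3/10, 1/2), the points
  -1 and -1/6 enclose the root - w and exclude 0; the signs at the four test points persist for
  small e uniformly in w.\<close>

lemma cubic_ok_small:
  assumes wM: "wM < 1/2" and s: "0 < s" "s < 1 - 2 * wM"
  shows "\<exists>e1>0. e1 \<le> 1/4 \<and> (\<forall>e w. 0 \<le> e \<longrightarrow> e \<le> e1 \<longrightarrow> 3/10 \<le> w \<longrightarrow> w \<le> wM \<longrightarrow> cubic_ok s e w)"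
proof -
  define P where "P = (\<lambda>(w, e). 0 < cu3 e w \<and> cu e w (-1) < 0 \<and> 0 < cu e w (-1/6) \<and> cu e w (1 - 2 * w - s) < 0 \<and>
    0 < cu e w (1 - 2 * w + s) \<and> 0 < cu_h e w - \<bar>cu_b e w\<bar> * 2)"
  have "eventually P (nhds (w, 0))" if w: "w \<in> {3/10..wM}" for w
  proof -
    have w': "w \<noteq> 0" "0 < w" "w < 1/2" "3/10 \<le> w" "s < 1 - 2 * w" using w wM s by auto
    note cu_defs = cu_def cu3_def cu2_def cu1_def cu0_def cu_coeff_defs
    have c: "isCont (\<lambda>x. cu3 (snd x) (fst x)) (w, 0)" "isCont (\<lambda>x. cu (snd x) (fst x) (-1)) (w, 0)"
      "isCont (\<lambda>x. cu (snd x) (fst x) (-1/6)) (w, 0)" "isCont (\<lambda>x. cu (snd x) (fst x) (1 - 2 * fst x - s)) (w, 0)"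
      "isCont (\<lambda>x. cu (snd x) (fst x) (1 - 2 * fst x + s)) (w, 0)"
      "isCont (\<lambda>x. cu_h (snd x) (fst x) - \<bar>cu_b (snd x) (fst x)\<bar> * 2) (w, 0)"
      unfolding cu_defs using w' by (intro continuous_intros; simp)+
    have v: "0 < cu3 0 w" "cu 0 w (-1) < 0" "0 < cu 0 w (-1/6)" "cu 0 w (1 - 2 * w - s) < 0" "0 < cu 0 w (1 - 2 * w + s)"
      "0 < cu_h 0 w - \<bar>cu_b 0 w\<bar> * 2"
    proof -
      show "0 < cu3 0 w" "0 < cu_h 0 w - \<bar>cu_b 0 w\<bar> * 2" using w' by (auto simp: cu_0 cu_coeff_defs)
      show "cu 0 w (-1) < 0" "0 < cu 0 w (-1/6)" "cu 0 w (1 - 2 * w - s) < 0" "0 < cu 0 w (1 - 2 * w + s)"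
        using w' s unfolding cu_0[OF w'(1)]
        by (auto intro!: mult_pos_pos mult_pos_neg mult_neg_neg mult_neg_pos simp: mult_less_0_iff zero_less_mult_iff)
    qed
    show ?thesis unfolding P_def case_prod_unfold using v by (intro eventually_conj isCont_eventually_less c) simp_all
  qed
  from uniform_eventually_compact[OF compact_Icc this]
  obtain \<delta> where \<delta>: "\<delta> > 0" "\<And>w e. w \<in> {3/10..wM} \<Longrightarrow> norm e < \<delta> \<Longrightarrow> P (w, e)"
    by blast
  show ?thesis
  proof (intro exI[of _ "min (\<delta> / 2) (1/4)"] conjI allI impI)
    fix e w assume A: "0 \<le> e" "e \<le> min (\<delta> / 2) (1/4)" "3/10 \<le> w" "w \<le> wM"
    then have Pw: "P (w, e)" using \<delta>(1) by (intro \<delta>(2)) auto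
    have "cu_h e w + cu_b e w * (1 - 2 * w + y) > 0" if y: "\<bar>y\<bar> \<le> s" for y
    proof -
      have "\<bar>cu_b e w * (1 - 2 * w + y)\<bar> \<le> \<bar>cu_b e w\<bar> * 2"
        unfolding abs_mult using y A s wM by (intro mult_left_mono) auto
      then show ?thesis using Pw by (auto simp: P_def)
    qed
    with Pw show "cubic_ok s e w" by (auto simp: P_def cubic_ok_def)
  qed (use \<delta> in auto)
qed

lemma cubic_roots:
  assumes ok: "cubic_ok s e w" and s: "0 < s" "s < 1 - 2 * w"
  obtains r1 r2 r3 where "- 1 < r1" "r1 < -1/6" "-1/6 < r2" "r2 < 1 - 2 * w - s" "1 - 2 * w - s < r3" "r3 < 1 - 2 * w + s"
    "\<And>X. cu e w X = cu3 e w * ((X - r1) * (X - r2) * (X - r3))"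
    "cu2 e w = - cu3 e w * (r1 + r2 + r3)" "cu0 e w = - cu3 e w * r1 * r2 * r3"
proof -
  have cont: "continuous_on S (cu e w)" for S unfolding cu_def by (intro continuous_intros)
  have c: "cu e w (-1) < 0" "0 < cu e w (-1/6)" "cu e w (1 - 2 * w - s) < 0" "0 < cu e w (1 - 2 * w + s)"
    using ok by (auto simp: cubic_ok_def)
  obtain r1 where r1: "-1 \<le> r1" "r1 \<le> -1/6" "cu e w r1 = 0"
    using IVT'[of "cu e w" "-1" 0 "-1/6", OF _ _ _ cont] c by auto
  obtain r2 where r2: "-1/6 \<le> r2" "r2 \<le> 1 - 2 * w - s" "cu e w r2 = 0"
    using IVT2'[of "cu e w" "1 - 2 * w - s" 0 "-1/6", OF _ _ _ cont] c s by auto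
  obtain r3 where r3: "1 - 2 * w - s \<le> r3" "r3 \<le> 1 - 2 * w + s" "cu e w r3 = 0"
    using IVT'[of "cu e w" "1 - 2 * w - s" 0 "1 - 2 * w + s", OF _ _ _ cont] c s by auto
  have ne: "r1 \<noteq> -1" "r1 \<noteq> -1/6" "r2 \<noteq> -1/6" "r2 \<noteq> 1 - 2 * w - s" "r3 \<noteq> 1 - 2 * w - s" "r3 \<noteq> 1 - 2 * w + s"
    using r1(3) r2(3) r3(3) c by auto
  have roots: "cu3 e w * r^3 + cu2 e w * r^2 + cu1 e w * r + cu0 e w = 0" if "cu e w r = 0" for r
    using that by (simp add: cu_def)
  note F = cubic_factor[OF roots[OF r1(3)] roots[OF r2(3)] roots[OF r3(3)]]
  show ?thesis
  proof (rule that[of r1 r2 r3])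
    have d: "r1 \<noteq> r2" "r2 \<noteq> r3" "r1 \<noteq> r3" using r1 r2 r3 ne by auto
    show "cu2 e w = - cu3 e w * (r1 + r2 + r3)" "cu0 e w = - cu3 e w * r1 * r2 * r3"
      "cu e w X = cu3 e w * ((X - r1) * (X - r2) * (X - r3))" for X
      unfolding cu_def by (rule F[OF d])+
  qed (use r1 r2 r3 ne in auto)
qed

text \<open>The continuation of the root - w at e = 0, isolated as the only root to the left of
  -1/6.\<close>

definition cu_root :: "real \<Rightarrow> real \<Rightarrow> real" where
  "cu_root e w = (THE X. X < -1/6 \<and> cu e w X = 0)"

lemma cu_root:
  assumes ok: "cubic_ok s e w" and s: "0 < s" "s < 1 - 2 * w"
  shows "cu_root e w < -1/6" "cu e w (cu_root e w) = 0"
    "X < -1/6 \<Longrightarrow> X < cu_root e w \<Longrightarrow> cu e w X < 0" "X < -1/6 \<Longrightarrow> cu_root e w < X \<Longrightarrow> 0 < cu e w X"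
    "X < -1/6 \<Longrightarrow> cu e w X = 0 \<Longrightarrow> X = cu_root e w"
    "\<exists>r2 r3. 1 - 2 * w - s < r3 \<and> r3 < 1 - 2 * w + s \<and> r2 < r3 \<and> cu e w r3 = 0 \<and>
       cu2 e w = - cu3 e w * (cu_root e w + r2 + r3) \<and> cu0 e w = - cu3 e w * cu_root e w * r2 * r3"
proof -
  obtain r1 r2 r3 where r: "- 1 < r1" "r1 < -1/6" "-1/6 < r2" "r2 < 1 - 2 * w - s" "1 - 2 * w - s < r3" "r3 < 1 - 2 * w + s"
    and f: "\<And>X. cu e w X = cu3 e w * ((X - r1) * (X - r2) * (X - r3))"
    and k: "cu2 e w = - cu3 e w * (r1 + r2 + r3)" "cu0 e w = - cu3 e w * r1 * r2 * r3"
    using cubic_roots[OF assms] by metis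
  have pos: "0 < cu3 e w" using ok by (simp add: cubic_ok_def)
  have *: "0 < (X - r2) * (X - r3)" if "X < -1/6" for X using that r by (intro mult_neg_neg) auto
  have uni: "X = r1" if "X < -1/6" "cu e w X = 0" for X
  proof -
    have "cu3 e w * ((X - r1) * ((X - r2) * (X - r3))) = 0" using that(2) unfolding f by (simp only: mult.assoc)
    moreover have "(X - r2) * (X - r3) \<noteq> 0" using *[OF that(1)] by linarith
    ultimately have "X - r1 = 0" using pos by (metis less_irrefl mult_eq_0_iff)
    then show ?thesis by simp
  qed
  have [simp]: "cu_root e w = r1" unfolding cu_root_def
  proof (rule the_equality)
    show "r1 < -1/6 \<and> cu e w r1 = 0" using r(2) by (simp add: f)
  qed (use uni in blast)
  show "cu_root e w < -1/6" "cu e w (cu_root e w) = 0" using r f by simp_all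
  show "cu e w X < 0" if X: "X < -1/6" "X < cu_root e w"
  proof -
    have "(X - r1) * ((X - r2) * (X - r3)) < 0" using X(2) by (intro mult_neg_pos[OF _ *[OF X(1)]]) simp
    then show ?thesis unfolding f using pos by (simp add: mult.assoc mult_pos_neg)
  qed
  show "0 < cu e w X" if X: "X < -1/6" "cu_root e w < X"
  proof -
    have "0 < (X - r1) * ((X - r2) * (X - r3))" using X(2) by (intro mult_pos_pos[OF _ *[OF X(1)]]) simp
    then show ?thesis unfolding f using pos by (simp add: mult.assoc)
  qed
  show "X = cu_root e w" if "X < -1/6" "cu e w X = 0" using uni[OF that] by simp
  show "\<exists>r2 r3. 1 - 2 * w - s < r3 \<and> r3 < 1 - 2 * w + s \<and> r2 < r3 \<and> cu e w r3 = 0 \<and>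
       cu2 e w = - cu3 e w * (cu_root e w + r2 + r3) \<and> cu0 e w = - cu3 e w * cu_root e w * r2 * r3"
    using r f k by (intro exI[of _ r2] exI[of _ r3]) auto
qed

text \<open>If r1 < r2 < r3 are the roots and r1 is the branch \<open>W1_gh\<close>, then Vieta
  gives - (a2 / a3 + r1) = r2 + r3 and \<open>Delta_Q\<close> = (r3 - r2)^2. The formula for W_1
  therefore selects the largest root, the one near 1 - 2 w.\<close>

lemma rlp_slopes:
  assumes s: "0 < s" "s < 1 - 2 * wM" and eps: "0 \<le> eps" "eps < 1" and x: "0 < x"
    and ok: "\<And>e. 0 \<le> e \<Longrightarrow> e \<le> eps \<Longrightarrow> cubic_ok s e (om_root e x)"
    and w: "\<And>e. 0 \<le> e \<Longrightarrow> e \<le> eps \<Longrightarrow> 3/10 \<le> om_root e x \<and> om_root e x \<le> wM"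
  shows "cu eps (om_root eps x) (W1_rlp eps x) = 0" "\<bar>W1_rlp eps x - (1 - 2 * om_root eps x)\<bar> < s"
    "R1_rlp eps x = cu_R eps (om_root eps x) (W1_rlp eps x)"
proof -
  have om: "omega e x = om_root e x" if "0 \<le> e" "e \<le> eps" for e using that eps x by (intro omega_eq) auto
  have s': "s < 1 - 2 * om_root e x" if "0 \<le> e" "e \<le> eps" for e using w[OF that] s by linarith
  note root = cu_root[OF ok s(1) s']
  have eq: "X^3 + a2 e x / a3 e x * X^2 + a1 e x / a3 e x * X + a0 e x / a3 e x = 0 \<longleftrightarrow> cu e (om_root e x) X = 0"
    if "0 \<le> e" "e \<le> eps" for e X
  proof -
    have "0 < cu3 e (om_root e x)" using ok[OF that] by (simp add: cubic_ok_def)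
    moreover have "cu3 e (om_root e x) * (X^3 + a2 e x / a3 e x * X^2 + a1 e x / a3 e x * X + a0 e x / a3 e x) = cu e (om_root e x) X"
      using calculation unfolding coeff_eq_cu om[OF that] cu_def by (simp add: algebra_simps)
    ultimately show ?thesis by (metis less_irrefl mult_eq_0_iff)
  qed
  define g where "g = (\<lambda>e. cu_root e (om_root e x))"
  have cont_om: "continuous_on {0..eps} (\<lambda>e. om_root e x)"
    by (rule continuous_on_subset[OF om_root_continuous_e[OF x]]) (use eps in auto)
  have "continuous_on {0..eps} g"
  proof (rule root_continuous[of "{..<-1/6}" _ _ "\<lambda>e X. cu e (om_root e x) X"])
    show "continuous_on {0..eps} (\<lambda>e. cu e (om_root e x) X)" for X
      unfolding cu_def cu3_def cu2_def cu1_def cu0_def cu_coeff_defs son_H0_def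
      by (intro continuous_intros cont_om) (use eps w in fastforce)+
  qed (use root(1,3,4) in \<open>auto simp: g_def\<close>)
  moreover have om0: "om_root 0 x = 1 / x"
    using x by (intro om_root_eqI) (auto simp: om_G_def son_H0_def eta_def power_divide)
  then have x6: "- 1 / x < - 1/6" using w[of 0] eps by simp
  have "g 0 = - 1 / x"
  proof -
    have "cu 0 (1 / x) (- 1 / x) = 0" using x by (subst cu_0) auto
    then show ?thesis using root(5)[of 0 "- 1 / x"] eps x6 by (simp add: g_def om0)
  qed
  ultimately have gh: "gh_branch eps x g" unfolding gh_branch_def using eq root(2) by (auto simp: g_def)
  \<comment> \<open>A continuous branch starting at - 1 / x cannot pass -1/6, where the cubic is
    positive for all e, hence it remains the leftmost root.\<close>
  have gh_unique: "v eps = g eps" if "gh_branch eps x v" for v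
  proof -
    have v: "continuous_on {0..eps} v" "v 0 = - 1 / x" "\<And>e. 0 \<le> e \<Longrightarrow> e \<le> eps \<Longrightarrow> cu e (om_root e x) (v e) = 0"
      using that eq by (auto simp: gh_branch_def)
    have "v eps < -1/6"
    proof (rule ccontr)
      assume "\<not> v eps < -1/6"
      then obtain e where e: "0 \<le> e" "e \<le> eps" "v e = -1/6" using IVT'[of v 0 "-1/6" eps] v(1,2) x6 eps by auto
      then show False using v(3)[of e] ok[of e] by (simp add: cubic_ok_def)
    qed
    then show ?thesis using root(5)[of eps] v(3)[of eps] eps by (simp add: g_def)
  qed
  have W1gh: "W1_gh eps x = g eps" unfolding W1_gh_def by (rule the_equality) (use gh gh_unique in blast)+
  obtain r2 r3 where r: "1 - 2 * om_root eps x - s < r3" "r3 < 1 - 2 * om_root eps x + s" "r2 < r3" "cu eps (om_root eps x) r3 = 0"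
    and k: "cu2 eps (om_root eps x) = - cu3 eps (om_root eps x) * (g eps + r2 + r3)"
      "cu0 eps (om_root eps x) = - cu3 eps (om_root eps x) * g eps * r2 * r3"
    using root(6)[of eps] eps unfolding g_def by auto
  have pos: "0 < cu3 eps (om_root eps x)" using ok[of eps] eps by (simp add: cubic_ok_def)
  have g0: "g eps \<noteq> 0" using root(1)[of eps] eps by (simp add: g_def)
  have q: "a2 eps x / a3 eps x + W1_gh eps x = - (r2 + r3)" "4 * a0 eps x / (a3 eps x * W1_gh eps x) = - (4 * r2 * r3)"
    unfolding coeff_eq_cu om[OF eps(1) order_refl] W1gh k using pos g0 by (simp_all add: field_simps)
  have "Delta_Q eps x = (r3 - r2)^2" unfolding Delta_Q_def q by (simp add: power2_eq_square algebra_simps)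
  then have "sqrt (Delta_Q eps x) = r3 - r2" using r(3) by simp
  then have W1: "W1_rlp eps x = r3" unfolding W1_rlp_def q by simp
  show "cu eps (om_root eps x) (W1_rlp eps x) = 0" "\<bar>W1_rlp eps x - (1 - 2 * om_root eps x)\<bar> < s"
    using r by (auto simp: W1)
  show "R1_rlp eps x = cu_R eps (om_root eps x) (W1_rlp eps x)"
    unfolding R1_rlp_def cu_R_def coeff_eq_cu om[OF eps(1) order_refl] ..
qed

subsection \<open>Existence and uniqueness of RLP germs\<close>

lemma has_fps_expansion_eventually_deriv:
  fixes f :: "real \<Rightarrow> real"
  assumes f: "f has_fps_expansion F"
  shows "\<forall>\<^sub>F t in nhds 0. (f has_real_derivative deriv f t) (at t)"
    and "(f has_real_derivative fps_nth F 1) (at 0)"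
proof -
  have ev: "\<forall>\<^sub>F t in nhds 0. eval_fps F t = f t" and pos: "fps_conv_radius F > 0"
    using f by (auto simp: has_fps_expansion_def)
  have "\<forall>\<^sub>F t in nhds 0. t \<in> eball 0 (fps_conv_radius F)"
    using pos by (intro eventually_nhds_in_open) (auto simp: zero_ereal_def)
  moreover have "\<forall>\<^sub>F t in nhds 0. \<forall>\<^sub>F s in nhds t. eval_fps F s = f s"
    using ev by (simp add: eventually_eventually)
  ultimately have *: "\<forall>\<^sub>F t in nhds 0. (f has_real_derivative eval_fps (fps_deriv F) t) (at t)"
  proof eventually_elim
    case (elim t)
    have "(eval_fps F has_real_derivative eval_fps (fps_deriv F) t) (at t)"
      using elim(1) by (intro has_field_derivative_eval_fps) (simp add: in_eball_iff)
    then show ?case using DERIV_cong_ev[OF refl elim(2) refl] by simp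
  qed
  then show "\<forall>\<^sub>F t in nhds 0. (f has_real_derivative deriv f t) (at t)"
    by eventually_elim (simp add: DERIV_imp_deriv)
  have "(f has_real_derivative eval_fps (fps_deriv F) 0) (at 0)" using * by (rule eventually_nhds_x_imp_x)
  then show "(f has_real_derivative fps_nth F 1) (at 0)" by (simp add: eval_fps_at_0)
qed

lemma has_fps_expansion_at_0: "f has_fps_expansion F \<Longrightarrow> f 0 = fps_nth F 0" for f :: "real \<Rightarrow> real"
  using eventually_nhds_x_imp_x[of "\<lambda>t. eval_fps F t = f t" 0]
  by (simp add: has_fps_expansion_def eval_fps_at_0)

lemma has_fps_expansion_eq_0_iff:
  fixes f :: "real \<Rightarrow> real"
  assumes "f has_fps_expansion F"
  shows "F = 0 \<longleftrightarrow> (\<forall>\<^sub>F t in nhds 0. f t = 0)"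
proof
  assume "\<forall>\<^sub>F t in nhds 0. f t = 0"
  then have "(\<lambda>_. 0) has_fps_expansion F" using assms by (subst (asm) has_fps_expansion_cong[OF _ refl]) auto
  then show "F = 0" by (rule has_fps_expansion_0_real)
next
  assume "F = 0"
  then show "\<forall>\<^sub>F t in nhds 0. f t = 0"
    using assms by (auto simp: has_fps_expansion_def elim!: eventually_mono)
qed

text \<open>Convergence turns the formal equations of \<open>rlp_series\<close> into differential
  equations near the sonic point and back, so that all further work can use functions.\<close>

lemma rlp_equations_iff:
  fixes f h :: "real \<Rightarrow> real" and eps xs :: real
  assumes f: "f has_fps_expansion R" and h: "h has_fps_expansion V" and pos: "fps_nth R 0 > 0"
  defines "B \<equiv> \<lambda>t. B_fun eps (xs * (1 + t)) (f t) (h t)"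
  shows "B_fps eps xs R V * fps_deriv R + fps_const (2 * xs^2 * (1 - eps)) * fps_z * R * (V + fps_const eps) * (R - V) = 0 \<longleftrightarrow>
      (\<forall>\<^sub>F t in nhds 0. B t * deriv f t + 2 * xs^2 * (1 - eps) * (1 + t) * f t * (h t + eps) * (f t - h t) = 0)"
    and "B_fps eps xs R V * fps_deriv V - (1 - 3 * V) * B_fps eps xs R V * inverse fps_z
       - fps_const (2 * xs^2 * (1 + eps)) * fps_z * V * (V + fps_const eps) * (R - V) = 0 \<longleftrightarrow>
      (\<forall>\<^sub>F t in nhds 0. B t * deriv h t - (1 - 3 * h t) * B t * inverse (1 + t)
         - 2 * xs^2 * (1 + eps) * (1 + t) * h t * (h t + eps) * (f t - h t) = 0)"
proof -
  have z: "(\<lambda>t. 1 + t) has_fps_expansion fps_z" unfolding fps_z_def by (intro fps_expansion_intros)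
  have iz: "(\<lambda>t. inverse (1 + t)) has_fps_expansion inverse fps_z"
    by (intro fps_expansion_intros z) (simp add: fps_z_def)
  have B: "B has_fps_expansion B_fps eps xs R V"
  proof -
    have "(\<lambda>t. f t powr (- eta eps) - ((h t + eps)^2 - eps * (h t - 1)^2 + 4 * eps * f t * h t) * xs^2 * (1 + t)^2)
        has_fps_expansion B_fps eps xs R V"
      unfolding B_fps_def by (intro fps_expansion_intros has_fps_expansion_powr f h pos z)
    then show ?thesis by (simp add: B_def B_fun_def power_mult_distrib mult.assoc)
  qed
  show "B_fps eps xs R V * fps_deriv R + fps_const (2 * xs^2 * (1 - eps)) * fps_z * R * (V + fps_const eps) * (R - V) = 0 \<longleftrightarrow>
      (\<forall>\<^sub>F t in nhds 0. B t * deriv f t + 2 * xs^2 * (1 - eps) * (1 + t) * f t * (h t + eps) * (f t - h t) = 0)"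
    by (rule has_fps_expansion_eq_0_iff) (intro fps_expansion_intros B f h z)
  show "B_fps eps xs R V * fps_deriv V - (1 - 3 * V) * B_fps eps xs R V * inverse fps_z
       - fps_const (2 * xs^2 * (1 + eps)) * fps_z * V * (V + fps_const eps) * (R - V) = 0 \<longleftrightarrow>
      (\<forall>\<^sub>F t in nhds 0. B t * deriv h t - (1 - 3 * h t) * B t * inverse (1 + t)
         - 2 * xs^2 * (1 + eps) * (1 + t) * h t * (h t + eps) * (f t - h t) = 0)"
    by (rule has_fps_expansion_eq_0_iff) (intro fps_expansion_intros B f h z iz)
qed

text \<open>The sonic equation says that w powr (- eta e) is x^2 times \<open>son_H0\<close>. This
  is why B / x^2 is polynomial in the blown-up unknowns.\<close>

lemma om_G_powr:
  assumes "om_G e w = 1 / x^2" "0 < w" "0 < x" "0 < D"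
  shows "D powr (- eta e) = x^2 * (son_H0 e w * (D / w) powr (- eta e))"
proof -
  have "x^2 * son_H0 e w * w powr (eta e) = 1" using assms by (simp add: om_G_def field_simps)
  then have "w powr (- eta e) = x^2 * son_H0 e w" using assms by (simp add: powr_minus field_simps)
  moreover have "D powr (- eta e) = w powr (- eta e) * (D / w) powr (- eta e)"
    using assms by (simp add: powr_mult[symmetric])
  ultimately show ?thesis by simp
qed

context sonic
begin

definition slopes_ok :: "real \<Rightarrow> real \<Rightarrow> real \<Rightarrow> bool" where
  "slopes_ok e w X \<longleftrightarrow> cu e w X = 0 \<and> cu_h e w + cu_b e w * X \<noteq> 0 \<and> \<bar>X - (1 - 2 * w)\<bar> \<le> \<kappa> * r / 2 \<and>
     \<bar>cu_R e w X + w\<bar> \<le> \<kappa> * r / 2 \<and> eta e * \<bar>cu_R e w X\<bar> / w \<le> \<kappa> * r"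

text \<open>The value of (p, u, g) at t = 0 that belongs to a root X of the cubic: p = R_1 + W_1, u
  = W_1, and g is the derivative of (R / w) powr (- eta e).\<close>

definition slope_var :: "real \<Rightarrow> real \<Rightarrow> real \<Rightarrow> son_var \<Rightarrow> real" where
  "slope_var e w X i = (case i of VP \<Rightarrow> cu_R e w X + X | VU \<Rightarrow> X | VG \<Rightarrow> - eta e * cu_R e w X / w)"

lemma slope_var_ball:
  assumes ok: "slopes_ok e w X" and p: "par e w"
  shows "\<bar>slope_var e w X i - son_c w i\<bar> \<le> son_k \<kappa> i * r"
proof -
  have "\<kappa> * r / 2 \<le> r" using \<kappa> r mult_right_mono[of \<kappa> 1 r] by simp
  moreover have "0 < w" "0 \<le> eta e" using p e0 by (auto intro!: eta_nonneg)
  moreover have "\<bar>cu_R e w X + X - (1 - 3 * w)\<bar> \<le> \<kappa> * r"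
    using ok unfolding slopes_ok_def by linarith
  ultimately show ?thesis using ok unfolding slopes_ok_def
    by (cases i) (auto simp: slope_var_def son_c_def son_k_def abs_mult abs_divide)
qed

text \<open>The slopes given by the cubic form a fixed point of the equation at t = 0 and lie in the
  ball, so the constructed solution has the slopes prescribed for RLP type.\<close>

lemma sol_at_0:
  assumes ok: "slopes_ok e w X" and p: "par e w"
  shows "sol e w i 0 = slope_var e w X i"
proof (rule fixed_point_unique[OF p])
  have w: "w > 0" and e1: "1 - e > 0" using p e0 by auto
  show "\<bar>slope_var e w X j - son_c w j\<bar> \<le> son_k \<kappa> j * (2 * r)" for j
    using slope_var_ball[OF assms, of j] mult_pos_pos[OF son_k_pos[of j] r(1)] by simp
  show "\<bar>sol e w j 0 - son_c w j\<bar> \<le> son_k \<kappa> j * (2 * r)" for j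
    using sol_props(1)[OF p, of 0 j] \<rho> mult_pos_pos[OF son_k_pos[of j] r(1)] by simp
  show "son_N e w i 0 (\<lambda>j. of_real (sol e w j 0)) = of_real (sol e w i 0)" for i
    using sol_props(3)[OF p, of 0 i] \<rho> by simp
  define Rx where "Rx = cu_R e w X"
  define K where "K = cu_b e w * Rx + cu_d e w * X + son_H0 e w"
  have ball: "son_ball \<kappa> w r (\<lambda>j. complex_of_real (slope_var e w X j))"
    by (rule son_ballI_real[OF slope_var_ball[OF assms]])
  \<comment> \<open>K is the bracket in \<open>cu_slopes\<close>; x_*^2 times this value is the
    z-derivative of B at the sonic point, so K \<noteq> 0 says that B has a simple zero.\<close>
  have b: "son_b e w 0 (Rx + X) X (- eta e * Rx / w) = - 2 * K"
    using w e1 unfolding K_def son_b_def son_S_def cu_b_def cu_d_def eta_def by (simp add: field_simps)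
  have K0: "K \<noteq> 0"
    using son_b_nz[OF p, of 0 "\<lambda>j. of_real (slope_var e w X j)"] son_ball_mono[OF ball] \<rho> b
      son_of_real(1)[of e w 0 "Rx + X" X "- eta e * Rx / w"]
    by (auto simp: slope_var_def Rx_def[symmetric])
  have q: "son_q e w 0 (Rx + X) X (- eta e * Rx / w) = - (Rx - X) / (2 * K)"
    unfolding son_q_def b using K0 by (simp add: field_simps)
  have S: "K * Rx = (1 - e) * cu_a e w * (Rx - X)" "- K * (X + cu_c w) = (1 + e) * cu_a e w * (Rx - X)"
    using cu_slopes[of e w X] ok unfolding slopes_ok_def K_def Rx_def by blast+
  have NU: "son_NU e w 0 (Rx + X) X (- eta e * Rx / w) = X"
  proof -
    have "son_NU e w 0 (Rx + X) X (- eta e * Rx / w) = - cu_c w - (1 + e) * cu_a e w * (Rx - X) / K"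
      unfolding son_NU_def q using K0 by (simp add: cu_c_def cu_a_def field_simps)
    then show ?thesis unfolding S(2)[symmetric] using K0 by (simp add: field_simps)
  qed
  have NP: "son_NP e w 0 (Rx + X) X (- eta e * Rx / w) = Rx + X"
  proof -
    have "son_NP e w 0 (Rx + X) X (- eta e * Rx / w) = - cu_c w - ((1 + e) * cu_a e w * (Rx - X) - (1 - e) * cu_a e w * (Rx - X)) / K"
      unfolding son_NP_def q using K0 by (simp add: cu_c_def cu_a_def field_simps)
    also have "(1 + e) * cu_a e w * (Rx - X) - (1 - e) * cu_a e w * (Rx - X) = K * (- (X + cu_c w) - Rx)"
      unfolding S[symmetric] by (simp add: algebra_simps)
    finally show ?thesis using K0 by simp
  qed
  have NG: "son_NG e w 0 (Rx + X) X (- eta e * Rx / w) = - eta e * Rx / w"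
  proof -
    have "Rx = (1 - e) * cu_a e w * (Rx - X) / K" unfolding S(1)[symmetric] using K0 by simp
    then have "- eta e * Rx / w = - (eta e * (1 - e)) * cu_a e w * (Rx - X) / (K * w)"
      by (metis (no_types, lifting) divide_divide_eq_left minus_mult_left mult.assoc times_divide_eq_right)
    also have "eta e * (1 - e) = 2 * e" using e1 by (simp add: eta_def)
    also have "- (2 * e) * cu_a e w * (Rx - X) / (K * w) = son_NG e w 0 (Rx + X) X (- eta e * Rx / w)"
      unfolding son_NG_def q using K0 w by (simp add: cu_a_def field_simps)
    finally show ?thesis by simp
  qed
  show "son_N e w i 0 (\<lambda>j. of_real (slope_var e w X j)) = of_real (slope_var e w X i)" for i
    using son_of_real[of e w 0 "Rx + X" X "- eta e * Rx / w"] NU NP NG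
    by (cases i) (simp_all add: son_N_def slope_var_def Rx_def[symmetric])
qed

lemma sR_fps: "par e w \<Longrightarrow> \<bar>t\<bar> < \<rho> \<Longrightarrow> \<exists>F. (\<lambda>s. sR e w (t + s)) has_fps_expansion F"
  and sW_fps: "par e w \<Longrightarrow> \<bar>t\<bar> < \<rho> \<Longrightarrow> \<exists>F. (\<lambda>s. sW e w (t + s)) has_fps_expansion F"
proof -
  assume p: "par e w" and t: "\<bar>t\<bar> < \<rho>"
  obtain F where F: "\<And>i. (\<lambda>s. sol e w i (t + s)) has_fps_expansion F i" using sol_fps[OF p t] by metis
  have "(\<lambda>s. w + (t + s) * (sol e w VP (t + s) - sol e w VU (t + s))) has_fps_expansion
      fps_const w + (fps_const t + fps_X) * (F VP - F VU)"
    "(\<lambda>s. w + (t + s) * sol e w VU (t + s)) has_fps_expansion fps_const w + (fps_const t + fps_X) * F VU"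
    by (intro fps_expansion_intros F)+
  then show "\<exists>F. (\<lambda>s. sR e w (t + s)) has_fps_expansion F" "\<exists>F. (\<lambda>s. sW e w (t + s)) has_fps_expansion F"
    unfolding sR_def sW_def by blast+
qed

lemma B_fun_eq:
  assumes p: "par e w" and t: "\<bar>t\<bar> < \<rho>" and G: "om_G e w = 1 / x^2" and x: "0 < x"
  shows "B_fun e (x * (1 + t)) (sR e w t) (sW e w t) = x^2 * (t * sb e w t)"
proof -
  have "sR e w t powr (- eta e) = x^2 * (son_H0 e w * sE e w t)"
    unfolding sE_eq[OF p t] using G x p sRW_bounds(2)[OF p t] by (intro om_G_powr) auto
  then show ?thesis unfolding B_fun_def sb_eq[OF p t] EE_S_def power_mult_distrib by (simp add: algebra_simps)
qed

lemma germ_exists: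
  assumes p: "par e w" and G: "om_G e w = 1 / x^2" and x: "0 < x" and om: "omega e x = w"
    and slopes: "sol e w VU 0 = W1_rlp e x" "sol e w VP 0 = R1_rlp e x + W1_rlp e x"
    and D: "\<And>t. \<bar>t\<bar> < \<rho> \<Longrightarrow> D (x * (1 + t)) = sR e w t" and W: "\<And>t. \<bar>t\<bar> < \<rho> \<Longrightarrow> W (x * (1 + t)) = sW e w t"
  shows "rlp_germ e x D W"
proof -
  have \<rho>0: "\<bar>0\<bar> < \<rho>" using \<rho> by simp
  obtain R V where R: "sR e w has_fps_expansion R" and V: "sW e w has_fps_expansion V"
    using sR_fps[OF p \<rho>0] sW_fps[OF p \<rho>0] by auto
  have ev: "\<forall>\<^sub>F t in nhds 0. \<bar>t\<bar> < \<rho>"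
    using eventually_nhds_in_open[of "ball 0 \<rho>" "0::real"] \<rho> by (auto elim!: eventually_mono)
  have R0: "fps_nth R 0 = w" "fps_nth V 0 = w"
    using has_fps_expansion_at_0[OF R] has_fps_expansion_at_0[OF V] by (simp_all add: sR_def sW_def)
  have "(sR e w has_real_derivative R1_rlp e x) (at 0)" "(sW e w has_real_derivative W1_rlp e x) (at 0)"
    unfolding sR_def sW_def using sol_deriv[OF p \<rho>0] slopes by (auto intro!: derivative_eq_intros)
  then have R1: "fps_nth R 1 = R1_rlp e x" "fps_nth V 1 = W1_rlp e x"
    using has_fps_expansion_eventually_deriv(2)[OF R] has_fps_expansion_eventually_deriv(2)[OF V]
    by (auto dest: DERIV_unique)
  have w: "0 < w" using p by simp
  have "rlp_series e x R V" unfolding rlp_series_def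
  proof (intro conjI)
    show "B_fps e x R V * fps_deriv R + fps_const (2 * x^2 * (1 - e)) * fps_z * R * (V + fps_const e) * (R - V) = 0"
      unfolding rlp_equations_iff(1)[OF R V w[folded R0(1)]] using ev
    proof eventually_elim
      case (elim t)
      have d: "deriv (sR e w) t = - 2 * (1 - e) * (1 + t) * sR e w t * (sW e w t + e) * sq e w t"
        by (rule DERIV_imp_deriv[OF sR_deriv[OF p elim]])
      have "sR e w t - sW e w t = t * (sb e w t * sq e w t)" unfolding sR_minus_sW[OF p elim] sq_eq[OF p elim] ..
      then show ?case unfolding d B_fun_eq[OF p elim G x] by (simp add: algebra_simps)
    qed
    show "B_fps e x R V * fps_deriv V - (1 - 3 * V) * B_fps e x R V * inverse fps_z
       - fps_const (2 * x^2 * (1 + e)) * fps_z * V * (V + fps_const e) * (R - V) = 0"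
      unfolding rlp_equations_iff(2)[OF R V w[folded R0(1)]] using ev
    proof eventually_elim
      case (elim t)
      have d: "deriv (sW e w) t = (1 - 3 * sW e w t) / (1 + t) + 2 * (1 + e) * (1 + t) * sW e w t * (sW e w t + e) * sq e w t"
        by (rule DERIV_imp_deriv[OF sW_deriv[OF p elim]])
      have "sR e w t - sW e w t = t * (sb e w t * sq e w t)" unfolding sR_minus_sW[OF p elim] sq_eq[OF p elim] ..
      then show ?case unfolding d B_fun_eq[OF p elim G x] divide_inverse by (simp add: algebra_simps)
    qed
  qed (use R0 R1 om in auto)
  moreover have "(\<lambda>t. D (x * (1 + t))) has_fps_expansion R"
    by (rule has_fps_expansion_cong[THEN iffD2, OF _ refl R]) (use ev in \<open>eventually_elim, auto intro: D\<close>)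
  moreover have "(\<lambda>t. W (x * (1 + t))) has_fps_expansion V"
    by (rule has_fps_expansion_cong[THEN iffD2, OF _ refl V]) (use ev in \<open>eventually_elim, auto intro: W\<close>)
  ultimately show ?thesis unfolding rlp_germ_def by blast
qed

text \<open>The difference quotients of any RLP germ solve the blown-up system and tend to
  \<open>slope_var\<close>, so near t = 0 they lie in the ball of radius 2 r, where
  \<open>sol_unique\<close> applies. Here E is the power itself, and its equation is
  derived.\<close>

lemma germ_unique:
  assumes p: "par e w" and G: "om_G e w = 1 / x^2" and x: "0 < x" and om: "omega e x = w"
    and ok: "slopes_ok e w (W1_rlp e x)" and R1: "R1_rlp e x = cu_R e w (W1_rlp e x)"
    and germ: "rlp_germ e x D W"
  shows "\<exists>T>0. T \<le> \<rho> \<and> (\<forall>t. - T < t \<longrightarrow> t < 0 \<longrightarrow> D (x * (1 + t)) = sR e w t \<and> W (x * (1 + t)) = sW e w t)"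
proof -
  define f h where "f = (\<lambda>t. D (x * (1 + t)))" and "h = (\<lambda>t. W (x * (1 + t)))"
  obtain R V where RV: "rlp_series e x R V" and f: "f has_fps_expansion R" and h: "h has_fps_expansion V"
    using germ unfolding rlp_germ_def f_def h_def by blast
  have w: "0 < w" and e1: "0 < 1 - e" using p e0 by auto
  have R0: "fps_nth R 0 = w" "fps_nth V 0 = w" "fps_nth R 1 = R1_rlp e x" "fps_nth V 1 = W1_rlp e x"
    using RV om by (simp_all add: rlp_series_def)
  have pos: "0 < fps_nth R 0" using w R0 by simp
  have f0: "f 0 = w" "h 0 = w" using has_fps_expansion_at_0[OF f] has_fps_expansion_at_0[OF h] R0 by auto
  note df = has_fps_expansion_eventually_deriv[OF f] and dh = has_fps_expansion_eventually_deriv[OF h]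
  define E where "E = (\<lambda>t. (f t / w) powr (- eta e))"
  define y where "y i t = (case i of VP \<Rightarrow> (f t - w) / t + (h t - w) / t | VU \<Rightarrow> (h t - w) / t | VG \<Rightarrow> (E t - 1) / t)" for i t
  define E' where "E' = (\<lambda>t. - eta e * E t * deriv f t / f t)"
  define y' where "y' i t = (case i of VP \<Rightarrow> (deriv f t + deriv h t - y VP t) / t | VU \<Rightarrow> (deriv h t - y VU t) / t | VG \<Rightarrow> (E' t - y VG t) / t)" for i t
  have dE: "(E has_real_derivative - eta e * E t * d / f t) (at t)" if "f t > 0" "(f has_real_derivative d) (at t)" for t d
  proof -
    have "(E has_real_derivative (- eta e) * (f t / w) powr (- eta e - 1) * (d / w)) (at t)"
      unfolding E_def using that w by (auto intro!: derivative_eq_intros simp: powr_diff field_simps)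
    moreover have "(f t / w) powr (- eta e - 1) = E t / (f t / w)"
      unfolding E_def using that w powr_diff[of "f t / w" "- eta e" 1] powr_one[of "f t / w"] by simp
    ultimately show ?thesis using w that by (simp add: field_simps)
  qed
  have lim: "(\<lambda>t. y i t) \<midarrow>0\<rightarrow> slope_var e w (W1_rlp e x) i" for i
  proof -
    have lf: "(\<lambda>t. (f t - w) / t) \<midarrow>0\<rightarrow> R1_rlp e x"
      using df(2) unfolding has_field_derivative_iff f0 R0 by simp
    have lh: "(\<lambda>t. (h t - w) / t) \<midarrow>0\<rightarrow> W1_rlp e x"
      using dh(2) unfolding has_field_derivative_iff f0 R0 by simp
    have "E 0 = 1" using w by (simp add: E_def f0)
    then have lE: "(\<lambda>t. (E t - 1) / t) \<midarrow>0\<rightarrow> - eta e * R1_rlp e x / w"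
      using dE[of 0 "R1_rlp e x"] df(2) w unfolding R0 by (simp add: has_field_derivative_iff f0)
    show ?thesis using lh lE tendsto_add[OF lf lh] R1 by (cases i) (simp_all add: y_def slope_var_def)
  qed
  have inball: "\<forall>\<^sub>F t in at 0. \<bar>y i t - son_c w i\<bar> \<le> son_k \<kappa> i * (2 * r)" for i
  proof -
    have "(\<lambda>t. \<bar>y i t - son_c w i\<bar>) \<midarrow>0\<rightarrow> \<bar>slope_var e w (W1_rlp e x) i - son_c w i\<bar>"
      by (intro tendsto_intros lim)
    moreover have "\<bar>slope_var e w (W1_rlp e x) i - son_c w i\<bar> < son_k \<kappa> i * (2 * r)"
      using slope_var_ball[OF ok p, of i] mult_pos_pos[OF son_k_pos[of i] r(1)] by simp
    ultimately have "\<forall>\<^sub>F t in at 0. \<bar>y i t - son_c w i\<bar> < son_k \<kappa> i * (2 * r)"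
      by (rule order_tendstoD)
    then show ?thesis by eventually_elim simp
  qed
  have fpos: "\<forall>\<^sub>F t in nhds 0. 0 < f t"
  proof -
    have "isCont f 0" using df(2) by (rule DERIV_isCont)
    then show ?thesis using isCont_eventually_less(2)[where f = f and x = 0 and c = 0] w f0 by simp
  qed
  have eq1: "\<forall>\<^sub>F t in nhds 0. B_fun e (x * (1 + t)) (f t) (h t) * deriv f t + 2 * x^2 * (1 - e) * (1 + t) * f t * (h t + e) * (f t - h t) = 0"
    and eq2: "\<forall>\<^sub>F t in nhds 0. B_fun e (x * (1 + t)) (f t) (h t) * deriv h t - (1 - 3 * h t) * B_fun e (x * (1 + t)) (f t) (h t) * inverse (1 + t)
         - 2 * x^2 * (1 + e) * (1 + t) * h t * (h t + e) * (f t - h t) = 0"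
    using RV rlp_equations_iff[OF f h pos, of e x] unfolding rlp_series_def by blast+
  have at_0: "\<forall>\<^sub>F t in nhds 0. P t \<Longrightarrow> \<forall>\<^sub>F t in at 0. P t" for P :: "real \<Rightarrow> bool"
    by (simp add: eventually_nhds_conv_at)
  define good where "good t \<longleftrightarrow> 0 < f t \<and> (f has_real_derivative deriv f t) (at t) \<and> (h has_real_derivative deriv h t) (at t) \<and>
      B_fun e (x * (1 + t)) (f t) (h t) * deriv f t + 2 * x^2 * (1 - e) * (1 + t) * f t * (h t + e) * (f t - h t) = 0 \<and>
      B_fun e (x * (1 + t)) (f t) (h t) * deriv h t - (1 - 3 * h t) * B_fun e (x * (1 + t)) (f t) (h t) * inverse (1 + t)
         - 2 * x^2 * (1 + e) * (1 + t) * h t * (h t + e) * (f t - h t) = 0 \<and>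
      \<bar>y VP t - son_c w VP\<bar> \<le> son_k \<kappa> VP * (2 * r) \<and> \<bar>y VU t - son_c w VU\<bar> \<le> son_k \<kappa> VU * (2 * r) \<and>
      \<bar>y VG t - son_c w VG\<bar> \<le> son_k \<kappa> VG * (2 * r)" for t
  have "\<forall>\<^sub>F t in at 0. t \<noteq> 0 \<and> good t" unfolding good_def
    by (intro eventually_conj at_0[OF fpos] at_0[OF df(1)] at_0[OF dh(1)] at_0[OF eq1] at_0[OF eq2] inball)
      (simp add: eventually_at_filter)
  then obtain T0 where T0: "0 < T0" and near0: "\<And>t. t \<noteq> 0 \<Longrightarrow> \<bar>t\<bar> < T0 \<Longrightarrow> good t"
    unfolding eventually_at by (auto simp: dist_real_def)
  define T where "T = min T0 \<rho>"
  have T: "0 < T" "T \<le> \<rho>" using T0 \<rho> by (auto simp: T_def)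
  have main: "(y i has_real_derivative y' i t) (at t) \<and> of_real (t * y' i t + y i t) = son_N e w i (of_real t) (\<lambda>j. of_real (y j t)) \<and>
      \<bar>y i t - son_c w i\<bar> \<le> son_k \<kappa> i * (2 * r)" if t: "- T < t" "t < 0" for i t
  proof (intro conjI)
    have t0: "t \<noteq> 0" "\<bar>t\<bar> < T0" "\<bar>t\<bar> < \<rho>" using t by (auto simp: T_def)
    note N = near0[OF t0(1,2), unfolded good_def]
    have ft: "0 < f t" and Df: "(f has_real_derivative deriv f t) (at t)" and Dh: "(h has_real_derivative deriv h t) (at t)"
      using N by auto
    have DE: "(E has_real_derivative E' t) (at t)" using dE[OF ft Df] by (simp add: E'_def)
    show yb: "\<bar>y i t - son_c w i\<bar> \<le> son_k \<kappa> i * (2 * r)" for i using N by (cases i) auto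
    show "(y i has_real_derivative y' i t) (at t)" using t0(1) Df Dh DE unfolding y_def y'_def
      by (cases i) (auto intro!: derivative_eq_intros simp: field_simps)
    define b where "b = son_b e w t (y VP t) (y VU t) (y VG t)"
    define q where "q = son_q e w t (y VP t) (y VU t) (y VG t)"
    have eqs: "f t = w + t * (y VP t - y VU t)" "h t = w + t * y VU t" "E t = 1 + t * y VG t"
      using t0(1) by (simp_all add: y_def)
    have b0: "b \<noteq> 0"
      using son_b_nz[OF p, of "of_real t" "\<lambda>j. of_real (y j t)"] son_ballI_real[OF yb] t0(3)
      by (auto simp: b_def son_of_real)
    have bq: "b * q = y VP t - 2 * y VU t" using b0 by (simp add: q_def son_q_def b_def[symmetric])
    have fh: "f t - h t = t * (b * q)" unfolding bq eqs by (simp add: algebra_simps)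
    have B: "B_fun e (x * (1 + t)) (f t) (h t) = x^2 * (t * b)"
    proof -
      have "f t powr (- eta e) = x^2 * (son_H0 e w * E t)" unfolding E_def by (intro om_G_powr G w x ft)
      then show ?thesis
        unfolding B_fun_def b_def son_b_eq[OF eqs] EE_S_def power_mult_distrib by (simp add: algebra_simps)
    qed
    have z: "1 + t \<noteq> 0" using t0(3) \<rho> by auto
    define K where "K = x^2 * (t * b)"
    have K: "K \<noteq> 0" using x t0 b0 by (simp add: K_def)
    have "K * (deriv f t + 2 * (1 - e) * (1 + t) * f t * (h t + e) * q) = 0"
      using N unfolding B fh K_def by (simp add: algebra_simps)
    then have "deriv f t + 2 * (1 - e) * (1 + t) * f t * (h t + e) * q = 0" using K by (metis mult_eq_0_iff)
    then have f': "deriv f t = - 2 * (1 - e) * (1 + t) * f t * (h t + e) * q" by (simp add: algebra_simps)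
    have "K * (deriv h t - (1 - 3 * h t) * inverse (1 + t) - 2 * (1 + e) * (1 + t) * h t * (h t + e) * q) = 0"
      using N unfolding B fh K_def by (simp add: algebra_simps)
    then have "deriv h t - (1 - 3 * h t) * inverse (1 + t) - 2 * (1 + e) * (1 + t) * h t * (h t + e) * q = 0"
      using K by (metis mult_eq_0_iff)
    then have h': "deriv h t = (1 - 3 * h t) / (1 + t) + 2 * (1 + e) * (1 + t) * h t * (h t + e) * q"
      by (simp add: divide_inverse algebra_simps)
    have "E' t = - eta e * E t * (- 2 * (1 - e) * (1 + t) * (h t + e) * q)" unfolding E'_def f' using ft by simp
    also have "\<dots> = (eta e * (1 - e)) * 2 * (1 + t) * E t * (h t + e) * q" by (simp add: algebra_simps)
    also have "eta e * (1 - e) = 2 * e" using e1 by (simp add: eta_def)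
    finally have E'': "E' t = 4 * e * (1 + t) * E t * (h t + e) * q" by simp
    have "t * y' VP t + y VP t = son_NP e w t (y VP t) (y VU t) (y VG t)"
      "t * y' VU t + y VU t = son_NU e w t (y VP t) (y VU t) (y VG t)"
      "t * y' VG t + y VG t = son_NG e w t (y VP t) (y VU t) (y VG t)"
    proof -
      have ty: "t * y' VP t + y VP t = deriv f t + deriv h t" "t * y' VU t + y VU t = deriv h t" "t * y' VG t + y VG t = E' t"
        using t0(1) by (simp_all add: y'_def)
      show "t * y' VP t + y VP t = son_NP e w t (y VP t) (y VU t) (y VG t)"
        unfolding ty f' h' son_NP_def q_def[symmetric] eqs[symmetric] by (simp add: algebra_simps)
      show "t * y' VU t + y VU t = son_NU e w t (y VP t) (y VU t) (y VG t)"
        unfolding ty h' son_NU_def q_def[symmetric] eqs[symmetric] ..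
      show "t * y' VG t + y VG t = son_NG e w t (y VP t) (y VU t) (y VG t)"
        unfolding ty E'' son_NG_def q_def[symmetric] eqs[symmetric] ..
    qed
    then show "of_real (t * y' i t + y i t) = son_N e w i (of_real t) (\<lambda>j. of_real (y j t))"
      by (cases i) (simp_all add: son_N_def son_of_real)
  qed
  have "f t = sR e w t \<and> h t = sW e w t" if t: "- T < t" "t < 0" for t
  proof -
    have "y i t = sol e w i t" for i by (rule sol_unique[OF p T, of y y']) (use main t in auto)
    moreover have "f t = w + t * (y VP t - y VU t)" "h t = w + t * y VU t" using t by (simp_all add: y_def)
    ultimately show ?thesis by (simp add: sR_def sW_def)
  qed
  then show ?thesis using T unfolding f_def h_def by blast
qed

end

subsection \<open>Ordinary differential equations with Lipschitz right-hand side\<close>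

lemma DERIV_nonneg_imp_le:
  fixes f :: "real \<Rightarrow> real"
  assumes "a \<le> b" and cont: "continuous_on {a..b} f"
    and der: "\<And>x. a < x \<Longrightarrow> x < b \<Longrightarrow> \<exists>d\<ge>0. (f has_real_derivative d) (at x)"
  shows "f a \<le> f b"
proof (cases "a = b")
  case False
  then have "a < b" using assms by simp
  have "\<exists>l z. a < z \<and> z < b \<and> DERIV f z :> l \<and> f b - f a = (b - a) * l"
    using der by (intro MVT \<open>a < b\<close> cont) (auto simp: real_differentiable_def)
  then obtain l z where z: "a < z" "z < b" "DERIV f z :> l" "f b - f a = (b - a) * l" by blast
  then have "0 \<le> l" using DERIV_unique der by blast
  then show ?thesis using z(4) mult_nonneg_nonneg[of "b - a" l] \<open>a < b\<close> by linarith
qed simp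

definition ode_on :: "(real \<Rightarrow> 'a \<Rightarrow> 'a::real_normed_vector) \<Rightarrow> real set \<Rightarrow> (real \<Rightarrow> 'a) \<Rightarrow> bool" where
  "ode_on f I y \<longleftrightarrow> (\<forall>x\<in>I. (y has_vector_derivative f x (y x)) (at x within I))"

lemma ode_on_subset: "ode_on f I y \<Longrightarrow> J \<subseteq> I \<Longrightarrow> ode_on f J y"
  unfolding ode_on_def by (meson has_vector_derivative_within_subset subsetD)

lemma ode_on_continuous: "ode_on f I y \<Longrightarrow> continuous_on I y"
  unfolding ode_on_def by (rule continuous_on_vector_derivative) blast

lemma ode_on_interior:
  "ode_on f {a..b} y \<Longrightarrow> a < x \<Longrightarrow> x < b \<Longrightarrow> (y has_vector_derivative f x (y x)) (at x)"
  unfolding ode_on_def by (metis at_within_Icc_at atLeastAtMost_iff less_imp_le)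

text \<open>The function |y1 - y2|^2 exp (2 L x) has nonnegative derivative. The estimate runs to
  the left because solutions are launched at the right end.\<close>

lemma gronwall_backward:
  fixes y1 y2 :: "real \<Rightarrow> 'a::real_inner"
  assumes cont: "continuous_on {a..b} y1" "continuous_on {a..b} y2"
    and der: "\<And>x. a < x \<Longrightarrow> x < b \<Longrightarrow> (y1 has_vector_derivative d1 x) (at x)"
      "\<And>x. a < x \<Longrightarrow> x < b \<Longrightarrow> (y2 has_vector_derivative d2 x) (at x)"
    and lip: "\<And>x. a < x \<Longrightarrow> x < b \<Longrightarrow> norm (d1 x - d2 x) \<le> L * norm (y1 x - y2 x)"
    and x: "a \<le> x" "x \<le> b"
  shows "norm (y1 x - y2 x) \<le> norm (y1 b - y2 b) * exp (L * (b - x))"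
proof -
  define v where "v = (\<lambda>x. y1 x - y2 x)"
  define \<phi> where "\<phi> = (\<lambda>x. (v x \<bullet> v x) * exp (2 * L * x))"
  have "\<phi> x \<le> \<phi> b"
  proof (rule DERIV_nonneg_imp_le[where f = \<phi> and a = x and b = b])
    show "continuous_on {x..b} \<phi>" unfolding \<phi>_def v_def using x
      by (intro continuous_intros continuous_on_subset[OF cont(1)] continuous_on_subset[OF cont(2)]) auto
    fix s assume s: "x < s" "s < b"
    have "(v has_vector_derivative d1 s - d2 s) (at s)"
      unfolding v_def using s x by (intro has_vector_derivative_diff der) auto
    then have "(v has_derivative (\<lambda>h. h *\<^sub>R (d1 s - d2 s))) (at s)"
      by (simp add: has_vector_derivative_def)
    then have "((\<lambda>s. v s \<bullet> v s) has_derivative (\<lambda>h. v s \<bullet> (h *\<^sub>R (d1 s - d2 s)) + (h *\<^sub>R (d1 s - d2 s)) \<bullet> v s)) (at s)"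
      by (intro has_derivative_inner)
    then have "((\<lambda>s. v s \<bullet> v s) has_real_derivative 2 * (v s \<bullet> (d1 s - d2 s))) (at s)"
      unfolding has_field_derivative_def by (rule has_derivative_eq_rhs) (auto simp: inner_commute algebra_simps)
    moreover have "((\<lambda>s. exp (2 * L * s)) has_real_derivative exp (2 * L * s) * (2 * L)) (at s)"
      by (auto intro!: derivative_eq_intros)
    ultimately have "(\<phi> has_real_derivative
        2 * (v s \<bullet> (d1 s - d2 s)) * exp (2 * L * s) + exp (2 * L * s) * (2 * L) * (v s \<bullet> v s)) (at s)"
      unfolding \<phi>_def by (rule DERIV_mult)
    moreover have "- (v s \<bullet> (d1 s - d2 s)) \<le> L * (v s \<bullet> v s)"
    proof -
      have "- (v s \<bullet> (d1 s - d2 s)) \<le> norm (v s) * norm (d1 s - d2 s)"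
        using Cauchy_Schwarz_ineq2[of "v s" "d1 s - d2 s"] by linarith
      also have "\<dots> \<le> norm (v s) * (L * norm (v s))"
        using lip[of s] s x unfolding v_def by (intro mult_left_mono) auto
      finally show ?thesis by (simp add: power2_norm_eq_inner[symmetric] power2_eq_square mult_ac)
    qed
    then have "0 \<le> (2 * (v s \<bullet> (d1 s - d2 s)) + 2 * L * (v s \<bullet> v s)) * exp (2 * L * s)"
      by (intro mult_nonneg_nonneg) auto
    then have "0 \<le> 2 * (v s \<bullet> (d1 s - d2 s)) * exp (2 * L * s) + exp (2 * L * s) * (2 * L) * (v s \<bullet> v s)"
      by (simp add: algebra_simps)
    ultimately show "\<exists>d\<ge>0. (\<phi> has_real_derivative d) (at s)" by blast
  qed (use x in auto)
  then have "(norm (v x))^2 * exp (2 * L * x) \<le> (norm (v b))^2 * exp (2 * L * b)"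
    by (simp add: \<phi>_def power2_norm_eq_inner)
  then have "(norm (v x))^2 * exp (2 * L * x) * exp (- (2 * L * x)) \<le> (norm (v b))^2 * exp (2 * L * b) * exp (- (2 * L * x))"
    by (rule mult_right_mono) simp
  also have "\<dots> = (norm (v b))^2 * (exp (L * (b - x)))^2"
    by (simp add: exp_add[symmetric] power2_eq_square algebra_simps)
  finally have "(norm (v x))^2 \<le> (norm (v b) * exp (L * (b - x)))^2"
    by (simp add: power_mult_distrib mult.assoc exp_add[symmetric])
  then have "norm (v x) \<le> norm (v b) * exp (L * (b - x))" by (rule power2_le_imp_le) auto
  then show ?thesis by (simp add: v_def)
qed

text \<open>In the weight exp (2 L (b - x)) the Picard map halves distances, so the iteration
  converges on the whole interval at once.\<close>

lemma ode_global:
  fixes f :: "real \<Rightarrow> 'a \<Rightarrow> 'a::euclidean_space"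
  assumes ab: "a \<le> b" and cont: "continuous_on ({a..b} \<times> UNIV) (\<lambda>(x, u). f x u)"
    and L: "L > 0" "\<And>x u v. x \<in> {a..b} \<Longrightarrow> norm (f x u - f x v) \<le> L * norm (u - v)"
  shows "\<exists>y. ode_on f {a..b} y \<and> y b = y0"
proof -
  define T where "T y x = y0 + (integral {a..x} (\<lambda>s. f s (y s)) - integral {a..b} (\<lambda>s. f s (y s)))" for y x
  have Tb [simp]: "T y b = y0" for y by (simp add: T_def)
  have Tder: "(T y has_vector_derivative f x (y x)) (at x within {a..b})" if "continuous_on {a..b} y" "x \<in> {a..b}" for y x
  proof -
    have "continuous_on {a..b} (\<lambda>s. (\<lambda>(x, u). f x u) (s, y s))"
      using that by (intro continuous_on_compose2[OF cont] continuous_intros) auto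
    then have "((\<lambda>x. integral {a..x} (\<lambda>s. f s (y s))) has_vector_derivative f x (y x)) (at x within {a..b})"
      using that by (intro integral_has_vector_derivative) auto
    then show ?thesis unfolding T_def by (auto intro!: derivative_eq_intros)
  qed
  have Tcont: "continuous_on {a..b} (T y)" if "continuous_on {a..b} y" for y
    by (rule continuous_on_vector_derivative[OF Tder[OF that]])
  have step: "norm (T y x - T z x) \<le> C / 2 * exp (2 * L * (b - x))"
    if y: "continuous_on {a..b} y" and z: "continuous_on {a..b} z" and "0 \<le> C" and x: "x \<in> {a..b}"
      and d: "\<And>x. x \<in> {a..b} \<Longrightarrow> norm (y x - z x) \<le> C * exp (2 * L * (b - x))" for y z C x
  proof (cases "x = b")
    case False
    define v where "v = (\<lambda>x. T y x - T z x)"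
    have "norm (v b - v x) \<le> - (C / 2 * exp (2 * L * (b - b))) - - (C / 2 * exp (2 * L * (b - x)))"
    proof (rule differentiable_bound_general[where f' = "\<lambda>x. f x (y x) - f x (z x)" and \<phi>' = "\<lambda>x. L * (C * exp (2 * L * (b - x)))"])
      show "x < b" using x False by simp
      show "continuous_on {x..b} v"
        unfolding v_def using Tcont[OF y] Tcont[OF z] x by (intro continuous_intros) (auto elim: continuous_on_subset)
      show "continuous_on {x..b} (\<lambda>x. - (C / 2 * exp (2 * L * (b - x))))" by (intro continuous_intros)
      fix s assume s: "x < s" "s < b"
      then have s': "s \<in> {a..b}" "at s within {a..b} = at s" using x by (auto intro: at_within_Icc_at)
      show "(v has_vector_derivative f s (y s) - f s (z s)) (at s)"
        unfolding v_def using Tder[OF y s'(1)] Tder[OF z s'(1)] s'(2) by (intro has_vector_derivative_diff) auto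
      show "((\<lambda>x. - (C / 2 * exp (2 * L * (b - x)))) has_vector_derivative L * (C * exp (2 * L * (b - s)))) (at s)"
        unfolding has_real_derivative_iff_has_vector_derivative[symmetric] by (auto intro!: derivative_eq_intros)
      show "norm (f s (y s) - f s (z s)) \<le> L * (C * exp (2 * L * (b - s)))"
        using L(2)[OF s'(1), of "y s" "z s"] mult_left_mono[OF d[OF s'(1)], of L] L(1) by linarith
    qed
    then show ?thesis using \<open>0 \<le> C\<close> by (simp add: v_def norm_minus_commute)
  qed (use \<open>0 \<le> C\<close> in simp)
  define Y where "Y = rec_nat (\<lambda>_. y0) (\<lambda>_. T)"
  have Y0: "Y 0 = (\<lambda>_. y0)" and YS: "Y (Suc n) = T (Y n)" for n by (simp_all add: Y_def)
  have Yc: "continuous_on {a..b} (Y n)" for n by (induction n) (auto simp: Y0 YS Tcont)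
  have "compact ((\<lambda>x. Y 1 x - Y 0 x) ` {a..b})"
    by (intro compact_continuous_image continuous_intros Yc compact_Icc)
  then obtain C where C: "\<And>x. x \<in> {a..b} \<Longrightarrow> norm (Y 1 x - Y 0 x) \<le> C"
    by (meson bounded_iff compact_imp_bounded image_eqI)
  have C0: "0 \<le> C" using C[of a] ab norm_ge_zero by (meson atLeastAtMost_iff order_refl order_trans)
  have diff: "norm (Y (Suc n) x - Y n x) \<le> C / 2 ^ n * exp (2 * L * (b - x))" if "x \<in> {a..b}" for n x using that
  proof (induction n arbitrary: x)
    case 0
    have "C * 1 \<le> C * exp (2 * L * (b - x))" using C0 L 0 by (intro mult_left_mono) auto
    then show ?case using C[OF 0] by simp
  next
    case (Suc n)
    have "norm (T (Y (Suc n)) x - T (Y n) x) \<le> C / 2 ^ n / 2 * exp (2 * L * (b - x))"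
      using Suc C0 by (intro step Yc) auto
    then show ?case by (simp add: YS[of "Suc n"] YS[of n])
  qed
  define M where "M = exp (2 * L * (b - a))"
  have M: "exp (2 * L * (b - x)) \<le> M" "0 < M" if "x \<in> {a..b}" for x using that L by (auto simp: M_def)
  have "uniformly_convergent_on {a..b} (\<lambda>n x. \<Sum>i<n. Y (Suc i) x - Y i x)"
  proof (rule Weierstrass_m_test')
    show "norm (Y (Suc n) x - Y n x) \<le> C * M * (1 / 2) ^ n" if "x \<in> {a..b}" for n x
    proof -
      have "C / 2 ^ n * exp (2 * L * (b - x)) \<le> C / 2 ^ n * M" using M(1)[OF that] C0 by (intro mult_left_mono) auto
      then show ?thesis using diff[OF that, of n] by (simp add: power_one_over field_simps)
    qed
    show "summable (\<lambda>n. C * M * (1 / 2) ^ n)" by (intro summable_mult summable_geometric) simp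
  qed
  then obtain V where V: "uniform_limit {a..b} (\<lambda>n x. \<Sum>i<n. Y (Suc i) x - Y i x) V sequentially"
    by (auto simp: uniformly_convergent_on_def)
  have tel: "(\<Sum>i<n. Y (Suc i) x - Y i x) = Y n x - y0" for n x
    using sum_lessThan_telescope[of "\<lambda>i. Y i x" n] by (simp add: Y0)
  define y where "y = (\<lambda>x. y0 + V x)"
  have yc: "continuous_on {a..b} y"
  proof -
    have "continuous_on {a..b} V"
      by (rule uniform_limit_theorem[OF _ V]) (auto simp: tel intro!: always_eventually continuous_intros Yc)
    then show ?thesis unfolding y_def by (intro continuous_intros)
  qed
  have conv: "\<forall>\<^sub>F n in sequentially. \<forall>x\<in>{a..b}. norm (Y n x - y x) < e" if "e > 0" for e
    using uniform_limitD[OF V that] by (simp add: tel y_def dist_norm diff_diff_eq)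
  have Ty: "T y x = y x" if x: "x \<in> {a..b}" for x
  proof -
    have lim1: "(\<lambda>n. Y n x) \<longlonglongrightarrow> y x" unfolding tendsto_iff dist_norm
    proof (intro allI impI)
      fix e :: real assume "e > 0"
      from conv[OF this] show "\<forall>\<^sub>F n in sequentially. norm (Y n x - y x) < e"
        by eventually_elim (use x in blast)
    qed
    have "(\<lambda>n. T (Y n) x) \<longlonglongrightarrow> T y x" unfolding tendsto_iff dist_norm
    proof (intro allI impI)
      fix e :: real assume e: "e > 0"
      define e' where "e' = e / M"
      have e': "e' > 0" using e M(2)[OF x] by (simp add: e'_def)
      from conv[OF e'] show "\<forall>\<^sub>F n in sequentially. norm (T (Y n) x - T y x) < e"
      proof eventually_elim
        case (elim n)
        have "norm (T (Y n) x - T y x) \<le> e' / 2 * exp (2 * L * (b - x))"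
        proof (rule step[OF Yc yc _ x])
          fix x assume x: "x \<in> {a..b}"
          have "e' * 1 \<le> e' * exp (2 * L * (b - x))" using e' L x by (intro mult_left_mono) auto
          then show "norm (Y n x - y x) \<le> e' * exp (2 * L * (b - x))" using elim x by force
        qed (use e' in simp)
        also have "\<dots> \<le> e' / 2 * M" using M(1)[OF x] e' by (intro mult_left_mono) auto
        also have "\<dots> < e" using e M(2)[OF x] by (simp add: e'_def)
        finally show ?case .
      qed
    qed
    then have "(\<lambda>n. Y (Suc n) x) \<longlonglongrightarrow> T y x" by (simp add: YS)
    with lim1 show ?thesis using LIMSEQ_unique LIMSEQ_Suc by blast
  qed
  have "ode_on f {a..b} y" unfolding ode_on_def
  proof
    fix x assume x: "x \<in> {a..b}"
    show "(y has_vector_derivative f x (y x)) (at x within {a..b})"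
      by (rule has_vector_derivative_transform[OF x _ Tder[OF yc x]]) (simp add: Ty)
  qed
  moreover have "y b = y0" using Ty[of b] ab by simp
  ultimately show ?thesis by blast
qed

text \<open>The right-hand side only matters in the tube of radius \<open>r\<close> around \<open>Y\<close>: outside it is replaced
  by its value at the closest point, which keeps the Lipschitz constant.\<close>

lemma ode_tube:
  fixes f :: "real \<Rightarrow> 'a \<Rightarrow> 'a::euclidean_space"
  assumes ab: "a \<le> b" and r: "r > 0" and Y: "continuous_on {a..b} Y"
    and cont: "continuous_on {(x, u). x \<in> {a..b} \<and> norm (u - Y x) \<le> r} (\<lambda>(x, u). f x u)"
    and L: "L > 0" "\<And>x u v. \<lbrakk>x \<in> {a..b}; norm (u - Y x) \<le> r; norm (v - Y x) \<le> r\<rbrakk> \<Longrightarrow>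
      norm (f x u - f x v) \<le> L * norm (u - v)"
  obtains g y where "ode_on g {a..b} y" "y b = y0"
    "\<And>x u. norm (u - Y x) \<le> r \<Longrightarrow> g x u = f x u"
    "\<And>x u v. x \<in> {a..b} \<Longrightarrow> norm (g x u - g x v) \<le> L * norm (u - v)"
    "\<And>x u. x \<in> {a..b} \<Longrightarrow> \<exists>v. norm (v - Y x) \<le> r \<and> g x u = f x v"
proof -
  define P where "P = closest_point (cball (0::'a) r)"
  have P: "norm (P u) \<le> r" "norm u \<le> r \<Longrightarrow> P u = u" "norm (P u - P v) \<le> norm (u - v)" for u v
    using closest_point_in_set[of "cball (0::'a) r" u] closest_point_self[of u "cball (0::'a) r"]
      closest_point_lipschitz[of "cball (0::'a) r" u v] r by (auto simp: P_def dist_norm)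
  have Pc: "continuous_on UNIV P" unfolding P_def using r by (intro continuous_on_closest_point) auto
  define g where "g x u = f x (Y x + P (u - Y x))" for x u
  have gL: "norm (g x u - g x v) \<le> L * norm (u - v)" if x: "x \<in> {a..b}" for x u v
  proof -
    have "norm (g x u - g x v) \<le> L * norm (P (u - Y x) - P (v - Y x))"
      unfolding g_def using L(2)[OF x, of "Y x + P (u - Y x)" "Y x + P (v - Y x)"] P(1) by simp
    also have "\<dots> \<le> L * norm ((u - Y x) - (v - Y x))" using L(1) by (intro mult_left_mono P(3)) auto
    finally show ?thesis by simp
  qed
  have "continuous_on ({a..b} \<times> UNIV) (\<lambda>(x, u). g x u)"
  proof -
    have Yf: "continuous_on ({a..b} \<times> UNIV) (\<lambda>p. Y (fst p))"
      by (rule continuous_on_compose2[OF Y]) (auto intro!: continuous_intros)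
    have "continuous_on ({a..b} \<times> UNIV) (\<lambda>p. (\<lambda>(x, u). f x u) (fst p, Y (fst p) + P (snd p - Y (fst p))))"
    proof (rule continuous_on_compose2[OF cont])
      show "continuous_on ({a..b} \<times> UNIV) (\<lambda>p. (fst p, Y (fst p) + P (snd p - Y (fst p))))"
        by (intro continuous_intros Yf continuous_on_compose2[OF Pc]) auto
    qed (use P(1) in auto)
    then show ?thesis by (simp add: g_def case_prod_unfold)
  qed
  then obtain y where "ode_on g {a..b} y" "y b = y0" using ode_global[of a b g L y0, OF ab _ L(1) gL] by blast
  then show ?thesis
  proof (rule that)
    show "\<exists>v. norm (v - Y x) \<le> r \<and> g x u = f x v" for x u
      unfolding g_def using P(1)[of "u - Y x"] by (intro exI[of _ "Y x + P (u - Y x)"]) simp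
  qed (use gL P(2) in \<open>auto simp: g_def\<close>)
qed

text \<open>The solution of the truncated equation moves by at most M (b - a) <= r, so it never
  meets the truncation.\<close>

lemma ode_local:
  fixes f :: "real \<Rightarrow> 'a \<Rightarrow> 'a::euclidean_space"
  assumes ab: "a \<le> b" and r: "r > 0"
    and cont: "continuous_on ({a..b} \<times> cball y0 r) (\<lambda>(x, u). f x u)"
    and L: "\<And>x u v. \<lbrakk>x \<in> {a..b}; u \<in> cball y0 r; v \<in> cball y0 r\<rbrakk> \<Longrightarrow> norm (f x u - f x v) \<le> L * norm (u - v)"
    and M: "\<And>x u. \<lbrakk>x \<in> {a..b}; u \<in> cball y0 r\<rbrakk> \<Longrightarrow> norm (f x u) \<le> M" "M * (b - a) \<le> r"
  shows "\<exists>y. ode_on f {a..b} y \<and> y b = y0 \<and> (\<forall>x\<in>{a..b}. y x \<in> cball y0 r)"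
proof -
  define L' where "L' = max L 1"
  have cb: "u \<in> cball y0 r \<longleftrightarrow> norm (u - y0) \<le> r" for u
    by (simp add: dist_norm norm_minus_commute)
  have set_eq: "{(x, u). x \<in> {a..b} \<and> norm (u - y0) \<le> r} = {a..b} \<times> cball y0 r"
    by (auto simp: dist_norm norm_minus_commute)
  have L': "norm (f x u - f x v) \<le> L' * norm (u - v)" if "x \<in> {a..b}" "norm (u - y0) \<le> r" "norm (v - y0) \<le> r" for x u v
  proof -
    have "norm (f x u - f x v) \<le> L * norm (u - v)" using that by (intro L) (simp_all only: cb)
    moreover have "L * norm (u - v) \<le> L' * norm (u - v)" by (intro mult_right_mono) (auto simp: L'_def)
    ultimately show ?thesis by linarith
  qed
  obtain g y where y: "ode_on g {a..b} y" "y b = y0"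
    and g: "\<And>x u. norm (u - y0) \<le> r \<Longrightarrow> g x u = f x u"
    and gv: "\<And>x u. x \<in> {a..b} \<Longrightarrow> \<exists>v. norm (v - y0) \<le> r \<and> g x u = f x v"
  proof (rule ode_tube[OF ab r continuous_on_const, of y0 f L' y0])
    show "continuous_on {(x, u). x \<in> {a..b} \<and> norm (u - y0) \<le> r} (\<lambda>(x, u). f x u)"
      unfolding set_eq by (rule cont)
    show "norm (f x u - f x v) \<le> L' * norm (u - v)"
      if "x \<in> {a..b}" "norm (u - y0) \<le> r" "norm (v - y0) \<le> r" for x u v
      by (rule L'[OF that])
  qed (simp add: L'_def, rule that)
  have gM: "norm (g x u) \<le> M" if "x \<in> {a..b}" for x u using gv[OF that, of u] M(1)[OF that] cb by metis
  have in_ball: "norm (y x - y0) \<le> r" if x: "x \<in> {a..b}" for x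
  proof (cases "x = b")
    case False
    have "norm (y b - y x) \<le> M * b - M * x"
    proof (rule differentiable_bound_general[where f' = "\<lambda>x. g x (y x)" and \<phi>' = "\<lambda>_. M"])
      show "continuous_on {x..b} y" by (rule continuous_on_subset[OF ode_on_continuous[OF y(1)]]) (use x in auto)
      show "((\<lambda>x. M * x) has_vector_derivative M) (at s)" for s by (auto intro!: derivative_eq_intros)
    qed (use x False in \<open>auto intro!: continuous_intros ode_on_interior[OF y(1)] gM\<close>)
    also have "\<dots> = M * (b - x)" by (simp add: algebra_simps)
    also have "\<dots> \<le> M * (b - a)"
    proof (intro mult_left_mono)
      show "0 \<le> M" using order_trans[OF norm_ge_zero gM[OF x]] .
    qed (use x in auto)
    finally show ?thesis using M(2) y(2) by (simp add: norm_minus_commute)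
  qed (use y r in simp)
  have "ode_on f {a..b} y" using y(1) in_ball g unfolding ode_on_def by simp
  then show ?thesis using y(2) in_ball cb by blast
qed

text \<open>Reference and perturbed solution both solve the truncated equation, which is globally
  Lipschitz; the Gronwall bound then shows that the perturbed one stays in the tube.\<close>

lemma ode_dependence:
  fixes f :: "real \<Rightarrow> 'a \<Rightarrow> 'a::euclidean_space"
  assumes ab: "a \<le> b" and r: "r > 0" and Y: "ode_on f {a..b} Y"
    and cont: "continuous_on {(x, u). x \<in> {a..b} \<and> norm (u - Y x) \<le> r} (\<lambda>(x, u). f x u)"
    and L: "L > 0" "\<And>x u v. \<lbrakk>x \<in> {a..b}; norm (u - Y x) \<le> r; norm (v - Y x) \<le> r\<rbrakk> \<Longrightarrow>
      norm (f x u - f x v) \<le> L * norm (u - v)"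
    and y0: "norm (y0 - Y b) * exp (L * (b - a)) \<le> r"
  shows "\<exists>y. ode_on f {a..b} y \<and> y b = y0 \<and> (\<forall>x\<in>{a..b}. norm (y x - Y x) \<le> norm (y0 - Y b) * exp (L * (b - a)))"
proof -
  obtain g y where y: "ode_on g {a..b} y" "y b = y0"
    and g: "\<And>x u. norm (u - Y x) \<le> r \<Longrightarrow> g x u = f x u"
    and gL: "\<And>x u v. x \<in> {a..b} \<Longrightarrow> norm (g x u - g x v) \<le> L * norm (u - v)"
  proof (rule ode_tube[OF ab r ode_on_continuous[OF Y] cont L(1), of y0])
    show "norm (f x u - f x v) \<le> L * norm (u - v)"
      if "x \<in> {a..b}" "norm (u - Y x) \<le> r" "norm (v - Y x) \<le> r" for x u v
      by (rule L(2)[OF that])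
  qed (rule that)
  have Yg: "ode_on g {a..b} Y" using Y g r unfolding ode_on_def by simp
  have bd: "norm (y x - Y x) \<le> norm (y0 - Y b) * exp (L * (b - a))" if x: "x \<in> {a..b}" for x
  proof -
    have "norm (y x - Y x) \<le> norm (y b - Y b) * exp (L * (b - x))"
      by (rule gronwall_backward[OF ode_on_continuous[OF y(1)] ode_on_continuous[OF Y]
          ode_on_interior[OF y(1)] ode_on_interior[OF Yg]]) (use x gL in auto)
    also have "\<dots> \<le> norm (y b - Y b) * exp (L * (b - a))" using L(1) x by (intro mult_left_mono) auto
    finally show ?thesis by (simp add: y(2))
  qed
  have "ode_on f {a..b} y" using y(1) bd y0 g unfolding ode_on_def by (metis order_trans)
  then show ?thesis using y(2) bd by blast
qed

subsection \<open>Solutions of the Einstein--Euler system\<close>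

text \<open>A calculus of bounded Lipschitz functions on an arbitrary set K. Estimating products and
  quotients directly avoids convexity of K, and the abstract distance \<delta> serves both the real
  plane and complex vectors indexed by \<open>son_var\<close>.\<close>

locale lipschitz_functions =
  fixes K :: "('t \<times> 'u) set" and \<delta> :: "'u \<Rightarrow> 'u \<Rightarrow> real"
  assumes \<delta>: "0 \<le> \<delta> u v"
begin

definition lip :: "('t \<Rightarrow> 'u \<Rightarrow> 'c::real_normed_field) \<Rightarrow> bool" where
  "lip F \<longleftrightarrow> (\<exists>M\<ge>0. \<forall>x u v. (x, u) \<in> K \<longrightarrow> (x, v) \<in> K \<longrightarrow> norm (F x u) \<le> M \<and> norm (F x u - F x v) \<le> M * \<delta> u v)"

lemma lipI:
  assumes "\<And>x u. (x, u) \<in> K \<Longrightarrow> norm (F x u) \<le> M"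
    and "\<And>x u v. (x, u) \<in> K \<Longrightarrow> (x, v) \<in> K \<Longrightarrow> norm (F x u - F x v) \<le> L * \<delta> u v"
  shows "lip F"
proof -
  have "L * \<delta> u v \<le> max 0 (max M L) * \<delta> u v" for u v by (intro mult_right_mono \<delta>) simp
  then have "norm (F x u) \<le> max 0 (max M L) \<and> norm (F x u - F x v) \<le> max 0 (max M L) * \<delta> u v"
    if "(x, u) \<in> K" "(x, v) \<in> K" for x u v
    using assms(1)[OF that(1)] assms(2)[OF that] order_trans by fastforce
  then show ?thesis unfolding lip_def by (intro exI[of _ "max 0 (max M L)"]) simp
qed

lemma lipE:
  assumes "lip F"
  obtains M where "0 \<le> M" "\<And>x u. (x, u) \<in> K \<Longrightarrow> norm (F x u) \<le> M"
    "\<And>x u v. (x, u) \<in> K \<Longrightarrow> (x, v) \<in> K \<Longrightarrow> norm (F x u - F x v) \<le> M * \<delta> u v"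
  using assms unfolding lip_def by blast

lemma lip_of_x: "(\<And>x u. (x, u) \<in> K \<Longrightarrow> norm (f x) \<le> M) \<Longrightarrow> lip (\<lambda>x u. f x)"
  by (rule lipI[of _ M 0]) auto

lemma lip_const: "lip (\<lambda>x u. c)" by (rule lip_of_x[of _ "norm c"]) auto

lemma lip_add:
  assumes "lip F" "lip G"
  shows "lip (\<lambda>x u. F x u + G x u)"
proof -
  obtain M where F: "\<And>x u. (x, u) \<in> K \<Longrightarrow> norm (F x u) \<le> M"
    "\<And>x u v. (x, u) \<in> K \<Longrightarrow> (x, v) \<in> K \<Longrightarrow> norm (F x u - F x v) \<le> M * \<delta> u v"
    using lipE[OF assms(1)] by metis
  obtain N where G: "\<And>x u. (x, u) \<in> K \<Longrightarrow> norm (G x u) \<le> N"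
    "\<And>x u v. (x, u) \<in> K \<Longrightarrow> (x, v) \<in> K \<Longrightarrow> norm (G x u - G x v) \<le> N * \<delta> u v"
    using lipE[OF assms(2)] by metis
  show ?thesis
  proof (rule lipI[of _ "M + N" "M + N"])
    show "norm (F x u + G x u) \<le> M + N" if "(x, u) \<in> K" for x u
      using F(1)[OF that] G(1)[OF that] by (rule norm_triangle_mono)
    show "norm (F x u + G x u - (F x v + G x v)) \<le> (M + N) * \<delta> u v" if "(x, u) \<in> K" "(x, v) \<in> K" for x u v
      using norm_triangle_mono[OF F(2)[OF that] G(2)[OF that]] by (simp add: algebra_simps)
  qed
qed

lemma lip_mult:
  assumes "lip F" "lip G"
  shows "lip (\<lambda>x u. F x u * G x u)"
proof -
  obtain M where F: "0 \<le> M" "\<And>x u. (x, u) \<in> K \<Longrightarrow> norm (F x u) \<le> M"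
    "\<And>x u v. (x, u) \<in> K \<Longrightarrow> (x, v) \<in> K \<Longrightarrow> norm (F x u - F x v) \<le> M * \<delta> u v"
    using lipE[OF assms(1)] by metis
  obtain N where G: "0 \<le> N" "\<And>x u. (x, u) \<in> K \<Longrightarrow> norm (G x u) \<le> N"
    "\<And>x u v. (x, u) \<in> K \<Longrightarrow> (x, v) \<in> K \<Longrightarrow> norm (G x u - G x v) \<le> N * \<delta> u v"
    using lipE[OF assms(2)] by metis
  show ?thesis
  proof (rule lipI[of _ "M * N" "2 * M * N"])
    show "norm (F x u * G x u) \<le> M * N" if "(x, u) \<in> K" for x u
      unfolding norm_mult using F(1,2) G(1,2) that by (intro mult_mono) auto
    show "norm (F x u * G x u - F x v * G x v) \<le> 2 * M * N * \<delta> u v" if "(x, u) \<in> K" "(x, v) \<in> K" for x u v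
    proof -
      have "F x u * G x u - F x v * G x v = F x u * (G x u - G x v) + (F x u - F x v) * G x v"
        by (simp add: algebra_simps)
      moreover have "norm (F x u * (G x u - G x v)) \<le> M * (N * \<delta> u v)"
        unfolding norm_mult using F(1,2) G(3) that by (intro mult_mono) auto
      moreover have "norm ((F x u - F x v) * G x v) \<le> M * \<delta> u v * N"
        unfolding norm_mult using F(1,3) G(2) that \<delta> by (intro mult_mono) auto
      ultimately show ?thesis using norm_triangle_mono by (fastforce simp: algebra_simps)
    qed
  qed
qed

lemma lip_uminus: "lip F \<Longrightarrow> lip (\<lambda>x u. - F x u)"
  unfolding lip_def by (simp add: norm_minus_commute)

lemma lip_diff: "lip F \<Longrightarrow> lip G \<Longrightarrow> lip (\<lambda>x u. F x u - G x u)"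
  using lip_add[of F "\<lambda>x u. - G x u"] lip_uminus[of G] by simp

lemma lip_power: "lip F \<Longrightarrow> lip (\<lambda>x u. F x u ^ n)"
  by (induction n) (auto intro: lip_const lip_mult)

lemma lip_divide:
  assumes F: "lip F" and "lip G" and c: "c > 0" "\<And>x u. (x, u) \<in> K \<Longrightarrow> c \<le> norm (G x u)"
  shows "lip (\<lambda>x u. F x u / G x u)"
proof -
  obtain M where G: "0 \<le> M" "\<And>x u v. (x, u) \<in> K \<Longrightarrow> (x, v) \<in> K \<Longrightarrow> norm (G x u - G x v) \<le> M * \<delta> u v"
    using lipE[OF assms(2)] by metis
  have i: "norm (inverse (G x u)) \<le> inverse c" "G x u \<noteq> 0" if "(x, u) \<in> K" for x u
    using c(2)[OF that] c(1) by (auto simp: norm_inverse intro: le_imp_inverse_le)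
  have "lip (\<lambda>x u. inverse (G x u))"
  proof (rule lipI[of _ "inverse c" "inverse c * M * inverse c"])
    show "norm (inverse (G x u) - inverse (G x v)) \<le> inverse c * M * inverse c * \<delta> u v" if "(x, u) \<in> K" "(x, v) \<in> K" for x u v
    proof -
      have "norm (inverse (G x u) - inverse (G x v)) = norm (inverse (G x u)) * norm (G x u - G x v) * norm (inverse (G x v))"
        using i(2) that by (simp add: inverse_diff_inverse norm_mult)
      also have "\<dots> \<le> inverse c * (M * \<delta> u v) * inverse c"
        using i(1) G that \<delta> c by (intro mult_mono) auto
      finally show ?thesis by (simp add: mult_ac)
    qed
  qed (use i in auto)
  then show ?thesis unfolding divide_inverse by (intro lip_mult F)
qed

lemma lip_powr:
  fixes F :: "'t \<Rightarrow> 'u \<Rightarrow> real"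
  assumes "lip F" and c: "c > 0" "\<And>x u. (x, u) \<in> K \<Longrightarrow> c \<le> F x u"
  shows "lip (\<lambda>x u. F x u powr p)"
proof -
  obtain M where F: "\<And>x u. (x, u) \<in> K \<Longrightarrow> norm (F x u) \<le> M"
    "\<And>x u v. (x, u) \<in> K \<Longrightarrow> (x, v) \<in> K \<Longrightarrow> norm (F x u - F x v) \<le> M * \<delta> u v"
    using lipE[OF assms(1)] by metis
  have "compact ((\<lambda>s. s powr p) ` {c..M})" "compact ((\<lambda>s. p * s powr (p - 1)) ` {c..M})"
    using c by (auto intro!: compact_continuous_image continuous_intros)
  then obtain A B where A: "\<And>s. s \<in> {c..M} \<Longrightarrow> norm (s powr p) \<le> A"
    and B: "\<And>s. s \<in> {c..M} \<Longrightarrow> norm (p * s powr (p - 1)) \<le> B"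
    by (metis (no_types, lifting) bounded_iff compact_imp_bounded image_eqI)
  have inI: "F x u \<in> {c..M}" if "(x, u) \<in> K" for x u using F(1)[OF that] c(2)[OF that] by auto
  show ?thesis
  proof (rule lipI[of _ A "B * M"])
    show "norm (F x u powr p - F x v powr p) \<le> B * M * \<delta> u v" if "(x, u) \<in> K" "(x, v) \<in> K" for x u v
    proof -
      have "norm (F x u powr p - F x v powr p) \<le> B * norm (F x u - F x v)"
      proof (rule field_differentiable_bound[of "{c..M}" "\<lambda>s. s powr p" "\<lambda>s. p * s powr (p - 1)"])
        show "((\<lambda>s. s powr p) has_real_derivative p * s powr (p - 1)) (at s within {c..M})" if "s \<in> {c..M}" for s
          using that c by (auto intro!: derivative_eq_intros)
      qed (use B inI that in auto)
      also have "\<dots> \<le> B * (M * \<delta> u v)"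
        using B[OF inI[OF that(1)]] norm_ge_zero F(2)[OF that] by (intro mult_left_mono) (auto intro: order_trans)
      finally show ?thesis by simp
    qed
  qed (use A inI in auto)
qed

end

section \<open>The Einstein--Euler system as an equation in the plane\<close>

abbreviation D_rhs :: "real \<Rightarrow> real \<Rightarrow> real \<Rightarrow> real \<Rightarrow> real" where
  "D_rhs eps x D W \<equiv> - (2 * x * (1 - eps) * D * (W + eps) * (D - W) / B_fun eps x D W)"

abbreviation W_rhs :: "real \<Rightarrow> real \<Rightarrow> real \<Rightarrow> real \<Rightarrow> real" where
  "W_rhs eps x D W \<equiv> (1 - 3 * W) / x + 2 * x * (1 + eps) * W * (W + eps) * (D - W) / B_fun eps x D W"

definition EE_f :: "real \<Rightarrow> real \<Rightarrow> real \<times> real \<Rightarrow> real \<times> real" where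
  "EE_f eps x u = (case u of (D, W) \<Rightarrow>
     (D_rhs eps x D W,
      W_rhs eps x D W))"

definition EE_dom :: "real \<Rightarrow> (real \<times> real \<times> real) set" where
  "EE_dom eps = {(x, D, W). 0 < x \<and> 0 < D \<and> 0 < B_fun eps x D W}"

lemma solves_EE_iff:
  "solves_EE eps I D W \<longleftrightarrow> (\<forall>x\<in>I. (x, D x, W x) \<in> EE_dom eps) \<and> ode_on (EE_f eps) I (\<lambda>x. (D x, W x))"
proof -
  have "((\<lambda>x. (D x, W x)) has_vector_derivative (a, b)) (at x within I) \<longleftrightarrow>
      (D has_real_derivative a) (at x within I) \<and> (W has_real_derivative b) (at x within I)" for a b x
  proof
    assume "((\<lambda>x. (D x, W x)) has_vector_derivative (a, b)) (at x within I)"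
    then have "((\<lambda>x. fst (D x, W x)) has_vector_derivative fst (a, b)) (at x within I)"
      "((\<lambda>x. snd (D x, W x)) has_vector_derivative snd (a, b)) (at x within I)"
      by (rule bounded_linear.has_vector_derivative[OF bounded_linear_fst]
          bounded_linear.has_vector_derivative[OF bounded_linear_snd])+
    then show "(D has_real_derivative a) (at x within I) \<and> (W has_real_derivative b) (at x within I)"
      by (simp add: has_real_derivative_iff_has_vector_derivative)
  qed (auto simp: has_real_derivative_iff_has_vector_derivative intro: has_vector_derivative_Pair)
  then show ?thesis unfolding solves_EE_def ode_on_def EE_f_def EE_dom_def by auto
qed

lemma B_fun_continuous_on: "continuous_on {p. 0 < fst (snd p)} (\<lambda>p. B_fun eps (fst p) (fst (snd p)) (snd (snd p)))"
  unfolding B_fun_def by (intro continuous_intros) auto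

lemma open_EE_dom: "open (EE_dom eps)"
proof -
  have o: "open {p::real \<times> real \<times> real. 0 < fst (snd p)}" "open {p::real \<times> real \<times> real. 0 < fst p}"
    by (intro open_Collect_less continuous_intros)+
  have "open ({p. 0 < fst (snd p)} \<inter> (\<lambda>p. B_fun eps (fst p) (fst (snd p)) (snd (snd p))) -` {0<..})"
    by (rule continuous_open_preimage[OF B_fun_continuous_on o(1) open_greaterThan])
  then have "open ({p. 0 < fst p} \<inter> ({p. 0 < fst (snd p)} \<inter> (\<lambda>p. B_fun eps (fst p) (fst (snd p)) (snd (snd p))) -` {0<..}))"
    by (rule open_Int[OF o(2)])
  also have "\<dots> = EE_dom eps" by (auto simp: EE_dom_def)
  finally show ?thesis .
qed

lemma EE_f_continuous: "continuous_on (EE_dom eps) (\<lambda>(x, u). EE_f eps x u)"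
proof -
  have "continuous_on (EE_dom eps) (\<lambda>p. B_fun eps (fst p) (fst (snd p)) (snd (snd p)))"
    by (rule continuous_on_subset[OF B_fun_continuous_on]) (auto simp: EE_dom_def)
  then show ?thesis unfolding EE_f_def case_prod_unfold by (intro continuous_intros) (auto simp: EE_dom_def)
qed

lemma norm_prod_bounds:
  fixes u :: "real \<times> real"
  shows "\<bar>fst u\<bar> \<le> norm u" "\<bar>snd u\<bar> \<le> norm u" "norm u \<le> \<bar>fst u\<bar> + \<bar>snd u\<bar>"
  using norm_fst_le[of "fst u" "snd u"] norm_snd_le[of "snd u" "fst u"] norm_Pair_le[of "fst u" "snd u"] by simp_all

lemma EE_f_lipschitz:
  assumes K: "compact K" "K \<subseteq> EE_dom eps"
  obtains L where "L > 0"
    "\<And>x u v. (x, u) \<in> K \<Longrightarrow> (x, v) \<in> K \<Longrightarrow> norm (EE_f eps x u - EE_f eps x v) \<le> L * norm (u - v)"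
proof (cases "K = {}")
  case True
  then show ?thesis by (intro that[of 1]) auto
next
  case False
  interpret lipschitz_functions K "\<lambda>u v :: real \<times> real. norm (u - v)"
    by unfold_locales simp
  have pos: "\<exists>c>0. \<forall>p\<in>K. c \<le> f p" if c: "continuous_on K f" and p: "\<And>p. p \<in> K \<Longrightarrow> 0 < f p" for f :: "real \<times> real \<times> real \<Rightarrow> real"
    using continuous_attains_inf[OF K(1) False c] p by blast
  have fst_K: "0 < fst p" "0 < fst (snd p)" "0 < B_fun eps (fst p) (fst (snd p)) (snd (snd p))" if "p \<in> K" for p
    using that K(2) by (auto simp: EE_dom_def)
  obtain cx where cx: "cx > 0" "\<And>p. p \<in> K \<Longrightarrow> cx \<le> fst p"
    using pos[of fst, OF continuous_on_fst[OF continuous_on_id]] fst_K by blast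
  obtain cD where cD: "cD > 0" "\<And>p. p \<in> K \<Longrightarrow> cD \<le> fst (snd p)"
    using pos[of "\<lambda>p. fst (snd p)", OF continuous_on_fst[OF continuous_on_snd[OF continuous_on_id]]] fst_K by blast
  have "continuous_on K (\<lambda>p. B_fun eps (fst p) (fst (snd p)) (snd (snd p)))"
    by (rule continuous_on_subset[OF B_fun_continuous_on]) (use fst_K in auto)
  then obtain cB where cB: "cB > 0" "\<And>p. p \<in> K \<Longrightarrow> cB \<le> B_fun eps (fst p) (fst (snd p)) (snd (snd p))"
    using pos[of "\<lambda>p. B_fun eps (fst p) (fst (snd p)) (snd (snd p))"] fst_K by blast
  obtain M where M: "\<And>p. p \<in> K \<Longrightarrow> norm p \<le> M"
    using compact_imp_bounded[OF K(1)] by (auto simp: bounded_iff)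
  have Mx: "norm (fst p) \<le> M" "norm (fst (snd p)) \<le> M" "norm (snd (snd p)) \<le> M" if "p \<in> K" for p
    using M[OF that] norm_fst_le[of "fst p" "snd p"] norm_snd_le[of "snd p" "fst p"]
      norm_fst_le[of "fst (snd p)" "snd (snd p)"] norm_snd_le[of "snd (snd p)" "fst (snd p)"] by simp_all
  have lx: "lip (\<lambda>x u. x)" using Mx(1) by (intro lip_of_x[of _ M]) force
  have lD: "lip (\<lambda>x u. fst u)" by (rule lipI[of _ M 1]) (use Mx norm_prod_bounds(1)[of "_ - _"] in force)+
  have lW: "lip (\<lambda>x u. snd u)" by (rule lipI[of _ M 1]) (use Mx norm_prod_bounds(2)[of "_ - _"] in force)+
  have lB: "lip (\<lambda>x u. B_fun eps x (fst u) (snd u))" unfolding B_fun_def using cD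
    by (intro lip_diff lip_add lip_mult lip_power lip_const lip_powr[of _ cD] lx lD lW) force+
  have l1: "lip (\<lambda>x u. fst (EE_f eps x u))" unfolding EE_f_def case_prod_unfold fst_conv using cB
    by (intro lip_uminus lip_divide[of _ _ cB] lip_diff lip_add lip_mult lip_const lx lD lW lB) force+
  have l2: "lip (\<lambda>x u. snd (EE_f eps x u))" unfolding EE_f_def case_prod_unfold snd_conv
  proof (rule lip_add)
    show "lip (\<lambda>x u. (1 - 3 * snd u) / x)"
      using cx by (intro lip_divide[of _ _ cx] lip_diff lip_mult lip_const lx lW) force+
    show "lip (\<lambda>x u. 2 * x * (1 + eps) * snd u * (snd u + eps) * (fst u - snd u) / B_fun eps x (fst u) (snd u))"
      using cB by (intro lip_divide[of _ _ cB] lip_diff lip_add lip_mult lip_const lx lD lW lB) force+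
  qed
  obtain L1 where L1: "0 \<le> L1" "\<And>x u v. (x, u) \<in> K \<Longrightarrow> (x, v) \<in> K \<Longrightarrow> norm (fst (EE_f eps x u) - fst (EE_f eps x v)) \<le> L1 * norm (u - v)"
    using lipE[OF l1] by metis
  obtain L2 where L2: "0 \<le> L2" "\<And>x u v. (x, u) \<in> K \<Longrightarrow> (x, v) \<in> K \<Longrightarrow> norm (snd (EE_f eps x u) - snd (EE_f eps x v)) \<le> L2 * norm (u - v)"
    using lipE[OF l2] by metis
  show ?thesis
  proof (rule that[of "L1 + L2 + 1"])
    fix x u v assume xuv: "(x, u) \<in> K" "(x, v) \<in> K"
    have "norm (EE_f eps x u - EE_f eps x v) \<le> norm (fst (EE_f eps x u) - fst (EE_f eps x v)) + norm (snd (EE_f eps x u) - snd (EE_f eps x v))"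
      using norm_prod_bounds(3)[of "EE_f eps x u - EE_f eps x v"] by simp
    then show "norm (EE_f eps x u - EE_f eps x v) \<le> (L1 + L2 + 1) * norm (u - v)"
      using L1(2)[OF xuv] L2(2)[OF xuv] norm_ge_zero[of "u - v"] unfolding ring_distribs by linarith
  qed (use L1 L2 in simp)
qed

lemma solves_EE_subset: "solves_EE eps I D W \<Longrightarrow> J \<subseteq> I \<Longrightarrow> solves_EE eps J D W"
  unfolding solves_EE_iff using ode_on_subset by blast

lemma solves_EE_cong:
  assumes S: "solves_EE eps I D W" and eq: "\<And>x. x \<in> I \<Longrightarrow> D' x = D x" "\<And>x. x \<in> I \<Longrightarrow> W' x = W x"
  shows "solves_EE eps I D' W'" unfolding solves_EE_def
proof (rule ballI, goal_cases)
  case (1 x)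
  have *: "(f' has_real_derivative d) (at x within I)"
    if "(f has_real_derivative d) (at x within I)" "\<And>x. x \<in> I \<Longrightarrow> f' x = f x" for f f' d
    using that 1 unfolding has_field_derivative_def by (auto intro: has_derivative_transform)
  show ?case unfolding eq[OF 1] using S 1 eq unfolding solves_EE_def by (intro conjI *[of D _ D'] *[of W _ W']) blast+
qed

lemma DERIV_within_Un:
  "(f has_real_derivative d) (at x within S) \<Longrightarrow> (f has_real_derivative d) (at x within T) \<Longrightarrow>
   (f has_real_derivative d) (at x within (S \<union> T))"
  unfolding has_field_derivative_iff by (rule Lim_Un)

text \<open>Outside a closed set containing T the filter is trivial. When solutions are glued, a
  derivative has to be checked only on the side that contains the point.\<close>

lemma DERIV_within_closed:
  fixes S :: "real set"
  assumes "closed S" "x \<notin> S" "T \<subseteq> S"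
  shows "(f has_real_derivative d) (at x within T)"
proof -
  have "\<not> x islimpt T" using assms closed_limpt islimpt_subset by blast
  then have "at x within T = bot" using trivial_limit_within[of x T] by simp
  then show ?thesis by (simp add: has_field_derivative_iff)
qed

lemma solves_EE_glue:
  assumes S: "solves_EE eps I D W" "solves_EE eps J D' W'" and I: "I \<subseteq> {..b}" "b \<in> I" and J: "J \<subseteq> {b..}" "b \<in> J"
    and eq: "D b = D' b" "W b = W' b"
  shows "solves_EE eps (I \<union> J) (\<lambda>x. if x \<le> b then D x else D' x) (\<lambda>x. if x \<le> b then W x else W' x)"
    (is "solves_EE eps _ ?D ?W")
proof -
  have S1: "solves_EE eps I ?D ?W" by (rule solves_EE_cong[OF S(1)]) (use I in auto)
  have S2: "solves_EE eps J ?D ?W"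
  proof (rule solves_EE_cong[OF S(2)])
    fix x assume "x \<in> J"
    then show "?D x = D' x" "?W x = W' x" using J eq by (cases "x = b", auto)+
  qed
  show ?thesis unfolding solves_EE_def
  proof (rule ballI, goal_cases)
    case (1 x)
    have "b < x \<or> x \<in> I" "x < b \<or> x \<in> J" using 1 I J by (cases "x = b"; auto)+
    then have "x \<notin> I \<Longrightarrow> x \<notin> {..b}" "x \<notin> J \<Longrightarrow> x \<notin> {b..}"
      by auto
    then have P: "(f has_real_derivative d) (at x within (I \<union> J))"
      if "x \<in> I \<Longrightarrow> (f has_real_derivative d) (at x within I)"
        "x \<in> J \<Longrightarrow> (f has_real_derivative d) (at x within J)" for f d
      using that I(1) J(1)
      by (intro DERIV_within_Un) (blast intro: DERIV_within_closed[OF closed_atMost] DERIV_within_closed[OF closed_atLeast])+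
    show ?case using 1 S1 S2 unfolding solves_EE_def by (intro conjI P) blast+
  qed
qed

lemma solves_EE_graph_compact:
  assumes "solves_EE eps {a..b} D W"
  shows "compact ((\<lambda>x. (x, D x, W x)) ` {a..b})" "(\<lambda>x. (x, D x, W x)) ` {a..b} \<subseteq> EE_dom eps"
    "continuous_on {a..b} (\<lambda>x. (D x, W x))"
proof -
  show c: "continuous_on {a..b} (\<lambda>x. (D x, W x))" using assms ode_on_continuous unfolding solves_EE_iff by blast
  show "compact ((\<lambda>x. (x, D x, W x)) ` {a..b})"
    by (rule compact_continuous_image[OF continuous_on_Pair[OF continuous_on_id c] compact_Icc])
  show "(\<lambda>x. (x, D x, W x)) ` {a..b} \<subseteq> EE_dom eps" using assms unfolding solves_EE_iff by blast
qed

lemma solves_EE_unique: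
  assumes S: "solves_EE eps {a..b} D1 W1" "solves_EE eps {a..b} D2 W2" and eq: "D1 b = D2 b" "W1 b = W2 b"
    and x: "x \<in> {a..b}"
  shows "D1 x = D2 x" "W1 x = W2 x"
proof -
  define K where "K = (\<lambda>x. (x, D1 x, W1 x)) ` {a..b} \<union> (\<lambda>x. (x, D2 x, W2 x)) ` {a..b}"
  have K: "compact K" "K \<subseteq> EE_dom eps"
    unfolding K_def using solves_EE_graph_compact[OF S(1)] solves_EE_graph_compact[OF S(2)] by (auto intro: compact_Un)
  obtain L where L: "L > 0" "\<And>x u v. (x, u) \<in> K \<Longrightarrow> (x, v) \<in> K \<Longrightarrow> norm (EE_f eps x u - EE_f eps x v) \<le> L * norm (u - v)"
    using EE_f_lipschitz[OF K] by blast
  have "norm ((D1 x, W1 x) - (D2 x, W2 x)) \<le> norm ((D1 b, W1 b) - (D2 b, W2 b)) * exp (L * (b - x))"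
  proof (rule gronwall_backward[where a = a and ?d1.0 = "\<lambda>x. EE_f eps x (D1 x, W1 x)" and ?d2.0 = "\<lambda>x. EE_f eps x (D2 x, W2 x)"])
    show "continuous_on {a..b} (\<lambda>x. (D1 x, W1 x))" "continuous_on {a..b} (\<lambda>x. (D2 x, W2 x))"
      by (rule solves_EE_graph_compact(3)[OF S(1)] solves_EE_graph_compact(3)[OF S(2)])+
    show "((\<lambda>x. (D1 x, W1 x)) has_vector_derivative EE_f eps x (D1 x, W1 x)) (at x)" if "a < x" "x < b" for x
      using S(1) ode_on_interior[OF _ that] unfolding solves_EE_iff by blast
    show "((\<lambda>x. (D2 x, W2 x)) has_vector_derivative EE_f eps x (D2 x, W2 x)) (at x)" if "a < x" "x < b" for x
      using S(2) ode_on_interior[OF _ that] unfolding solves_EE_iff by blast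
    show "norm (EE_f eps x (D1 x, W1 x) - EE_f eps x (D2 x, W2 x)) \<le> L * norm ((D1 x, W1 x) - (D2 x, W2 x))"
      if "a < x" "x < b" for x
      using that by (intro L(2)) (auto simp: K_def)
  qed (use x in auto)
  then show "D1 x = D2 x" "W1 x = W2 x" by (auto simp: eq norm_eq_zero zero_prod_def)
qed

lemma EE_dom_thicken:
  assumes K: "compact K" "K \<subseteq> EE_dom eps"
  obtains e K' where "e > 0" "compact K'" "K' \<subseteq> EE_dom eps" "\<And>p q. p \<in> K \<Longrightarrow> norm (q - p) \<le> e \<Longrightarrow> q \<in> K'"
proof -
  obtain e where e: "e > 0" "(\<Union>p\<in>K. ball p e) \<subseteq> EE_dom eps"
    using compact_subset_open_imp_ball_epsilon_subset[OF K(1) open_EE_dom K(2)] by blast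
  define K' where "K' = (\<lambda>(p, q). p + q) ` (K \<times> cball 0 (e / 2))"
  have "compact K'" unfolding K'_def case_prod_unfold
    by (intro compact_continuous_image compact_Times K compact_cball continuous_intros)
  moreover have "K' \<subseteq> EE_dom eps"
  proof
    fix x assume "x \<in> K'"
    then obtain p q where "x = p + q" "p \<in> K" "norm q \<le> e / 2" by (auto simp: K'_def)
    then have "x \<in> ball p e" using e(1) by (simp add: dist_norm)
    then show "x \<in> EE_dom eps" using e(2) \<open>p \<in> K\<close> by blast
  qed
  moreover have "q \<in> K'" if "p \<in> K" "norm (q - p) \<le> e / 2" for p q
    unfolding K'_def by (rule image_eqI[of _ _ "(p, q - p)"]) (use that in auto)
  ultimately show ?thesis using that[of "e / 2" K'] e(1) by simp
qed

lemma norm_triple_le: "norm (x :: real, u :: 'a::real_normed_vector) \<le> \<bar>x\<bar> + norm u"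
  using norm_Pair_le[of x u] by simp

text \<open>The step h depends on the compact set only; this uniformity allows continuation in
  finitely many steps.\<close>

lemma EE_local:
  assumes K: "compact K" "K \<subseteq> EE_dom eps"
  shows "\<exists>h>0. \<forall>x0 D0 W0 a. (x0, D0, W0) \<in> K \<longrightarrow> x0 - h \<le> a \<longrightarrow> a \<le> x0 \<longrightarrow>
    (\<exists>D W. solves_EE eps {a..x0} D W \<and> D x0 = D0 \<and> W x0 = W0)"
proof -
  obtain e K' where e: "e > 0" "compact K'" "K' \<subseteq> EE_dom eps"
    and near: "\<And>p q. p \<in> K \<Longrightarrow> norm (q - p) \<le> e \<Longrightarrow> q \<in> K'"
    using EE_dom_thicken[OF K] by blast
  obtain L where L: "L > 0" "\<And>x u v. (x, u) \<in> K' \<Longrightarrow> (x, v) \<in> K' \<Longrightarrow> norm (EE_f eps x u - EE_f eps x v) \<le> L * norm (u - v)"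
    using EE_f_lipschitz[OF e(2,3)] by blast
  have cK': "continuous_on K' (\<lambda>(x, u). EE_f eps x u)" by (rule continuous_on_subset[OF EE_f_continuous e(3)])
  obtain M where M: "M > 0" "\<And>p. p \<in> K' \<Longrightarrow> norm ((\<lambda>(x, u). EE_f eps x u) p) \<le> M"
    using compact_imp_bounded[OF compact_continuous_image[OF cK' e(2)]] unfolding bounded_pos by blast
  define h where "h = min (e / 2) (e / 2 / M)"
  show ?thesis
  proof (intro exI[of _ h] conjI allI impI)
    show "h > 0" using e(1) M(1) by (simp add: h_def)
    fix x0 D0 W0 a assume p: "(x0, D0, W0) \<in> K" and a: "x0 - h \<le> a" "a \<le> x0"
    have sub: "(x, u) \<in> K'" if "x \<in> {a..x0}" "u \<in> cball (D0, W0) (e / 2)" for x u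
    proof (rule near[OF p])
      have "norm ((x, u) - (x0, D0, W0)) \<le> \<bar>x - x0\<bar> + norm (u - (D0, W0))"
        using norm_triple_le[of "x - x0" "u - (D0, W0)"] by simp
      also have "\<dots> \<le> e / 2 + e / 2"
        using that a by (intro add_mono) (auto simp: h_def dist_norm norm_minus_commute)
      finally show "norm ((x, u) - (x0, D0, W0)) \<le> e" by simp
    qed
    have "\<exists>y. ode_on (EE_f eps) {a..x0} y \<and> y x0 = (D0, W0) \<and> (\<forall>x\<in>{a..x0}. y x \<in> cball (D0, W0) (e / 2))"
    proof (rule ode_local[OF a(2)])
      show "continuous_on ({a..x0} \<times> cball (D0, W0) (e / 2)) (\<lambda>(x, u). EE_f eps x u)"
        by (rule continuous_on_subset[OF cK']) (use sub in blast)
      show "norm (EE_f eps x u - EE_f eps x v) \<le> L * norm (u - v)"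
        if "x \<in> {a..x0}" "u \<in> cball (D0, W0) (e / 2)" "v \<in> cball (D0, W0) (e / 2)" for x u v
        by (rule L(2)[OF sub[OF that(1,2)] sub[OF that(1,3)]])
      show "norm (EE_f eps x u) \<le> M" if "x \<in> {a..x0}" "u \<in> cball (D0, W0) (e / 2)" for x u
        using M(2)[OF sub[OF that]] by simp
      have "M * (x0 - a) \<le> M * (e / 2 / M)" using a M(1) by (intro mult_left_mono) (auto simp: h_def)
      then show "M * (x0 - a) \<le> e / 2" using M(1) by simp
    qed (use e(1) in simp)
    then obtain y where y: "ode_on (EE_f eps) {a..x0} y" "y x0 = (D0, W0)" "\<And>x. x \<in> {a..x0} \<Longrightarrow> y x \<in> cball (D0, W0) (e / 2)"
      by blast
    have "solves_EE eps {a..x0} (\<lambda>x. fst (y x)) (\<lambda>x. snd (y x))"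
      unfolding solves_EE_iff using y(1) sub[OF _ y(3)] e(3) by (auto simp del: mem_cball)
    then show "\<exists>D W. solves_EE eps {a..x0} D W \<and> D x0 = D0 \<and> W x0 = W0"
      using y(2) by (intro exI[of _ "\<lambda>x. fst (y x)"] exI[of _ "\<lambda>x. snd (y x)"]) simp
  qed
qed

lemma EE_dependence:
  assumes S: "solves_EE eps {a..b} D W" and ab: "a \<le> b" and r: "r > 0"
  shows "\<exists>d>0. \<forall>D0 W0. \<bar>D0 - D b\<bar> < d \<longrightarrow> \<bar>W0 - W b\<bar> < d \<longrightarrow>
    (\<exists>D' W'. solves_EE eps {a..b} D' W' \<and> D' b = D0 \<and> W' b = W0 \<and> (\<forall>x\<in>{a..b}. \<bar>D' x - D x\<bar> < r \<and> \<bar>W' x - W x\<bar> < r))"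
proof -
  define K where "K = (\<lambda>x. (x, D x, W x)) ` {a..b}"
  have K: "compact K" "K \<subseteq> EE_dom eps" unfolding K_def by (rule solves_EE_graph_compact[OF S])+
  obtain e K' where e: "e > 0" "compact K'" "K' \<subseteq> EE_dom eps"
    and near: "\<And>p q. p \<in> K \<Longrightarrow> norm (q - p) \<le> e \<Longrightarrow> q \<in> K'"
    using EE_dom_thicken[OF K] by blast
  obtain L where L: "L > 0" "\<And>x u v. (x, u) \<in> K' \<Longrightarrow> (x, v) \<in> K' \<Longrightarrow> norm (EE_f eps x u - EE_f eps x v) \<le> L * norm (u - v)"
    using EE_f_lipschitz[OF e(2,3)] by blast
  define Y where "Y = (\<lambda>x. (D x, W x))"
  define C where "C = exp (L * (b - a))"
  define e' where "e' = min e (r / 2)"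
  have C: "C > 0" and e': "e' > 0" "e' \<le> e" "e' < r" using e(1) r by (auto simp: C_def e'_def)
  have sub: "(x, u) \<in> K'" if "x \<in> {a..b}" "norm (u - Y x) \<le> e'" for x u
  proof (rule near[of "(x, D x, W x)"])
    show "norm ((x, u) - (x, D x, W x)) \<le> e" using that e'(2) by (simp add: Y_def norm_Pair)
  qed (use that in \<open>simp add: K_def\<close>)
  have dep: "\<exists>y. ode_on (EE_f eps) {a..b} y \<and> y b = y0 \<and> (\<forall>x\<in>{a..b}. norm (y x - Y x) \<le> norm (y0 - Y b) * exp (L * (b - a)))"
    if "norm (y0 - Y b) * exp (L * (b - a)) \<le> e'" for y0
  proof (rule ode_dependence[where r = e' and L = L and Y = Y])
    show "ode_on (EE_f eps) {a..b} Y" using S unfolding solves_EE_iff Y_def by blast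
    show "continuous_on {(x, u). x \<in> {a..b} \<and> norm (u - Y x) \<le> e'} (\<lambda>(x, u). EE_f eps x u)"
      by (rule continuous_on_subset[OF continuous_on_subset[OF EE_f_continuous e(3)]]) (use sub in blast)
    show "norm (EE_f eps x u - EE_f eps x v) \<le> L * norm (u - v)"
      if "x \<in> {a..b}" "norm (u - Y x) \<le> e'" "norm (v - Y x) \<le> e'" for x u v
      by (rule L(2)[OF sub[OF that(1,2)] sub[OF that(1,3)]])
  qed (use ab e'(1) L(1) that in auto)
  show ?thesis
  proof (intro exI[of _ "e' / (2 * C)"] conjI allI impI)
    show "0 < e' / (2 * C)" using C e' by simp
    fix D0 W0 assume d: "\<bar>D0 - D b\<bar> < e' / (2 * C)" "\<bar>W0 - W b\<bar> < e' / (2 * C)"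
    have "norm ((D0, W0) - Y b) \<le> \<bar>D0 - D b\<bar> + \<bar>W0 - W b\<bar>"
      using norm_triple_le[of "D0 - D b" "W0 - W b"] by (simp add: Y_def)
    also have "\<dots> \<le> e' / C" using d by (simp add: field_simps)
    finally have nC: "norm ((D0, W0) - Y b) * exp (L * (b - a)) \<le> e'"
      using C unfolding C_def[symmetric] by (simp add: field_simps)
    from dep[OF nC] obtain y where y: "ode_on (EE_f eps) {a..b} y" "y b = (D0, W0)"
      and yY: "\<And>x. x \<in> {a..b} \<Longrightarrow> norm (y x - Y x) \<le> e'"
      using nC by (meson order_trans)
    have "solves_EE eps {a..b} (\<lambda>x. fst (y x)) (\<lambda>x. snd (y x))"
      unfolding solves_EE_iff using y(1) sub[OF _ yY] e(3) by auto
    moreover have "\<bar>fst (y x) - D x\<bar> < r \<and> \<bar>snd (y x) - W x\<bar> < r" if x: "x \<in> {a..b}" for x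
      using norm_prod_bounds(1,2)[of "y x - Y x"] yY[OF x] e'(3) by (simp add: Y_def)
    ultimately show "\<exists>D' W'. solves_EE eps {a..b} D' W' \<and> D' b = D0 \<and> W' b = W0 \<and> (\<forall>x\<in>{a..b}. \<bar>D' x - D x\<bar> < r \<and> \<bar>W' x - W x\<bar> < r)"
      using y(2) by (intro exI[of _ "\<lambda>x. fst (y x)"] exI[of _ "\<lambda>x. snd (y x)"]) simp
  qed
qed

text \<open>A priori confinement to a compact subset of the domain excludes blow-up: finitely many
  steps of the uniform length h reach c.\<close>

lemma EE_continue:
  assumes K: "compact K" "K \<subseteq> EE_dom eps" and c: "c \<le> b" and start: "(b, D0, W0) \<in> K"
    and stay: "\<And>a D W. c \<le> a \<Longrightarrow> a \<le> b \<Longrightarrow> solves_EE eps {a..b} D W \<Longrightarrow> D b = D0 \<Longrightarrow> W b = W0 \<Longrightarrow> (a, D a, W a) \<in> K"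
  shows "\<exists>D W. solves_EE eps {c..b} D W \<and> D b = D0 \<and> W b = W0"
proof -
  obtain h where h: "h > 0" and ext: "\<And>x0 D0 W0 a. (x0, D0, W0) \<in> K \<Longrightarrow> x0 - h \<le> a \<Longrightarrow> a \<le> x0 \<Longrightarrow>
    \<exists>D W. solves_EE eps {a..x0} D W \<and> D x0 = D0 \<and> W x0 = W0"
    using EE_local[OF K] by blast
  have step: "\<exists>D W. solves_EE eps {max c (b - real n * h)..b} D W \<and> D b = D0 \<and> W b = W0" for n
  proof (induction n)
    case 0
    show ?case using ext[OF start, of b] h c by (simp add: max_def)
  next
    case (Suc n)
    define a where "a = max c (b - real n * h)"
    define a' where "a' = max c (b - real (Suc n) * h)"
    have a: "c \<le> a" "a \<le> b" "a' \<le> a" "a - h \<le> a'"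
      using c h by (auto simp: a_def a'_def max_def algebra_simps)
    obtain D W where DW: "solves_EE eps {a..b} D W" "D b = D0" "W b = W0" using Suc.IH unfolding a_def by blast
    obtain D' W' where DW': "solves_EE eps {a'..a} D' W'" "D' a = D a" "W' a = W a"
      using ext[OF stay[OF a(1,2) DW] a(4,3)] by blast
    have "solves_EE eps ({a'..a} \<union> {a..b}) (\<lambda>x. if x \<le> a then D' x else D x) (\<lambda>x. if x \<le> a then W' x else W x)"
      using a by (intro solves_EE_glue DW DW') auto
    moreover have "{a'..a} \<union> {a..b} = {a'..b}" using a by auto
    ultimately have "solves_EE eps {a'..b} (\<lambda>x. if x \<le> a then D' x else D x) (\<lambda>x. if x \<le> a then W' x else W x)"
      by simp
    moreover have "(if b \<le> a then D' b else D b) = D0 \<and> (if b \<le> a then W' b else W b) = W0"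
      using a(2) DW DW' by auto
    ultimately show ?case unfolding a'_def[symmetric] by blast
  qed
  obtain n where "b - c \<le> real n * h" using h by (metis ex_less_of_nat_mult less_imp_le)
  then have "max c (b - real n * h) = c" by simp
  then show ?thesis using step[of n] by simp
qed

lemma EE_global:
  assumes ex: "\<And>a. 0 < a \<Longrightarrow> a \<le> b \<Longrightarrow> \<exists>D W. solves_EE eps {a..b} D W \<and> D b = D0 \<and> W b = W0" and b: "0 < b"
  shows "\<exists>D W. solves_EE eps {0<..b} D W \<and> D b = D0 \<and> W b = W0"
proof -
  have "\<forall>a\<in>{0<..b}. \<exists>p. solves_EE eps {a..b} (fst p) (snd p) \<and> fst p b = D0 \<and> snd p b = W0"
  proof
    fix a assume "a \<in> {0<..b}"
    then obtain D W where "solves_EE eps {a..b} D W \<and> D b = D0 \<and> W b = W0" using ex[of a] by auto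
    then show "\<exists>p. solves_EE eps {a..b} (fst p) (snd p) \<and> fst p b = D0 \<and> snd p b = W0"
      by (intro exI[of _ "(D, W)"]) simp
  qed
  from bchoice[OF this] obtain H where H: "\<And>a. a \<in> {0<..b} \<Longrightarrow> solves_EE eps {a..b} (fst (H a)) (snd (H a))"
    "\<And>a. a \<in> {0<..b} \<Longrightarrow> fst (H a) b = D0" "\<And>a. a \<in> {0<..b} \<Longrightarrow> snd (H a) b = W0"
    by blast
  \<comment> \<open>By uniqueness the solutions on different intervals agree, so evaluating at x the
    one that lives on {x..b} glues them.\<close>
  define D where "D = (\<lambda>x. fst (H x) x)"
  define W where "W = (\<lambda>x. snd (H x) x)"
  have S: "solves_EE eps {a..b} D W" if a: "a \<in> {0<..b}" for a
  proof (rule solves_EE_cong[OF H(1)[OF a]])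
    fix y assume y: "y \<in> {a..b}"
    then have y': "y \<in> {0<..b}" using a by auto
    have "solves_EE eps {y..b} (fst (H a)) (snd (H a))" by (rule solves_EE_subset[OF H(1)[OF a]]) (use y in auto)
    from solves_EE_unique[OF H(1)[OF y'] this, of y] show "D y = fst (H a) y" "W y = snd (H a) y"
      using H(2,3)[OF a] H(2,3)[OF y'] y by (auto simp: D_def W_def)
  qed
  have "solves_EE eps {0<..b} D W" unfolding solves_EE_def
  proof (rule ballI, goal_cases)
    case (1 x)
    have "at x within {0<..b} = at x within {x/2..b}" by (rule at_within_nhd[of _ "{x/2<..}"]) (use 1 in auto)
    then show ?case using S[of "x/2"] 1 unfolding solves_EE_def by auto
  qed
  moreover have "D b = D0" "W b = W0" using H(2,3)[of b] b by (auto simp: D_def W_def)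
  ultimately show ?thesis by blast
qed

subsection \<open>The region to the left of the sonic point\<close>

text \<open>Continuous induction from the right: a nonempty closed set of failures would contain its
  supremum, to the right of which P holds.\<close>

lemma backward_induct_Icc:
  fixes a b :: real
  assumes closed: "closed {x\<in>{a..b}. \<not> P x}"
    and step: "\<And>x. a \<le> x \<Longrightarrow> x \<le> b \<Longrightarrow> (\<And>y. x < y \<Longrightarrow> y \<le> b \<Longrightarrow> P y) \<Longrightarrow> P x"
    and x: "x \<in> {a..b}"
  shows "P x"
proof (rule ccontr)
  assume nP: "\<not> P x"
  define S where "S = {x\<in>{a..b}. \<not> P x}"
  have S: "S \<noteq> {}" "bdd_above S" using x nP unfolding S_def by (blast, intro bdd_aboveI[of _ b]) auto
  have "Sup S \<in> S" using closed_contains_Sup[OF S] closed unfolding S_def by blast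
  then have sup: "a \<le> Sup S" "Sup S \<le> b" "\<not> P (Sup S)" unfolding S_def by auto
  have right: "P y" if "Sup S < y" "y \<le> b" for y
  proof (rule ccontr)
    assume "\<not> P y"
    then have "y \<in> S" using that sup(1) unfolding S_def by simp
    then show False using cSup_upper[OF _ S(2), of y] that by simp
  qed
  show False using step[OF sup(1,2) right] sup(3) by blast
qed

lemma solves_EE_at:
  assumes "solves_EE eps {a..b} D W" "a < x" "x < b"
  shows "(D has_real_derivative D_rhs eps x (D x) (W x)) (at x)"
    and "(W has_real_derivative W_rhs eps x (D x) (W x)) (at x)"
  using assms at_within_Icc_at[OF assms(2,3)] unfolding solves_EE_def by (auto dest!: bspec[of _ _ x])

lemma solves_EE_pos:
  assumes "solves_EE eps I D W" "x \<in> I"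
  shows "0 < x" "0 < D x" "0 < B_fun eps x (D x) (W x)" using assms unfolding solves_EE_def by blast+

lemma solves_EE_cont:
  assumes "solves_EE eps I D W"
  shows "continuous_on I D" "continuous_on I W"
proof -
  have "continuous_on I (\<lambda>x. (D x, W x))" using assms ode_on_continuous unfolding solves_EE_iff by blast
  from continuous_on_fst[OF this] continuous_on_snd[OF this] show "continuous_on I D" "continuous_on I W" by simp_all
qed

lemma solves_EE_deriv_W:
  assumes "solves_EE eps I D W" "x \<in> I"
  shows "(W has_real_derivative W_rhs eps x (D x) (W x)) (at x within I)" using assms unfolding solves_EE_def by blast

lemma solves_EE_D_backward:
  assumes S: "solves_EE eps {a..b} D W" and e: "0 \<le> eps" "eps < 1" and x: "a \<le> x" "x \<le> b"
    and sgn: "\<And>y. x < y \<Longrightarrow> y < b \<Longrightarrow> 0 \<le> (W y + eps) * (D y - W y)"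
  shows "D b \<le> D x"
proof -
  have "- D x \<le> - D b"
  proof (rule DERIV_nonneg_imp_le[where f = "\<lambda>x. - D x"])
    show "continuous_on {x..b} (\<lambda>x. - D x)"
      using solves_EE_cont(1)[OF S] x by (auto intro!: continuous_intros elim: continuous_on_subset)
    fix y assume y: "x < y" "y < b"
    note p = solves_EE_pos[OF S, of y]
    have "0 \<le> 2 * y * (1 - eps) * D y * ((W y + eps) * (D y - W y)) / B_fun eps y (D y) (W y)"
      using p y x e by (intro divide_nonneg_pos mult_nonneg_nonneg[OF _ sgn[OF y]]) auto
    then show "\<exists>d\<ge>0. ((\<lambda>x. - D x) has_real_derivative d) (at y)"
      using y(1) x(1) by - (rule exI, rule conjI[rotated], rule DERIV_minus[OF solves_EE_at(1)[OF S _ y(2)]], simp_all add: mult.assoc)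
  qed (use x in simp)
  then show ?thesis by simp
qed

text \<open>Suppose W returns to 1/3 at x. Between x and b one has 0 < W < 1/3 < D, so D grows to
  the left and exceeds 1/3 at x. There the source term gives W' > 0, so W exceeds 1/3 immediately to
  the right, a contradiction.\<close>

lemma W_below_third_persists:
  assumes S: "solves_EE eps {a..b} D W" and e: "0 < eps" "eps < 1" and b: "W b < 1/3" "D b > 1/3" and x: "x \<in> {a..b}"
  shows "W x < 1/3"
proof (rule backward_induct_Icc[of a b "\<lambda>x. W x < 1/3", OF _ _ x])
  show "closed {x\<in>{a..b}. \<not> W x < 1/3}"
    unfolding not_less using solves_EE_cont[OF S] by (intro continuous_on_closed_Collect_le continuous_intros) auto
  fix x assume x: "a \<le> x" "x \<le> b" and right: "\<And>y. x < y \<Longrightarrow> y \<le> b \<Longrightarrow> W y < 1/3"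
  show "W x < 1/3"
  proof (rule ccontr)
    assume nl: "\<not> W x < 1/3"
    then have xb: "x < b" using b(1) x by (cases "x = b") auto
    have Sx: "solves_EE eps {x..b} D W" by (rule solves_EE_subset[OF S]) (use x in auto)
    \<comment> \<open>A sign change of W is excluded first: at the leftmost point m with W <= 0 one
      has W m = 0 and W' = 1 / m > 0, which makes W negative just to the left of m.\<close>
    have pos: "W y > 0" if y: "y \<in> {x..b}" for y
    proof (rule ccontr)
      assume ny: "\<not> W y > 0"
      define T where "T = {y\<in>{x..b}. W y \<le> 0}"
      have "closed T"
        unfolding T_def using solves_EE_cont[OF Sx] by (intro continuous_on_closed_Collect_le continuous_intros) auto
      moreover have T: "T \<noteq> {}" "bdd_below T" using y ny unfolding T_def by (auto intro!: bdd_belowI[of _ x])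
      ultimately have m: "Inf T \<in> T" using closed_contains_Inf by blast
      define m where "m = Inf T"
      have min: "W y > 0" if "x \<le> y" "y < m" for y
      proof (rule ccontr)
        assume "\<not> 0 < W y"
        then have "y \<in> T" using that m unfolding m_def by (auto simp: T_def)
        then show False using cInf_lower[OF _ T(2), of y] that unfolding m_def by simp
      qed
      have mx: "x < m" "m \<le> b" "W m \<le> 0"
      proof -
        have "m \<in> T" using m by (simp add: m_def)
        then have mT: "x \<le> m" "m \<le> b" "W m \<le> 0" by (auto simp: T_def)
        then show "x < m" "m \<le> b" "W m \<le> 0" using nl by (cases "x = m"; simp)+
      qed
      have "W m = 0"
      proof (rule antisym[OF mx(3)])
        have "\<forall>\<^sub>F y in at_left m. 0 \<le> W y"
          using eventually_at_left_real[OF mx(1)] by eventually_elim (intro less_imp_le min; simp)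
        moreover have "(W \<longlongrightarrow> W m) (at m within {x..m})"
          using continuous_on_subset[OF solves_EE_cont(2)[OF Sx], of "{x..m}"] mx by (auto simp: continuous_on_def)
        then have "(W \<longlongrightarrow> W m) (at_left m)" using mx(1) by (simp add: at_within_Icc_at_left)
        ultimately show "0 \<le> W m" by (intro tendsto_lowerbound[of W "W m" "at_left m"]) auto
      qed
      then have "(W has_real_derivative 1 / m) (at m within {x..b})" using solves_EE_deriv_W[OF Sx, of m] mx by simp
      moreover have "0 < 1 / m" using solves_EE_pos(1)[OF Sx, of m] mx by simp
      ultimately obtain d where d: "d > 0" "\<And>h. h > 0 \<Longrightarrow> m - h \<in> {x..b} \<Longrightarrow> h < d \<Longrightarrow> W (m - h) < W m"
        using has_real_derivative_pos_inc_left by blast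
      define h where "h = min (d / 2) (m - x)"
      have "W (m - h) < W m" by (rule d(2)) (use d(1) mx in \<open>auto simp: h_def min_def\<close>)
      moreover have "0 < W (m - h)" by (rule min) (use d(1) mx in \<open>auto simp: h_def min_def\<close>)
      ultimately show False using \<open>W m = 0\<close> by simp
    qed
    have D: "D y > 1/3" if y: "y \<in> {x..b}" for y
    proof (rule backward_induct_Icc[of x b "\<lambda>y. D y > 1/3", OF _ _ y])
      show "closed {y\<in>{x..b}. \<not> 1/3 < D y}"
        unfolding not_less using solves_EE_cont[OF Sx] by (intro continuous_on_closed_Collect_le continuous_intros) auto
      fix y assume y: "x \<le> y" "y \<le> b" and ry: "\<And>z. y < z \<Longrightarrow> z \<le> b \<Longrightarrow> 1/3 < D z"
      have "D b \<le> D y"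
      proof (rule solves_EE_D_backward[OF Sx _ e(2) y])
        fix z assume z: "y < z" "z < b"
        then show "0 \<le> (W z + eps) * (D z - W z)"
          using pos[of z] ry[of z] right[of z] y x e by (intro mult_nonneg_nonneg) auto
      qed (use e in simp)
      then show "1/3 < D y" using b(2) by simp
    qed
    have "W x = 1/3"
    proof (rule antisym)
      have "\<forall>\<^sub>F y in at_right x. W y \<le> 1/3"
        using eventually_at_right_real[OF xb] by eventually_elim (intro less_imp_le right; simp)
      moreover have "(W \<longlongrightarrow> W x) (at x within {x..b})"
        using solves_EE_cont(2)[OF Sx] xb by (auto simp: continuous_on_def)
      then have "(W \<longlongrightarrow> W x) (at_right x)" using xb by (simp add: at_within_Icc_at_right)
      ultimately show "W x \<le> 1/3" by (intro tendsto_upperbound[of W "W x" "at_right x"]) auto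
    qed (use nl in simp)
    have "0 < W_rhs eps x (D x) (W x)"
    proof -
      have "0 < 2 * x * (1 + eps) * W x * (W x + eps) * (D x - W x) / B_fun eps x (D x) (W x)"
      proof (intro divide_pos_pos mult_pos_pos)
        show "0 < x" "0 < B_fun eps x (D x) (W x)" using solves_EE_pos[OF Sx, of x] xb by auto
        show "0 < W x" "0 < W x + eps" "0 < D x - W x" using D[of x] xb e \<open>W x = 1/3\<close> by auto
      qed (use e in auto)
      moreover have "(1 - 3 * W x) / x = 0" using \<open>W x = 1/3\<close> by simp
      ultimately show ?thesis by linarith
    qed
    with solves_EE_deriv_W[OF Sx, of x] xb obtain d where d: "d > 0" "\<And>h. h > 0 \<Longrightarrow> x + h \<in> {x..b} \<Longrightarrow> h < d \<Longrightarrow> W x < W (x + h)"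
      using has_real_derivative_pos_inc_right by force
    define h where "h = min (d / 2) (b - x)"
    have "W x < W (x + h)" by (rule d(2)) (use d(1) xb in \<open>auto simp: h_def min_def\<close>)
    moreover have "W (x + h) < 1/3" by (rule right) (use d(1) xb in \<open>auto simp: h_def min_def\<close>)
    ultimately show False using \<open>W x = 1/3\<close> by simp
  qed
qed

lemma solves_EE_W_backward:
  assumes S: "solves_EE eps {a..b} D W" and x: "a \<le> x" "x \<le> b"
    and sgn: "\<And>y. x < y \<Longrightarrow> y < b \<Longrightarrow> W_rhs eps y (D y) (W y) \<le> 0"
  shows "W b \<le> W x"
proof -
  have "- W x \<le> - W b"
  proof (rule DERIV_nonneg_imp_le[where f = "\<lambda>x. - W x"])
    show "continuous_on {x..b} (\<lambda>x. - W x)"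
      using solves_EE_cont(2)[OF S] x by (auto intro!: continuous_intros elim: continuous_on_subset)
    fix y assume y: "x < y" "y < b"
    show "\<exists>d\<ge>0. ((\<lambda>x. - W x) has_real_derivative d) (at y)"
      using DERIV_minus[OF solves_EE_at(2)[OF S _ y(2)]] y(1) x(1) sgn[OF y] by (meson less_trans neg_0_le_iff_le le_less_trans)
  qed (use x in simp)
  then show ?thesis by simp
qed

text \<open>In this region both terms of W' are nonpositive and D' is nonnegative, so to the left W
  grows, D falls and the gap widens.\<close>

lemma W_above_D_persists:
  assumes S: "solves_EE eps {a..b} D W" and e: "0 < eps" "eps < 1" and b: "1/3 < W b" "D b < W b" and x: "x \<in> {a..b}"
  shows "1/3 < W x \<and> D x < W x"
proof (rule backward_induct_Icc[of a b "\<lambda>x. 1/3 < W x \<and> D x < W x", OF _ _ x])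
  have "closed ({x\<in>{a..b}. W x \<le> 1/3} \<union> {x\<in>{a..b}. W x \<le> D x})"
    using solves_EE_cont[OF S] by (intro closed_Un continuous_on_closed_Collect_le continuous_intros) auto
  also have "{x\<in>{a..b}. W x \<le> 1/3} \<union> {x\<in>{a..b}. W x \<le> D x} = {x\<in>{a..b}. \<not> (1/3 < W x \<and> D x < W x)}"
    by auto
  finally show "closed {x\<in>{a..b}. \<not> (1/3 < W x \<and> D x < W x)}" .
  fix x assume x: "a \<le> x" "x \<le> b" and right: "\<And>y. x < y \<Longrightarrow> y \<le> b \<Longrightarrow> 1/3 < W y \<and> D y < W y"
  have W: "W b \<le> W x"
  proof (rule solves_EE_W_backward[OF S x])
    fix y assume y: "x < y" "y < b"
    note p = solves_EE_pos[OF S, of y] and r = right[of y]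
    have "(1 - 3 * W y) / y \<le> 0" using p r y x by (intro divide_nonpos_pos) auto
    moreover have "2 * y * (1 + eps) * W y * (W y + eps) * (D y - W y) / B_fun eps y (D y) (W y) \<le> 0"
      using p r y x e by (intro divide_nonpos_pos mult_nonneg_nonpos mult_nonneg_nonneg) auto
    ultimately show "W_rhs eps y (D y) (W y) \<le> 0" by simp
  qed
  have D: "D x \<le> D b"
  proof (rule DERIV_nonneg_imp_le[where f = D])
    show "continuous_on {x..b} D"
      using solves_EE_cont(1)[OF S] x by (auto intro!: continuous_intros elim: continuous_on_subset)
    fix y assume y: "x < y" "y < b"
    note p = solves_EE_pos[OF S, of y] and r = right[of y]
    have "2 * y * (1 - eps) * D y * (W y + eps) * (D y - W y) / B_fun eps y (D y) (W y) \<le> 0"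
      using p y x e r by (intro divide_nonpos_pos mult_nonneg_nonpos mult_nonneg_nonneg) auto
    then show "\<exists>d\<ge>0. (D has_real_derivative d) (at y)"
      using y(1) x(1) by - (rule exI, rule conjI[rotated], rule solves_EE_at(1)[OF S _ y(2)], simp_all)
  qed (use x in simp)
  show "1/3 < W x \<and> D x < W x" using W D b by simp
qed

text \<open>The exponent cancels the factor 1 - eps in D'. Moreover q^2 = x^2 D powr (eta eps) D^2,
  the quantity that competes with 1 in D powr (eta eps) * Q.\<close>

definition q_fun :: "real \<Rightarrow> real \<Rightarrow> real \<Rightarrow> real" where
  "q_fun eps x D = x * D powr (1 / (1 - eps))"

text \<open>x q' / q = Q / B, so q increases with x as long as Q and B are positive.\<close>

definition Q_fun :: "real \<Rightarrow> real \<Rightarrow> real \<Rightarrow> real \<Rightarrow> real" where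
  "Q_fun eps x D W = B_fun eps x D W - 2 * x^2 * (W + eps) * (D - W)"

lemma q_fun_sq: "eps < 1 \<Longrightarrow> 0 < D \<Longrightarrow> (q_fun eps x D)^2 = x^2 * D powr (eta eps) * D^2"
proof -
  assume e: "eps < 1" and D: "0 < D"
  have "(D powr (1 / (1 - eps)))^2 = D powr (2 / (1 - eps))" by (simp add: power2_eq_square powr_add[symmetric])
  also have "2 / (1 - eps) = eta eps + 2" using e by (simp add: eta_def field_simps)
  also have "D powr (eta eps + 2) = D powr (eta eps) * D^2" using D by (simp add: powr_add)
  finally show ?thesis by (simp add: q_fun_def power_mult_distrib)
qed

text \<open>Up to terms with a factor eps the bracket is (W - D)^2 - D^2, hence at least - D^2. On
  1/3 <= W <= D the inequality D <= 3 D^2 bounds the coefficient of eps by 16 D^2, which is rounded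
  up to 20 D^2.\<close>

lemma Q_fun_lower:
  assumes e: "0 \<le> eps" "eps < 1" and W: "1/3 \<le> W" "W \<le> D"
  shows "1 - (1 + 20 * eps) * (q_fun eps x D)^2 \<le> Q_fun eps x D W * D powr (eta eps)"
proof -
  define Y where "Y = x^2 * D powr (eta eps)"
  define R where "R = (1 + eps) * W^2 - 2 * eps * W + eps - eps^2 - D * ((2 + 4 * eps) * W + 2 * eps)"
  have D: "0 < D" using W by simp
  have "D powr (- eta eps) * D powr (eta eps) = 1" using D by (simp add: powr_minus)
  then have Q: "Q_fun eps x D W * D powr (eta eps) = 1 + Y * R"
    by (simp add: Q_fun_def B_fun_def R_def Y_def algebra_simps power2_eq_square)
  have DD: "D \<le> 3 * D^2" using mult_right_mono[of "1/3" D D] W by (simp add: power2_eq_square)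
  have WD: "D * W \<le> D * D" using W by (intro mult_left_mono) auto
  have "2 * W + 4 * (D * W) + 2 * D + eps - 1 \<le> 20 * D^2" using DD WD W e unfolding power2_eq_square by linarith
  then have "2 * W + 4 * (D * W) + 2 * D + eps - 1 - W^2 \<le> 20 * D^2" using zero_le_power2[of W] by linarith
  then have "eps * (2 * W + 4 * (D * W) + 2 * D + eps - 1 - W^2) \<le> eps * (20 * D^2)"
    using e by (intro mult_left_mono) auto
  moreover have "R = (W - D)^2 - D^2 - eps * (2 * W + 4 * (D * W) + 2 * D + eps - 1 - W^2)"
    by (simp add: R_def algebra_simps power2_eq_square)
  moreover have "(1 + 20 * eps) * D^2 = D^2 + eps * (20 * D^2)" by (simp add: algebra_simps)
  ultimately have "R \<ge> - ((1 + 20 * eps) * D^2)" using zero_le_power2[of "W - D"] by linarith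
  then have "Y * - ((1 + 20 * eps) * D^2) \<le> Y * R" by (intro mult_left_mono) (auto simp: Y_def)
  then show ?thesis unfolding Q q_fun_sq[OF e(2) D] Y_def by (simp add: algebra_simps)
qed

lemma q_fun_deriv:
  assumes S: "solves_EE eps {a..b} D W" and e: "eps < 1" and x: "a < x" "x < b"
  shows "((\<lambda>x. q_fun eps x (D x)) has_real_derivative
    D x powr (1 / (1 - eps)) * (Q_fun eps x (D x) (W x) / B_fun eps x (D x) (W x))) (at x)"
proof -
  have p: "0 < D x" "0 < B_fun eps x (D x) (W x)" using solves_EE_pos[OF S, of x] x by auto
  define d where "d = D_rhs eps x (D x) (W x)"
  have d: "(D has_real_derivative d) (at x)" unfolding d_def by (rule solves_EE_at(1)[OF S x])
  define k where "k = 1 / (1 - eps)"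
  have k: "k * (1 - eps) = 1" using e by (simp add: k_def)
  have "((\<lambda>x. x * D x powr k) has_real_derivative D x powr k + x * (k * D x powr (k - 1) * d)) (at x)"
    using p by (auto intro!: derivative_eq_intros d)
  also have "D x powr (k - 1) = D x powr k / D x" using p by (simp add: powr_diff)
  also have "D x powr k + x * (k * (D x powr k / D x) * d) = D x powr k * (1 + x * k * (d / D x))"
    by (simp add: algebra_simps)
  also have "x * k * (d / D x) = - (2 * x^2 * (k * (1 - eps)) * (W x + eps) * (D x - W x) / B_fun eps x (D x) (W x))"
    using p by (simp add: d_def power2_eq_square)
  also have "1 + \<dots> = Q_fun eps x (D x) (W x) / B_fun eps x (D x) (W x)"
    using p unfolding k by (simp add: Q_fun_def diff_divide_distrib)
  finally show ?thesis unfolding q_fun_def k_def .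
qed

text \<open>Q >= 0 says that 2 x^2 (W + eps) (D - W) / B is at most 1. In x W' this turns 1 - 3 W
  into at most 1 - 3 W + (1 + eps) W: the origin of the threshold 1 / (2 - eps).\<close>

lemma W_rate_le:
  assumes "0 < x" "0 \<le> W" "0 < B_fun eps x D W" "0 \<le> Q_fun eps x D W" "0 \<le> eps"
  shows "W_rhs eps x D W \<le> (1 - (2 - eps) * W) / x"
proof -
  have "2 * x^2 * (W + eps) * (D - W) / B_fun eps x D W \<le> 1" using assms(3,4) by (simp add: Q_fun_def)
  then have "(1 + eps) * W * (2 * x^2 * (W + eps) * (D - W) / B_fun eps x D W) \<le> (1 + eps) * W * 1"
    using assms by (intro mult_left_mono) auto
  then have "(1 - 3 * W + (1 + eps) * W * (2 * x^2 * (W + eps) * (D - W) / B_fun eps x D W)) / x \<le> (1 - (2 - eps) * W) / x"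
    using assms(1) by (intro divide_right_mono) (auto simp: algebra_simps)
  moreover have "(1 + eps) * W * (2 * x^2 * (W + eps) * (D - W) / B_fun eps x D W) / x = 2 * x * (1 + eps) * W * (W + eps) * (D - W) / B_fun eps x D W"
    using assms(1) by (simp add: power2_eq_square)
  ultimately show ?thesis by (simp add: add_divide_distrib)
qed

text \<open>\<theta> is the bound for q at the start, and \<kappa> is the margin left in 1 - (1 + 20
  eps) q^2, the lower bound for D powr (eta eps) * Q.\<close>

locale left_region =
  fixes eps \<theta> \<kappa> :: real
  assumes e: "0 < eps" "eps < 1" and \<theta>: "0 < \<theta>" and \<kappa>: "0 < \<kappa>" and \<theta>\<kappa>: "(1 + 20 * eps) * \<theta>^2 \<le> 1 - \<kappa>"
begin

lemma Q_pos:
  assumes "1/3 \<le> W" "W \<le> D" "0 \<le> q_fun eps x D" "q_fun eps x D \<le> \<theta>"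
  shows "\<kappa> \<le> Q_fun eps x D W * D powr (eta eps)" "0 < Q_fun eps x D W" "Q_fun eps x D W \<le> B_fun eps x D W"
proof -
  have "(1 + 20 * eps) * (q_fun eps x D)^2 \<le> (1 + 20 * eps) * \<theta>^2"
    using assms e by (intro mult_left_mono power_mono) auto
  then show k: "\<kappa> \<le> Q_fun eps x D W * D powr (eta eps)"
    using Q_fun_lower[of eps W D x] assms e \<theta>\<kappa> by linarith
  then have "0 < Q_fun eps x D W * D powr (eta eps)" using \<kappa> by linarith
  then show "0 < Q_fun eps x D W" by (simp add: zero_less_mult_iff)
  show "Q_fun eps x D W \<le> B_fun eps x D W" using assms e by (simp add: Q_fun_def)
qed

lemma q_fun_nonneg: "0 \<le> x \<Longrightarrow> 0 \<le> q_fun eps x D" by (simp add: q_fun_def)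

text \<open>The bound q < \<theta> and the monotonicity of q support each other: the former gives Q
  > 0, the latter restores the bound further left.\<close>

lemma q_backward:
  assumes S: "solves_EE eps {a..b} D W" and q: "q_fun eps b (D b) < \<theta>"
    and DW: "\<And>x. a < x \<Longrightarrow> x \<le> b \<Longrightarrow> 1/3 \<le> W x \<and> W x \<le> D x" and x: "x \<in> {a..b}"
  shows "q_fun eps x (D x) \<le> q_fun eps b (D b)"
proof -
  have cont: "continuous_on {a..b} (\<lambda>x. q_fun eps x (D x))"
    unfolding q_fun_def using solves_EE_cont(1)[OF S] solves_EE_pos(2)[OF S] by (intro continuous_intros) force+
  have mono: "q_fun eps x (D x) \<le> q_fun eps b (D b)" if x: "a \<le> x" "x \<le> b"
    and right: "\<And>y. x < y \<Longrightarrow> y \<le> b \<Longrightarrow> q_fun eps y (D y) < \<theta>" for x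
  proof (rule DERIV_nonneg_imp_le[where f = "\<lambda>x. q_fun eps x (D x)"])
    show "continuous_on {x..b} (\<lambda>x. q_fun eps x (D x))" by (rule continuous_on_subset[OF cont]) (use x in auto)
    fix y assume y: "x < y" "y < b"
    have p: "0 < y" "0 < B_fun eps y (D y) (W y)" using solves_EE_pos[OF S, of y] x y by auto
    have "0 < Q_fun eps y (D y) (W y)" using DW[of y] right[of y] x y p by (intro Q_pos(2) q_fun_nonneg) auto
    then have "0 \<le> D y powr (1 / (1 - eps)) * (Q_fun eps y (D y) (W y) / B_fun eps y (D y) (W y))" using p by simp
    then show "\<exists>d\<ge>0. ((\<lambda>x. q_fun eps x (D x)) has_real_derivative d) (at y)"
      using q_fun_deriv[OF S e(2), of y] x y by auto
  qed (use x in simp)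
  have "q_fun eps y (D y) < \<theta>" if "y \<in> {a..b}" for y
  proof (rule backward_induct_Icc[of a b "\<lambda>y. q_fun eps y (D y) < \<theta>", OF _ _ that])
    show "closed {y\<in>{a..b}. \<not> q_fun eps y (D y) < \<theta>}"
      unfolding not_less using cont by (intro continuous_on_closed_Collect_le continuous_intros) auto
    fix z assume z: "a \<le> z" "z \<le> b" and "\<And>y. z < y \<Longrightarrow> y \<le> b \<Longrightarrow> q_fun eps y (D y) < \<theta>"
    then have "q_fun eps z (D z) \<le> q_fun eps b (D b)" by (intro mono) auto
    then show "q_fun eps z (D z) < \<theta>" using q by simp
  qed
  then show ?thesis using mono[of x] x by simp
qed

text \<open>Above 1 / (2 - eps) the rate bound gives W' <= 0, so W cannot decrease to the left. The
  rate bound relies on W <= D; if that failed somewhere with W > 1/3,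
  \<open>W_above_D_persists\<close> would already give the claim.\<close>

lemma W_large_persists:
  assumes S: "solves_EE eps {a..b} D W" and q: "q_fun eps b (D b) < \<theta>"
    and b: "1 / (2 - eps) < W b" and x: "x \<in> {a..b}"
  shows "1/3 < W x"
proof (rule ccontr)
  assume nl: "\<not> 1/3 < W x"
  have DW: "W y \<le> D y" if "x \<le> y" "y \<le> b" "1/3 < W y" for y
  proof (rule ccontr)
    assume "\<not> W y \<le> D y"
    moreover have "solves_EE eps {a..y} D W" by (rule solves_EE_subset[OF S]) (use that in auto)
    ultimately show False using W_above_D_persists[of eps a y D W x] e that x nl by auto
  qed
  have third: "1/3 < 1 / (2 - eps)" using e by (simp add: field_simps)
  have "1 / (2 - eps) < W y" if y: "y \<in> {x..b}" for y
  proof (rule backward_induct_Icc[of x b "\<lambda>y. 1 / (2 - eps) < W y", OF _ _ y])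
    have "continuous_on {x..b} W" by (rule continuous_on_subset[OF solves_EE_cont(2)[OF S]]) (use x in auto)
    then show "closed {y\<in>{x..b}. \<not> 1 / (2 - eps) < W y}"
      unfolding not_less by (intro continuous_on_closed_Collect_le continuous_intros) auto
    fix y assume y: "x \<le> y" "y \<le> b" and right: "\<And>z. y < z \<Longrightarrow> z \<le> b \<Longrightarrow> 1 / (2 - eps) < W z"
    have Sy: "solves_EE eps {y..b} D W" by (rule solves_EE_subset[OF S]) (use x y in auto)
    have r: "1/3 \<le> W z \<and> W z \<le> D z" if "y < z" "z \<le> b" for z
      using right[OF that] third DW[of z] that y by force
    have "W b \<le> W y"
    proof (rule solves_EE_W_backward[OF Sy])
      fix z assume z: "y < z" "z < b"
      have p: "0 < z" "0 < B_fun eps z (D z) (W z)" using solves_EE_pos[OF Sy, of z] z by auto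
      have "q_fun eps z (D z) \<le> q_fun eps b (D b)" by (rule q_backward[OF Sy q r]) (use z in auto)
      then have "0 < Q_fun eps z (D z) (W z)" using r[of z] z p q by (intro Q_pos(2) q_fun_nonneg) auto
      then have "W_rhs eps z (D z) (W z) \<le> (1 - (2 - eps) * W z) / z" using r[of z] z p e by (intro W_rate_le) auto
      also have "\<dots> \<le> 0" using right[of z] z p e by (intro divide_nonpos_pos) (auto simp: field_simps)
      finally show "W_rhs eps z (D z) (W z) \<le> 0" .
    qed (use y in auto)
    then show "1 / (2 - eps) < W y" using b by simp
  qed
  from this[of x] show False using nl third x by auto
qed

text \<open>If neither exit occurs, the bounds sustain each other: D > 1/3 gives 1/3 <= W <= D, and
  then D grows to the left. The assumptions \<open>low\<close> and \<open>high\<close> are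
  conditional because an exit is known to persist only where D > 1/3 or W > 1/3,
  respectively.\<close>

lemma left_trichotomy:
  assumes S: "solves_EE eps {a..b} D W" and D: "1/3 < D b" and q: "q_fun eps b (D b) < \<theta>"
    and low: "\<And>y. y \<in> {a..b} \<Longrightarrow> 1/3 < D y \<Longrightarrow> 1/3 \<le> W y"
    and high: "\<And>y. y \<in> {a..b} \<Longrightarrow> 1/3 < W y \<Longrightarrow> W y \<le> D y"
    and x: "x \<in> {a..b}"
  shows "1/3 \<le> W x \<and> W x \<le> D x \<and> D b \<le> D x \<and> q_fun eps x (D x) \<le> q_fun eps b (D b)"
proof -
  have DW: "1/3 \<le> W y \<and> W y \<le> D y" if "y \<in> {a..b}" "1/3 < D y" for y
    using low[OF that] high[OF that(1)] that by force
  have D_back: "D b \<le> D x" if x: "a \<le> x" "x \<le> b" and right: "\<And>y. x < y \<Longrightarrow> y \<le> b \<Longrightarrow> 1/3 < D y" for x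
  proof (rule solves_EE_D_backward[OF S _ e(2) x])
    fix y assume "x < y" "y < b"
    then show "0 \<le> (W y + eps) * (D y - W y)" using right[of y] DW[of y] x e by (intro mult_nonneg_nonneg) auto
  qed (use e in simp)
  have D': "1/3 < D y" if "y \<in> {a..b}" for y
  proof (rule backward_induct_Icc[of a b "\<lambda>y. 1/3 < D y", OF _ _ that])
    show "closed {y\<in>{a..b}. \<not> 1/3 < D y}"
      unfolding not_less using solves_EE_cont[OF S] by (intro continuous_on_closed_Collect_le continuous_intros) auto
    fix z assume z: "a \<le> z" "z \<le> b" and "\<And>y. z < y \<Longrightarrow> y \<le> b \<Longrightarrow> 1/3 < D y"
    then have "D b \<le> D z" by (intro D_back) auto
    then show "1/3 < D z" using D by simp
  qed
  moreover have "q_fun eps x (D x) \<le> q_fun eps b (D b)" by (rule q_backward[OF S q _ x]) (use DW D' in auto)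
  ultimately show ?thesis using DW[of x] D_back[of x] x by auto
qed

text \<open>At x itself D > 1/3 is unknown. By \<open>left_trichotomy\<close> some y in [x, b] has
  both D > 1/3 and W < 1/3, and persistence is applied from y.\<close>

lemma low_persists:
  assumes S: "solves_EE eps {a..b} D W" and D: "1/3 < D b" and q: "q_fun eps b (D b) < \<theta>"
    and x: "x \<in> {a..b}" "W x < 1/3" and z: "z \<in> {a..x}"
  shows "W z < 1/3"
proof -
  have Sx: "solves_EE eps {x..b} D W" by (rule solves_EE_subset[OF S]) (use x in auto)
  have "\<exists>y\<in>{x..b}. 1/3 < D y \<and> W y < 1/3"
  proof (rule ccontr)
    assume no: "\<not> (\<exists>y\<in>{x..b}. 1/3 < D y \<and> W y < 1/3)"
    have "1/3 \<le> W x \<and> W x \<le> D x \<and> D b \<le> D x \<and> q_fun eps x (D x) \<le> q_fun eps b (D b)"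
    proof (rule left_trichotomy[OF Sx D q])
      show "1/3 \<le> W y" if "y \<in> {x..b}" "1/3 < D y" for y using no that by force
      fix y assume y: "y \<in> {x..b}" "1/3 < W y"
      show "W y \<le> D y"
      proof (rule ccontr)
        assume "\<not> W y \<le> D y"
        moreover have "solves_EE eps {x..y} D W" by (rule solves_EE_subset[OF Sx]) (use y in auto)
        ultimately have "1/3 < W x \<and> D x < W x" using W_above_D_persists[of eps x y D W x] e y by auto
        then show False using x(2) by simp
      qed
    qed (use x in auto)
    then show False using x(2) by simp
  qed
  then obtain y where y: "y \<in> {x..b}" "1/3 < D y" "W y < 1/3" by blast
  have "solves_EE eps {a..y} D W" by (rule solves_EE_subset[OF S]) (use y in auto)
  then show ?thesis using W_below_third_persists[of eps a y D W z] e y z x by auto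
qed

text \<open>If W > D with W > 1/3 occurs somewhere in [x, b], it persists from there. Otherwise 1/3
  <= W <= D and the bound on q hold on [x, b], so W x must exceed 1 / (2 - eps) and
  \<open>W_large_persists\<close> takes over.\<close>

lemma high_persists:
  assumes S: "solves_EE eps {a..b} D W" and D: "1/3 < D b" and q: "q_fun eps b (D b) < \<theta>"
    and x: "x \<in> {a..b}" "1/3 < W x" "D x < W x \<or> 1 / (2 - eps) < W x" and z: "z \<in> {a..x}"
  shows "1/3 < W z"
proof (cases "\<exists>y\<in>{x..b}. 1/3 < W y \<and> D y < W y")
  case True
  then obtain y where y: "y \<in> {x..b}" "1/3 < W y" "D y < W y" by blast
  have "solves_EE eps {a..y} D W" by (rule solves_EE_subset[OF S]) (use y in auto)
  then show ?thesis using W_above_D_persists[of eps a y D W z] e y z x by auto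
next
  case False
  have Sx: "solves_EE eps {x..b} D W" by (rule solves_EE_subset[OF S]) (use x in auto)
  have "1/3 \<le> W x \<and> W x \<le> D x \<and> D b \<le> D x \<and> q_fun eps x (D x) \<le> q_fun eps b (D b)"
  proof (rule left_trichotomy[OF Sx D q])
    fix y assume y: "y \<in> {x..b}" "1/3 < D y"
    show "1/3 \<le> W y"
    proof (rule ccontr)
      assume "\<not> 1/3 \<le> W y"
      moreover have "solves_EE eps {x..y} D W" by (rule solves_EE_subset[OF Sx]) (use y in auto)
      ultimately have "W x < 1/3" using W_below_third_persists[of eps x y D W x] e y by auto
      then show False using x(2) by simp
    qed
  qed (use x False in auto)
  moreover have "solves_EE eps {a..x} D W" by (rule solves_EE_subset[OF S]) (use x in auto)
  ultimately show ?thesis using W_large_persists[of a x D W z] x z q by auto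
qed

end

subsection \<open>Analyticity of solutions\<close>

text \<open>Writing \<open>u = u0 + t y\<close> turns the equation \<open>t u' + (\<mu> - 1) (u - u0) = t F(t, u)\<close> into
  \<open>t y' + \<mu> y = F(t, u0 + t y)\<close>, whose right-hand side is a contraction in \<open>y\<close> for small \<open>t\<close>.\<close>

definition fuchs_regular :: "('i \<Rightarrow> complex \<Rightarrow> ('i \<Rightarrow> complex) \<Rightarrow> complex) \<Rightarrow> ('i \<Rightarrow> real) \<Rightarrow> real \<Rightarrow> real \<Rightarrow> bool" where
  "fuchs_regular F u0 \<rho> L \<longleftrightarrow> 0 < \<rho> \<and> 0 \<le> L \<and>
    (\<forall>i t u v d. norm t < \<rho> \<longrightarrow> (\<forall>j. norm (u j - of_real (u0 j)) \<le> \<rho> \<and> norm (v j - of_real (u0 j)) \<le> \<rho> \<and> norm (u j - v j) \<le> d) \<longrightarrow>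
      norm (F i t u - F i t v) \<le> L * d) \<and>
    (\<forall>i Y \<rho>'. \<rho>' \<le> \<rho> \<longrightarrow> (\<forall>j. Y j holomorphic_on ball 0 \<rho>' \<and> (\<forall>t\<in>ball 0 \<rho>'. norm (Y j t - of_real (u0 j)) \<le> \<rho>)) \<longrightarrow>
      (\<lambda>t. F i t (\<lambda>j. Y j t)) holomorphic_on ball 0 \<rho>')"

text \<open>The last condition keeps (u - u0) / t within distance 1 of f (0, u0) / \<mu>, the value
  at t = 0 forced by the equation for y. It puts the solution into the ball where uniqueness
  holds.\<close>

definition fuchs_solution :: "('i \<Rightarrow> real \<Rightarrow> ('i \<Rightarrow> real) \<Rightarrow> real) \<Rightarrow> ('i \<Rightarrow> real) \<Rightarrow> ('i \<Rightarrow> real) \<Rightarrow> real \<Rightarrow> real \<Rightarrow>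
    ('i \<Rightarrow> real \<Rightarrow> real) \<Rightarrow> ('i \<Rightarrow> real \<Rightarrow> real) \<Rightarrow> bool" where
  "fuchs_solution f \<mu> u0 \<sigma> T u u' \<longleftrightarrow> (\<forall>i t. 0 < \<sigma> * t \<longrightarrow> \<sigma> * t < T \<longrightarrow> (u i has_real_derivative u' i t) (at t) \<and>
    t * u' i t + (\<mu> i - 1) * (u i t - u0 i) = t * f i t (\<lambda>j. u j t) \<and> \<bar>u i t - u0 i - t * (f i 0 u0 / \<mu> i)\<bar> \<le> \<bar>t\<bar>)"

text \<open>A solution that lives on one side only must agree there with the two-sided analytic g;
  this is what gives analyticity at the end point x = 0.\<close>

definition fuchs_analytic :: "('i \<Rightarrow> real \<Rightarrow> ('i \<Rightarrow> real) \<Rightarrow> real) \<Rightarrow> ('i \<Rightarrow> real) \<Rightarrow> ('i \<Rightarrow> real) \<Rightarrow> real \<Rightarrow> ('i \<Rightarrow> real \<Rightarrow> real) \<Rightarrow> bool" where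
  "fuchs_analytic f \<mu> u0 T g \<longleftrightarrow> 0 < T \<and> (\<forall>i t. \<bar>t\<bar> < T \<longrightarrow> (\<exists>G. (\<lambda>s. g i (t + s)) has_fps_expansion G)) \<and> (\<forall>i. g i 0 = u0 i) \<and>
    (\<forall>\<sigma> T' u u' i t. \<sigma> = 1 \<or> \<sigma> = - 1 \<longrightarrow> T' \<le> T \<longrightarrow> fuchs_solution f \<mu> u0 \<sigma> T' u u' \<longrightarrow> 0 < \<sigma> * t \<longrightarrow> \<sigma> * t < T' \<longrightarrow> u i t = g i t)"

theorem fuchsian_analytic:
  fixes F :: "'i \<Rightarrow> complex \<Rightarrow> ('i \<Rightarrow> complex) \<Rightarrow> complex" and u0 \<mu> :: "'i \<Rightarrow> real"
  assumes fin: "finite (UNIV :: 'i set)" and \<mu>: "\<And>i. \<mu> i > 0" and reg: "fuchs_regular F u0 \<rho>0 L"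
    and sym: "\<And>i t u. F i (cnj t) (\<lambda>j. cnj (u j)) = cnj (F i t u)"
    and real: "\<And>i t u. F i (of_real t) (\<lambda>j. of_real (u j)) = of_real (f i t u)"
  shows "\<exists>T g. fuchs_analytic f \<mu> u0 T g"
proof -
  have \<rho>0: "\<rho>0 > 0" and L: "L \<ge> 0"
    and lip: "\<And>i t u v d. \<lbrakk>norm t < \<rho>0; \<And>j. norm (u j - of_real (u0 j)) \<le> \<rho>0; \<And>j. norm (v j - of_real (u0 j)) \<le> \<rho>0;
        \<And>j. norm (u j - v j) \<le> d\<rbrakk> \<Longrightarrow> norm (F i t u - F i t v) \<le> L * d"
    and holo: "\<And>i Y \<rho>. \<lbrakk>\<rho> \<le> \<rho>0; \<And>j. Y j holomorphic_on ball 0 \<rho>; \<And>j t. t \<in> ball 0 \<rho> \<Longrightarrow> norm (Y j t - of_real (u0 j)) \<le> \<rho>0\<rbrakk> \<Longrightarrow>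
        (\<lambda>t. F i t (\<lambda>j. Y j t)) holomorphic_on ball 0 \<rho>"
    using reg unfolding fuchs_regular_def by blast+
  define c where "c i = f i 0 u0 / \<mu> i" for i
  have c: "F i 0 (\<lambda>j. of_real (u0 j)) = of_real (\<mu> i * c i)" for i
    using real[of i 0 u0] \<mu>[of i] by (simp add: c_def)
  \<comment> \<open>Bounds |y j| on the ball of radius 1 around c, for all j.\<close>
  define C where "C = (\<Sum>i\<in>UNIV. \<bar>c i\<bar>) + 1"
  have C: "\<bar>c i\<bar> + 1 \<le> C" "C > 0" for i
    using member_le_sum[of i UNIV "\<lambda>i. \<bar>c i\<bar>"] fin sum_nonneg[of UNIV "\<lambda>i. \<bar>c i\<bar>"] by (auto simp: C_def)
  define m where "m = Min (range \<mu>)"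
  have m: "m > 0" "m \<le> \<mu> i" for i using fin \<mu> by (auto simp: m_def)
  have "\<exists>d>0. \<forall>i t. norm t < d \<longrightarrow> norm (F i t (\<lambda>j. of_real (u0 j)) - F i 0 (\<lambda>j. of_real (u0 j))) < m / 4"
  proof -
    have "\<forall>i\<in>UNIV. \<forall>\<^sub>F t in nhds 0. norm (F i t (\<lambda>j. of_real (u0 j)) - F i 0 (\<lambda>j. of_real (u0 j))) < m / 4"
    proof
      fix i
      have "(\<lambda>t. F i t (\<lambda>j. of_real (u0 j))) holomorphic_on ball 0 \<rho>0"
        using \<rho>0 by (intro holo) auto
      from holomorphic_on_imp_continuous_on[OF this] have "isCont (\<lambda>t. F i t (\<lambda>j. of_real (u0 j))) 0"
        using \<rho>0 by (simp add: continuous_on_eq_continuous_at[OF open_ball])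
      then have "((\<lambda>t. F i t (\<lambda>j. of_real (u0 j))) \<longlongrightarrow> F i 0 (\<lambda>j. of_real (u0 j))) (nhds 0)"
        using tendsto_at_iff_tendsto_nhds[of "\<lambda>t. F i t (\<lambda>j. of_real (u0 j))" 0] by (simp add: continuous_at)
      from tendstoD[OF this, of "m / 4"] show "\<forall>\<^sub>F t in nhds 0. norm (F i t (\<lambda>j. of_real (u0 j)) - F i 0 (\<lambda>j. of_real (u0 j))) < m / 4"
        using m by (simp add: dist_norm)
    qed
    then have "\<forall>\<^sub>F t in nhds 0. \<forall>i\<in>UNIV. norm (F i t (\<lambda>j. of_real (u0 j)) - F i 0 (\<lambda>j. of_real (u0 j))) < m / 4"
      by (intro eventually_ball_finite[OF fin])
    then show ?thesis by (auto simp: eventually_nhds_metric dist_norm)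
  qed
  then obtain d where d: "d > 0" "\<And>i t. norm t < d \<Longrightarrow> norm (F i t (\<lambda>j. of_real (u0 j)) - F i 0 (\<lambda>j. of_real (u0 j))) < m / 4"
    by blast
  \<comment> \<open>Chosen so that u0 + t y stays in the domain of F, and so that the factor t in
    front of y reduces the Lipschitz constant to L \<rho> <= m / 4, half of what the contraction
    constant 1/2 allows.\<close>
  define \<rho> where "\<rho> = min (min \<rho>0 d) (min (\<rho>0 / C) (m / (4 * (L + 1) * C)))"
  have \<rho>: "\<rho> > 0" "\<rho> \<le> \<rho>0" "\<rho> \<le> d" "\<rho> * C \<le> \<rho>0" "\<rho> * ((L + 1) * C) \<le> m / 4"
  proof -
    have K: "4 * (L + 1) * C > 0" using L C(2) by simp
    show "\<rho> > 0" "\<rho> \<le> \<rho>0" "\<rho> \<le> d"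
      using \<rho>0 d(1) C(2) m(1) K by (auto simp: \<rho>_def simp del: mult_pos_pos)
    have "\<rho> \<le> \<rho>0 / C" "\<rho> \<le> m / (4 * (L + 1) * C)" by (auto simp: \<rho>_def)
    then show "\<rho> * C \<le> \<rho>0" "\<rho> * ((L + 1) * C) \<le> m / 4"
      unfolding pos_le_divide_eq[OF C(2)] pos_le_divide_eq[OF K] by (auto simp: algebra_simps)
  qed
  have L\<rho>: "L * \<rho> * C \<le> m / 4" "L * \<rho> \<le> m / 4"
  proof -
    have C1: "1 \<le> C" using C(1)[of undefined] by simp
    have "L * \<rho> * C \<le> (L + 1) * \<rho> * C" using \<rho>(1) C(2) by (intro mult_right_mono) auto
    also have "\<dots> = \<rho> * ((L + 1) * C)" by simp
    finally show 1: "L * \<rho> * C \<le> m / 4" using \<rho>(5) by linarith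
    have "L * \<rho> * 1 \<le> L * \<rho> * C" using C1 \<rho>(1) L by (intro mult_left_mono) auto
    then show "L * \<rho> \<le> m / 4" using 1 by simp
  qed
  define N where "N = (\<lambda>i t y. F i t (\<lambda>j. of_real (u0 j) + t * y j))"
  have near: "norm (of_real (u0 j) + t * y - of_real (u0 j)) \<le> \<rho>0" if "norm t < \<rho>" "norm (y - of_real (c j)) \<le> 1" for t y :: complex and j :: 'i
  proof -
    have "norm y \<le> norm (y - of_real (c j)) + norm (complex_of_real (c j))"
      using norm_triangle_ineq[of "y - of_real (c j)" "complex_of_real (c j)"] by simp
    then have "norm y \<le> C" using that(2) C(1)[of j] by simp
    then have "norm (t * y) \<le> \<rho> * C" unfolding norm_mult using that(1) \<rho>(1) by (intro mult_mono) auto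
    then show ?thesis using \<rho>(4) by simp
  qed
  interpret rs: rs_contraction N c \<mu> "\<lambda>_. 1" \<rho> 1 "1 / 2"
  proof
    fix i u v and t :: complex and \<delta>
    assume t: "norm t < \<rho>" and "rs_ball c (\<lambda>_. 1) 1 u" "rs_ball c (\<lambda>_. 1) 1 v" "0 \<le> \<delta>" "\<And>j. norm (u j - v j) \<le> 1 * \<delta>"
    then have uv: "\<And>j. norm (u j - of_real (c j)) \<le> 1" "\<And>j. norm (v j - of_real (c j)) \<le> 1" "0 \<le> \<delta>" "\<And>j. norm (u j - v j) \<le> 1 * \<delta>"
      by (auto simp: rs_ball_def)
    have "norm (N i t u - N i t v) \<le> L * (\<rho> * \<delta>)" unfolding N_def
    proof (rule lip)
      show "norm t < \<rho>0" using t \<rho>(2) by simp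
      show "norm (of_real (u0 j) + t * u j - of_real (u0 j)) \<le> \<rho>0" "norm (of_real (u0 j) + t * v j - of_real (u0 j)) \<le> \<rho>0" for j
        using near[OF t, of "u j" j] near[OF t, of "v j" j] uv by simp_all
      show "norm (of_real (u0 j) + t * u j - (of_real (u0 j) + t * v j)) \<le> \<rho> * \<delta>" for j
      proof -
        have "norm (t * (u j - v j)) \<le> \<rho> * \<delta>"
          unfolding norm_mult using t uv(4)[of j] \<rho>(1) by (intro mult_mono) auto
        then show ?thesis by (simp add: algebra_simps)
      qed
    qed
    also have "\<dots> = L * \<rho> * \<delta>" by simp
    also have "\<dots> \<le> 1 / 2 * \<mu> i * \<delta>"
    proof (rule mult_right_mono)
      show "L * \<rho> \<le> 1 / 2 * \<mu> i" using L\<rho>(2) m(1) m(2)[of i] by linarith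
    qed (use uv(3) in simp)
    finally show "norm (N i t u - N i t v) \<le> 1 / 2 * \<mu> i * 1 * \<delta>" by simp
  qed (use \<rho>(1) \<mu> in auto)
  interpret rs: rs_problem N c \<mu> "\<lambda>_. 1" \<rho> 1 "1 / 2"
  proof
    show "norm (N i t (\<lambda>j. of_real (c j)) - of_real (\<mu> i * c i)) \<le> (1 - 1 / 2) * \<mu> i * 1 * 1" if t: "norm t < \<rho>" for i t
    proof -
      have "norm (N i t (\<lambda>j. of_real (c j)) - F i t (\<lambda>j. of_real (u0 j))) \<le> L * (\<rho> * C)"
        unfolding N_def
      proof (rule lip)
        show "norm t < \<rho>0" using t \<rho>(2) by simp
        show "norm (of_real (u0 j) + t * of_real (c j) - of_real (u0 j)) \<le> \<rho>0" for j by (rule near[OF t]) simp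
        show "norm (of_real (u0 j) + t * of_real (c j) - of_real (u0 j)) \<le> \<rho> * C" for j
          using t C(1)[of j] \<rho>(1) by (auto simp: norm_mult intro!: mult_mono)
      qed (use \<rho>0 \<rho>(1) C(2) in auto)
      moreover have "norm (F i t (\<lambda>j. of_real (u0 j)) - F i 0 (\<lambda>j. of_real (u0 j))) < m / 4"
        using t \<rho>(3) by (intro d(2)) auto
      ultimately have "norm (N i t (\<lambda>j. of_real (c j)) - F i 0 (\<lambda>j. of_real (u0 j))) \<le> L * (\<rho> * C) + m / 4"
        using norm_triangle_ineq[of "N i t (\<lambda>j. of_real (c j)) - F i t (\<lambda>j. of_real (u0 j))" "F i t (\<lambda>j. of_real (u0 j)) - F i 0 (\<lambda>j. of_real (u0 j))"]
        by simp
      then show ?thesis unfolding c using L\<rho>(1) m(2)[of i] by (simp add: mult_ac)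
    qed
    show "(\<lambda>t. N i t (\<lambda>j. Y j t)) holomorphic_on ball 0 \<rho>"
      if Y: "\<And>j. Y j holomorphic_on ball 0 \<rho>" "\<And>t. norm t < \<rho> \<Longrightarrow> rs_ball c (\<lambda>_. 1) 1 (\<lambda>j. Y j t)" for i Y
      unfolding N_def
    proof (rule holo[OF \<rho>(2)])
      show "(\<lambda>t. of_real (u0 j) + t * Y j t) holomorphic_on ball 0 \<rho>" for j by (intro holomorphic_intros Y)
      show "norm (of_real (u0 j) + t * Y j t - of_real (u0 j)) \<le> \<rho>0" if "t \<in> ball 0 \<rho>" for j t
        using near[of t "Y j t" j] Y(2)[of t] that by (simp add: rs_ball_def)
    qed
    show "N i (cnj t) (\<lambda>j. cnj (u j)) = cnj (N i t u)" for i t u unfolding N_def sym[symmetric] by simp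
  qed
  obtain y y' where sol: "rs_solution N c \<mu> (\<lambda>_. 1) 1 {t. \<bar>t\<bar> < \<rho>} y y'"
    and fps: "\<And>i t. \<bar>t\<bar> < \<rho> \<Longrightarrow> \<exists>G. (\<lambda>s. y i (t + s)) has_fps_expansion G"
    using rs.exists_real by blast
  define g where "g = (\<lambda>i t. u0 i + t * y i t)"
  have "\<exists>G. (\<lambda>s. g i (t + s)) has_fps_expansion G" if t: "\<bar>t\<bar> < \<rho>" for i t
  proof -
    obtain G where "(\<lambda>s. y i (t + s)) has_fps_expansion G" using fps[OF t] by blast
    then have "(\<lambda>s. u0 i + (t + s) * y i (t + s)) has_fps_expansion (fps_const (u0 i) + (fps_const t + fps_X) * G)"
      by (intro fps_expansion_intros)
    then show ?thesis unfolding g_def by blast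
  qed
  moreover have "g i 0 = u0 i" for i by (simp add: g_def)
  moreover have "u i t = g i t"
    if \<sigma>: "\<sigma> = 1 \<or> \<sigma> = - 1" and T': "T' \<le> \<rho>" and u: "fuchs_solution f \<mu> u0 \<sigma> T' u u'"
      and t: "0 < \<sigma> * t" "\<sigma> * t < T'" for \<sigma> T' u u' i t
  proof -
    define v where "v = (\<lambda>i t. (u i t - u0 i) / t)"
    define v' where "v' = (\<lambda>i t. (u' i t * t - (u i t - u0 i)) / (t * t))"
    have nz: "s \<noteq> 0" "\<bar>s\<bar> < \<rho>" if "0 < \<sigma> * s" "\<sigma> * s < T'" for s
      using that \<sigma> T' by auto
    have "\<bar>v i t - y i t\<bar> \<le> 1 * (0 / (1 - 1 / 2))"
    proof (rule rs.compare[where N' = N and \<sigma> = \<sigma> and T = T' and t = t])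
      show "rs_solution N c \<mu> (\<lambda>_. 1) 1 {t. 0 < \<sigma> * t \<and> \<sigma> * t < T'} y y'"
        using sol nz(2) by (auto simp: rs_solution_def)
      show "rs_solution N c \<mu> (\<lambda>_. 1) 1 {t. 0 < \<sigma> * t \<and> \<sigma> * t < T'} v v'"
        unfolding rs_solution_def mem_Collect_eq
      proof (intro allI ballI conjI; unfold mem_Collect_eq; elim conjE)
        fix j s assume s: "0 < \<sigma> * s" "\<sigma> * s < T'"
        have s0: "s \<noteq> 0" by (rule nz(1)[OF s])
        have us: "(u j has_real_derivative u' j s) (at s)" "\<bar>u j s - u0 j - s * c j\<bar> \<le> \<bar>s\<bar>"
            "s * u' j s + (\<mu> j - 1) * (u j s - u0 j) = s * f j s (\<lambda>j. u j s)"
          using u s unfolding fuchs_solution_def c_def by blast+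
        have "((\<lambda>s. u j s - u0 j) has_real_derivative u' j s) (at s)"
          using DERIV_diff[OF us(1) DERIV_const[of "u0 j"]] by simp
        from DERIV_divide[OF this DERIV_ident s0] show "(v j has_real_derivative v' j s) (at s)"
          unfolding v_def v'_def by simp
        have "v j s - c j = (u j s - u0 j - s * c j) / s" using s0 by (simp add: v_def field_simps)
        then show "\<bar>v j s - c j\<bar> \<le> 1 * 1" using us(2) s0 by (simp add: abs_divide)
        have "s * (s * v' j s + \<mu> j * v j s) = s * u' j s + (\<mu> j - 1) * (u j s - u0 j)"
          using s0 by (simp add: v_def v'_def field_simps)
        then have "s * v' j s + \<mu> j * v j s = f j s (\<lambda>j. u j s)"
          unfolding us(3) using s0 by (metis mult_left_cancel)
        moreover have "(\<lambda>j. of_real (u0 j) + of_real s * of_real (v j s)) = (\<lambda>j. complex_of_real (u j s))"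
          using s0 by (auto simp: v_def)
        then have "N j (of_real s) (\<lambda>j. of_real (v j s)) = of_real (f j s (\<lambda>j. u j s))"
          unfolding N_def real[symmetric] by (rule arg_cong)
        ultimately show "of_real (s * v' j s + \<mu> j * v j s) = N j (of_real s) (\<lambda>j. of_real (v j s))"
          by presburger
      qed
    qed (use \<sigma> T' \<mu> t in auto)
    then have "v i t = y i t" by simp
    then show ?thesis using nz(1)[OF t] by (simp add: v_def g_def field_simps)
  qed
  ultimately show ?thesis
    using \<rho>(1) unfolding fuchs_analytic_def by (intro exI[of _ \<rho>] exI[of _ g]) (intro conjI allI impI; assumption?, blast?)
qed

lemma DERIV_linear_approx:
  assumes "(f has_real_derivative d) (at a)"
  obtains \<delta> where "\<delta> > 0" "\<And>y. \<bar>y - a\<bar> < \<delta> \<Longrightarrow> \<bar>f y - f a - d * (y - a)\<bar> \<le> \<bar>y - a\<bar>"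
proof -
  have "\<forall>e>0. \<exists>\<delta>>0. \<forall>y. norm (y - a) < \<delta> \<longrightarrow> norm (f y - f a - d * (y - a)) \<le> e * norm (y - a)"
    using assms unfolding has_field_derivative_def has_derivative_at_alt by blast
  then obtain \<delta> where "\<delta> > 0" "\<forall>y. norm (y - a) < \<delta> \<longrightarrow> norm (f y - f a - d * (y - a)) \<le> 1 * norm (y - a)"
    using zero_less_one by blast
  then show ?thesis using that by auto
qed

lemma UNIV_son_var: "(UNIV :: son_var set) = {VP, VU, VG}" by (auto intro: son_var.exhaust)

text \<open>With \<open>E = D powr (- eta e)\<close> as a third unknown the system is rational. The variables
  \<open>VP, VU, VG\<close> now stand for \<open>D, W, E\<close>; at \<open>x0 = 0\<close> the singular term \<open>(1 - 3 W) / x\<close> is not part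
  of \<open>an_F\<close>.\<close>

definition an_B :: "real \<Rightarrow> 'a::real_normed_field \<Rightarrow> (son_var \<Rightarrow> 'a) \<Rightarrow> 'a" where
  "an_B e x u = u VG - ((u VU + of_real e)^2 - of_real e * (u VU - 1)^2 + 4 * of_real e * u VP * u VU) * x^2"

definition an_G :: "real \<Rightarrow> 'a::real_normed_field \<Rightarrow> (son_var \<Rightarrow> 'a) \<Rightarrow> 'a" where
  "an_G e x u = x * (u VU + of_real e) * (u VP - u VU) / an_B e x u"

definition an_F :: "real \<Rightarrow> real \<Rightarrow> son_var \<Rightarrow> 'a::real_normed_field \<Rightarrow> (son_var \<Rightarrow> 'a) \<Rightarrow> 'a" where
  "an_F e x0 i t u = (case i of
     VP \<Rightarrow> - (2 * (1 - of_real e) * u VP * an_G e (of_real x0 + t) u)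
   | VU \<Rightarrow> (if x0 = 0 then 0 else (1 - 3 * u VU) / (of_real x0 + t)) + 2 * (1 + of_real e) * u VU * an_G e (of_real x0 + t) u
   | VG \<Rightarrow> 4 * of_real e * u VG * an_G e (of_real x0 + t) u)"

lemma an_F_of_real:
  "an_F e x0 i (of_real t) (\<lambda>j. of_real (u j)) = (of_real (an_F e x0 i t u) :: 'a::real_normed_field)"
  by (cases i) (simp_all add: an_F_def an_G_def an_B_def)

lemma an_F_cnj: "an_F e x0 i (cnj t) (\<lambda>j. cnj (u j)) = cnj (an_F e x0 i t u)"
  by (cases i) (simp_all add: an_F_def an_G_def an_B_def)

text \<open>The denominator does not vanish at the base point, hence is bounded below on a small
  polydisc; for x0 > 0 the radius is at most x0 / 2, which also keeps x0 + t away from 0.\<close>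

lemma an_F_regular:
  fixes u0 :: "son_var \<Rightarrow> real"
  assumes x0: "0 \<le> x0" and B: "an_B e x0 u0 \<noteq> 0"
  obtains \<rho> L where "fuchs_regular (an_F e x0) u0 \<rho> L"
proof -
  define P where "P = (\<lambda>(t, D, W, E). an_B e (of_real x0 + t) (case_son_var D W E) :: complex)"
  define p0 where "p0 = (0::complex, complex_of_real (u0 VP), complex_of_real (u0 VU), complex_of_real (u0 VG))"
  define \<beta> where "\<beta> = norm (P p0) / 2"
  have "P p0 = of_real (an_B e x0 u0)" by (simp add: P_def p0_def an_B_def)
  then have \<beta>: "\<beta> > 0" "norm (P p0) = 2 * \<beta>" using B by (auto simp: \<beta>_def)
  have "isCont P p0" unfolding P_def case_prod_unfold an_B_def son_var.case by (intro continuous_intros)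
  then obtain d where d: "d > 0" "\<And>p. norm (p - p0) < d \<Longrightarrow> norm (P p - P p0) < \<beta>"
    using \<beta>(1) unfolding continuous_at_eps_delta dist_norm by blast
  define \<rho> where "\<rho> = min (d / 5) (if x0 = 0 then 1 else x0 / 2)"
  have \<rho>: "\<rho> > 0" "4 * \<rho> < d" "x0 \<noteq> 0 \<Longrightarrow> \<rho> \<le> x0 / 2"
    using d(1) x0 by (auto simp: \<rho>_def)
  have Bn: "\<beta> \<le> norm (an_B e (of_real x0 + t) u)"
    if t: "norm t \<le> \<rho>" and u: "\<And>j. norm (u j - complex_of_real (u0 j)) \<le> \<rho>" for t u
  proof -
    define p where "p = (t, u VP, u VU, u VG)"
    have "norm (p - p0) \<le> norm t + (norm (u VP - of_real (u0 VP)) + (norm (u VU - of_real (u0 VU)) + norm (u VG - of_real (u0 VG))))"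
      unfolding p_def p0_def diff_Pair diff_0_right by (intro order_trans[OF norm_Pair_le] add_left_mono order_refl)
    also have "\<dots> < d" using t u[of VP] u[of VU] u[of VG] \<rho>(2) by linarith
    finally have "norm (P p - P p0) < \<beta>" by (rule d(2))
    then have "norm (P p) \<ge> \<beta>"
      using \<beta>(2) norm_triangle_ineq2[of "P p0" "P p"] by (simp add: norm_minus_commute)
    moreover have "P p = an_B e (of_real x0 + t) u" by (simp add: P_def p_def an_B_def)
    ultimately show ?thesis by simp
  qed
  have xn: "x0 / 2 \<le> norm (complex_of_real x0 + t)" if "norm t \<le> \<rho>" "x0 \<noteq> 0" for t
    using norm_triangle_ineq2[of "complex_of_real x0" "- t"] \<rho>(3) that x0 by simp
  define K where "K = {(t :: complex, u). norm t \<le> \<rho> \<and> (\<forall>j. norm (u j - complex_of_real (u0 j)) \<le> \<rho>)}"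
  define \<delta> where "\<delta> = (\<lambda>u v :: son_var \<Rightarrow> complex. norm (u VP - v VP) + norm (u VU - v VU) + norm (u VG - v VG))"
  have \<delta>: "0 \<le> \<delta> u v" "norm (u j - v j) \<le> \<delta> u v" for u v j
    by (cases j; simp add: \<delta>_def)+
  note \<delta>' = \<delta>
  interpret lipschitz_functions K \<delta>
    by unfold_locales (rule \<delta>)
  have lx: "lip (\<lambda>t u. complex_of_real x0 + t)"
  proof (rule lip_of_x)
    show "norm (complex_of_real x0 + t) \<le> \<bar>x0\<bar> + \<rho>" if "(t, u) \<in> K" for t u
      using that norm_triangle_ineq[of "complex_of_real x0" t] by (simp add: K_def)
  qed
  have lu: "lip (\<lambda>t u. u j)" for j
  proof (rule lipI[of _ "\<bar>u0 j\<bar> + \<rho>" 1])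
    show "norm (u j) \<le> \<bar>u0 j\<bar> + \<rho>" if "(t, u) \<in> K" for t u
    proof -
      have "norm (u j - of_real (u0 j)) \<le> \<rho>" using that by (simp add: K_def)
      then show ?thesis using norm_triangle_ineq[of "u j - of_real (u0 j)" "complex_of_real (u0 j)"] by simp
    qed
  qed (use \<delta>' in auto)
  have lG: "lip (\<lambda>t u. an_G e (of_real x0 + t) u)" unfolding an_G_def
  proof (rule lip_divide[where c = \<beta>])
    show "lip (\<lambda>t u. an_B e (of_real x0 + t) u)"
      unfolding an_B_def by (intro lip_diff lip_add lip_mult lip_power lip_const lx lu)
    show "\<beta> \<le> norm (an_B e (of_real x0 + t) u)" if "(t, u) \<in> K" for t u
      using that Bn unfolding K_def by blast
  qed (intro lip_diff lip_add lip_mult lip_const lx lu \<beta>(1))+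
  have l0: "lip (\<lambda>t u. if x0 = 0 then 0 else (1 - 3 * u VU) / (of_real x0 + t))"
  proof (cases "x0 = 0")
    case False
    then have "lip (\<lambda>t u. (1 - 3 * u VU) / (of_real x0 + t))"
      using x0 xn by (intro lip_divide[where c = "x0 / 2"] lip_diff lip_mult lip_const lx lu) (auto simp: K_def)
    then show ?thesis using False by simp
  qed (simp add: lip_const)
  have "lip (an_F e x0 i)" for i unfolding an_F_def by (cases i; simp only: son_var.case)
      (intro lip_uminus lip_diff lip_add lip_mult lip_const lu lG l0)+
  then have "\<forall>i. \<exists>L\<ge>0. \<forall>t u v. (t, u) \<in> K \<longrightarrow> (t, v) \<in> K \<longrightarrow> norm (an_F e x0 i t u - an_F e x0 i t v) \<le> L * \<delta> u v"
    by (metis lipE)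
  then obtain Lf where Lf: "\<And>i. Lf i \<ge> 0"
    "\<And>i t u v. (t, u) \<in> K \<Longrightarrow> (t, v) \<in> K \<Longrightarrow> norm (an_F e x0 i t u - an_F e x0 i t v) \<le> Lf i * \<delta> u v"
    by metis
  define L where "L = 3 * (Lf VP + Lf VU + Lf VG)"
  have L: "L \<ge> 0" "3 * Lf i \<le> L" for i
    using Lf(1)[of VP] Lf(1)[of VU] Lf(1)[of VG] by (auto simp: L_def) (cases i; simp)
  show ?thesis
  proof (rule that[of \<rho> L], unfold fuchs_regular_def, intro conjI allI impI)
    show "norm (an_F e x0 i t u - an_F e x0 i t v) \<le> L * d"
      if t: "norm t < \<rho>" and u: "\<forall>j. norm (u j - complex_of_real (u0 j)) \<le> \<rho> \<and> norm (v j - of_real (u0 j)) \<le> \<rho> \<and> norm (u j - v j) \<le> d" for i t u v d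
    proof -
      have that: "0 \<le> d" "norm (u j - v j) \<le> d" for j using u norm_ge_zero order_trans by blast+
      have "(t, u) \<in> K" "(t, v) \<in> K" using t u by (auto simp: K_def)
      from Lf(2)[OF this] have "norm (an_F e x0 i t u - an_F e x0 i t v) \<le> Lf i * \<delta> u v" .
      also have "\<dots> \<le> Lf i * (3 * d)"
        using that(2)[of VP] that(2)[of VU] that(2)[of VG] Lf(1)[of i] by (intro mult_left_mono) (auto simp: \<delta>_def)
      also have "\<dots> \<le> L * d" using mult_right_mono[OF L(2)[of i] that(1)] by simp
      finally show ?thesis .
    qed
    show "(\<lambda>t. an_F e x0 i t (\<lambda>j. Y j t)) holomorphic_on ball 0 \<rho>'"
      if \<rho>': "\<rho>' \<le> \<rho>" and Y': "\<forall>j. Y j holomorphic_on ball 0 \<rho>' \<and> (\<forall>t\<in>ball 0 \<rho>'. norm (Y j t - complex_of_real (u0 j)) \<le> \<rho>)" for i Y \<rho>'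
    proof -
      have Y: "Y j holomorphic_on ball 0 \<rho>'" "t \<in> ball 0 \<rho>' \<Longrightarrow> norm (Y j t - complex_of_real (u0 j)) \<le> \<rho>" for j t
        using Y' by blast+
      have "an_B e (of_real x0 + t) (\<lambda>j. Y j t) \<noteq> 0" if "t \<in> ball 0 \<rho>'" for t
        using Bn[of t "\<lambda>j. Y j t"] Y(2)[OF that] that \<rho>' \<beta>(1) by auto
      moreover have "(\<lambda>t. an_B e (of_real x0 + t) (\<lambda>j. Y j t)) holomorphic_on ball 0 \<rho>'"
        unfolding an_B_def by (intro holomorphic_intros Y)
      ultimately have hG: "(\<lambda>t. an_G e (of_real x0 + t) (\<lambda>j. Y j t)) holomorphic_on ball 0 \<rho>'"
        unfolding an_G_def by (intro holomorphic_intros Y)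
      have h0: "(\<lambda>t. if x0 = 0 then 0 else (1 - 3 * Y VU t) / (of_real x0 + t)) holomorphic_on ball 0 \<rho>'"
      proof (cases "x0 = 0")
        case False
        have "of_real x0 + t \<noteq> 0" if "t \<in> ball 0 \<rho>'" for t :: complex
          using xn[of t] False x0 that \<rho>' by auto
        then show ?thesis using False by (simp, intro holomorphic_intros Y)
      qed simp
      show ?thesis unfolding an_F_def by (cases i; simp only: son_var.case) (intro holomorphic_intros Y hG h0)+
    qed
  qed (use \<rho> L in auto)
qed

lemma an_analytic:
  assumes "0 \<le> x0" "an_B e x0 u0 \<noteq> 0" and \<mu>: "\<And>i. \<mu> i > 0"
  shows "\<exists>T g. fuchs_analytic (an_F e x0) \<mu> u0 T g"
proof (rule an_F_regular[OF assms(1,2)])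
  fix \<rho> L assume "fuchs_regular (an_F e x0) u0 \<rho> L"
  then show ?thesis
    by (intro fuchsian_analytic[where F = "an_F e x0"] \<mu> an_F_cnj an_F_of_real) (simp add: UNIV_son_var)
qed

definition EE_u :: "real \<Rightarrow> (real \<Rightarrow> real) \<Rightarrow> (real \<Rightarrow> real) \<Rightarrow> real \<Rightarrow> son_var \<Rightarrow> real" where
  "EE_u e D W x i = (case i of VP \<Rightarrow> D x | VU \<Rightarrow> W x | VG \<Rightarrow> D x powr (- eta e))"

lemma an_B_EE: "an_B e x (EE_u e D W x) = B_fun e x (D x) (W x)"
  by (simp add: an_B_def EE_u_def B_fun_def algebra_simps)

lemma EE_u_deriv:
  assumes S: "solves_EE e {a..b} D W" and e: "e < 1" and x: "a < x0 + t" "x0 + t < b"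
  shows "((\<lambda>t. EE_u e D W (x0 + t) i) has_real_derivative
    (if x0 = 0 \<and> i = VU then (1 - 3 * W t) / t else 0) + an_F e x0 i t (EE_u e D W (x0 + t))) (at t)"
proof -
  have p: "0 < D (x0 + t)" "0 < B_fun e (x0 + t) (D (x0 + t)) (W (x0 + t))"
    using solves_EE_pos[OF S, of "x0 + t"] x by auto
  define X where "X = x0 + t"
  define G where "G = an_G e X (EE_u e D W X)"
  have G: "G = X * (W X + e) * (D X - W X) / B_fun e X (D X) (W X)"
    unfolding G_def an_G_def an_B_EE by (simp add: EE_u_def)
  have "(D has_real_derivative - (2 * (1 - e) * D X * G)) (at X)"
    by (rule DERIV_cong[OF solves_EE_at(1)[OF S x, folded X_def]]) (simp add: G)
  then have D: "((\<lambda>t. D (x0 + t)) has_real_derivative - (2 * (1 - e) * D X * G)) (at t)"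
    using DERIV_shift[of D _ t x0] by (simp add: X_def add.commute)
  have "(W has_real_derivative (1 - 3 * W X) / X + 2 * (1 + e) * W X * G) (at X)"
    by (rule DERIV_cong[OF solves_EE_at(2)[OF S x, folded X_def]]) (simp add: G)
  then have W: "((\<lambda>t. W (x0 + t)) has_real_derivative (1 - 3 * W X) / X + 2 * (1 + e) * W X * G) (at t)"
    using DERIV_shift[of W _ t x0] by (simp add: X_def add.commute)
  show ?thesis
  proof (cases i)
    case VP
    then show ?thesis using D by (simp add: an_F_def EE_u_def G_def X_def)
  next
    case VU
    then show ?thesis using W by (cases "x0 = 0") (simp_all add: an_F_def EE_u_def G_def X_def)
  next
    case VG
    have "((\<lambda>t. D (x0 + t) powr (- eta e)) has_real_derivative
        - eta e * D X powr (- eta e - 1) * - (2 * (1 - e) * D X * G)) (at t)"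
      using p by (auto intro!: derivative_eq_intros D simp: X_def)
    also have "- eta e * D X powr (- eta e - 1) * - (2 * (1 - e) * D X * G) = 2 * (eta e * (1 - e)) * D X powr (- eta e) * G"
      using p by (simp add: powr_diff X_def)
    also have "eta e * (1 - e) = 2 * e" using e by (simp add: eta_def)
    finally show ?thesis using VG by (simp add: an_F_def EE_u_def G_def X_def)
  qed
qed

text \<open>A regular point is the case \<mu> = 1, where the singular term (\<mu> - 1) (u - u0) is
  absent.\<close>

lemma EE_analytic_interior:
  assumes S: "solves_EE e {a..b} D W" and e: "e < 1" and x0: "a < x0" "x0 < b"
  shows "\<exists>F. (\<lambda>s. D (x0 + s)) has_fps_expansion F" "\<exists>F. (\<lambda>s. W (x0 + s)) has_fps_expansion F"
proof -
  define u0 where "u0 = EE_u e D W x0"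
  define u where "u = (\<lambda>i t. EE_u e D W (x0 + t) i)"
  have p: "0 < x0" "0 < B_fun e x0 (D x0) (W x0)" using solves_EE_pos[OF S, of x0] x0 by auto
  have u0: "an_B e x0 u0 \<noteq> 0" using p by (simp add: u0_def an_B_EE)
  have u_eq: "(\<lambda>j. u j t) = EE_u e D W (x0 + t)" for t by (simp add: u_def)
  have der: "(u i has_real_derivative an_F e x0 i t (\<lambda>j. u j t)) (at t)" if "a < x0 + t" "x0 + t < b" for i t
    using EE_u_deriv[OF S e that, of i] p(1) unfolding u_def by simp
  obtain T g where g0: "fuchs_analytic (an_F e x0) (\<lambda>_. 1) u0 T g"
    using an_analytic[of x0 e u0 "\<lambda>_. 1", OF less_imp_le[OF p(1)] u0 zero_less_one] by blast
  from g0 have T: "T > 0" and g: "\<bar>t\<bar> < T \<Longrightarrow> \<exists>G. (\<lambda>s. g i (t + s)) has_fps_expansion G" "g i 0 = u0 i" for i t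
    unfolding fuchs_analytic_def by blast+
  note uniq = g0[unfolded fuchs_analytic_def, THEN conjunct2, THEN conjunct2, THEN conjunct2, rule_format]
  have "\<exists>\<delta>>0. \<forall>t. \<bar>t\<bar> < \<delta> \<longrightarrow> \<bar>u i t - u0 i - t * an_F e x0 i 0 u0\<bar> \<le> \<bar>t\<bar>" for i
  proof -
    have d0: "(u i has_real_derivative an_F e x0 i 0 u0) (at 0)"
      using der[of 0 i] x0 unfolding u_eq by (simp add: u0_def)
    have "u i 0 = u0 i" by (simp add: u_def u0_def)
    with DERIV_linear_approx[OF d0] show ?thesis by (metis diff_zero mult.commute)
  qed
  then obtain \<delta> where \<delta>: "\<And>i. \<delta> i > 0" "\<And>i t. \<bar>t\<bar> < \<delta> i \<Longrightarrow> \<bar>u i t - u0 i - t * an_F e x0 i 0 u0\<bar> \<le> \<bar>t\<bar>"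
    by metis
  define T' where "T' = min T (min (min (x0 - a) (b - x0)) (min (\<delta> VP) (min (\<delta> VU) (\<delta> VG))))"
  have T': "0 < T'" "T' \<le> T" "T' \<le> x0 - a" "T' \<le> b - x0" using T x0 \<delta>(1) by (auto simp: T'_def)
  have T'\<delta>: "T' \<le> \<delta> i" for i by (cases i) (auto simp: T'_def)
  have side: "u i t = g i t" if "\<sigma> = 1 \<or> \<sigma> = - 1" "0 < \<sigma> * t" "\<sigma> * t < T'" for \<sigma> i t
  proof -
    have "fuchs_solution (an_F e x0) (\<lambda>_. 1) u0 \<sigma> T' u (\<lambda>i t. an_F e x0 i t (\<lambda>j. u j t))"
      unfolding fuchs_solution_def
    proof (intro allI impI conjI)
      fix i t assume t: "0 < \<sigma> * t" "\<sigma> * t < T'"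
      then have t': "\<bar>t\<bar> < T'" using that(1) by auto
      show "(u i has_real_derivative an_F e x0 i t (\<lambda>j. u j t)) (at t)" by (rule der) (use t' T' in auto)
      show "\<bar>u i t - u0 i - t * (an_F e x0 i 0 u0 / 1)\<bar> \<le> \<bar>t\<bar>"
        using \<delta>(2)[of t i] t' T'\<delta>[of i] by simp
    qed simp
    from uniq[OF that(1) T'(2) this that(2,3)] show ?thesis .
  qed
  have eq: "\<forall>\<^sub>F t in nhds 0. g i t = EE_u e D W (x0 + t) i" for i
  proof -
    have "g i t = u i t" if "\<bar>t\<bar> < T'" for t
    proof (cases "t = 0")
      case True
      then show ?thesis by (simp add: g(2) u_def u0_def)
    next
      case False
      then show ?thesis using side[of 1 t i] side[of "- 1" t i] that by (cases "0 < t") auto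
    qed
    then show ?thesis using T'(1) unfolding eventually_nhds_metric u_def by (intro exI[of _ T']) (simp add: dist_norm)
  qed
  have "\<exists>F. (\<lambda>s. EE_u e D W (x0 + s) i) has_fps_expansion F" for i
    using g(1)[of 0 i] T has_fps_expansion_cong[OF eq[of i] refl] by auto
  from this[of VP] this[of VU] show "\<exists>F. (\<lambda>s. D (x0 + s)) has_fps_expansion F" "\<exists>F. (\<lambda>s. W (x0 + s)) has_fps_expansion F"
    by (simp_all add: EE_u_def)
qed

text \<open>For W the term (1 - 3 W) / x gives t W' + 3 (W - 1/3) = t F, that is \<mu> = 4. The
  bounds of order x^2 supply the first-order condition of \<open>fuchs_solution\<close>, with slope
  0 since F vanishes at x = 0.\<close>

lemma EE_analytic_zero:
  assumes S: "solves_EE e {0<..b} D W" and e: "e < 1" and b: "0 < b" and D0: "0 < D0"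
    and D: "\<And>x. 0 < x \<Longrightarrow> x \<le> b \<Longrightarrow> \<bar>D x - D0\<bar> \<le> C * x^2" and W: "\<And>x. 0 < x \<Longrightarrow> x \<le> b \<Longrightarrow> \<bar>W x - 1/3\<bar> \<le> C * x^2"
  shows "\<exists>T>0. \<exists>gD gW. (\<forall>t. \<bar>t\<bar> < T \<longrightarrow> (\<exists>F. (\<lambda>s. gD (t + s)) has_fps_expansion F) \<and> (\<exists>F. (\<lambda>s. gW (t + s)) has_fps_expansion F)) \<and>
    gD 0 = D0 \<and> gW 0 = 1/3 \<and> (\<forall>t. 0 < t \<longrightarrow> t < T \<longrightarrow> D t = gD t \<and> W t = gW t)"
proof -
  define u0 where "u0 = (\<lambda>i. case i of VP \<Rightarrow> D0 | VU \<Rightarrow> 1/3 | VG \<Rightarrow> D0 powr (- eta e))"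
  define u where "u = (\<lambda>i t. EE_u e D W t i)"
  define \<mu> where "\<mu> = (\<lambda>i. if i = VU then 4 else 1 :: real)"
  have u_eq: "(\<lambda>j. u j t) = EE_u e D W t" for t by (simp add: u_def)
  have \<mu>: "\<mu> i > 0" for i by (simp add: \<mu>_def)
  have "an_B e 0 u0 \<noteq> 0" using D0 by (simp add: an_B_def u0_def)
  obtain T g where g0: "fuchs_analytic (an_F e 0) \<mu> u0 T g"
    using an_analytic[of 0 e u0 \<mu>, OF order_refl \<open>an_B e 0 u0 \<noteq> 0\<close> \<mu>] by blast
  from g0 have T: "T > 0" and g: "\<bar>t\<bar> < T \<Longrightarrow> \<exists>G. (\<lambda>s. g i (t + s)) has_fps_expansion G" "g i 0 = u0 i" for i t
    unfolding fuchs_analytic_def by blast+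
  note uniq = g0[unfolded fuchs_analytic_def, THEN conjunct2, THEN conjunct2, THEN conjunct2, rule_format]
  define d where "d = - eta e * D0 powr (- eta e - 1)"
  have "((\<lambda>y. y powr (- eta e)) has_real_derivative d) (at D0)"
    unfolding d_def using D0 by (auto intro!: derivative_eq_intros)
  from DERIV_linear_approx[OF this] obtain \<delta> where \<delta>: "\<delta> > 0"
    "\<And>y. \<bar>y - D0\<bar> < \<delta> \<Longrightarrow> \<bar>y powr (- eta e) - D0 powr (- eta e) - d * (y - D0)\<bar> \<le> \<bar>y - D0\<bar>"
    by blast
  \<comment> \<open>The factor |d| + 1 transfers the quadratic bound from D to D powr (- eta e); T'
    below ensures C' t^2 <= t.\<close>
  define C' where "C' = (\<bar>d\<bar> + 1) * (\<bar>C\<bar> + 1)"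
  have C': "C' > 0" "\<bar>C\<bar> + 1 \<le> C'"
    using mult_right_mono[of 1 "\<bar>d\<bar> + 1" "\<bar>C\<bar> + 1"] by (auto simp: C'_def)
  define T' where "T' = min (min T b) (min (1 / C') (min 1 (\<delta> / C')))"
  have T': "0 < T'" "T' \<le> T" "T' \<le> b" "T' \<le> 1" "T' \<le> 1 / C'" "T' \<le> \<delta> / C'"
    using T b C' \<delta>(1) by (auto simp: T'_def)
  have bound: "\<bar>u i t - u0 i\<bar> \<le> C' * t^2" "C' * t^2 \<le> t" if t: "0 < t" "t < T'" for i t
  proof -
    have tb: "t \<le> b" using t T' by simp
    have "C' * t \<le> 1"
    proof -
      have "t \<le> 1 / C'" using t T'(5) by simp
      then show ?thesis using C'(1) by (simp add: field_simps)
    qed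
    then show le: "C' * t^2 \<le> t" using mult_right_mono[of "C' * t" 1 t] t by (simp add: power2_eq_square)
    have CC: "C * t^2 \<le> (\<bar>C\<bar> + 1) * t^2" by (intro mult_right_mono) auto
    have CC': "(\<bar>C\<bar> + 1) * t^2 \<le> C' * t^2" using C'(2) by (intro mult_right_mono) auto
    have Db: "\<bar>D t - D0\<bar> \<le> (\<bar>C\<bar> + 1) * t^2" using D[OF t(1) tb] CC by linarith
    have "t < \<delta> / C'" "t \<le> 1" using t T' by auto
    then have "C' * t < \<delta>" using C'(1) by (simp add: field_simps)
    moreover have "C' * t^2 \<le> C' * t"
      using t \<open>t \<le> 1\<close> C'(1) by (intro mult_left_mono) (auto simp: power2_eq_square mult_left_le)
    ultimately have "\<bar>D t - D0\<bar> < \<delta>" using Db CC' by linarith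
    from \<delta>(2)[OF this] have "\<bar>D t powr (- eta e) - D0 powr (- eta e)\<bar> \<le> \<bar>D t - D0\<bar> + \<bar>d * (D t - D0)\<bar>"
      by linarith
    also have "\<dots> = (\<bar>d\<bar> + 1) * \<bar>D t - D0\<bar>" unfolding abs_mult by (simp add: distrib_right)
    also have "\<dots> \<le> (\<bar>d\<bar> + 1) * ((\<bar>C\<bar> + 1) * t^2)" using Db by (intro mult_left_mono) auto
    finally have E: "\<bar>D t powr (- eta e) - D0 powr (- eta e)\<bar> \<le> C' * t^2" by (simp add: C'_def mult.assoc)
    show "\<bar>u i t - u0 i\<bar> \<le> C' * t^2"
    proof (cases i)
      case VP
      then show ?thesis using Db CC' by (simp add: u_def u0_def EE_u_def)
    next
      case VU
      then show ?thesis using W[OF t(1) tb] CC CC' by (simp add: u_def u0_def EE_u_def)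
    next
      case VG
      then show ?thesis using E by (simp add: u_def u0_def EE_u_def)
    qed
  qed
  have F0: "an_F e 0 i 0 u0 = 0" for i by (cases i) (simp_all add: an_F_def an_G_def)
  define u' where "u' = (\<lambda>i t. (if i = VU then (1 - 3 * W t) / t else 0) + an_F e 0 i t (\<lambda>j. u j t))"
  have "fuchs_solution (an_F e 0) \<mu> u0 1 T' u u'" unfolding fuchs_solution_def
  proof (intro allI impI conjI)
    fix i t assume "0 < 1 * t" "1 * t < T'"
    then have t: "0 < t" "t < T'" by auto
    have "solves_EE e {t/2..b} D W" by (rule solves_EE_subset[OF S]) (use t in auto)
    from EE_u_deriv[OF this e, of 0 t i] show "(u i has_real_derivative u' i t) (at t)"
      using t T'(3) unfolding u'_def u_eq by (simp add: u_def)
    show "t * u' i t + (\<mu> i - 1) * (u i t - u0 i) = t * an_F e 0 i t (\<lambda>j. u j t)"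
      using t by (cases "i = VU") (simp_all add: u'_def \<mu>_def u_def u0_def EE_u_def field_simps)
    show "\<bar>u i t - u0 i - t * (an_F e 0 i 0 u0 / \<mu> i)\<bar> \<le> \<bar>t\<bar>"
      using bound(1)[OF t, of i] bound(2)[OF t] t F0[of i] by simp
  qed
  from uniq[OF _ T'(2) this] have eq: "u i t = g i t" if "0 < t" "t < T'" for i t using that by simp
  have "D t = g VP t \<and> W t = g VU t" if "0 < t" "t < T'" for t
    using eq[OF that, of VP] eq[OF that, of VU] by (simp add: u_def EE_u_def)
  moreover have "g VP 0 = D0" "g VU 0 = 1/3" by (simp_all add: g(2) u0_def)
  ultimately show ?thesis using T' g(1) by (intro exI[of _ T'] conjI exI[of _ "g VP"] exI[of _ "g VU"] allI impI) auto
qed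

section \<open>The solution without exit: continuation to x = 0 and behaviour there\<close>

context left_region
begin

lemma third_le: "1/3 < 1 / (2 - eps)" "1 / (2 - eps) < 1" using e by (simp_all add: field_simps)

text \<open>On {c..b} the bound q <= \<theta> gives D <= max 1 (\<theta> / c), so the solution is
  trapped in a compact set on which Q > 0 and hence B > 0. Continuation then reaches every c >
  0.\<close>

lemma critical_global:
  assumes b: "(b, D1, W1) \<in> EE_dom eps" and D1: "1/3 < D1" and q: "q_fun eps b D1 < \<theta>"
    and nolow: "\<And>a D W y. solves_EE eps {a..b} D W \<Longrightarrow> D b = D1 \<Longrightarrow> W b = W1 \<Longrightarrow> y \<in> {a..b} \<Longrightarrow> 1/3 \<le> W y"
    and nohigh: "\<And>a D W y. solves_EE eps {a..b} D W \<Longrightarrow> D b = D1 \<Longrightarrow> W b = W1 \<Longrightarrow> y \<in> {a..b} \<Longrightarrow> 1/3 < W y \<Longrightarrow>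
      W y \<le> D y \<and> W y \<le> 1 / (2 - eps)"
  shows "\<exists>D W. solves_EE eps {0<..b} D W \<and> D b = D1 \<and> W b = W1 \<and>
    (\<forall>x\<in>{0<..b}. 1/3 \<le> W x \<and> W x \<le> D x \<and> W x \<le> 1 \<and> D1 \<le> D x \<and> q_fun eps x (D x) \<le> \<theta>)"
proof -
  have inv: "1/3 \<le> W y \<and> W y \<le> D y \<and> W y \<le> 1 \<and> D1 \<le> D y \<and> q_fun eps y (D y) \<le> \<theta>"
    if S: "solves_EE eps {a..b} D W" "D b = D1" "W b = W1" and y: "y \<in> {a..b}" for a D W y
  proof -
    have "1/3 \<le> W y \<and> W y \<le> D y \<and> D b \<le> D y \<and> q_fun eps y (D y) \<le> q_fun eps b (D b)"
      by (rule left_trichotomy[OF S(1) _ _ _ _ y]) (use nolow[OF S] nohigh[OF S] D1 q S in auto)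
    then show ?thesis using nohigh[OF S y] third_le S q by (cases "1/3 < W y") auto
  qed
  have b0: "0 < b" "0 < D1" using b by (auto simp: EE_dom_def)
  have ex: "\<exists>D W. solves_EE eps {c..b} D W \<and> D b = D1 \<and> W b = W1" if c: "0 < c" "c \<le> b" for c
  proof -
    define M where "M = max 1 (\<theta> / c)"
    have DM: "D \<le> M" if "c \<le> x" "0 < D" "q_fun eps x D \<le> \<theta>" for x D
    proof (cases "D \<le> 1")
      case False
      have "c * D powr (1 / (1 - eps)) \<le> x * D powr (1 / (1 - eps))" using that by (intro mult_right_mono) auto
      then have "c * D powr (1 / (1 - eps)) \<le> \<theta>" using that(3) by (simp add: q_fun_def)
      then have "D powr (1 / (1 - eps)) \<le> \<theta> / c" using c by (simp add: field_simps)
      moreover have "D powr 1 \<le> D powr (1 / (1 - eps))" using False e by (intro powr_mono) (auto simp: field_simps)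
      ultimately show ?thesis using that False by (simp add: M_def)
    qed (simp add: M_def)
    define S where "S = {c..b} \<times> {D1..M} \<times> {1/3..1::real}"
    define K where "K = {p \<in> S. snd (snd p) \<le> fst (snd p)} \<inter> {p \<in> S. q_fun eps (fst p) (fst (snd p)) \<le> \<theta>}"
    have cS: "compact S" unfolding S_def by (intro compact_Times compact_Icc)
    have "closed {p \<in> S. snd (snd p) \<le> fst (snd p)}"
      by (intro continuous_on_closed_Collect_le continuous_intros compact_imp_closed cS)
    moreover have "closed {p \<in> S. q_fun eps (fst p) (fst (snd p)) \<le> \<theta>}" unfolding q_fun_def
      by (intro continuous_on_closed_Collect_le continuous_intros compact_imp_closed cS) (use b0 in \<open>auto simp: S_def\<close>)
    ultimately have "compact (K \<inter> S)" unfolding K_def by (intro closed_Int_compact cS closed_Int)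
    moreover have "K \<inter> S = K" by (auto simp: K_def)
    ultimately have "compact K" by simp
    moreover have "K \<subseteq> EE_dom eps"
    proof
      fix p assume "p \<in> K"
      then obtain x D W where p: "p = (x, D, W)" "c \<le> x" "D1 \<le> D" "1/3 \<le> W" "W \<le> D" "q_fun eps x D \<le> \<theta>"
        by (auto simp: K_def S_def)
      have "0 < Q_fun eps x D W \<and> Q_fun eps x D W \<le> B_fun eps x D W"
        using p c by (intro conjI Q_pos q_fun_nonneg) auto
      then show "p \<in> EE_dom eps" using p c b0 by (auto simp: EE_dom_def)
    qed
    moreover have inK: "(a, D a, W a) \<in> K"
      if "c \<le> a" "a \<le> b" and S: "solves_EE eps {a..b} D W" "D b = D1" "W b = W1" for a D W
      using inv[OF S, of a] DM[of a "D a"] that b0 by (auto simp: K_def S_def)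
    moreover have "(b, D1, W1) \<in> K"
    proof -
      \<comment> \<open>On a one-point interval derivatives are vacuous, so constants solve the
        system there and the trapping argument also covers the starting point.\<close>
      have "at b within {b} = bot" by (simp add: trivial_limit_within islimpt_finite)
      then have "solves_EE eps {b..b} (\<lambda>_. D1) (\<lambda>_. W1)"
        using b b0 unfolding solves_EE_def EE_dom_def by (auto simp: has_field_derivative_iff)
      from inK[OF c(2) order_refl this] show ?thesis by simp
    qed
    ultimately show ?thesis by (intro EE_continue[of K] c(2)) auto
  qed
  obtain D W where DW: "solves_EE eps {0<..b} D W" "D b = D1" "W b = W1" using EE_global[OF ex b0(1)] by blast
  moreover have "\<forall>x\<in>{0<..b}. 1/3 \<le> W x \<and> W x \<le> D x \<and> W x \<le> 1 \<and> D1 \<le> D x \<and> q_fun eps x (D x) \<le> \<theta>"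
  proof
    fix x assume x: "x \<in> {0<..b}"
    have "solves_EE eps {x..b} D W" by (rule solves_EE_subset[OF DW(1)]) (use x in auto)
    from inv[OF this DW(2,3), of x] show "1/3 \<le> W x \<and> W x \<le> D x \<and> W x \<le> 1 \<and> D1 \<le> D x \<and> q_fun eps x (D x) \<le> \<theta>"
      using x by auto
  qed
  ultimately show ?thesis by blast
qed

text \<open>From q <= \<theta> alone D might grow like x powr (eps - 1). The resulting bound x powr
  (- eps) for the logarithmic derivative of D is integrable, so D is bounded. Then G = O(x), D
  converges at a quadratic rate, and W - 1/3 is controlled by an integrating factor.\<close>

lemma zero_bounds:
  assumes S: "solves_EE eps {0<..b} D W" and b: "0 < b" and D1: "0 < D1"
    and inv: "\<And>x. 0 < x \<Longrightarrow> x \<le> b \<Longrightarrow> 1/3 \<le> W x \<and> W x \<le> D x \<and> W x \<le> 1 \<and> D1 \<le> D x \<and> q_fun eps x (D x) \<le> \<theta>"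
  shows "\<exists>D0\<ge>D1. \<exists>C. \<forall>x. 0 < x \<longrightarrow> x \<le> b \<longrightarrow> \<bar>D x - D0\<bar> \<le> C * x^2 \<and> \<bar>W x - 1/3\<bar> \<le> C * x^2"
proof -
  define G where "G = (\<lambda>x. 2 * x * (W x + eps) * (D x - W x) / B_fun eps x (D x) (W x))"
  have der: "(D has_real_derivative - ((1 - eps) * D x * G x)) (at x)"
    "(W has_real_derivative (1 - 3 * W x) / x + (1 + eps) * W x * G x) (at x)" if x: "0 < x" "x < b" for x
  proof -
    have "solves_EE eps {x/2..b} D W" by (rule solves_EE_subset[OF S]) (use x in auto)
    note d = solves_EE_at[OF this, of x]
    show "(D has_real_derivative - ((1 - eps) * D x * G x)) (at x)"
      by (rule DERIV_cong[OF d(1)]) (use x in \<open>auto simp: G_def\<close>)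
    show "(W has_real_derivative (1 - 3 * W x) / x + (1 + eps) * W x * G x) (at x)"
      by (rule DERIV_cong[OF d(2)]) (use x in \<open>auto simp: G_def\<close>)
  qed
  have cont: "continuous_on {y..x} D" "continuous_on {y..x} W" if "0 < y" "x \<le> b" for x y
    using solves_EE_cont[OF S] that by (auto elim!: continuous_on_subset)
  have pos: "0 < D x" if "0 < x" "x \<le> b" for x using inv[OF that] D1 by linarith
  have G: "0 \<le> G x" "G x \<le> 4 / \<kappa> * (x * D x powr (1 + eta eps))" if x: "0 < x" "x \<le> b" for x
  proof -
    note i = inv[OF x]
    have "\<kappa> \<le> Q_fun eps x (D x) (W x) * D x powr (eta eps)" "Q_fun eps x (D x) (W x) \<le> B_fun eps x (D x) (W x)"
      "0 < Q_fun eps x (D x) (W x)"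
      using i x by (intro Q_pos q_fun_nonneg; simp)+
    then have B: "0 < B_fun eps x (D x) (W x)" "\<kappa> \<le> B_fun eps x (D x) (W x) * D x powr (eta eps)"
      using mult_right_mono[of "Q_fun eps x (D x) (W x)" "B_fun eps x (D x) (W x)" "D x powr (eta eps)"] by auto
    show "0 \<le> G x" unfolding G_def using i x e B by (intro divide_nonneg_pos mult_nonneg_nonneg) auto
    have iB: "1 / B_fun eps x (D x) (W x) \<le> D x powr (eta eps) / \<kappa>"
      using B \<kappa> by (simp add: field_simps)
    have "2 * x * (W x + eps) * (D x - W x) \<le> 2 * x * 2 * D x" using i x e by (intro mult_mono) auto
    then have "2 * x * (W x + eps) * (D x - W x) * (1 / B_fun eps x (D x) (W x)) \<le> 2 * x * 2 * D x * (D x powr (eta eps) / \<kappa>)"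
      using i x e B iB pos[OF x] by (intro mult_mono) auto
    then show "G x \<le> 4 / \<kappa> * (x * D x powr (1 + eta eps))"
      using pos[OF x] by (simp add: G_def powr_add mult_ac)
  qed
  \<comment> \<open>1 + eta eps = (1 + eps) / (1 - eps), so q <= \<theta> controls exactly this
    power of D.\<close>
  have rate: "x * D x powr (1 + eta eps) \<le> \<theta> powr (1 + eps) * x powr (- eps)" if x: "0 < x" "x \<le> b" for x
  proof -
    have eq: "D x powr (1 + eta eps) = (D x powr (1 / (1 - eps))) powr (1 + eps)"
      using e by (simp add: powr_powr eta_def field_simps)
    have "D x powr (1 / (1 - eps)) \<le> \<theta> / x" using inv[OF x] x by (simp add: q_fun_def field_simps)
    then have "D x powr (1 + eta eps) \<le> (\<theta> / x) powr (1 + eps)"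
      unfolding eq using e by (intro powr_mono2) auto
    also have "\<dots> = \<theta> powr (1 + eps) * x powr (- 1 - eps)"
      using x \<theta> powr_minus_divide[of x "1 + eps"] by (simp add: powr_divide)
    finally have "x * D x powr (1 + eta eps) \<le> x powr 1 * (\<theta> powr (1 + eps) * x powr (- 1 - eps))"
      using x by (simp add: mult_left_mono)
    also have "\<dots> = \<theta> powr (1 + eps) * (x powr 1 * x powr (- 1 - eps))" by simp
    also have "x powr 1 * x powr (- 1 - eps) = x powr (- eps)" unfolding powr_add[symmetric] by simp
    finally show ?thesis .
  qed
  define c4 where "c4 = 4 / \<kappa> * \<theta> powr (1 + eps)"
  define K where "K = c4 / (1 - eps)"
  have c4: "0 \<le> c4" using \<kappa> by (simp add: c4_def)
  \<comment> \<open>Obtained by integrating the bound c4 * x powr (- eps) for - (ln D)' over (0,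
    b].\<close>
  define M where "M = exp (ln (D b) + K * b powr (1 - eps))"
  have DM: "D x \<le> M" if x: "0 < x" "x \<le> b" for x
  proof -
    have "ln (D x) + K * x powr (1 - eps) \<le> ln (D b) + K * b powr (1 - eps)"
    proof (rule DERIV_nonneg_imp_le[where f = "\<lambda>x. ln (D x) + K * x powr (1 - eps)"])
      show "continuous_on {x..b} (\<lambda>x. ln (D x) + K * x powr (1 - eps))"
      proof (intro continuous_intros cont(1)[OF x(1) order_refl])
        show "\<forall>y\<in>{x..b}. D y \<noteq> 0"
        proof
          fix y assume "y \<in> {x..b}"
          then show "D y \<noteq> 0" using pos[of y] x by auto
        qed
      qed (use x in auto)
      fix y assume y: "x < y" "y < b"
      then have y0: "0 < y" "y \<le> b" using x by auto
      have "((\<lambda>x. ln (D x)) has_real_derivative - ((1 - eps) * G y)) (at y)"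
        using pos[OF y0] by (auto intro!: derivative_eq_intros der(1) y0 y)
      moreover have "((\<lambda>x. K * x powr (1 - eps)) has_real_derivative c4 * y powr (- eps)) (at y)"
        using y0 e by (auto intro!: derivative_eq_intros simp: K_def)
      ultimately have "((\<lambda>x. ln (D x) + K * x powr (1 - eps)) has_real_derivative - ((1 - eps) * G y) + c4 * y powr (- eps)) (at y)"
        by (rule DERIV_add)
      moreover have "(1 - eps) * G y \<le> 1 * G y" using G(1)[OF y0] e by (intro mult_right_mono) auto
      moreover have "4 / \<kappa> * (y * D y powr (1 + eta eps)) \<le> 4 / \<kappa> * (\<theta> powr (1 + eps) * y powr (- eps))"
        using rate[OF y0] \<kappa> by (intro mult_left_mono) auto
      ultimately show "\<exists>d\<ge>0. ((\<lambda>x. ln (D x) + K * x powr (1 - eps)) has_real_derivative d) (at y)"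
        using G(2)[OF y0] by - (rule exI, rule conjI[rotated], assumption, simp add: c4_def mult_ac)
    qed (use x in simp)
    moreover have "0 \<le> K * x powr (1 - eps)" using c4 e by (simp add: K_def)
    ultimately have "ln (D x) \<le> ln (D b) + K * b powr (1 - eps)" by linarith
    then show ?thesis unfolding M_def using pos[OF x] by (metis exp_le_cancel_iff exp_ln)
  qed
  define C1 where "C1 = 4 / \<kappa> * M powr (1 + eta eps)"
  have C1: "0 \<le> C1" and M0: "0 < M" using \<kappa> by (simp_all add: C1_def M_def)
  have GC: "G x \<le> C1 * x" if x: "0 < x" "x \<le> b" for x
  proof -
    have "D x powr (1 + eta eps) \<le> M powr (1 + eta eps)"
      using DM[OF x] pos[OF x] eta_nonneg[of eps] e by (intro powr_mono2) auto
    then have "4 / \<kappa> * (x * D x powr (1 + eta eps)) \<le> 4 / \<kappa> * (x * M powr (1 + eta eps))"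
      using x \<kappa> by (intro mult_left_mono) auto
    then show ?thesis using G(2)[OF x] by (simp add: C1_def mult_ac)
  qed
  have Dmono: "D x \<le> D y" if "0 < y" "y \<le> x" "x \<le> b" for x y
  proof -
    have "- D y \<le> - D x"
    proof (rule DERIV_nonneg_imp_le[where f = "\<lambda>x. - D x"])
      fix s assume "y < s" "s < x"
      then show "\<exists>d\<ge>0. ((\<lambda>x. - D x) has_real_derivative d) (at s)"
        using that pos[of s] G(1)[of s] e by - (rule exI, rule conjI[rotated], rule DERIV_minus[OF der(1)], auto)
    qed (use that cont in \<open>auto intro!: continuous_intros\<close>)
    then show ?thesis by simp
  qed
  define C2 where "C2 = M * C1"
  have C2: "0 \<le> C2" using M0 C1 by (simp add: C2_def)
  \<comment> \<open>D decreases and D + C2 x^2 increases in x; this squeezes D between D0 - C2 x^2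
    and its supremum D0.\<close>
  have Dinc: "D y + C2 * y^2 \<le> D x + C2 * x^2" if "0 < y" "y \<le> x" "x \<le> b" for x y
  proof (rule DERIV_nonneg_imp_le[where f = "\<lambda>x. D x + C2 * x^2"])
    fix s assume s: "y < s" "s < x"
    then have s0: "0 < s" "s < b" "s \<le> b" using that by auto
    have "((\<lambda>x. D x + C2 * x^2) has_real_derivative - ((1 - eps) * D s * G s) + C2 * (2 * s)) (at s)"
      by (auto intro!: derivative_eq_intros der(1) s0)
    moreover have "(1 - eps) * D s * G s \<le> 1 * M * (C1 * s)"
      using DM[of s] GC[of s] G(1)[of s] pos[of s] s0 e M0 by (intro mult_mono) auto
    moreover have "0 \<le> C2 * s" using C2 s0 by simp
    ultimately show "\<exists>d\<ge>0. ((\<lambda>x. D x + C2 * x^2) has_real_derivative d) (at s)"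
      by - (rule exI, rule conjI[rotated], assumption, simp add: C2_def)
  qed (use that cont in \<open>auto intro!: continuous_intros\<close>)
  define D0 where "D0 = Sup (D ` {0<..b})"
  have bdd: "bdd_above (D ` {0<..b})" using DM by (intro bdd_aboveI[of _ M]) auto
  have D0: "D x \<le> D0" if "0 < x" "x \<le> b" for x unfolding D0_def using that bdd by (intro cSup_upper) auto
  have D0': "D0 \<le> D x + C2 * x^2" if x: "0 < x" "x \<le> b" for x unfolding D0_def
  proof (rule cSup_least)
    fix v assume "v \<in> D ` {0<..b}"
    then obtain y where y: "0 < y" "y \<le> b" "v = D y" by auto
    show "v \<le> D x + C2 * x^2"
    proof (cases "y \<le> x")
      case True
      moreover have "0 \<le> C2 * y^2" using C2 by simp
      ultimately show ?thesis using Dinc[OF y(1) True x(2)] y(3) by linarith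
    next
      case False
      have "0 \<le> C2 * x^2" using C2 by simp
      then show ?thesis using Dmono[of x y] False x y by linarith
    qed
  qed (use b in auto)
  \<comment> \<open>x^3 is the integrating factor of x W' = 1 - 3 W. The function C1 x^5 - x^3 (W -
    1/3) is nondecreasing, and a negative value would contradict its limit 0 at the origin.\<close>
  have Wb: "x^3 * (W x - 1/3) \<le> C1 * x^5" if x: "0 < x" "x \<le> b" for x
  proof (rule ccontr)
    assume "\<not> ?thesis"
    then have neg: "C1 * x^5 - x^3 * (W x - 1/3) < 0" by simp
    define m where "m = - (C1 * x^5 - x^3 * (W x - 1/3))"
    have m: "m > 0" using neg by (simp add: m_def)
    define y where "y = min x (min 1 (m / 2))"
    have y: "0 < y" "y \<le> x" "y \<le> 1" "y \<le> m / 2" using x m by (auto simp: y_def)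
    have "C1 * y^5 - y^3 * (W y - 1/3) \<le> C1 * x^5 - x^3 * (W x - 1/3)"
    proof (rule DERIV_nonneg_imp_le[where f = "\<lambda>x. C1 * x^5 - x^3 * (W x - 1/3)"])
      show "continuous_on {y..x} (\<lambda>x. C1 * x^5 - x^3 * (W x - 1/3))"
        using cont(2)[OF y(1) x(2)] by (intro continuous_intros)
      fix s assume s: "y < s" "s < x"
      then have s0: "0 < s" "s < b" "s \<le> b" using x y by auto
      have "((\<lambda>x. C1 * x^5 - x^3 * (W x - 1/3)) has_real_derivative
          C1 * (5 * s^4) - (3 * s^2 * (W s - 1/3) + s^3 * ((1 - 3 * W s) / s + (1 + eps) * W s * G s))) (at s)"
        by (auto intro!: derivative_eq_intros der(2) s0)
      also have "C1 * (5 * s^4) - (3 * s^2 * (W s - 1/3) + s^3 * ((1 - 3 * W s) / s + (1 + eps) * W s * G s)) =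
          C1 * (5 * s^4) - s^3 * ((1 + eps) * W s * G s)"
        using s0 by (simp add: field_simps power2_eq_square power3_eq_cube)
      finally have "((\<lambda>x. C1 * x^5 - x^3 * (W x - 1/3)) has_real_derivative C1 * (5 * s^4) - s^3 * ((1 + eps) * W s * G s)) (at s)" .
      moreover have "s^3 * ((1 + eps) * W s * G s) \<le> s^3 * (2 * 1 * (C1 * s))"
        using inv[of s] GC[of s] G(1)[of s] s0 e by (intro mult_mono) auto
      moreover have "s^3 * (2 * 1 * (C1 * s)) = 2 * (C1 * s^4)" by (simp add: power4_eq_xxxx power3_eq_cube)
      moreover have "0 \<le> C1 * s^4" using C1 by simp
      ultimately show "\<exists>d\<ge>0. ((\<lambda>x. C1 * x^5 - x^3 * (W x - 1/3)) has_real_derivative d) (at s)"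
        by - (rule exI, rule conjI[rotated], assumption, linarith)
    qed (use y in simp)
    then have "m \<le> y^3 * (W y - 1/3) - C1 * y^5" by (simp add: m_def)
    also have "\<dots> \<le> y^3 * 1"
    proof -
      have "y^3 * (W y - 1/3) \<le> y^3 * 1" using inv[of y] y x by (intro mult_left_mono) auto
      moreover have "0 \<le> C1 * y^5" using C1 y by simp
      ultimately show ?thesis by linarith
    qed
    also have "\<dots> \<le> y" using power_decreasing[of 1 3 y] y by simp
    finally show False using y m by simp
  qed
  have Wb': "W x - 1/3 \<le> C1 * x^2" if x: "0 < x" "x \<le> b" for x
  proof -
    have "x^3 * (W x - 1/3) \<le> x^3 * (C1 * x^2)" using Wb[OF x] by (simp add: power_numeral_reduce algebra_simps)
    then show ?thesis using x by simp
  qed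
  have le: "C2 * x^2 \<le> (C1 + C2) * x^2" "C1 * x^2 \<le> (C1 + C2) * x^2" for x
    using C1 C2 by (auto intro!: mult_right_mono)
  show ?thesis
  proof (rule exI[of _ D0], rule conjI)
    show "D1 \<le> D0" using D0[OF b order_refl] inv[OF b order_refl] by simp
    have "\<bar>D x - D0\<bar> \<le> (C1 + C2) * x^2 \<and> \<bar>W x - 1/3\<bar> \<le> (C1 + C2) * x^2" if x: "0 < x" "x \<le> b" for x
      using D0[OF x] D0'[OF x] le(1)[of x] inv[OF x] Wb'[OF x] le(2)[of x] by linarith
    then show "\<exists>C. \<forall>x. 0 < x \<longrightarrow> x \<le> b \<longrightarrow> \<bar>D x - D0\<bar> \<le> C * x^2 \<and> \<bar>W x - 1/3\<bar> \<le> C * x^2"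
      by blast
  qed
qed

end

subsection \<open>Solutions launched in the sonic window\<close>

lemma rlp_germ_cong:
  assumes germ: "rlp_germ eps x D W" and x: "0 < x" and d: "0 < d"
    and eq: "\<And>y. \<bar>y - x\<bar> < d \<Longrightarrow> D' y = D y" "\<And>y. \<bar>y - x\<bar> < d \<Longrightarrow> W' y = W y"
  shows "rlp_germ eps x D' W'"
proof -
  have ev: "\<forall>\<^sub>F t in nhds 0. f' (x * (1 + t)) = f (x * (1 + t))" if f: "\<And>y. \<bar>y - x\<bar> < d \<Longrightarrow> f' y = f y" for f f' :: "real \<Rightarrow> real"
  proof -
    have "f' (x * (1 + t)) = f (x * (1 + t))" if "\<bar>t\<bar> < d / x" for t
    proof (rule f)
      have "\<bar>x * (1 + t) - x\<bar> = x * \<bar>t\<bar>" using x by (simp add: algebra_simps abs_mult)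
      then show "\<bar>x * (1 + t) - x\<bar> < d" using that x by (simp add: field_simps)
    qed
    then show ?thesis unfolding eventually_nhds_metric using d x by (intro exI[of _ "d / x"]) (simp add: dist_norm)
  qed
  have "(\<lambda>t. D' (x * (1 + t))) has_fps_expansion F \<longleftrightarrow> (\<lambda>t. D (x * (1 + t))) has_fps_expansion F" for F
    by (rule has_fps_expansion_cong[OF ev[of D' D, OF eq(1)] refl])
  moreover have "(\<lambda>t. W' (x * (1 + t))) has_fps_expansion F \<longleftrightarrow> (\<lambda>t. W (x * (1 + t))) has_fps_expansion F" for F
    by (rule has_fps_expansion_cong[OF ev[of W' W, OF eq(2)] refl])
  ultimately show ?thesis using germ unfolding rlp_germ_def by simp
qed

lemma rlp_germ_value: "rlp_germ eps x D W \<Longrightarrow> W x = omega eps x"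
  unfolding rlp_germ_def rlp_series_def using has_fps_expansion_at_0 by fastforce

lemma has_fps_expansion_scale:
  fixes f :: "real \<Rightarrow> real"
  assumes f: "f has_fps_expansion F"
  shows "(\<lambda>x. f (c * x)) has_fps_expansion fps_compose F (fps_const c * fps_X)"
proof -
  obtain g where g: "g has_fps_expansion fps_cplx F"
    and gf: "\<forall>\<^sub>F x in nhds 0. g (of_real x) = of_real (f x)"
    using f by (auto simp: has_fps_expansion_cplx_iff)
  have "(\<lambda>z. complex_of_real c * z) has_fps_expansion fps_const (of_real c) * fps_X"
    by (intro fps_expansion_intros)
  from has_fps_expansion_compose[OF g this]
  have h: "(g \<circ> (\<lambda>z. of_real c * z)) has_fps_expansion fps_cplx (fps_compose F (fps_const c * fps_X))"
    by (simp add: fps_compose_linear fps_cplx_def)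
  have "((\<lambda>x. c * x) \<longlongrightarrow> c * 0) (nhds 0)" by (intro tendsto_intros filterlim_ident)
  then have "filterlim (\<lambda>x. c * x) (nhds 0) (nhds 0)" by simp
  from eventually_compose_filterlim[OF gf this]
  have "\<forall>\<^sub>F x in nhds 0. (g \<circ> (\<lambda>z. of_real c * z)) (of_real x) = of_real (f (c * x))"
    by simp
  with h show ?thesis by (subst has_fps_expansion_cplx_iff) blast
qed

lemma rlp_germ_analytic:
  assumes germ: "rlp_germ eps x D W" and x: "0 < x"
  shows "\<exists>F. (\<lambda>s. D (x + s)) has_fps_expansion F" "\<exists>F. (\<lambda>s. W (x + s)) has_fps_expansion F"
proof -
  have *: "\<exists>F. (\<lambda>s. f (x + s)) has_fps_expansion F" if "(\<lambda>t. f (x * (1 + t))) has_fps_expansion F" for f :: "real \<Rightarrow> real" and F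
  proof -
    have "x * (1 + 1 / x * s) = x + s" for s using x by (simp add: field_simps)
    with has_fps_expansion_scale[OF that, of "1 / x"] show ?thesis by auto
  qed
  show "\<exists>F. (\<lambda>s. D (x + s)) has_fps_expansion F" "\<exists>F. (\<lambda>s. W (x + s)) has_fps_expansion F"
    using germ * unfolding rlp_germ_def by blast+
qed

context sonic
begin

lemma sonic_signs:
  assumes p: "par e w" and t: "\<bar>t\<bar> < \<rho>"
  shows "0 < sq e w t" "t < 0 \<Longrightarrow> sW e w t < sR e w t" "t < 0 \<Longrightarrow> 0 < t * sb e w t"
proof -
  have "sb e w t * sq e w t < 0" using sq_eq[OF p t] sol_diff_neg[OF p t] by linarith
  then show "0 < sq e w t" using sb_bounds(1)[OF p t] by (auto simp: mult_less_0_iff)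
  show "sW e w t < sR e w t" if "t < 0"
    using mult_neg_neg[OF that, of "sol e w VP t - 2 * sol e w VU t"] sol_diff_neg[OF p t] sR_minus_sW[OF p t] by simp
  show "0 < t * sb e w t" if "t < 0" using mult_neg_neg[OF that, of "sb e w t"] sb_bounds(1)[OF p t] by simp
qed

lemma sW_strict_mono:
  assumes p: "par e w" and t: "- \<rho> < s" "s < t" "t < \<rho>"
  shows "sW e w s < sW e w t"
proof (rule DERIV_pos_imp_increasing[OF t(2)])
  fix x assume x: "s \<le> x" "x \<le> t"
  then have "\<bar>x\<bar> < \<rho>" using t by auto
  from sW_deriv_pos[OF p this] show "\<exists>y. DERIV (sW e w) x :> y \<and> 0 < y" by blast
qed

lemma sR_strict_antimono:
  assumes p: "par e w" and t: "- \<rho> < s" "s < t" "t < \<rho>"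
  shows "sR e w t < sR e w s"
proof (rule DERIV_neg_imp_decreasing[OF t(2)])
  fix x assume x: "s \<le> x" "x \<le> t"
  then have x': "\<bar>x\<bar> < \<rho>" using t by auto
  have "0 < 2 * (1 - e) * (1 + x) * sR e w x * (sW e w x + e) * sq e w x"
    using sonic_signs(1)[OF p x'] sRW_bounds[OF p x'] p e0 \<rho> x' by (intro mult_pos_pos) auto
  then have "- 2 * (1 - e) * (1 + x) * sR e w x * (sW e w x + e) * sq e w x < 0"
    by (simp only: mult_minus_left neg_less_0_iff_less)
  then show "\<exists>y. DERIV (sR e w) x :> y \<and> y < 0" using sR_deriv[OF p x'] by blast
qed

lemma sRW_at_0: "sR e w 0 = w" "sW e w 0 = w" by (simp_all add: sR_def sW_def)

text \<open>Joint continuity in e, w and t: closeness of blown-up solutions for nearby parameters,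
  uniform in time, combined with continuity in t for the fixed parameters.\<close>

lemma sRW_close:
  assumes p: "par e w" and t: "- \<rho> < t" "t < 0" and d: "0 < d"
  shows "\<exists>\<delta>>0. \<forall>e' w' t'. par e' w' \<longrightarrow> \<bar>e' - e\<bar> < \<delta> \<longrightarrow> \<bar>w' - w\<bar> < \<delta> \<longrightarrow> \<bar>t' - t\<bar> < \<delta> \<longrightarrow>
    \<bar>sR e' w' t' - sR e w t\<bar> < d \<and> \<bar>sW e' w' t' - sW e w t\<bar> < d"
proof -
  \<comment> \<open>A cut-off between - t and \<rho>, since uniform continuity in the parameters is
    available away from t = - \<rho>.\<close>
  define T where "T = (\<rho> - t) / 2"
  have T: "T < \<rho>" "- T < t" using t by (auto simp: T_def field_simps)
  obtain \<delta> where \<delta>: "\<delta> > 0" "\<And>e' w' i t. par e' w' \<Longrightarrow> \<bar>e' - e\<bar> < \<delta> \<Longrightarrow> \<bar>w' - w\<bar> < \<delta> \<Longrightarrow> - T < t \<Longrightarrow> t < 0 \<Longrightarrow>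
      \<bar>sol e w i t - sol e' w' i t\<bar> \<le> d / 8"
    using sol_continuous[OF p T(1), of "d / 8"] d by auto
  have "isCont (sR e w) t" "isCont (sW e w) t" "d / 2 > 0"
    using sR_deriv[OF p, of t] sW_deriv[OF p, of t] t d by (auto intro: DERIV_isCont)
  then obtain s1 s2 where s: "s1 > 0" "\<And>t'. \<bar>t' - t\<bar> < s1 \<Longrightarrow> \<bar>sR e w t' - sR e w t\<bar> < d / 2"
    "s2 > 0" "\<And>t'. \<bar>t' - t\<bar> < s2 \<Longrightarrow> \<bar>sW e w t' - sW e w t\<bar> < d / 2"
    unfolding continuous_at_eps_delta dist_real_def by metis
  define m where "m = min (min \<delta> (d / 8)) (min (min s1 s2) (min (t + T) (- t)))"
  show ?thesis
  proof (intro exI[of _ m] conjI[of "0 < m"] allI impI)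
    show "0 < m" using \<delta>(1) d s T t by (simp add: m_def)
    fix e' w' t' assume e': "par e' w'" "\<bar>e' - e\<bar> < m" "\<bar>w' - w\<bar> < m" "\<bar>t' - t\<bar> < m"
    then have "\<bar>t' - t\<bar> < t + T" "\<bar>t' - t\<bar> < - t" by (simp_all add: m_def)
    then have t': "- T < t'" "t' < 0" "- 1 < t'" using T(1) \<rho>(3) by linarith+
    have so: "\<bar>sol e w i t' - sol e' w' i t'\<bar> \<le> d / 8" for i
      using e' t' by (intro \<delta>(2)) (auto simp: m_def)
    have tm: "\<bar>t' * v\<bar> \<le> \<bar>v\<bar>" for v
      using t' mult_right_mono[of "\<bar>t'\<bar>" 1 "\<bar>v\<bar>"] unfolding abs_mult by simp
    have "sR e' w' t' - sR e w t' = (w' - w) + t' * ((sol e' w' VP t' - sol e w VP t') - (sol e' w' VU t' - sol e w VU t'))"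
      "sW e' w' t' - sW e w t' = (w' - w) + t' * (sol e' w' VU t' - sol e w VU t')"
      by (simp_all add: sR_def sW_def algebra_simps)
    moreover have "\<bar>w' - w\<bar> < d / 8" using e'(3) by (simp add: m_def)
    ultimately have "\<bar>sR e' w' t' - sR e w t'\<bar> < d / 2" "\<bar>sW e' w' t' - sW e w t'\<bar> < d / 2"
      using tm[of "(sol e' w' VP t' - sol e w VP t') - (sol e' w' VU t' - sol e w VU t')"] tm[of "sol e' w' VU t' - sol e w VU t'"]
        so[of VP] so[of VU] d by linarith+
    moreover have "\<bar>sR e w t' - sR e w t\<bar> < d / 2" "\<bar>sW e w t' - sW e w t\<bar> < d / 2"
      using s(2,4) e'(4) by (simp_all add: m_def)
    ultimately show "\<bar>sR e' w' t' - sR e w t\<bar> < d \<and> \<bar>sW e' w' t' - sW e w t\<bar> < d" by linarith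
  qed
qed

end

text \<open>Collects, for one eps, what holds uniformly on the window. At x (1 - \<delta>1) the
  description near the sonic point is handed over to the theory on the left; there q is already
  below \<theta>q.\<close>

locale rlp_window = sonic wM \<eta> \<theta> \<kappa> r \<rho> e0 + left: left_region eps \<theta>q \<kappa>q
  for wM \<eta> \<theta> \<kappa> r \<rho> e0 eps \<theta>q \<kappa>q :: real +
  fixes \<delta>1 xlo xhi :: real
  assumes eps0: "eps \<le> e0" and \<delta>1: "0 < \<delta>1" "\<delta>1 < \<rho>"
    and win: "\<And>x. x \<in> {xlo..xhi} \<Longrightarrow> 0 < x \<and> 1/3 \<le> om_root eps x \<and> om_root eps x \<le> wM \<and>
      slopes_ok eps (om_root eps x) (W1_rlp eps x) \<and> R1_rlp eps x = cu_R eps (om_root eps x) (W1_rlp eps x) \<and>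
      q_fun eps (x * (1 - \<delta>1)) (sR eps (om_root eps x) (- \<delta>1)) < \<theta>q"
begin

abbreviation "nR x y \<equiv> sR eps (om_root eps x) (y / x - 1)"
abbreviation "nW x y \<equiv> sW eps (om_root eps x) (y / x - 1)"

context
  fixes x assumes x: "x \<in> {xlo..xhi}"
begin

lemma x_pos: "0 < x" using win[OF x] by blast

lemma par_x: "par eps (om_root eps x)" using win[OF x] eps0 left.e by auto

lemma om_G_x: "om_G eps (om_root eps x) = 1 / x^2" using om_root(2)[of eps x] left.e x_pos by simp

lemma omega_x: "omega eps x = om_root eps x" using omega_eq[of eps x] left.e x_pos by simp

lemma \<rho>_less_1: "\<rho> < 1" using \<rho> by simp

lemma near_germ: "rlp_germ eps x (nR x) (nW x)"
proof (rule germ_exists[OF par_x om_G_x x_pos omega_x])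
  have ok: "slopes_ok eps (om_root eps x) (W1_rlp eps x)" using win[OF x] by blast
  show "sol eps (om_root eps x) VU 0 = W1_rlp eps x" "sol eps (om_root eps x) VP 0 = R1_rlp eps x + W1_rlp eps x"
    using sol_at_0[OF ok par_x] win[OF x] by (auto simp: slope_var_def)
qed (use x_pos in auto)

lemma near_solves:
  assumes a: "x * (1 - \<rho>) < a"
  shows "solves_EE eps {a..<x} (nR x) (nW x)" unfolding solves_EE_def
proof (rule ballI, goal_cases)
  case (1 y)
  define t where "t = y / x - 1"
  note x0 = x_pos
  have y: "y = x * (1 + t)" using x0 by (simp add: t_def)
  have "x * (1 - \<rho>) < x * (1 + t)" "x * (1 + t) < x * 1" using 1 a y by auto
  then have t: "- \<rho> < t" "t < 0" "\<bar>t\<bar> < \<rho>" using x0 by (auto simp del: mult_1_right)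
  define w where "w = om_root eps x"
  have p: "par eps w" unfolding w_def by (rule par_x)
  have B: "B_fun eps y (sR eps w t) (sW eps w t) = x^2 * (t * sb eps w t)"
    unfolding y w_def by (rule B_fun_eq[OF par_x t(3) om_G_x x0])
  note sg = sonic_signs[OF p t(3)]
  have Bpos: "0 < x^2 * (t * sb eps w t)" using sg(3)[OF t(2)] x0 by simp
  have inner: "((\<lambda>y. y / x - 1) has_real_derivative 1 / x) (at y within S)" for S
    using x0 by (auto intro!: derivative_eq_intros)
  have DW: "(sR eps w t - sW eps w t) / (x^2 * (t * sb eps w t)) = sq eps w t / x^2"
    using sR_minus_sW[OF p t(3)] sq_eq[OF p t(3), symmetric] sb_bounds(3)[OF p t(3)] t x0 by simp
  have alg: "(P / z + 2 * k * z * S * S' * u) * (1 / x) = P / (x * z) + 2 * (x * z) * k * S * S' * (u / x^2)" for P z k S S' u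
    using x0 by (simp add: power2_eq_square add_divide_distrib mult.commute[of z x])
  show ?case
  proof (intro conjI)
    show "0 < y" unfolding y using x0 t(1) \<rho>_less_1 by (intro mult_pos_pos) auto
    have nn: "nR x y = sR eps w t" "nW x y = sW eps w t" by (simp_all only: t_def w_def)
    show "0 < nR x y" unfolding nn using sRW_bounds(2)[OF p t(3)] by linarith
    show "0 < B_fun eps y (nR x y) (nW x y)" unfolding nn B by (rule Bpos)
    have "((\<lambda>y. sR eps w (y / x - 1)) has_real_derivative
        - 2 * (1 - eps) * (1 + t) * sR eps w t * (sW eps w t + eps) * sq eps w t * (1 / x)) (at y within {a..<x})"
      by (rule DERIV_chain2[where f = "sR eps w" and g = "\<lambda>y. y / x - 1", OF _ inner])
        (simp only: t_def[symmetric] sR_deriv[OF p t(3)])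
    also have "- 2 * (1 - eps) * (1 + t) * sR eps w t * (sW eps w t + eps) * sq eps w t * (1 / x) =
        - (2 * y * (1 - eps) * sR eps w t * (sW eps w t + eps) * ((sR eps w t - sW eps w t) / (x^2 * (t * sb eps w t))))"
      unfolding DW y using x0 by (simp add: power2_eq_square field_simps)
    finally show "(nR x has_real_derivative - (2 * y * (1 - eps) * nR x y * (nW x y + eps) * (nR x y - nW x y) / B_fun eps y (nR x y) (nW x y))) (at y within {a..<x})"
      unfolding t_def[symmetric] w_def[symmetric] B by simp
    have "((\<lambda>y. sW eps w (y / x - 1)) has_real_derivative
        ((1 - 3 * sW eps w t) / (1 + t) + 2 * (1 + eps) * (1 + t) * sW eps w t * (sW eps w t + eps) * sq eps w t) * (1 / x)) (at y within {a..<x})"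
      by (rule DERIV_chain2[where f = "sW eps w" and g = "\<lambda>y. y / x - 1", OF _ inner])
        (simp only: t_def[symmetric] sW_deriv[OF p t(3)])
    also have "((1 - 3 * sW eps w t) / (1 + t) + 2 * (1 + eps) * (1 + t) * sW eps w t * (sW eps w t + eps) * sq eps w t) * (1 / x) =
        (1 - 3 * sW eps w t) / y + 2 * y * (1 + eps) * sW eps w t * (sW eps w t + eps) * ((sR eps w t - sW eps w t) / (x^2 * (t * sb eps w t)))"
      unfolding DW y by (rule alg)
    finally show "(nW x has_real_derivative (1 - 3 * nW x y) / y + 2 * y * (1 + eps) * nW x y * (nW x y + eps) * (nR x y - nW x y) / B_fun eps y (nR x y) (nW x y)) (at y within {a..<x})"
      unfolding t_def[symmetric] w_def[symmetric] B by simp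
  qed
qed

text \<open>A germ determines the functions on some interval of unknown length only; uniqueness for
  the differential equation carries the agreement to the whole interval of relative length
  \<rho>.\<close>

lemma extends_near:
  assumes ext: "rlp_extends eps x {a..<x} D W" and y: "a \<le> y" "y < x" "x * (1 - \<rho>) < y"
  shows "D y = nR x y" "W y = nW x y"
proof -
  have ok: "slopes_ok eps (om_root eps x) (W1_rlp eps x)" and R1: "R1_rlp eps x = cu_R eps (om_root eps x) (W1_rlp eps x)"
    using win[OF x] by blast+
  have germ: "rlp_germ eps x D W" and S: "solves_EE eps {a..<x} D W" using ext by (auto simp: rlp_extends_def)
  obtain T where T: "T > 0" "\<And>t. - T < t \<Longrightarrow> t < 0 \<Longrightarrow> D (x * (1 + t)) = sR eps (om_root eps x) t \<and> W (x * (1 + t)) = sW eps (om_root eps x) t"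
    using germ_unique[OF par_x om_G_x x_pos omega_x ok R1 germ] by blast
  note x0 = x_pos
  define b where "b = max ((y + x) / 2) (x * (1 - T / 2))"
  have b: "y < b" "b < x" "x * (1 - T) < b"
  proof -
    show "y < b" using y by (simp add: b_def less_max_iff_disj)
    have "x * (1 - T / 2) < x * 1" "x * (1 - T) < x * (1 - T / 2)" using x0 T by (auto simp del: mult_1_right)
    then show "b < x" "x * (1 - T) < b" using y by (auto simp: b_def)
  qed
  have Db: "D b = nR x b" "W b = nW x b"
  proof -
    have "b / x - 1 < 0" "- T < b / x - 1" using b x0 by (auto simp: field_simps)
    from T(2)[OF this(2,1)] show "D b = nR x b" "W b = nW x b" using x0 by auto
  qed
  have S1: "solves_EE eps {y..b} D W" by (rule solves_EE_subset[OF S]) (use y b in auto)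
  have S2: "solves_EE eps {y..b} (nR x) (nW x)" by (rule solves_EE_subset[OF near_solves[OF y(3)]]) (use b in auto)
  show "D y = nR x y" "W y = nW x y" using solves_EE_unique[OF S1 S2 Db, of y] b by auto
qed

lemma extends_from:
  assumes S: "solves_EE eps J D W" and J: "J \<subseteq> {..b}" "b \<in> J" and b: "x * (1 - \<rho>) < b" "b < x"
    and eq: "D b = nR x b" "W b = nW x b"
  shows "rlp_extends eps x (J \<union> {b..<x}) (\<lambda>y. if y \<le> b then D y else nR x y) (\<lambda>y. if y \<le> b then W y else nW x y)"
  unfolding rlp_extends_def
proof
  show "rlp_germ eps x (\<lambda>y. if y \<le> b then D y else nR x y) (\<lambda>y. if y \<le> b then W y else nW x y)"
    by (rule rlp_germ_cong[OF near_germ x_pos, of "x - b"]) (use b in auto)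
  show "solves_EE eps (J \<union> {b..<x}) (\<lambda>y. if y \<le> b then D y else nR x y) (\<lambda>y. if y \<le> b then W y else nW x y)"
    by (rule solves_EE_glue[OF S near_solves[OF b(1)] J]) (use b eq in auto)
qed

lemma extends_from':
  assumes S: "solves_EE eps {a..b} D W" and ab: "a \<le> b" and b: "x * (1 - \<rho>) < b" "b < x"
    and eq: "D b = nR x b" "W b = nW x b"
  shows "\<exists>D' W'. rlp_extends eps x {a..<x} D' W' \<and> (\<forall>y\<in>{a..b}. D' y = D y \<and> W' y = W y)"
proof -
  have "{a..b} \<union> {b..<x} = {a..<x}" using ab b by auto
  then show ?thesis using extends_from[OF S _ _ b eq] ab
    by (intro exI[of _ "\<lambda>y. if y \<le> b then D y else nR x y"] exI[of _ "\<lambda>y. if y \<le> b then W y else nW x y"]) auto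
qed

lemma extends_unique:
  assumes ext: "rlp_extends eps x {a..<x} D W" "rlp_extends eps x {a'..<x} D' W'" and y: "a \<le> y" "a' \<le> y" "y < x"
  shows "D y = D' y" "W y = W' y"
proof -
  note x0 = x_pos
  define b where "b = max y (x * (1 - \<rho> / 2))"
  have "x * (1 - \<rho> / 2) < x * 1" "x * (1 - \<rho>) < x * (1 - \<rho> / 2)"
    using x0 \<rho> by (auto simp del: mult_1_right)
  then have b: "y \<le> b" "b < x" "x * (1 - \<rho>) < b" using y by (auto simp: b_def)
  have eq: "D b = D' b" "W b = W' b" using extends_near[OF ext(1), of b] extends_near[OF ext(2), of b] b y by auto
  have "solves_EE eps {y..b} D W" "solves_EE eps {y..b} D' W'"
    using ext y b unfolding rlp_extends_def by (auto elim!: solves_EE_subset)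
  from solves_EE_unique[OF this eq, of y] show "D y = D' y" "W y = W' y" using b by auto
qed

definition xb where "xb = x * (1 - \<delta>1)"

lemma xb: "0 < xb" "x * (1 - \<rho>) < xb" "xb < x" "xb / x - 1 = - \<delta>1"
proof -
  note x0 = x_pos
  have "x * (1 - \<rho>) < x * (1 - \<delta>1)" "x * (1 - \<delta>1) < x * 1"
    using x0 \<delta>1 by (auto simp del: mult_1_right)
  then show "0 < xb" "x * (1 - \<rho>) < xb" "xb < x" "xb / x - 1 = - \<delta>1"
    using x0 \<delta>1 \<rho>_less_1 by (auto simp: xb_def)
qed

lemma near_third: "y < x \<Longrightarrow> x * (1 - \<rho>) < y \<Longrightarrow> 1/3 < nR x y \<and> nW x y < nR x y \<and> nW x y < 1/2"
proof -
  assume y: "y < x" "x * (1 - \<rho>) < y"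
  note x0 = x_pos
  have t: "- \<rho> < y / x - 1" "y / x - 1 < 0" using y x0 by (auto simp: field_simps)
  have "om_root eps x < nR x y" using sR_strict_antimono[OF par_x t(1,2)] \<rho> by (simp add: sRW_at_0)
  moreover have "nW x y < om_root eps x" using sW_strict_mono[OF par_x t(1,2)] \<rho> by (simp add: sRW_at_0)
  moreover have "1/3 \<le> om_root eps x" "om_root eps x < 1/2" using win[OF x] wM by auto
  ultimately show ?thesis using sonic_signs(2)[OF par_x _ t(2)] t by auto
qed

lemma xb_q: "q_fun eps xb (nR x xb) < \<theta>q" "1/3 < nR x xb"
  using win[OF x] xb near_third[of xb] by (auto simp: xb_def[symmetric])

end
end

context rlp_window
begin

lemma near_continuous:
  assumes x: "x \<in> {xlo..xhi}" and b: "x * (1 - \<rho>) < b" "b < x" and d: "0 < d"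
  shows "\<exists>d'>0. \<forall>y\<in>{xlo..xhi}. \<bar>y - x\<bar> < d' \<longrightarrow> y * (1 - \<rho>) < b \<and> b < y \<and> \<bar>nR y b - nR x b\<bar> < d \<and> \<bar>nW y b - nW x b\<bar> < d"
proof -
  note x0 = x_pos[OF x] and p = par_x[OF x]
  define w where "w = om_root eps x"
  define t0 where "t0 = b / x - 1"
  have t0: "- \<rho> < t0" "t0 < 0" using b x0 by (auto simp: t0_def field_simps)
  obtain \<delta> where \<delta>: "\<delta> > 0" "\<And>w' t'. par eps w' \<Longrightarrow> \<bar>w' - w\<bar> < \<delta> \<Longrightarrow> \<bar>t' - t0\<bar> < \<delta> \<Longrightarrow>
      \<bar>sR eps w' t' - sR eps w t0\<bar> < d \<and> \<bar>sW eps w' t' - sW eps w t0\<bar> < d"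
    using sRW_close[OF p[folded w_def] t0 d] by (metis abs_zero diff_self)
  have "continuous_on {0<..} (om_root eps)" using left.e by (intro om_root_continuous_x) auto
  then have "isCont (om_root eps) x" using x0 by (simp add: continuous_on_eq_continuous_at)
  then have E1: "\<forall>\<^sub>F y in nhds x. \<bar>om_root eps y - w\<bar> < \<delta>"
    using \<delta>(1) unfolding continuous_at_eps_delta dist_real_def w_def eventually_nhds_metric by blast
  have c2: "isCont (\<lambda>y. b / y - 1) x" using x0 by (intro continuous_intros) auto
  then have E2: "\<forall>\<^sub>F y in nhds x. \<bar>b / y - 1 - t0\<bar> < \<delta>"
    using \<delta>(1) unfolding continuous_at_eps_delta t0_def eventually_nhds_metric dist_real_def by blast
  have E3: "\<forall>\<^sub>F y in nhds x. - \<rho> < b / y - 1" "\<forall>\<^sub>F y in nhds x. b / y - 1 < 0"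
    using isCont_eventually_less[OF c2] t0 unfolding t0_def by blast+
  have E4: "\<forall>\<^sub>F y in nhds x. 0 < y" using x0 eventually_nhds_in_open[of "{0<..}" x] by simp
  have "\<forall>\<^sub>F y in nhds x. y \<in> {xlo..xhi} \<longrightarrow> y * (1 - \<rho>) < b \<and> b < y \<and> \<bar>nR y b - nR x b\<bar> < d \<and> \<bar>nW y b - nW x b\<bar> < d"
    using E1 E2 E3 E4
  proof eventually_elim
    case (elim y)
    show ?case
    proof
      assume y: "y \<in> {xlo..xhi}"
      have "y * (1 - \<rho>) < b" "b < y" using elim(3-5) by (simp_all add: field_simps)
      then show "y * (1 - \<rho>) < b \<and> b < y \<and> \<bar>nR y b - nR x b\<bar> < d \<and> \<bar>nW y b - nW x b\<bar> < d"
        using \<delta>(2)[OF par_x[OF y] elim(1,2)] unfolding t0_def w_def by blast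
    qed
  qed
  then show ?thesis unfolding eventually_nhds_metric dist_norm real_norm_def by blast
qed

section \<open>The two exits as conditions on the sonic point\<close>

definition reaches :: "(real \<times> real) set \<Rightarrow> real \<Rightarrow> bool" where
  "reaches U x \<longleftrightarrow> (\<exists>a D W. 0 < a \<and> a < x \<and> rlp_extends eps x {a..<x} D W \<and> (D a, W a) \<in> U)"

text \<open>The values at the hand-over point vary continuously with the sonic point, and solutions
  to the left depend continuously on them. The point xb x of the reference solution is used for all
  neighbouring y; it lies in their near regions as well.\<close>

lemma reaches_open:
  assumes x: "x \<in> {xlo..xhi}" and U: "open U"
    and a: "0 < a" "a \<le> xb x" and ext: "rlp_extends eps x {a..<x} D W" and aU: "(D a, W a) \<in> U"
  shows "\<exists>d>0. \<forall>y\<in>{xlo..xhi}. \<bar>y - x\<bar> < d \<longrightarrow> reaches U y"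
proof -
  note X = xb[OF x]
  have S: "solves_EE eps {a..xb x} D W" using ext X unfolding rlp_extends_def by (auto elim!: solves_EE_subset)
  have eq: "D (xb x) = nR x (xb x)" "W (xb x) = nW x (xb x)" using extends_near[OF x ext a(2) X(3,2)] by auto
  obtain e where e: "e > 0" "\<And>p. dist p (D a, W a) < e \<Longrightarrow> p \<in> U"
    using U aU unfolding open_dist by blast
  obtain d where d: "d > 0" "\<And>D0 W0. \<bar>D0 - D (xb x)\<bar> < d \<Longrightarrow> \<bar>W0 - W (xb x)\<bar> < d \<Longrightarrow>
    \<exists>D' W'. solves_EE eps {a..xb x} D' W' \<and> D' (xb x) = D0 \<and> W' (xb x) = W0 \<and>
      (\<forall>z\<in>{a..xb x}. \<bar>D' z - D z\<bar> < e / 2 \<and> \<bar>W' z - W z\<bar> < e / 2)"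
    using EE_dependence[OF S a(2), of "e / 2"] e(1) by auto
  obtain d' where d': "d' > 0" "\<And>y. y \<in> {xlo..xhi} \<Longrightarrow> \<bar>y - x\<bar> < d' \<Longrightarrow>
      y * (1 - \<rho>) < xb x \<and> xb x < y \<and> \<bar>nR y (xb x) - nR x (xb x)\<bar> < d \<and> \<bar>nW y (xb x) - nW x (xb x)\<bar> < d"
    using near_continuous[OF x X(2,3) d(1)] by blast
  have "reaches U y" if y: "y \<in> {xlo..xhi}" "\<bar>y - x\<bar> < d'" for y
  proof -
    note n = d'(2)[OF y]
    obtain D' W' where D': "solves_EE eps {a..xb x} D' W'" "D' (xb x) = nR y (xb x)" "W' (xb x) = nW y (xb x)"
      "\<And>z. z \<in> {a..xb x} \<Longrightarrow> \<bar>D' z - D z\<bar> < e / 2 \<and> \<bar>W' z - W z\<bar> < e / 2"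
      using d(2)[of "nR y (xb x)" "nW y (xb x)"] n eq by auto
    obtain D'' W'' where D'': "rlp_extends eps y {a..<y} D'' W''" "\<And>z. z \<in> {a..xb x} \<Longrightarrow> D'' z = D' z \<and> W'' z = W' z"
      using extends_from'[OF y(1) D'(1) a(2) _ _ D'(2,3)] n by blast
    have "dist (D'' a, W'' a) (D a, W a) < e"
      using D'(4)[of a] D''(2)[of a] a(2) norm_prod_bounds(3)[of "(D'' a, W'' a) - (D a, W a)"] by (simp add: dist_norm)
    from e(2)[OF this] show ?thesis
      unfolding reaches_def using D''(1) a n by (intro exI[of _ a] exI[of _ D''] exI[of _ W'']) auto
  qed
  then show ?thesis using d'(1) by blast
qed

definition U_low :: "(real \<times> real) set" where "U_low = {(D, W). W < 1/3}"
text \<open>Two ways to exit: D < W persists by signs, W > 1 / (2 - eps) by the rate bound. The left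
  end of the window is supplied with the second one.\<close>

definition U_high :: "(real \<times> real) set" where "U_high = {(D, W). 1/3 < W \<and> (D < W \<or> 1 / (2 - eps) < W)}"

lemma open_U: "open U_low" "open U_high"
proof -
  show "open U_low" unfolding U_low_def case_prod_unfold by (intro open_Collect_less continuous_intros)
  show "open U_high"
    unfolding U_high_def case_prod_unfold by (intro open_Collect_less open_Collect_conj open_Collect_disj continuous_intros)
qed

lemma near_extends: "x \<in> {xlo..xhi} \<Longrightarrow> rlp_extends eps x {xb x..<x} (nR x) (nW x)"
  unfolding rlp_extends_def using near_germ near_solves xb by blast

lemma nW_less: "x \<in> {xlo..xhi} \<Longrightarrow> x * (1 - \<rho>) < y \<Longrightarrow> y < z \<Longrightarrow> z \<le> x \<Longrightarrow> nW x y < nW x z"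
proof (rule sW_strict_mono[OF par_x])
  assume x: "x \<in> {xlo..xhi}" "x * (1 - \<rho>) < y" "y < z" "z \<le> x"
  note x0 = x_pos[OF x(1)]
  show "- \<rho> < y / x - 1" "y / x - 1 < z / x - 1" using x x0 by (auto simp: field_simps)
  have "z / x \<le> 1" using x x0 by (simp add: field_simps)
  then show "z / x - 1 < \<rho>" using \<rho> by linarith
qed

lemma nW_at: "x \<in> {xlo..xhi} \<Longrightarrow> nW x x = om_root eps x" using x_pos[of x] by (simp add: sRW_at_0)

text \<open>W increases in the near region, so a witness there can be moved left to xb x.\<close>

lemma low_witness:
  assumes x: "x \<in> {xlo..xhi}" and low: "reaches U_low x"
  obtains a D W where "0 < a" "a \<le> xb x" "rlp_extends eps x {a..<x} D W" "W a < 1/3"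
proof -
  obtain a D W where a: "0 < a" "a < x" "rlp_extends eps x {a..<x} D W" "W a < 1/3"
    using low by (auto simp: reaches_def U_low_def)
  show ?thesis
  proof (cases "a \<le> xb x")
    case False
    then have "nW x (xb x) < nW x a" using xb[OF x] a by (intro nW_less[OF x]) auto
    moreover have "W a = nW x a" using extends_near[OF x a(3) order_refl a(2)] False xb[OF x] by simp
    ultimately show ?thesis using that[OF _ order_refl near_extends[OF x]] xb[OF x] a by simp
  qed (use that a in blast)
qed

text \<open>In the near region W < D and W < 1/2 < 1 / (2 - eps), so this exit happens at xb x or
  further left.\<close>

lemma high_witness:
  assumes x: "x \<in> {xlo..xhi}" and high: "reaches U_high x"
  obtains a D W where "0 < a" "a \<le> xb x" "rlp_extends eps x {a..<x} D W" "1/3 < W a" "D a < W a \<or> 1 / (2 - eps) < W a"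
proof -
  obtain a D W where a: "0 < a" "a < x" "rlp_extends eps x {a..<x} D W" "1/3 < W a" "D a < W a \<or> 1 / (2 - eps) < W a"
    using high by (auto simp: reaches_def U_high_def)
  have "a \<le> xb x"
  proof (rule ccontr)
    assume "\<not> a \<le> xb x"
    then have n: "x * (1 - \<rho>) < a" using xb[OF x] by simp
    have "nW x a < nR x a \<and> nW x a < 1/2" using near_third[OF x a(2) n] by simp
    moreover have "1/2 < 1 / (2 - eps)" using left.e by (simp add: field_simps)
    ultimately show False using extends_near[OF x a(3) order_refl a(2) n] a(5) by auto
  qed
  then show ?thesis using that a by blast
qed

text \<open>Both extensions agree where both exist. The exit at the witness further to the right
  persists to the other witness and contradicts the value of W there.\<close>

lemma low_high_False:
  assumes x: "x \<in> {xlo..xhi}" and low: "reaches U_low x" and high: "reaches U_high x"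
  shows False
proof -
  obtain a D W where a: "0 < a" "a \<le> xb x" "rlp_extends eps x {a..<x} D W" "W a < 1/3"
    using low_witness[OF x low] by blast
  obtain a' D' W' where a': "0 < a'" "a' \<le> xb x" "rlp_extends eps x {a'..<x} D' W'" "1/3 < W' a'" "D' a' < W' a' \<or> 1 / (2 - eps) < W' a'"
    using high_witness[OF x high] by blast
  note X = xb[OF x]
  have S: "solves_EE eps {a..xb x} D W" "solves_EE eps {a'..xb x} D' W'"
    using a a' X unfolding rlp_extends_def by (auto elim!: solves_EE_subset)
  have q: "1/3 < D (xb x)" "q_fun eps (xb x) (D (xb x)) < \<theta>q" "1/3 < D' (xb x)" "q_fun eps (xb x) (D' (xb x)) < \<theta>q"
    using extends_near[OF x a(3,2) X(3,2)] extends_near[OF x a'(3,2) X(3,2)] xb_q[OF x] by auto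
  show False
  proof (cases "a \<le> a'")
    case True
    have "D a' = D' a'" "W a' = W' a'" using extends_unique[OF x a(3) a'(3) True order_refl] a'(2) X by auto
    then show False using left.high_persists[OF S(1) q(1,2), of a' a] a a' True by auto
  next
    case False
    have "D a = D' a" "W a = W' a" using extends_unique[OF x a(3) a'(3), of a] False a(2) X by auto
    then show False using left.low_persists[OF S(2) q(3,4), of a a'] a a' False by auto
  qed
qed

definition third :: "real \<Rightarrow> bool" where
  "third x \<longleftrightarrow> (\<exists>y\<in>{sonic_time eps x<..x}. \<exists>D W. rlp_extends eps x {y..<x} D W \<and> W y = 1/3)"

lemma sonic_time_le:
  assumes "0 < a" "a \<le> x" "rlp_extends eps x {a..<x} D W"
  shows "sonic_time eps x \<le> a" unfolding sonic_time_def using assms by (intro cInf_lower bdd_belowI[of _ 0]) auto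

text \<open>A point with W = 1/3 strictly above the sonic time is interior to some extension. There
  D > 1/3, hence W' > 0, and W falls below 1/3 just to the left. So the condition in
  \<open>X_third\<close> amounts to an open one.\<close>

lemma third_imp_low:
  assumes x: "x \<in> {xlo..xhi}" and third: "third x"
  shows "reaches U_low x"
proof -
  note X = xb[OF x] and x0 = x_pos[OF x]
  obtain y D W where y: "sonic_time eps x < y" "y \<le> x" "rlp_extends eps x {y..<x} D W" "W y = 1/3"
    using third by (auto simp: third_def)
  have near: "reaches U_low x" if "nW x (xb x) < 1/3"
    unfolding reaches_def using near_extends[OF x] that X by (intro exI[of _ "xb x"] exI[of _ "nR x"] exI[of _ "nW x"]) (auto simp: U_low_def)
  consider "y = x" | "y < x" "xb x < y" | "y < x" "y \<le> xb x"
    using y(2) by linarith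
  then show ?thesis
  proof cases
    case 1
    \<comment> \<open>Here the value 1/3 is taken at the sonic point itself; W increases in the near
      region, so it is below 1/3 to the left.\<close>
    have "om_root eps x = 1/3" using y(3,4) rlp_germ_value[of eps x D W] omega_x[OF x] 1 by (auto simp: rlp_extends_def)
    then show ?thesis using nW_less[OF x X(2,3) order_refl] nW_at[OF x] by (intro near) simp
  next
    case 2
    then have "W y = nW x y" using extends_near[OF x y(3)] X by simp
    then show ?thesis using nW_less[OF x X(2) 2(2)] 2 y(4) by (intro near) simp
  next
    case 3
    have "{x1 \<in> {0<..x}. \<exists>D W. rlp_extends eps x {x1..<x} D W} \<noteq> {}"
    proof -
      have "xb x \<in> {x1 \<in> {0<..x}. \<exists>D W. rlp_extends eps x {x1..<x} D W}"
        using near_extends[OF x] X by (intro CollectI conjI exI[of _ "nR x"] exI[of _ "nW x"]) auto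
      then show ?thesis by blast
    qed
    from cInf_lessD[OF this, of y] y(1) obtain x1 D' W' where x1: "0 < x1" "x1 < y" "rlp_extends eps x {x1..<x} D' W'"
      unfolding sonic_time_def by auto
    have Wy: "W' y = 1/3" using extends_unique[OF x x1(3) y(3), of y] x1 3 y(4) by simp
    have S: "solves_EE eps {x1..xb x} D' W'" using x1 X unfolding rlp_extends_def by (auto elim!: solves_EE_subset)
    have Sy: "solves_EE eps {y..xb x} D' W'" by (rule solves_EE_subset[OF S]) (use x1 in auto)
    have q: "1/3 < D' (xb x)" "q_fun eps (xb x) (D' (xb x)) < \<theta>q"
      using extends_near[OF x x1(3) _ X(3,2)] x1 3 xb_q[OF x] by auto
    have "1/3 \<le> W' y \<and> W' y \<le> D' y \<and> D' (xb x) \<le> D' y \<and> q_fun eps y (D' y) \<le> q_fun eps (xb x) (D' (xb x))"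
    proof (rule left.left_trichotomy[OF Sy q])
      fix z assume z: "z \<in> {y..xb x}"
      have Sz: "solves_EE eps {y..z} D' W'" by (rule solves_EE_subset[OF Sy]) (use z in auto)
      show "1/3 \<le> W' z" if "1/3 < D' z" using W_below_third_persists[OF Sz left.e _ that, of y] Wy z by fastforce
      show "W' z \<le> D' z" if "1/3 < W' z" using W_above_D_persists[OF Sz left.e that, of y] Wy z by fastforce
    qed (use 3 in auto)
    then have Dy: "1/3 < D' y" using q(1) by linarith
    have pos: "0 < y" "0 < B_fun eps y (D' y) (W' y)" using solves_EE_pos[OF S, of y] x1 3 by auto
    have "(W' has_real_derivative W_rhs eps y (D' y) (W' y)) (at y within {x1..xb x})"
      by (rule solves_EE_deriv_W[OF S]) (use x1 3 in auto)
    moreover have "0 < W_rhs eps y (D' y) (W' y)"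
    proof -
      have "0 < 2 * y * (1 + eps) * W' y * (W' y + eps) * (D' y - W' y) / B_fun eps y (D' y) (W' y)"
      proof (intro divide_pos_pos mult_pos_pos)
        show "0 < W' y" "0 < W' y + eps" "0 < D' y - W' y" using Wy Dy left.e by auto
      qed (use pos left.e in auto)
      moreover have "(1 - 3 * W' y) / y = 0" using Wy by simp
      ultimately show ?thesis by linarith
    qed
    ultimately obtain d where d: "d > 0" "\<And>h. h > 0 \<Longrightarrow> y - h \<in> {x1..xb x} \<Longrightarrow> h < d \<Longrightarrow> W' (y - h) < W' y"
      using has_real_derivative_pos_inc_left by blast
    define h where "h = min (d / 2) (y - x1)"
    have h: "0 < h" "h < d" "x1 \<le> y - h" using d(1) x1 by (auto simp: h_def)
    then have "W' (y - h) < 1/3" using d(2)[of h] 3 Wy by simp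
    moreover have "rlp_extends eps x {y - h..<x} D' W'"
      using x1(3) h unfolding rlp_extends_def by (auto elim!: solves_EE_subset)
    ultimately show ?thesis
      unfolding reaches_def using h x1 3 by (intro exI[of _ "y - h"] exI[of _ D'] exI[of _ W']) (auto simp: U_low_def)
  qed
qed

text \<open>Intermediate value theorem between the witness and a point near the sonic point where W
  > 1/3; if the sonic value is 1/3, the sonic point itself serves. The crossing lies strictly to the
  right of the witness, hence strictly above the sonic time.\<close>

lemma low_imp_third:
  assumes x: "x \<in> {xlo..xhi}" and low: "reaches U_low x"
  shows "third x"
proof -
  note X = xb[OF x] and x0 = x_pos[OF x]
  obtain a D W where a: "0 < a" "a \<le> xb x" "rlp_extends eps x {a..<x} D W" "W a < 1/3"
    using low_witness[OF x low] by blast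
  have st: "sonic_time eps x \<le> a" using sonic_time_le[OF a(1) _ a(3)] a(2) X by simp
  show ?thesis
  proof (cases "om_root eps x = 1/3")
    case True
    \<comment> \<open>The interval {x..<x} is empty, so only the germ is asserted.\<close>
    have "rlp_extends eps x {x..<x} (nR x) (nW x)" using near_germ[OF x] by (simp add: rlp_extends_def solves_EE_def)
    moreover have "sonic_time eps x < x" using st a(2) X by simp
    ultimately have "x \<in> {sonic_time eps x<..x} \<and> rlp_extends eps x {x..<x} (nR x) (nW x) \<and> nW x x = 1/3"
    proof (intro conjI)
      show "nW x x = 1/3" using True nW_at[OF x] by (simp only:)
    qed simp
    then show ?thesis unfolding third_def by blast
  next
    case False
    then have w: "1/3 < om_root eps x" using win[OF x] by auto
    have "isCont (sW eps (om_root eps x)) 0" using sW_deriv[OF par_x[OF x], of 0] \<rho> by (auto intro: DERIV_isCont)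
    then have "\<forall>\<^sub>F t in nhds 0. 1/3 < sW eps (om_root eps x) t"
      by (rule isCont_eventually_less(2)) (use w in \<open>simp add: sRW_at_0\<close>)
    then obtain d where d: "d > 0" "\<And>t. \<bar>t\<bar> < d \<Longrightarrow> 1/3 < sW eps (om_root eps x) t"
      unfolding eventually_nhds_metric dist_norm by auto
    define t where "t = - min (d / 2) (\<delta>1 / 2)"
    have t: "\<bar>t\<bar> < d" "- \<delta>1 < t" "t < 0" using d(1) \<delta>1 by (auto simp: t_def)
    define y where "y = x * (1 + t)"
    have "x * (1 - \<delta>1) < x * (1 + t)" "x * (1 + t) < x * 1" using t x0 by (auto simp del: mult_1_right)
    then have y: "xb x < y" "y < x" by (auto simp: y_def xb_def[OF x])
    have "nW x y = sW eps (om_root eps x) t" using x0 by (simp add: y_def)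
    then have Wy: "1/3 < W y" using extends_near[OF x a(3) _ y(2)] d(2)[OF t(1)] y a(2) X by simp
    have "continuous_on {a..y} W"
      using a(3) y unfolding rlp_extends_def by (auto elim!: continuous_on_subset[OF solves_EE_cont(2)])
    then obtain z where z: "a \<le> z" "z \<le> y" "W z = 1/3" using IVT'[of W a "1/3" y] a(2,4) y Wy by auto
    have "a < z" using z a(4) by (cases "a = z") auto
    moreover have "rlp_extends eps x {z..<x} D W"
      using a(3) z unfolding rlp_extends_def by (auto elim!: solves_EE_subset)
    ultimately show ?thesis unfolding third_def using st z y by (intro bexI[of _ z] exI[of _ D] exI[of _ W]) auto
  qed
qed

text \<open>Without exits no extension meets \<open>U_low\<close> or \<open>U_high\<close>, which is
  what \<open>critical_global\<close> asks for. Analyticity is then proved separately at 0, in the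
  interior and at the sonic point.\<close>

lemma critical:
  assumes x: "x \<in> {xlo..xhi}" and nl: "\<not> reaches U_low x" and nh: "\<not> reaches U_high x"
  shows "\<exists>D W. rlp_extends eps x {0<..<x} D W \<and> real_analytic_on D {0..x} \<and> real_analytic_on W {0..x} \<and> W 0 = 1/3 \<and> D 0 > 1/3"
proof -
  note X = xb[OF x] and x0 = x_pos[OF x]
  define b where "b = xb x"
  have b: "0 < b" "x * (1 - \<rho>) < b" "b < x" using X by (auto simp: b_def)
  define D1 where "D1 = nR x b"
  define W1 where "W1 = nW x b"
  have reach: "rlp_extends eps x {y..<x} D' W' \<Longrightarrow> 0 < y \<Longrightarrow> y < x \<Longrightarrow> (D' y, W' y) \<notin> U_low \<and> (D' y, W' y) \<notin> U_high" for y D' W'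
    using nl nh unfolding reaches_def by blast
  have no: "(D y, W y) \<notin> U_low \<and> (D y, W y) \<notin> U_high"
    if S: "solves_EE eps {a..b} D W" "D b = D1" "W b = W1" and y: "y \<in> {a..b}" for a D W y
  proof -
    have Sy: "solves_EE eps {y..b} D W" by (rule solves_EE_subset[OF S(1)]) (use y in auto)
    obtain D' W' where D': "rlp_extends eps x {y..<x} D' W'" "\<And>z. z \<in> {y..b} \<Longrightarrow> D' z = D z \<and> W' z = W z"
      using extends_from'[OF x Sy _ b(2,3)] S(2,3) y unfolding D1_def W1_def by auto
    have "0 < y" using solves_EE_pos(1)[OF S(1) y] .
    with reach[OF D'(1)] D'(2)[of y] y b show ?thesis by auto
  qed
  have "\<exists>D W. solves_EE eps {0<..b} D W \<and> D b = D1 \<and> W b = W1 \<and>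
    (\<forall>x\<in>{0<..b}. 1/3 \<le> W x \<and> W x \<le> D x \<and> W x \<le> 1 \<and> D1 \<le> D x \<and> q_fun eps x (D x) \<le> \<theta>q)"
  proof (rule left.critical_global)
    show "(b, D1, W1) \<in> EE_dom eps" using near_solves[OF x b(2)] b unfolding solves_EE_iff D1_def W1_def by auto
    show "1/3 < D1" "q_fun eps b D1 < \<theta>q" using xb_q[OF x] by (auto simp: D1_def b_def)
    show "1/3 \<le> W y" if "solves_EE eps {a..b} D W" "D b = D1" "W b = W1" "y \<in> {a..b}" for a D W y
      using no[OF that] by (auto simp: U_low_def)
    show "W y \<le> D y \<and> W y \<le> 1 / (2 - eps)" if "solves_EE eps {a..b} D W" "D b = D1" "W b = W1" "y \<in> {a..b}" "1/3 < W y" for a D W y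
      using no[OF that(1-4)] that(5) by (auto simp: U_high_def)
  qed
  then obtain D W where S: "solves_EE eps {0<..b} D W" "D b = D1" "W b = W1"
    and inv: "\<And>x. 0 < x \<Longrightarrow> x \<le> b \<Longrightarrow> 1/3 \<le> W x \<and> W x \<le> D x \<and> W x \<le> 1 \<and> D1 \<le> D x \<and> q_fun eps x (D x) \<le> \<theta>q"
    by force
  have D1: "1/3 < D1" using xb_q[OF x] by (simp add: D1_def b_def)
  obtain D0 C where D0: "D1 \<le> D0" and C: "\<And>x. 0 < x \<Longrightarrow> x \<le> b \<Longrightarrow> \<bar>D x - D0\<bar> \<le> C * x^2" "\<And>x. 0 < x \<Longrightarrow> x \<le> b \<Longrightarrow> \<bar>W x - 1/3\<bar> \<le> C * x^2"
    using left.zero_bounds[OF S(1) b(1) _ inv] D1 by auto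
  have "0 < D0" using D0 D1 by simp
  have "\<exists>T>0. \<exists>gD gW. (\<forall>t. \<bar>t\<bar> < T \<longrightarrow> (\<exists>F. (\<lambda>s. gD (t + s)) has_fps_expansion F) \<and> (\<exists>F. (\<lambda>s. gW (t + s)) has_fps_expansion F)) \<and>
    gD 0 = D0 \<and> gW 0 = 1/3 \<and> (\<forall>t. 0 < t \<longrightarrow> t < T \<longrightarrow> D t = gD t \<and> W t = gW t)"
    by (rule EE_analytic_zero[where C = C, OF S(1) left.e(2) b(1) \<open>0 < D0\<close>]) (use C in auto)
  then obtain T gD gW where T: "T > 0" and G: "\<forall>t. \<bar>t\<bar> < T \<longrightarrow> (\<exists>F. (\<lambda>s. gD (t + s)) has_fps_expansion F) \<and> (\<exists>F. (\<lambda>s. gW (t + s)) has_fps_expansion F)"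
    and g0: "gD 0 = D0" "gW 0 = 1/3" and Gt: "\<forall>t. 0 < t \<longrightarrow> t < T \<longrightarrow> D t = gD t \<and> W t = gW t"
    by (elim exE conjE) (rule that)
  have g: "\<exists>F. (\<lambda>s. gD (t + s)) has_fps_expansion F" "\<exists>F. (\<lambda>s. gW (t + s)) has_fps_expansion F" if "\<bar>t\<bar> < T" for t
    using G that by blast+
  have gt: "D t = gD t \<and> W t = gW t" if "0 < t" "t < T" for t using Gt that by blast
  define Dl where "Dl = (\<lambda>y. if y \<le> b then D y else nR x y)"
  define Wl where "Wl = (\<lambda>y. if y \<le> b then W y else nW x y)"
  \<comment> \<open>For nonpositive arguments the analytic continuation is used, because analyticity
    at 0 is two-sided.\<close>
  define Df where "Df = (\<lambda>y. if y \<le> 0 then gD y else Dl y)"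
  define Wf where "Wf = (\<lambda>y. if y \<le> 0 then gW y else Wl y)"
  have "rlp_extends eps x ({0<..b} \<union> {b..<x}) Dl Wl"
    unfolding Dl_def Wl_def using S(2,3) b by (intro extends_from[OF x S(1)]) (auto simp: D1_def W1_def)
  moreover have "{0<..b} \<union> {b..<x} = {0<..<x}" using b by auto
  ultimately have l: "rlp_germ eps x Dl Wl" "solves_EE eps {0<..<x} Dl Wl" by (simp_all add: rlp_extends_def)
  have germ: "rlp_germ eps x Df Wf" by (rule rlp_germ_cong[OF l(1) x0 x0]) (auto simp: Df_def Wf_def)
  have solves: "solves_EE eps {0<..<x} Df Wf" by (rule solves_EE_cong[OF l(2)]) (auto simp: Df_def Wf_def)
  have an: "(\<exists>F. (\<lambda>t. Df (y + t)) has_fps_expansion F) \<and> (\<exists>F. (\<lambda>t. Wf (y + t)) has_fps_expansion F)" if y: "y \<in> {0..x}" for y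
  proof -
    consider "y = 0" | "0 < y" "y < x" | "y = x"
      using y by force
    then show ?thesis
    proof cases
      case 1
      have "Df t = gD t \<and> Wf t = gW t" if "\<bar>t\<bar> < min T b" for t
        using gt[of t] that by (auto simp: Df_def Wf_def Dl_def Wl_def)
      then have "\<forall>\<^sub>F t in nhds 0. Df (0 + t) = gD (0 + t)" "\<forall>\<^sub>F t in nhds 0. Wf (0 + t) = gW (0 + t)"
        unfolding eventually_nhds_metric using T b by (auto intro!: exI[of _ "min T b"] simp: dist_norm)
      note ev = has_fps_expansion_cong[OF this(1) refl] has_fps_expansion_cong[OF this(2) refl]
      show ?thesis unfolding 1 ev using g[of 0] T by simp
    next
      case 2
      have "solves_EE eps {y/2..(y + x)/2} Df Wf" by (rule solves_EE_subset[OF solves]) (use 2 in auto)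
      from EE_analytic_interior[OF this left.e(2), of y] 2 show ?thesis by auto
    next
      case 3
      show ?thesis unfolding 3 using rlp_germ_analytic[OF germ x0] by blast
    qed
  qed
  show ?thesis
  proof (rule exI[of _ Df], rule exI[of _ Wf], intro conjI)
    show "rlp_extends eps x {0<..<x} Df Wf" using germ solves by (simp add: rlp_extends_def)
    show "real_analytic_on Df {0..x}" "real_analytic_on Wf {0..x}" using an by (auto simp: real_analytic_on_def)
    show "Wf 0 = 1/3" "1/3 < Df 0" using g0 D0 D1 by (auto simp: Df_def Wf_def)
  qed
qed

end

subsection \<open>Uniform smallness in \<open>eps\<close>\<close>

context sonic
begin

lemma par_0: "3/10 \<le> w \<Longrightarrow> w \<le> wM \<Longrightarrow> par 0 w" using e0 by simp

lemma slopes_ok_0: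
  assumes "3/10 \<le> w" "w \<le> wM"
  shows "slopes_ok 0 w (1 - 2 * w)" "cu_R 0 w (1 - 2 * w) = - w"
proof -
  have w: "w > 0" using assms by simp
  show R: "cu_R 0 w (1 - 2 * w) = - w"
    using w by (simp add: cu_R_def cu_coeff_defs son_H0_def field_simps power2_eq_square)
  have "cu 0 w (1 - 2 * w) = 0" using cu_0(1)[of w] w by simp
  moreover have "cu_h 0 w + cu_b 0 w * (1 - 2 * w) \<noteq> 0" using w by (simp add: cu_coeff_defs)
  ultimately show "slopes_ok 0 w (1 - 2 * w)" using \<kappa> r w R by (simp add: slopes_ok_def eta_def)
qed

text \<open>At \<open>eps = 0\<close> the function \<open>\<psi> = z R - w\<close> vanishes to second order at \<open>z = 1\<close>. Where \<open>\<psi> \<ge> 0\<close>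
  and \<open>t < 0\<close> the quotient \<open>\<psi> / t\<close> strictly decreases, so a nonnegative value of \<open>\<psi>\<close> would be
  incompatible with \<open>\<psi> / t\<close> tending to \<open>0\<close>.\<close>

lemma zR_less:
  assumes w: "3/10 \<le> w" "w \<le> wM" and t: "- \<rho> < t" "t < 0"
  shows "(1 + t) * sR 0 w t < w"
proof (rule ccontr)
  assume neg: "\<not> (1 + t) * sR 0 w t < w"
  have p: "par 0 w" using w by (rule par_0)
  have wM: "0 < w" "w < 1/2" "8 * \<eta> \<le> 1 - 2 * w" using w wM \<eta> by auto
  define \<psi> where "\<psi> = (\<lambda>t. (1 + t) * sR 0 w t - w)"
  define \<psi>' where "\<psi>' = (\<lambda>t. sR 0 w t + (1 + t) * (- 2 * (1 + t) * sR 0 w t * sW 0 w t * sq 0 w t))"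
  have der: "(\<psi> has_real_derivative \<psi>' s) (at s)" if "\<bar>s\<bar> < \<rho>" for s
    unfolding \<psi>_def \<psi>'_def using sR_deriv[OF p that] by (auto intro!: derivative_eq_intros)
  have psi0: "\<psi> 0 = 0" "\<psi>' 0 = 0"
  proof -
    have "\<bar>0\<bar> < \<rho>" using \<rho> by simp
    have s: "sol 0 w VP 0 = 1 - 3 * w" "sol 0 w VU 0 = 1 - 2 * w" "sol 0 w VG 0 = 0"
      using sol_at_0[OF slopes_ok_0(1)[OF w] p] slopes_ok_0(2)[OF w] by (simp_all add: slope_var_def eta_def)
    have "sb 0 w 0 * sq 0 w 0 = sol 0 w VP 0 - 2 * sol 0 w VU 0"
      using sq_eq[OF p \<open>\<bar>0\<bar> < \<rho>\<close>] .
    moreover have "sb 0 w 0 = - 2 * w * (1 - w)"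
      unfolding sb_def s by (simp add: son_b_def son_S_def son_H0_def algebra_simps power2_eq_square)
    ultimately have "- 2 * w * (1 - w) * sq 0 w 0 = - (1 - w)" by (simp add: s)
    then have "(1 - w) * (2 * w * sq 0 w 0) = (1 - w) * 1" by (simp add: algebra_simps)
    then have "2 * w * sq 0 w 0 = 1" using wM by simp
    then show "\<psi> 0 = 0" "\<psi>' 0 = 0" by (auto simp: \<psi>_def \<psi>'_def sRW_at_0 algebra_simps)
  qed
  have key: "\<psi>' s * s - \<psi> s < 0" if s: "- \<rho> < s" "s < 0" and nn: "0 \<le> \<psi> s" for s
  proof -
    have s': "\<bar>s\<bar> < \<rho>" using s by simp
    define R where "R = sR 0 w s"
    define W where "W = sW 0 w s"
    define \<beta> where "\<beta> = - sb 0 w s"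
    define \<sigma> where "\<sigma> = sol 0 w VP s - 2 * sol 0 w VU s"
    have RW: "0 < R" "0 < W" "W < w"
      using sRW_bounds(1,2)[OF p s'] sW_strict_mono[OF p s(1,2)] \<rho> by (auto simp: R_def W_def sRW_at_0)
    have z: "0 < 1 + s" "1 + s < 1" using s \<rho> by auto
    have \<beta>: "2 * w * (1 - w) - \<eta> < \<beta>" "0 < \<beta>"
      using sb_bounds(1,4)[OF p s'] by (auto simp: \<beta>_def)
    have "sE 0 w s = 1" using sE_eq[OF p s'] RW wM by (simp add: eta_def R_def)
    then have "s * sb 0 w s = w^2 - W^2 * (1 + s)^2" using sb_eq[OF p s'] by (simp add: son_H0_def EE_S_def R_def W_def)
    then have sb: "s * - \<beta> = w^2 - W^2 * (1 + s)^2" by (simp add: \<beta>_def)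
    have sq: "- \<beta> * sq 0 w s = \<sigma>" "R - W = s * \<sigma>"
      using sq_eq[OF p s'] sR_minus_sW[OF p s'] by (simp_all add: \<beta>_def \<sigma>_def R_def W_def)
    \<comment> \<open>Multiplication by - \<beta> = \<open>sb\<close> removes the quotient: at eps =
      0 both s * sb and R - W are explicit. What remains is a square and a multiple of
      \<psi>.\<close>
    have "(\<psi>' s * s) * - \<beta> = R * (s * - \<beta>) - 2 * (1 + s)^2 * R * W * (s * (- \<beta> * sq 0 w s))"
      by (simp add: \<psi>'_def R_def[symmetric] W_def[symmetric] algebra_simps power2_eq_square)
    also have "\<dots> = R * (w^2 - W^2 * (1 + s)^2) - 2 * (1 + s)^2 * R * W * (R - W)" unfolding sb sq by simp
    also have "\<dots> = R * ((w - (1 + s) * W)^2 - 2 * (1 + s) * W * \<psi> s)"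
      by (simp add: \<psi>_def R_def[symmetric] algebra_simps power2_eq_square)
    finally have e1: "(\<psi>' s * s) * \<beta> = 2 * (1 + s) * W * R * \<psi> s - R * (w - (1 + s) * W)^2"
      by (simp add: algebra_simps)
    have "(1 + s) * W < 1 * w" using z RW by (intro mult_strict_mono) auto
    then have e2: "0 < R * (w - (1 + s) * W)^2" using RW by simp
    have zR: "(1 + s) * R \<le> w + \<eta> / 5"
    proof -
      have "- w - 2 * r \<le> sol 0 w VP s - sol 0 w VU s" using sol_bounds(1,2)[OF p s'] by linarith
      then have "s * (sol 0 w VP s - sol 0 w VU s) \<le> s * (- w - 2 * r)" using s by (intro mult_left_mono_neg) auto
      then have "R \<le> w + s * (- w - 2 * r)" by (simp add: R_def sR_def)
      then have "(1 + s) * R \<le> (1 + s) * (w + s * (- w - 2 * r))" using z by (intro mult_left_mono) auto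
      also have "\<dots> = w - s^2 * w + (- s) * (2 * r) * (1 + s)" by (simp add: algebra_simps power2_eq_square)
      also have "\<dots> \<le> w - 0 + 1 * (2 * r) * 1"
        using s z wM r \<rho> by (intro add_mono diff_mono mult_mono) auto
      finally show ?thesis using r by simp
    qed
    \<comment> \<open>At the sonic point this compares 2 w^2 with 2 w (1 - w); the gap 2 w (1 - 2 w)
      absorbs the errors of order \<eta>.\<close>
    have "2 * (1 + s) * W * R = 2 * W * ((1 + s) * R)" by simp
    also have "\<dots> \<le> 2 * w * (w + \<eta> / 5)" using zR RW wM z by (intro mult_mono) auto
    also have "\<dots> \<le> 2 * w * (1 - w) - \<eta>"
    proof -
      have "3/10 * (8 * \<eta>) \<le> w * (1 - 2 * w)" using w wM \<eta> by (intro mult_mono) auto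
      moreover have "w * \<eta> \<le> 1 * \<eta>" using wM \<eta> by (intro mult_right_mono) auto
      moreover have "0 < \<eta>" using \<eta> by simp
      moreover have "2 * w * (w + \<eta> / 5) = 2 * (w * w) + 2 / 5 * (w * \<eta>)" "2 * w * (1 - w) - \<eta> = 2 * w - 2 * (w * w) - \<eta>"
        "w * (1 - 2 * w) = w - 2 * (w * w)"
        by (simp_all add: algebra_simps)
      ultimately show ?thesis by linarith
    qed
    also have "\<dots> \<le> \<beta>" using \<beta> by simp
    finally have "2 * (1 + s) * W * R * \<psi> s \<le> \<beta> * \<psi> s" using nn by (rule mult_right_mono)
    with e1 e2 have "(\<psi>' s * s) * \<beta> < \<psi> s * \<beta>" by (simp add: mult.commute)
    then show ?thesis using \<beta>(2) by simp
  qed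
  define \<tau> where "\<tau> = (\<lambda>s. if s = 0 then 0 else \<psi> s / s)"
  have cont: "continuous_on {t..0} \<tau>"
  proof (rule continuous_at_imp_continuous_on, rule ballI)
    fix s assume s: "s \<in> {t..0}"
    show "isCont \<tau> s"
    proof (cases "s = 0")
      case True
      have "((\<lambda>h. (\<psi> (0 + h) - \<psi> 0) / h) \<longlongrightarrow> 0) (at 0)"
        using der[of 0] psi0 \<rho> unfolding DERIV_def by simp
      then have "(\<tau> \<longlongrightarrow> 0) (at 0)"
        by (rule Lim_transform_eventually) (auto simp: \<tau>_def psi0 eventually_at_filter)
      then show ?thesis by (simp add: True isCont_def \<tau>_def)
    next
      case False
      have "isCont \<psi> s" using der[of s] s t by (auto intro: DERIV_isCont)
      then have "isCont (\<lambda>s. \<psi> s / s) s" using False by (intro continuous_intros) auto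
      moreover have "\<forall>\<^sub>F s in nhds s. \<tau> s = \<psi> s / s"
        using eventually_nhds_in_open[of "- {0}" s] False by (auto elim!: eventually_mono simp: \<tau>_def)
      ultimately show ?thesis using isCont_cong[of \<tau> "\<lambda>s. \<psi> s / s" s] by simp
    qed
  qed
  obtain tm where tm: "tm \<in> {t..0}" "\<And>s. s \<in> {t..0} \<Longrightarrow> \<tau> tm \<le> \<tau> s"
    using continuous_attains_inf[OF compact_Icc _ cont] t by auto
  have \<tau>t: "\<tau> t \<le> 0" using neg t by (simp add: \<tau>_def \<psi>_def divide_nonneg_neg)
  \<comment> \<open>At a minimum of \<psi> / t over [t, 0] with \<psi> >= 0 and s < 0 the quotient
    cannot strictly decrease. If the minimum is found at 0, the value at t is 0 as well, and t
    itself is a minimum.\<close>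
  have "\<exists>s. t \<le> s \<and> s < 0 \<and> 0 \<le> \<psi> s \<and> (\<forall>u\<in>{t..0}. \<tau> s \<le> \<tau> u)"
  proof (cases "tm = 0")
    case True
    then have "\<tau> t \<le> \<tau> u" if "u \<in> {t..0}" for u using \<tau>t tm(2)[OF that] by (simp add: \<tau>_def)
    then show ?thesis using t neg by (intro exI[of _ t]) (auto simp: \<psi>_def)
  next
    case False
    then have "tm < 0" "\<tau> tm \<le> 0" using tm(1) tm(2)[of t] \<tau>t t by auto
    then have "0 \<le> \<psi> tm" using False by (simp add: \<tau>_def divide_le_0_iff)
    then show ?thesis using tm \<open>tm < 0\<close> by (intro exI[of _ tm]) auto
  qed
  then obtain s where s: "t \<le> s" "s < 0" "0 \<le> \<psi> s" "\<And>u. u \<in> {t..0} \<Longrightarrow> \<tau> s \<le> \<tau> u"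
    by blast
  have "((\<lambda>s. \<psi> s / s) has_real_derivative (\<psi>' s * s - \<psi> s * 1) / (s * s)) (at s)"
    using s t by (intro DERIV_divide der DERIV_ident) auto
  moreover have "(\<psi>' s * s - \<psi> s * 1) / (s * s) < 0"
    using key[of s] s t by (intro divide_neg_pos) (auto simp: mult_neg_neg)
  ultimately obtain d where d: "d > 0" "\<And>h. 0 < h \<Longrightarrow> h < d \<Longrightarrow> \<psi> (s + h) / (s + h) < \<psi> s / s"
    using DERIV_neg_dec_right by blast
  define h where "h = min (d / 2) (- s / 2)"
  have h: "0 < h" "h < d" "s + h < 0" using d(1) s(2) by (auto simp: h_def min_def)
  have "\<tau> s \<le> \<tau> (s + h)" using h s t by (intro s(4)) auto
  then show False using d(2)[OF h(1,2)] h s(2) by (simp add: \<tau>_def)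
qed

lemma sR_close:
  assumes p: "par e w" and t: "- \<rho> < t" "t < 0" and d: "0 < d"
  shows "\<exists>\<delta>>0. \<forall>e' w'. par e' w' \<longrightarrow> \<bar>e' - e\<bar> < \<delta> \<longrightarrow> \<bar>w' - w\<bar> < \<delta> \<longrightarrow> \<bar>sR e' w' t - sR e w t\<bar> < d"
  using sRW_close[OF assms] by (metis abs_zero diff_self)

text \<open>At eps = 0 one has x = 1 / w, so q at the hand-over point is (1 - \<delta>1) R / w,
  which is below 1 by \<open>zR_less\<close>. Its maximum over the compact range of w is below 1,
  and compactness extends the bound to small eps.\<close>

lemma q_fun_uniform:
  assumes \<delta>1: "0 < \<delta>1" "\<delta>1 < \<rho>"
  shows "\<exists>\<theta>q. 0 < \<theta>q \<and> \<theta>q < 1 \<and> (\<exists>e1>0. \<forall>e w x. par e w \<longrightarrow> e < e1 \<longrightarrow> 0 < x \<longrightarrow> om_G e w = 1 / x^2 \<longrightarrow>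
    q_fun e (x * (1 - \<delta>1)) (sR e w (- \<delta>1)) < \<theta>q)"
proof -
  define K where "K = {3/10..wM}"
  have K: "compact K" "K \<noteq> {}" using wM by (auto simp: K_def)
  have t: "- \<rho> < - \<delta>1" "- \<delta>1 < 0" "\<bar>- \<delta>1\<bar> < \<rho>" using \<delta>1 by auto
  define v where "v = (\<lambda>w. (1 - \<delta>1) * sR 0 w (- \<delta>1) / w)"
  have "continuous_on K (\<lambda>w. sR 0 w (- \<delta>1))" unfolding continuous_on_iff
  proof (intro ballI allI impI)
    fix w d :: real assume "w \<in> K" and d: "0 < d"
    then have "par 0 w" using e0 by (simp add: K_def)
    from sR_close[OF this t(1,2) d] obtain \<delta> where "\<delta> > 0"
      "\<And>e' w'. par e' w' \<Longrightarrow> \<bar>e' - 0\<bar> < \<delta> \<Longrightarrow> \<bar>w' - w\<bar> < \<delta> \<Longrightarrow> \<bar>sR e' w' (- \<delta>1) - sR 0 w (- \<delta>1)\<bar> < d"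
      by blast
    then show "\<exists>\<delta>>0. \<forall>w'\<in>K. dist w' w < \<delta> \<longrightarrow> dist (sR 0 w' (- \<delta>1)) (sR 0 w (- \<delta>1)) < d"
      using e0 by (intro exI[of _ \<delta>]) (auto simp: K_def dist_real_def)
  qed
  then have "continuous_on K v" unfolding v_def by (intro continuous_intros) (auto simp: K_def)
  from continuous_attains_sup[OF K this] obtain w0 where w0: "w0 \<in> K" "\<And>w. w \<in> K \<Longrightarrow> v w \<le> v w0"
    by blast
  have v1: "v w < 1" "0 < v w" if "w \<in> K" for w
    using zR_less[of w "- \<delta>1"] sRW_bounds(2)[OF par_0 t(3), of w] that t \<delta>1 \<rho> by (auto simp: v_def K_def)
  define \<theta>q where "\<theta>q = (1 + v w0) / 2"
  have \<theta>q: "0 < \<theta>q" "\<theta>q < 1" "\<And>w. w \<in> K \<Longrightarrow> v w < \<theta>q"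
    using v1[OF w0(1)] w0(2) by (force simp: \<theta>q_def)+
  \<comment> \<open>x is eliminated through x = 1 / sqrt (om_G e w), which makes q a continuous
    function of w, e and D.\<close>
  define \<Phi> where "\<Phi> = (\<lambda>(w, e, D). (1 - \<delta>1) / sqrt (om_G e w) * D powr (1 / (1 - e)))"
  define P where "P = (\<lambda>(w, e). par e w \<longrightarrow> \<Phi> (w, e, sR e w (- \<delta>1)) < \<theta>q)"
  have "\<exists>\<delta>>0. \<forall>w\<in>K. \<forall>e. norm e < \<delta> \<longrightarrow> P (w, e)"
  proof (rule uniform_eventually_compact[OF K(1)])
    fix w assume w: "w \<in> K"
    then have p: "par 0 w" and w0: "0 < w" using e0 by (auto simp: K_def)
    define D where "D = sR 0 w (- \<delta>1)"
    have D: "0 < D" using sRW_bounds(2)[OF p t(3)] by (simp add: D_def)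
    have G0: "om_G 0 w = w^2" using w0 by (simp add: om_G_eq eta_def)
    have "isCont \<Phi> (w, 0, D)" unfolding \<Phi>_def case_prod_unfold om_G_eq eta_def
      apply (intro continuous_intros)
      using w0 D G0 by (simp_all add: om_G_eq eta_def)
    moreover have "\<Phi> (w, 0, D) = v w" using w0 D G0 by (simp add: \<Phi>_def v_def D_def)
    ultimately have "\<forall>\<^sub>F y in nhds (w, 0, D). \<Phi> y < \<theta>q"
      using \<theta>q(3)[OF w] by (intro isCont_eventually_less(1)) auto
    then obtain d where d: "d > 0" "\<And>y. dist y (w, 0, D) < d \<Longrightarrow> \<Phi> y < \<theta>q"
      unfolding eventually_nhds_metric by blast
    have d3: "0 < d / 3" using d(1) by simp
    from sR_close[OF p t(1,2) d3] obtain \<delta> where \<delta>: "\<delta> > 0"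
      "\<And>e' w'. par e' w' \<Longrightarrow> \<bar>e' - 0\<bar> < \<delta> \<Longrightarrow> \<bar>w' - w\<bar> < \<delta> \<Longrightarrow> \<bar>sR e' w' (- \<delta>1) - sR 0 w (- \<delta>1)\<bar> < d / 3"
      by blast
    have "P y" if y: "dist y (w, 0) < min \<delta> (d / 3)" for y
    proof -
      obtain w' e' where ye: "y = (w', e')" by (cases y)
      have "\<bar>w' - w\<bar> < min \<delta> (d / 3)" "\<bar>e' - 0\<bar> < min \<delta> (d / 3)"
        using y norm_prod_bounds(1,2)[of "y - (w, 0)"] unfolding ye dist_norm by auto
      moreover have "dist (w', e', sR e' w' (- \<delta>1)) (w, 0, D) \<le> \<bar>w' - w\<bar> + (\<bar>e' - 0\<bar> + \<bar>sR e' w' (- \<delta>1) - D\<bar>)"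
        using norm_triple_le[of "w' - w" "(e' - 0, sR e' w' (- \<delta>1) - D)"] norm_triple_le[of "e' - 0" "sR e' w' (- \<delta>1) - D"]
        by (simp add: dist_norm)
      ultimately have "par e' w' \<longrightarrow> dist (w', e', sR e' w' (- \<delta>1)) (w, 0, D) < d"
        using \<delta>(2)[of e' w'] unfolding D_def by fastforce
      then show "P y" using d(2) by (simp add: P_def ye)
    qed
    then show "\<forall>\<^sub>F y in nhds (w, 0). P y"
      unfolding eventually_nhds_metric using \<delta>(1) d3 by (intro exI[of _ "min \<delta> (d / 3)"]) auto
  qed
  then obtain e1 where e1: "e1 > 0" "\<And>w e. w \<in> K \<Longrightarrow> \<bar>e\<bar> < e1 \<Longrightarrow> P (w, e)"
    by auto
  have "q_fun e (x * (1 - \<delta>1)) (sR e w (- \<delta>1)) < \<theta>q"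
    if "par e w" "e < e1" "0 < x" "om_G e w = 1 / x^2" for e w x
  proof -
    have "P (w, e)" using that by (intro e1(2)) (auto simp: K_def)
    moreover have "sqrt (1 / x^2) = 1 / x" using that(3) by (simp add: real_sqrt_divide)
    ultimately show ?thesis using that by (simp add: P_def \<Phi>_def q_fun_def mult_ac)
  qed
  then show ?thesis using \<theta>q(1,2) e1(1) by blast
qed

text \<open>At e = 0 and X = 1 - 2 w one has R_1 = - w, and all inequalities of
  \<open>slopes_ok\<close> hold strictly; they persist nearby by compactness in w.\<close>

lemma slopes_ok_uniform:
  "\<exists>s>0. \<forall>e w X. \<bar>e\<bar> < s \<longrightarrow> 3/10 \<le> w \<longrightarrow> w \<le> wM \<longrightarrow> \<bar>X - (1 - 2 * w)\<bar> < s \<longrightarrow> cu e w X = 0 \<longrightarrow> slopes_ok e w X"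
proof -
  define P where "P = (\<lambda>(w, e, y). \<bar>cu_R e w (1 - 2 * w + y) + w\<bar> < \<kappa> * r / 2 \<and>
    eta e * \<bar>cu_R e w (1 - 2 * w + y)\<bar> / w < \<kappa> * r \<and> 0 < cu_h e w + cu_b e w * (1 - 2 * w + y))"
  have \<kappa>r: "0 < \<kappa> * r" using \<kappa> r by simp
  have "\<exists>\<delta>>0. \<forall>w\<in>{3/10..wM}. \<forall>v. norm v < \<delta> \<longrightarrow> P (w, v)"
  proof (rule uniform_eventually_compact[OF compact_Icc])
    fix w assume w: "w \<in> {3/10..wM}"
    then have w0: "0 < w" by simp
    have h0: "cu_h 0 w + cu_b 0 w * (1 - 2 * w) = w^2" by (simp add: cu_coeff_defs power2_eq_square)
    define H where "H = (\<lambda>(w, e, y). cu_h e w + cu_b e w * (1 - 2 * w + y))"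
    define N where "N = (\<lambda>(w, e, y). cu_R e w (1 - 2 * w + y))"
    have cH: "isCont H (w, 0, 0)" unfolding H_def case_prod_unfold cu_coeff_defs son_H0_def
      apply (intro continuous_intros)
      using w0 by simp_all
    have cN: "isCont N (w, 0, 0)" unfolding N_def case_prod_unfold cu_R_def cu_coeff_defs son_H0_def
      apply (intro continuous_intros)
      using w0 by simp_all
    have N0: "N (w, 0, 0) = - w" using slopes_ok_0(2)[of w] w by (simp add: N_def)
    have "isCont (\<lambda>p. \<bar>N p + fst p\<bar>) (w, 0, 0)" by (intro continuous_intros cN)
    from isCont_eventually_less(1)[OF this, of "\<kappa> * r / 2"] have E1: "\<forall>\<^sub>F p in nhds (w, 0, 0). \<bar>N p + fst p\<bar> < \<kappa> * r / 2"
      using N0 \<kappa>r by simp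
    have "isCont (\<lambda>p. eta (fst (snd p)) * \<bar>N p\<bar> / fst p) (w, 0, 0)" unfolding eta_def
      apply (intro continuous_intros cN)
      using w0 by simp_all
    from isCont_eventually_less(1)[OF this, of "\<kappa> * r"] have E2: "\<forall>\<^sub>F p in nhds (w, 0, 0). eta (fst (snd p)) * \<bar>N p\<bar> / fst p < \<kappa> * r"
      using \<kappa>r by (simp add: eta_def)
    from isCont_eventually_less(2)[OF cH, of 0] have E3: "\<forall>\<^sub>F p in nhds (w, 0, 0). 0 < H p"
      using w0 h0 by (simp add: H_def)
    have "\<forall>\<^sub>F p in nhds (w, 0, 0). P p"
      using E1 E2 E3 by eventually_elim (auto simp: P_def N_def H_def split: prod.splits)
    then show "\<forall>\<^sub>F p in nhds (w, 0). P p" by (simp add: zero_prod_def)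
  qed
  then obtain \<delta> where \<delta>: "\<delta> > 0" "\<And>w v. w \<in> {3/10..wM} \<Longrightarrow> norm v < \<delta> \<Longrightarrow> P (w, v)"
    by blast
  show ?thesis
  proof (intro exI[of _ "min (\<delta> / 2) (\<kappa> * r / 2)"] conjI allI impI)
    show "0 < min (\<delta> / 2) (\<kappa> * r / 2)" using \<delta>(1) \<kappa>r by simp
    fix e w X assume e: "\<bar>e\<bar> < min (\<delta> / 2) (\<kappa> * r / 2)" and w: "3/10 \<le> w" "w \<le> wM"
      and X: "\<bar>X - (1 - 2 * w)\<bar> < min (\<delta> / 2) (\<kappa> * r / 2)" and root: "cu e w X = 0"
    have "norm (e, X - (1 - 2 * w)) < \<delta>" using e X norm_prod_bounds(3)[of "(e, X - (1 - 2 * w))"] by simp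
    then have "P (w, e, X - (1 - 2 * w))" using w by (intro \<delta>(2)) auto
    then show "slopes_ok e w X" using root X by (auto simp: P_def slopes_ok_def)
  qed
qed

end

context rlp_window
begin

text \<open>If the infimum had the high exit, openness would pass it on to points where
  \<open>third\<close> holds, although the exits exclude each other. If it had the low exit,
  \<open>third\<close> would hold on a neighbourhood and X would reach further left; the left end of
  the window is no exception, since it has the high exit.\<close>

lemma critical_point:
  assumes le: "xlo \<le> xhi" and hi: "third xhi" and lo: "reaches U_high xlo"
    and X: "X = {x \<in> {xlo..xhi}. \<forall>y\<in>{x..xhi}. third y}"
  shows "Inf X \<in> {xlo..xhi}" "\<not> reaches U_low (Inf X)" "\<not> reaches U_high (Inf X)"
proof -
  have hiX: "xhi \<in> X" using le hi by (auto simp: X)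
  have bdd: "bdd_below X" by (auto simp: X intro!: bdd_belowI[of _ xlo])
  define m where "m = Inf X"
  have "m \<le> xhi" unfolding m_def using hiX bdd by (rule cInf_lower)
  moreover have "xlo \<le> m" unfolding m_def using hiX by (intro cInf_greatest) (auto simp: X)
  ultimately have m: "m \<in> {xlo..xhi}" by simp
  then show "Inf X \<in> {xlo..xhi}" by (simp add: m_def)
  have above: "third y" if y: "m < y" "y \<le> xhi" for y
  proof -
    have "X \<noteq> {}" using hiX by blast
    from cInf_lessD[OF this, of y] y obtain z where "z \<in> X" "z < y" by (auto simp: m_def)
    then show ?thesis using y by (auto simp: X)
  qed
  show "\<not> reaches U_high (Inf X)"
  proof
    assume "reaches U_high (Inf X)"
    then have h: "reaches U_high m" by (simp add: m_def)
    obtain a D W where a: "0 < a" "a \<le> xb m" "rlp_extends eps m {a..<m} D W" "1/3 < W a" "D a < W a \<or> 1 / (2 - eps) < W a"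
      using high_witness[OF m h] by blast
    then have "(D a, W a) \<in> U_high" by (simp add: U_high_def)
    from reaches_open[OF m open_U(2) a(1-3) this] obtain d where d: "d > 0" "\<And>y. y \<in> {xlo..xhi} \<Longrightarrow> \<bar>y - m\<bar> < d \<Longrightarrow> reaches U_high y"
      by blast
    \<comment> \<open>If m is the right end, y = m is a point with \<open>third\<close>; otherwise y
      is taken above m, where \<open>third\<close> is known.\<close>
    define y where "y = (if m = xhi then xhi else min (m + d / 2) xhi)"
    have y: "y \<in> {xlo..xhi}" "\<bar>y - m\<bar> < d" "third y"
      using m d(1) hi above[of y] by (auto simp: y_def min_def split: if_splits)
    show False using low_high_False[OF y(1) third_imp_low[OF y(1,3)] d(2)[OF y(1,2)]] .
  qed
  show "\<not> reaches U_low (Inf X)"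
  proof
    assume "reaches U_low (Inf X)"
    then have l: "reaches U_low m" by (simp add: m_def)
    have "m \<noteq> xlo" using low_high_False[of xlo] l lo m by auto
    then have lt: "xlo < m" using m by simp
    obtain a D W where a: "0 < a" "a \<le> xb m" "rlp_extends eps m {a..<m} D W" "W a < 1/3"
      using low_witness[OF m l] by blast
    then have "(D a, W a) \<in> U_low" by (simp add: U_low_def)
    from reaches_open[OF m open_U(1) a(1-3) this] obtain d where d: "d > 0" "\<And>y. y \<in> {xlo..xhi} \<Longrightarrow> \<bar>y - m\<bar> < d \<Longrightarrow> reaches U_low y"
      by blast
    define y where "y = max xlo (m - d / 2)"
    have y: "y \<in> {xlo..xhi}" "y < m" "m - d < y" using lt m d(1) by (auto simp: y_def)
    have "third z" if z: "z \<in> {y..xhi}" for z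
    proof (cases "z \<le> m")
      case True
      have zi: "z \<in> {xlo..xhi}" using z y by auto
      have "\<bar>z - m\<bar> < d" using True z y by auto
      from low_imp_third[OF zi d(2)[OF zi this]] show ?thesis .
    next
      case False
      then show ?thesis using z by (intro above) auto
    qed
    then have "y \<in> X" using y by (simp add: X)
    from cInf_lower[OF this bdd] show False using y(2) by (simp add: m_def)
  qed
qed

end

lemma om_root_0: "0 < x \<Longrightarrow> om_root 0 x = 1 / x"
  by (rule om_root_eqI) (auto simp: om_G_eq eta_def power2_eq_square)

lemma om_root_antimono:
  assumes "0 \<le> e" "e < 1" "0 < x" "x \<le> y"
  shows "om_root e y \<le> om_root e x"
  using om_root_strict_antimono[OF assms(1-3), of y] assms(4) by (cases "x = y") auto

lemma om_root_near_0:
  assumes x: "0 < x" and d: "0 < d"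
  shows "\<exists>e1>0. \<forall>e. 0 \<le> e \<longrightarrow> e \<le> e1 \<longrightarrow> \<bar>om_root e x - 1 / x\<bar> < d"
proof -
  have "\<forall>e0\<in>{0..<1}. \<forall>d>0. \<exists>s>0. \<forall>e\<in>{0..<1}. dist e e0 < s \<longrightarrow> dist (om_root e x) (om_root e0 x) < d"
    using om_root_continuous_e[OF x] unfolding continuous_on_iff .
  from bspec[OF this, of 0] d obtain s where s: "s > 0" "\<And>e. e \<in> {0..<1} \<Longrightarrow> dist e 0 < s \<Longrightarrow> dist (om_root e x) (om_root 0 x) < d"
    by auto
  then show ?thesis by (intro exI[of _ "min (s / 2) (1 / 2)"]) (auto simp: dist_real_def om_root_0[OF x])
qed

text \<open>The solution is explicit, 1 / sqrt (om_G eps (1/3)); it is unique because the sonic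
  value decreases strictly in x.\<close>

lemma x_max_eq:
  assumes e: "0 < eps" "eps < 1"
  shows "0 < x_max eps" "om_root eps (x_max eps) = 1/3"
proof -
  have om: "x > 0 \<and> omega eps x = 1/3 \<longleftrightarrow> x > 0 \<and> om_root eps x = 1/3" for x
    using omega_eq[of eps x] e by auto
  define g where "g = om_G eps (1/3)"
  have "0 < (1 + 3 * eps) * (1/3)^2 + 4 * eps * (1/3) + eps * (eps - 1)"
    using e by (simp add: power2_eq_square algebra_simps add_pos_pos)
  then have g: "0 < g" unfolding g_def om_G_eq by simp
  have "om_root eps (1 / sqrt g) = 1/3" using e g by (intro om_root_eqI) (auto simp: g_def power_divide)
  moreover have "0 < 1 / sqrt g" using g by simp
  ultimately have "\<exists>!x. x > 0 \<and> omega eps x = 1/3" unfolding om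
  proof (intro ex1I[of _ "1 / sqrt g"] conjI)
    fix x assume x: "0 < x \<and> om_root eps x = 1/3"
    with \<open>om_root eps (1 / sqrt g) = 1/3\<close> \<open>0 < 1 / sqrt g\<close> show "x = 1 / sqrt g"
      using om_root_strict_antimono[of eps x "1 / sqrt g"] om_root_strict_antimono[of eps "1 / sqrt g" x] e
      by (cases x "1 / sqrt g" rule: linorder_cases) auto
  qed auto
  from theI'[OF this] show "0 < x_max eps" "om_root eps (x_max eps) = 1/3"
    using omega_eq[of eps "x_max eps"] e unfolding x_max_def[symmetric] by auto
qed

theorem theorem2p3:
  fixes \<delta>\<^sub>0 :: real
  assumes "admissible_delta0 \<delta>\<^sub>0"
  shows "\<exists>\<epsilon>\<^sub>0>0. \<forall>\<epsilon>\<in>{0<..\<epsilon>\<^sub>0}.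
           \<exists>D W :: real \<Rightarrow> real.
             rlp_extends \<epsilon> (x_bar \<delta>\<^sub>0 \<epsilon>) {0<..<x_bar \<delta>\<^sub>0 \<epsilon>} D W \<and>
             real_analytic_on D {0..x_bar \<delta>\<^sub>0 \<epsilon>} \<and>
             real_analytic_on W {0..x_bar \<delta>\<^sub>0 \<epsilon>} \<and>
             W 0 = 1/3 \<and> D 0 > 1/3"
proof -
  obtain ea where \<delta>0: "0 < \<delta>\<^sub>0" "\<delta>\<^sub>0 < 1" and ea: "ea > 0"
    and adm: "\<And>eps. eps \<in> {0<..ea} \<Longrightarrow> \<exists>z\<^sub>0\<in>{0<..<1}. \<exists>D W.
           rlp_extends eps (x_min \<delta>\<^sub>0) {z\<^sub>0 * x_min \<delta>\<^sub>0..<x_min \<delta>\<^sub>0} D W \<and> W (z\<^sub>0 * x_min \<delta>\<^sub>0) > 1 / (2 - 2 * eta eps)"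
    using assms unfolding admissible_delta0_def by blast
  \<comment> \<open>The sonic value at the left end of the window tends to 1 / (2 +
    \<open>\<delta>\<^sub>0\<close>); wM lies strictly between this limit and 1/2.\<close>
  define wM where "wM = 1 / (2 + \<delta>\<^sub>0 / 2)"
  have wMb: "3/10 \<le> wM" "wM < 1/2" "1 / (2 + \<delta>\<^sub>0) < wM"
    using \<delta>0 by (auto simp: wM_def field_simps)
  obtain \<theta> \<kappa> r \<rho> e0 where "sonic wM ((1 - 2 * wM) / 8) \<theta> \<kappa> r \<rho> e0"
    using sonic_exists[of wM "(1 - 2 * wM) / 8"] wMb by auto
  then interpret sonic wM "(1 - 2 * wM) / 8" \<theta> \<kappa> r \<rho> e0 .
  define \<delta>1 where "\<delta>1 = \<rho> / 2"
  have \<delta>1: "0 < \<delta>1" "\<delta>1 < \<rho>" using \<rho> by (auto simp: \<delta>1_def)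
  obtain \<theta>q eq where \<theta>q: "0 < \<theta>q" "\<theta>q < 1" and eq: "eq > 0"
    and q: "\<And>e w x. par e w \<Longrightarrow> e < eq \<Longrightarrow> 0 < x \<Longrightarrow> om_G e w = 1 / x^2 \<Longrightarrow> q_fun e (x * (1 - \<delta>1)) (sR e w (- \<delta>1)) < \<theta>q"
    using q_fun_uniform[OF \<delta>1] by blast
  \<comment> \<open>Half of the margin 1 - \<theta>q^2 is kept, the other half pays for the term 20
    eps.\<close>
  define \<kappa>q where "\<kappa>q = (1 - \<theta>q^2) / 2"
  have "\<theta>q^2 < 1" using \<theta>q by (simp add: power_less_one_iff)
  then have \<kappa>q: "0 < \<kappa>q" by (simp add: \<kappa>q_def)
  obtain s0 where s0: "s0 > 0" "\<And>e w X. \<bar>e\<bar> < s0 \<Longrightarrow> 3/10 \<le> w \<Longrightarrow> w \<le> wM \<Longrightarrow> \<bar>X - (1 - 2 * w)\<bar> < s0 \<Longrightarrow> cu e w X = 0 \<Longrightarrow> slopes_ok e w X"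
    using slopes_ok_uniform by blast
  define s where "s = min s0 ((1 - 2 * wM) / 2)"
  have s: "0 < s" "s < 1 - 2 * wM" "s \<le> s0" using s0(1) wMb by (auto simp: s_def min_def)
  obtain ec where ec: "ec > 0" "\<And>e w. 0 \<le> e \<Longrightarrow> e \<le> ec \<Longrightarrow> 3/10 \<le> w \<Longrightarrow> w \<le> wM \<Longrightarrow> cubic_ok s e w"
    using cubic_ok_small[OF wMb(2) s(1,2)] by blast
  have "0 < 2 + \<delta>\<^sub>0" using \<delta>0 by simp
  moreover have "0 < min (wM - 1 / (2 + \<delta>\<^sub>0)) (1 / (2 + \<delta>\<^sub>0) - 1/3)"
  proof -
    have "0 < wM - 1 / (2 + \<delta>\<^sub>0)" using wMb(3) by simp
    moreover have "0 < 1 / (2 + \<delta>\<^sub>0) - 1/3" using \<delta>0 by (simp add: field_simps)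
    ultimately show ?thesis by (simp only: min_less_iff_conj)
  qed
  ultimately obtain e1 where e1: "e1 > 0" "\<And>e. 0 \<le> e \<Longrightarrow> e \<le> e1 \<Longrightarrow> \<bar>om_root e (2 + \<delta>\<^sub>0) - 1 / (2 + \<delta>\<^sub>0)\<bar> < min (wM - 1 / (2 + \<delta>\<^sub>0)) (1 / (2 + \<delta>\<^sub>0) - 1/3)"
    using om_root_near_0 by blast
  \<comment> \<open>16/5 lies to the right of the window, as \<open>x_max\<close> tends to 3, and
    its sonic value tends to 5/16 > 3/10; this gives the lower bound for the sonic value on the
    window.\<close>
  obtain e2 where e2: "e2 > 0" "\<And>e. 0 \<le> e \<Longrightarrow> e \<le> e2 \<Longrightarrow> \<bar>om_root e (16/5) - 1 / (16/5)\<bar> < 1/100"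
    using om_root_near_0[of "16/5" "1/100"] by auto
  define E where "E = Min {ea, e0, eq / 2, \<kappa>q / 20, s0 / 2, ec, e1, e2, 1/4}"
  have E_le: "E \<le> x" if "x \<in> {ea, e0, eq / 2, \<kappa>q / 20, s0 / 2, ec, e1, e2, 1/4}" for x
    unfolding E_def using that by (intro Min_le) simp_all
  have E: "0 < E" "E \<le> ea" "E \<le> e0" "E \<le> eq / 2" "E \<le> \<kappa>q / 20" "E \<le> s0 / 2" "E \<le> ec" "E \<le> e1" "E \<le> e2" "E \<le> 1/4"
  proof -
    show "0 < E" unfolding E_def using ea e0 eq \<kappa>q s0(1) ec(1) e1(1) e2(1) by (subst Min_gr_iff) simp_all
  qed (rule E_le; simp)+
  have "\<exists>D W :: real \<Rightarrow> real.
             rlp_extends eps (x_bar \<delta>\<^sub>0 eps) {0<..<x_bar \<delta>\<^sub>0 eps} D W \<and>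
             real_analytic_on D {0..x_bar \<delta>\<^sub>0 eps} \<and>
             real_analytic_on W {0..x_bar \<delta>\<^sub>0 eps} \<and>
             W 0 = 1/3 \<and> D 0 > 1/3" if "eps \<in> {0<..E}" for eps
  proof -
    have eps: "0 < eps" "eps \<le> E" "eps < 1" using that E by auto
    note xm = x_max_eq[OF eps(1,3)]
    have lo: "om_root e (2 + \<delta>\<^sub>0) < wM" "1/3 < om_root e (2 + \<delta>\<^sub>0)" and hi: "3/10 < om_root e (16/5)" "om_root e (16/5) < 1/3"
      if "0 \<le> e" "e \<le> eps" for e
    proof -
      have le: "e \<le> e1" "e \<le> e2" using that eps E by auto
      show "om_root e (2 + \<delta>\<^sub>0) < wM" "1/3 < om_root e (2 + \<delta>\<^sub>0)"
        using e1(2)[OF that(1) le(1)] by (auto simp: abs_less_iff)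
      have "\<bar>om_root e (16/5) - 5 / 16\<bar> < 1/100" using e2(2)[OF that(1) le(2)] by simp
      then show "3/10 < om_root e (16/5)" "om_root e (16/5) < 1/3" by linarith+
    qed
    have xm_lo: "2 + \<delta>\<^sub>0 < x_max eps"
    proof (rule ccontr)
      assume "\<not> 2 + \<delta>\<^sub>0 < x_max eps"
      then have "om_root eps (2 + \<delta>\<^sub>0) \<le> om_root eps (x_max eps)"
        using eps xm by (intro om_root_antimono) auto
      then show False using lo(2)[of eps] xm eps by simp
    qed
    have xm_hi: "x_max eps < 16/5"
    proof (rule ccontr)
      assume "\<not> x_max eps < 16/5"
      then have "om_root eps (x_max eps) \<le> om_root eps (16/5)" using eps by (intro om_root_antimono) auto
      then show False using hi(2)[of eps] xm eps by simp
    qed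
    interpret rlp_window wM "(1 - 2 * wM) / 8" \<theta> \<kappa> r \<rho> e0 eps \<theta>q \<kappa>q \<delta>1 "2 + \<delta>\<^sub>0" "x_max eps"
    proof
      show "0 < eps" "eps < 1" "0 < \<theta>q" "0 < \<kappa>q" "0 < \<delta>1" "\<delta>1 < \<rho>"
        by (fact eps(1) eps(3) \<theta>q(1) \<kappa>q \<delta>1(1) \<delta>1(2))+
      show "eps \<le> e0" using eps E by simp
      have "20 * eps * \<theta>q^2 \<le> \<kappa>q * 1"
        using eps E \<open>\<theta>q^2 < 1\<close> \<kappa>q by (intro mult_mono) auto
      then show "(1 + 20 * eps) * \<theta>q^2 \<le> 1 - \<kappa>q"
      proof -
        have "(1 + 20 * eps) * \<theta>q^2 = \<theta>q^2 + 20 * eps * \<theta>q^2" by (simp add: distrib_right)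
        moreover have "\<theta>q^2 + \<kappa>q = 1 - \<kappa>q" unfolding \<kappa>q_def by (simp add: field_simps)
        ultimately show ?thesis using \<open>20 * eps * \<theta>q^2 \<le> \<kappa>q * 1\<close> by linarith
      qed
      fix x assume x: "x \<in> {2 + \<delta>\<^sub>0..x_max eps}"
      have x0: "0 < x" using x \<delta>0 by simp
      have w: "3/10 \<le> om_root e x \<and> om_root e x \<le> wM" if "0 \<le> e" "e \<le> eps" for e
        using om_root_antimono[of e x "16/5"] om_root_antimono[of e "2 + \<delta>\<^sub>0" x] lo(1)[OF that] hi(1)[OF that] that eps x x0 xm_hi \<delta>0
        by auto
      have p: "par eps (om_root eps x)" using w[of eps] eps E by auto
      have sl: "cu eps (om_root eps x) (W1_rlp eps x) = 0" "\<bar>W1_rlp eps x - (1 - 2 * om_root eps x)\<bar> < s"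
        "R1_rlp eps x = cu_R eps (om_root eps x) (W1_rlp eps x)"
        by (rule rlp_slopes[OF s(1,2) _ eps(3) x0]; use w ec(2) eps E in force)+
      have "slopes_ok eps (om_root eps x) (W1_rlp eps x)" using sl s(3) p eps E s0(1) by (intro s0(2)) auto
      moreover have "1/3 \<le> om_root eps x" using om_root_antimono[of eps x "x_max eps"] x x0 xm eps by simp
      moreover have "q_fun eps (x * (1 - \<delta>1)) (sR eps (om_root eps x) (- \<delta>1)) < \<theta>q"
        using om_root(2)[of eps x] p eps E x0 eq by (intro q) auto
      ultimately show "0 < x \<and> 1/3 \<le> om_root eps x \<and> om_root eps x \<le> wM \<and>
        slopes_ok eps (om_root eps x) (W1_rlp eps x) \<and> R1_rlp eps x = cu_R eps (om_root eps x) (W1_rlp eps x) \<and>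
        q_fun eps (x * (1 - \<delta>1)) (sR eps (om_root eps x) (- \<delta>1)) < \<theta>q"
        using x0 sl p by simp
    qed
    have xin: "x_max eps \<in> {2 + \<delta>\<^sub>0..x_max eps}" "2 + \<delta>\<^sub>0 \<in> {2 + \<delta>\<^sub>0..x_max eps}"
      using xm_lo by auto
    \<comment> \<open>At the right end the sonic value is 1/3 and W increases in the near region, so
      the low exit occurs at once.\<close>
    have th: "third (x_max eps)"
    proof (rule low_imp_third[OF xin(1)])
      note X = xb[OF xin(1)]
      have "nW (x_max eps) (xb (x_max eps)) < 1/3"
        using nW_less[OF xin(1) X(2,3) order_refl] nW_at[OF xin(1)] xm(2) by linarith
      then show "reaches U_low (x_max eps)"
        unfolding reaches_def U_low_def using near_extends[OF xin(1)] X(1,3) by blast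
    qed
    have hh: "reaches U_high (2 + \<delta>\<^sub>0)"
    proof -
      obtain z0 D W where z: "0 < z0" "z0 < 1" "rlp_extends eps (2 + \<delta>\<^sub>0) {z0 * (2 + \<delta>\<^sub>0)..<2 + \<delta>\<^sub>0} D W"
        "W (z0 * (2 + \<delta>\<^sub>0)) > 1 / (2 - 2 * eta eps)"
        using adm[of eps] eps E unfolding x_min_def by auto
      \<comment> \<open>The condition at the left end is stated with 1 / (2 - 2 eta); eta >= 2 eps
        makes this at least 1 / (2 - eps).\<close>
      have "2 * eps \<le> 2 * eps / (1 - eps)" "2 * eps / (1 - eps) < 1" using eps E by (simp_all add: field_simps)
      then have "2 * eps \<le> eta eps" "eta eps < 1" by (simp_all add: eta_def)
      then have "1 / (2 - eps) \<le> 1 / (2 - 2 * eta eps)" using eps by (intro divide_left_mono) auto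
      then have "1 / (2 - eps) < W (z0 * (2 + \<delta>\<^sub>0))" "1/3 < W (z0 * (2 + \<delta>\<^sub>0))"
        using z(4) left.third_le by linarith+
      moreover have "0 < z0 * (2 + \<delta>\<^sub>0)" "z0 * (2 + \<delta>\<^sub>0) < 2 + \<delta>\<^sub>0"
        using z(1,2) \<delta>0 by auto
      ultimately show ?thesis unfolding reaches_def U_high_def using z(3) by blast
    qed
    have "X_set \<delta>\<^sub>0 eps = {x \<in> {2 + \<delta>\<^sub>0..x_max eps}. \<forall>y\<in>{x..x_max eps}. third y}"
      unfolding X_set_def X_third_def sonic_window_def x_min_def third_def by auto
    from critical_point[OF less_imp_le[OF xm_lo] th hh this, folded x_bar_def] show ?thesis by (rule critical)
  qed
  then show ?thesis using E(1) by blast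
qed

end
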